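(* Let $k$ be a field of characteristic not $2$, $A$ the split Albert algebra over $k$, and $G=\mathrm{Aut}(A)$. Let $\sigma$ be a $k$-involution of $G$ of type (II), that is, $\sigma$ is conjugation by an element $r_w\in\mathrm{Aut}(A)$ of order $2$, where $w\in A$ is a primitive idempotent and $r_w\neq1$ is the nontrivial central element of the stabilizer $\mathrm{Aut}(A)_w$ of $w$. Then the fixed point group $G^\sigma$ of $\sigma$ is isomorphic to $\mathrm{Spin}(Q,E_0)$.
   Context: For an octonion algebra $C$ over $k$ with norm $q$ and conjugation $\bar{\ }$, and $\gamma=(\gamma_1,\gamma_2,\gamma_3)\in(k^* )^3$, the Albert algebra $H_3(C,\gamma)$ is the set of $3\times3$ matrices over $C$ of the form $$x=\begin{bmatrix} f_1&c_3&\gamma_1^{-1}\gamma_3\bar c_2\\ \gamma_2^{-1}\gamma_1\bar c_3&f_2&c_1\\ c_2&\gamma_3^{-1}\gamma_2\bar c_1&f_3\end{bmatrix},\quad f_i\in k,\ c_i\in C,$$ with product $xy=\frac12(x\cdot y+y\cdot x)$ (dot: matrix multiplication), identity $e$, and quadratic form $$Q(x)=\tfrac12(f_1^2+f_2^2+f_3^2)+\gamma_3^{-1}\gamma_2q(c_1)+\gamma_1^{-1}\gamma_3q(c_2)+\gamma_2^{-1}\gamma_1q(c_3),$$ with bilinear form $\langle x,y\rangle=Q(x+y)-Q(x)-Q(y)$. It is split if $C$ is split (contains zero divisors); the split Albert algebra is unique up to isomorphism. $\mathrm{Aut}(A)$ is the algebraic group of linear automorphisms of the algebra $A$ (of type $F_4$).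 An idempotent $w\in A$ ($w^2=w$) is primitive if $Q(w)=\frac12$. For such $w$, $E_0=\{a\in e^\perp\mid wa=0\}$, with $e^\perp$ the orthogonal complement of $e$ for $\langle\cdot,\cdot\rangle$. $\mathrm{Spin}(Q,E_0)$ is the spin group of the restriction of $Q$ to $E_0$. The fixed subalgebra of $r_w$ in $A$ is $11$-dimensional. *)

theory Defs
  imports
    "HOL-Algebra.Algebraic_Closure_Type"
    "HOL-Algebra.Bij"
    "HOL-Algebra.QuotRing"
    "HOL-Analysis.Cartesian_Space"
begin

section \<open>Octonion algebras\<close>

definition polar :: "('v::ab_group_add \<Rightarrow> 'f::field) \<Rightarrow> 'v \<Rightarrow> 'v \<Rightarrow> 'f" where
  "polar q x y = q (x + y) - q x - q y"

text \<open>An algebra on the coordinate space \<open>F\<^sup>8\<close>, that is, an 8-dimensional algebra with a chosen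
  basis, together with its unit and a norm.\<close>

record 'f octonions =
  omult :: "'f ^ 8 \<Rightarrow> 'f ^ 8 \<Rightarrow> 'f ^ 8"
  oone :: "'f ^ 8"
  onorm :: "'f ^ 8 \<Rightarrow> 'f"

definition octonion_algebra :: "'f::field octonions \<Rightarrow> bool" where
  "octonion_algebra C \<longleftrightarrow>
     (\<forall>x. Vector_Spaces.linear (*s) (*s) (omult C x)) \<and>
     (\<forall>y. Vector_Spaces.linear (*s) (*s) (\<lambda>x. omult C x y)) \<and>
     (\<forall>x. omult C (oone C) x = x \<and> omult C x (oone C) = x) \<and>
     (\<forall>a x. onorm C (a *s x) = a\<^sup>2 * onorm C x) \<and>
     (\<forall>x. Vector_Spaces.linear (*s) (*) (polar (onorm C) x)) \<and>
     (\<forall>x. (\<forall>y. polar (onorm C) x y = 0) \<longrightarrow> x = 0) \<and>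
     (\<forall>x y. onorm C (omult C x y) = onorm C x * onorm C y)"

definition split_octonions :: "'f::field octonions \<Rightarrow> bool" where
  "split_octonions C \<longleftrightarrow> (\<exists>x y. x \<noteq> 0 \<and> y \<noteq> 0 \<and> omult C x y = 0)"

definition oconj :: "'f::field octonions \<Rightarrow> 'f ^ 8 \<Rightarrow> 'f ^ 8" where
  "oconj C x = polar (onorm C) x (oone C) *s oone C - x"

section \<open>Albert algebras\<close>

definition mscale :: "'f::times \<Rightarrow> 'f ^ 'n ^ 'm ^ 'l \<Rightarrow> 'f ^ 'n ^ 'm ^ 'l" where
  "mscale a x = (\<chi> i j. a *s (x $ i $ j))"

definition hermitian ::
  "'f::field octonions \<Rightarrow> 'f ^ 3 \<Rightarrow> 'f \<Rightarrow> 'f \<Rightarrow> 'f \<Rightarrow> 'f ^ 8 \<Rightarrow> 'f ^ 8 \<Rightarrow> 'f ^ 8 \<Rightarrow> 'f ^ 8 ^ 3 ^ 3" where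
  "hermitian C \<gamma> f1 f2 f3 c1 c2 c3 = vector [
     vector [f1 *s oone C, c3, (inverse (\<gamma>$1) * \<gamma>$3) *s oconj C c2],
     vector [(inverse (\<gamma>$2) * \<gamma>$1) *s oconj C c3, f2 *s oone C, c1],
     vector [c2, (inverse (\<gamma>$3) * \<gamma>$2) *s oconj C c1, f3 *s oone C]]"

definition albert :: "'f::field octonions \<Rightarrow> 'f ^ 3 \<Rightarrow> ('f ^ 8 ^ 3 ^ 3) set" where
  "albert C \<gamma> = {hermitian C \<gamma> f1 f2 f3 c1 c2 c3 | f1 f2 f3 c1 c2 c3. True}"

definition omatmult :: "'f::field octonions \<Rightarrow> 'f ^ 8 ^ 3 ^ 3 \<Rightarrow> 'f ^ 8 ^ 3 ^ 3 \<Rightarrow> 'f ^ 8 ^ 3 ^ 3" where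
  "omatmult C x y = (\<chi> i j. \<Sum>l\<in>UNIV. omult C (x $ i $ l) (y $ l $ j))"

definition albert_mult :: "'f::field octonions \<Rightarrow> 'f ^ 8 ^ 3 ^ 3 \<Rightarrow> 'f ^ 8 ^ 3 ^ 3 \<Rightarrow> 'f ^ 8 ^ 3 ^ 3" where
  "albert_mult C x y = mscale (1/2) (omatmult C x y + omatmult C y x)"

definition albert_one :: "'f::field octonions \<Rightarrow> 'f ^ 3 \<Rightarrow> 'f ^ 8 ^ 3 ^ 3" where
  "albert_one C \<gamma> = hermitian C \<gamma> 1 1 1 0 0 0"

text \<open>The quadratic form, meaningful on \<open>albert C \<gamma>\<close> only; there the parameters of a matrix are
  uniquely determined.\<close>

definition albert_Q :: "'f::field octonions \<Rightarrow> 'f ^ 3 \<Rightarrow> 'f ^ 8 ^ 3 ^ 3 \<Rightarrow> 'f" where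
  "albert_Q C \<gamma> x = (THE v. \<exists>f1 f2 f3 c1 c2 c3. x = hermitian C \<gamma> f1 f2 f3 c1 c2 c3 \<and>
     v = (1/2) * (f1\<^sup>2 + f2\<^sup>2 + f3\<^sup>2)
         + inverse (\<gamma>$3) * \<gamma>$2 * onorm C c1
         + inverse (\<gamma>$1) * \<gamma>$3 * onorm C c2
         + inverse (\<gamma>$2) * \<gamma>$1 * onorm C c3)"

definition primitive_idempotent :: "'f::field octonions \<Rightarrow> 'f ^ 3 \<Rightarrow> 'f ^ 8 ^ 3 ^ 3 \<Rightarrow> bool" where
  "primitive_idempotent C \<gamma> w \<longleftrightarrow>
     w \<in> albert C \<gamma> \<and> albert_mult C w w = w \<and> albert_Q C \<gamma> w = 1/2"

definition E0 :: "'f::field octonions \<Rightarrow> 'f ^ 3 \<Rightarrow> 'f ^ 8 ^ 3 ^ 3 \<Rightarrow> ('f ^ 8 ^ 3 ^ 3) set" where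
  "E0 C \<gamma> w = {a \<in> albert C \<gamma>.
     polar (albert_Q C \<gamma>) a (albert_one C \<gamma>) = 0 \<and> albert_mult C w a = 0}"

definition albert_aut :: "'f::field octonions \<Rightarrow> 'f ^ 3 \<Rightarrow> ('f ^ 8 ^ 3 ^ 3 \<Rightarrow> 'f ^ 8 ^ 3 ^ 3) monoid" where
  "albert_aut C \<gamma> = BijGroup (albert C \<gamma>) \<lparr>carrier := {g \<in> Bij (albert C \<gamma>).
     (\<forall>x\<in>albert C \<gamma>. \<forall>y\<in>albert C \<gamma>. g (x + y) = g x + g y) \<and>
     (\<forall>a. \<forall>x\<in>albert C \<gamma>. g (mscale a x) = mscale a (g x)) \<and>
     (\<forall>x\<in>albert C \<gamma>. \<forall>y\<in>albert C \<gamma>. g (albert_mult C x y) = albert_mult C (g x) (g y))}\<rparr>"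

section \<open>Scalar extension to the algebraic closure\<close>

definition vec_ac :: "'k::field ^ 'n \<Rightarrow> 'k alg_closure ^ 'n" where
  "vec_ac x = (\<chi> i. to_ac (x $ i))"

definition mat_ac :: "'k::field ^ 'n ^ 'm ^ 'l \<Rightarrow> 'k alg_closure ^ 'n ^ 'm ^ 'l" where
  "mat_ac x = (\<chi> i j. vec_ac (x $ i $ j))"

text \<open>\<open>C \<otimes>\<^sub>k K\<close> on \<open>K\<^sup>8\<close>: the multiplication is the bilinear extension of the structure constants,
  and the norm is the extension of the quadratic form \<open>q(x) = \<langle>x,x\<rangle>/2\<close> (characteristic not 2).\<close>

definition octonions_ac :: "'k::field octonions \<Rightarrow> 'k alg_closure octonions" where
  "octonions_ac C = \<lparr>
     omult = \<lambda>x y. \<Sum>i\<in>UNIV. \<Sum>j\<in>UNIV. (x $ i * y $ j) *s vec_ac (omult C (axis i 1) (axis j 1)),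
     oone = vec_ac (oone C),
     onorm = \<lambda>x. (1/2) * (\<Sum>i\<in>UNIV. \<Sum>j\<in>UNIV.
               x $ i * x $ j * to_ac (polar (onorm C) (axis i 1) (axis j 1)))\<rparr>"

section \<open>Affine algebraic groups over \<open>k\<close>\<close>

text \<open>An algebraic group over \<open>k\<close> is given in the classical language: a linear group over the
  algebraic closure \<open>K\<close>, with the \<open>k\<close>-algebra \<open>k[G]\<close> of \<open>K\<close>-valued functions on it. The
  parameter \<open>L\<close> below consists of coordinate functions, defined over \<open>k\<close>, of an ambient
  finite-dimensional associative \<open>K\<close>-algebra with a \<open>k\<close>-form. The coordinates of the inverse are
  among the generators since \<open>G\<close> is a subgroup of the unit group of that algebra: for \<open>GL(V)\<close>
  they account for the function \<open>1/det\<close>.\<close>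

inductive_set k_polys :: "('g \<Rightarrow> 'k::field alg_closure) set \<Rightarrow> ('g \<Rightarrow> 'k alg_closure) set"
  for S :: "('g \<Rightarrow> 'k::field alg_closure) set" where
  const: "(\<lambda>_. to_ac c) \<in> k_polys S"
| gen: "p \<in> S \<Longrightarrow> p \<in> k_polys S"
| add: "p \<in> k_polys S \<Longrightarrow> p' \<in> k_polys S \<Longrightarrow> (\<lambda>g. p g + p' g) \<in> k_polys S"
| mult: "p \<in> k_polys S \<Longrightarrow> p' \<in> k_polys S \<Longrightarrow> (\<lambda>g. p g * p' g) \<in> k_polys S"

definition coord_ring ::
  "('g, 'm) monoid_scheme \<Rightarrow> ('g \<Rightarrow> 'k::field alg_closure) set \<Rightarrow> ('g \<Rightarrow> 'k alg_closure) set" where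
  "coord_ring G L =
     {restrict p (carrier G) | p. p \<in> k_polys (L \<union> {\<lambda>g. l (inv\<^bsub>G\<^esub> g) | l. l \<in> L})}"

text \<open>Isomorphism of algebraic groups over \<open>k\<close>: a group isomorphism such that it and its inverse
  are morphisms of varieties defined over \<open>k\<close>.\<close>

definition alg_group_iso ::
  "('g, 'm) monoid_scheme \<Rightarrow> ('g \<Rightarrow> 'k::field alg_closure) set \<Rightarrow>
   ('h, 'n) monoid_scheme \<Rightarrow> ('h \<Rightarrow> 'k alg_closure) set \<Rightarrow> bool" where
  "alg_group_iso G RG H RH \<longleftrightarrow> (\<exists>\<phi>\<in>iso G H.
     (\<forall>f\<in>RH. restrict (f \<circ> \<phi>) (carrier G) \<in> RG) \<and>
     (\<forall>f\<in>RG. restrict (f \<circ> inv_into (carrier G) \<phi>) (carrier H) \<in> RH))"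

section \<open>The group \<open>G = Aut(A)\<close> and its involutions of type (II)\<close>

text \<open>In this section \<open>C\<close>, \<open>\<gamma>\<close> and \<open>w\<close> live over \<open>k\<close>.\<close>

definition Aut_A :: "'k::field octonions \<Rightarrow> 'k ^ 3 \<Rightarrow>
    ('k alg_closure ^ 8 ^ 3 ^ 3 \<Rightarrow> 'k alg_closure ^ 8 ^ 3 ^ 3) monoid" where
  "Aut_A C \<gamma> = albert_aut (octonions_ac C) (vec_ac \<gamma>)"

text \<open>The coordinate functions on \<open>End(A\<^sub>K)\<close> defined over \<open>k\<close>: matrix coefficients
  \<open>g \<mapsto> l (g a)\<close> with \<open>a \<in> A\<close> and \<open>l\<close> a linear form on \<open>A\<^sub>K\<close> taking values in \<open>k\<close> on \<open>A\<close>.\<close>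

definition Aut_A_coords :: "'k::field octonions \<Rightarrow> 'k ^ 3 \<Rightarrow>
    (('k alg_closure ^ 8 ^ 3 ^ 3 \<Rightarrow> 'k alg_closure ^ 8 ^ 3 ^ 3) \<Rightarrow> 'k alg_closure) set" where
  "Aut_A_coords C \<gamma> = {\<lambda>g. l (g (mat_ac a)) | l a. a \<in> albert C \<gamma> \<and>
     (\<forall>x\<in>albert (octonions_ac C) (vec_ac \<gamma>). \<forall>y\<in>albert (octonions_ac C) (vec_ac \<gamma>).
        l (x + y) = l x + l y) \<and>
     (\<forall>c. \<forall>x\<in>albert (octonions_ac C) (vec_ac \<gamma>). l (mscale c x) = c * l x) \<and>
     (\<forall>x\<in>albert C \<gamma>. l (mat_ac x) \<in> range to_ac)}"

definition Aut_A_rational :: "'k::field octonions \<Rightarrow> 'k ^ 3 \<Rightarrow>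
    ('k alg_closure ^ 8 ^ 3 ^ 3 \<Rightarrow> 'k alg_closure ^ 8 ^ 3 ^ 3) set" where
  "Aut_A_rational C \<gamma> =
     {g \<in> carrier (Aut_A C \<gamma>). g ` mat_ac ` albert C \<gamma> \<subseteq> mat_ac ` albert C \<gamma>}"

definition stabilizer_A :: "'k::field octonions \<Rightarrow> 'k ^ 3 \<Rightarrow> 'k ^ 8 ^ 3 ^ 3 \<Rightarrow>
    ('k alg_closure ^ 8 ^ 3 ^ 3 \<Rightarrow> 'k alg_closure ^ 8 ^ 3 ^ 3) set" where
  "stabilizer_A C \<gamma> w = {g \<in> carrier (Aut_A C \<gamma>). g (mat_ac w) = mat_ac w}"

definition type_II_involution :: "'k::field octonions \<Rightarrow> 'k ^ 3 \<Rightarrow> 'k ^ 8 ^ 3 ^ 3 \<Rightarrow>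
    (('k alg_closure ^ 8 ^ 3 ^ 3 \<Rightarrow> 'k alg_closure ^ 8 ^ 3 ^ 3) \<Rightarrow>
     ('k alg_closure ^ 8 ^ 3 ^ 3 \<Rightarrow> 'k alg_closure ^ 8 ^ 3 ^ 3)) \<Rightarrow> bool" where
  "type_II_involution C \<gamma> w \<sigma> \<longleftrightarrow> primitive_idempotent C \<gamma> w \<and>
     (\<exists>r \<in> Aut_A_rational C \<gamma>.
        r \<in> stabilizer_A C \<gamma> w \<and>
        (\<forall>g \<in> stabilizer_A C \<gamma> w. r \<otimes>\<^bsub>Aut_A C \<gamma>\<^esub> g = g \<otimes>\<^bsub>Aut_A C \<gamma>\<^esub> r) \<and>
        r \<noteq> \<one>\<^bsub>Aut_A C \<gamma>\<^esub> \<and> r \<otimes>\<^bsub>Aut_A C \<gamma>\<^esub> r = \<one>\<^bsub>Aut_A C \<gamma>\<^esub> \<and>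
        (\<forall>g \<in> carrier (Aut_A C \<gamma>).
           \<sigma> g = r \<otimes>\<^bsub>Aut_A C \<gamma>\<^esub> g \<otimes>\<^bsub>Aut_A C \<gamma>\<^esub> inv\<^bsub>Aut_A C \<gamma>\<^esub> r))"

definition fixed_point_group :: "('g, 'm) monoid_scheme \<Rightarrow> ('g \<Rightarrow> 'g) \<Rightarrow> ('g, 'm) monoid_scheme" where
  "fixed_point_group G \<sigma> = G\<lparr>carrier := {g \<in> carrier G. \<sigma> g = g}\<rparr>"

section \<open>Clifford algebras and spin groups\<close>

text \<open>The free (tensor) algebra on a set \<open>V\<close> of letters: finitely supported functions on words.\<close>

definition free_algebra :: "'v set \<Rightarrow> ('v list \<Rightarrow> 'f::field) ring" where
  "free_algebra V = \<lparr>carrier = {f. finite {u. f u \<noteq> 0} \<and> {u. f u \<noteq> 0} \<subseteq> lists V},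
     monoid.mult = \<lambda>f g u. \<Sum>i\<le>length u. f (take i u) * g (drop i u),
     one = \<lambda>u. if u = [] then 1 else 0,
     zero = \<lambda>_. 0,
     add = \<lambda>f g u. f u + g u\<rparr>"

definition word :: "'f::field \<Rightarrow> 'v list \<Rightarrow> 'v list \<Rightarrow> 'f" where
  "word c u = (\<lambda>u'. if u' = u then c else 0)"

definition clifford_ideal ::
  "('f::field \<Rightarrow> 'v::ab_group_add \<Rightarrow> 'v) \<Rightarrow> ('v \<Rightarrow> 'f) \<Rightarrow> 'v set \<Rightarrow> ('v list \<Rightarrow> 'f) set" where
  "clifford_ideal sc q V = Idl\<^bsub>free_algebra V\<^esub>
     ({\<lambda>u. word 1 [x + y] u - word 1 [x] u - word 1 [y] u | x y. x \<in> V \<and> y \<in> V} \<union>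
      {\<lambda>u. word 1 [sc a x] u - word a [x] u | a x. x \<in> V} \<union>
      {\<lambda>u. word 1 [x, x] u - word (q x) [] u | x. x \<in> V})"

definition clifford ::
  "('f::field \<Rightarrow> 'v::ab_group_add \<Rightarrow> 'v) \<Rightarrow> ('v \<Rightarrow> 'f) \<Rightarrow> 'v set \<Rightarrow> ('v list \<Rightarrow> 'f) set ring" where
  "clifford sc q V = free_algebra V Quot clifford_ideal sc q V"

definition clifford_class ::
  "('f::field \<Rightarrow> 'v::ab_group_add \<Rightarrow> 'v) \<Rightarrow> ('v \<Rightarrow> 'f) \<Rightarrow> 'v set \<Rightarrow> ('v list \<Rightarrow> 'f) \<Rightarrow> ('v list \<Rightarrow> 'f) set" where
  "clifford_class sc q V f = clifford_ideal sc q V +>\<^bsub>free_algebra V\<^esub> f"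

definition clifford_vec ::
  "('f::field \<Rightarrow> 'v::ab_group_add \<Rightarrow> 'v) \<Rightarrow> ('v \<Rightarrow> 'f) \<Rightarrow> 'v set \<Rightarrow> 'v \<Rightarrow> ('v list \<Rightarrow> 'f) set" where
  "clifford_vec sc q V x = clifford_class sc q V (word 1 [x])"

definition clifford_even ::
  "('f::field \<Rightarrow> 'v::ab_group_add \<Rightarrow> 'v) \<Rightarrow> ('v \<Rightarrow> 'f) \<Rightarrow> 'v set \<Rightarrow> ('v list \<Rightarrow> 'f) set set" where
  "clifford_even sc q V = clifford_class sc q V `
     {f \<in> carrier (free_algebra V). \<forall>u. f u \<noteq> 0 \<longrightarrow> even (length u)}"

text \<open>The canonical anti-involution \<open>x\<^sub>1\<cdots>x\<^sub>r \<mapsto> x\<^sub>r\<cdots>x\<^sub>1\<close>, acting on cosets. The ideal is stable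
  under reversal, so cosets go to cosets.\<close>

definition clifford_rev :: "('v list \<Rightarrow> 'f) set \<Rightarrow> ('v list \<Rightarrow> 'f) set" where
  "clifford_rev S = (\<lambda>f. f \<circ> rev) ` S"

definition spin_group ::
  "('f::field \<Rightarrow> 'v::ab_group_add \<Rightarrow> 'v) \<Rightarrow> ('v \<Rightarrow> 'f) \<Rightarrow> 'v set \<Rightarrow> ('v list \<Rightarrow> 'f) set monoid" where
  "spin_group sc q V = (let Cl = clifford sc q V in
     units_of Cl \<lparr>carrier := {s \<in> Units Cl. s \<in> clifford_even sc q V \<and>
       (\<lambda>x. s \<otimes>\<^bsub>Cl\<^esub> x \<otimes>\<^bsub>Cl\<^esub> inv\<^bsub>Cl\<^esub> s) ` clifford_vec sc q V ` V = clifford_vec sc q V ` V \<and>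
       s \<otimes>\<^bsub>Cl\<^esub> clifford_rev s = \<one>\<^bsub>Cl\<^esub>}\<rparr>)"

text \<open>The linear forms on the Clifford algebra over \<open>K\<close> that take values in \<open>k\<close> on the
  \<open>k\<close>-subalgebra generated by a \<open>k\<close>-form \<open>Vk\<close> of \<open>V\<close>.\<close>

definition clifford_coords ::
  "('k::field alg_closure \<Rightarrow> 'v::ab_group_add \<Rightarrow> 'v) \<Rightarrow> ('v \<Rightarrow> 'k alg_closure) \<Rightarrow> 'v set \<Rightarrow> 'v set \<Rightarrow>
   (('v list \<Rightarrow> 'k alg_closure) set \<Rightarrow> 'k alg_closure) set" where
  "clifford_coords sc q V Vk = {l.
     (\<forall>S\<in>carrier (clifford sc q V). \<forall>T\<in>carrier (clifford sc q V).
        l (S \<oplus>\<^bsub>clifford sc q V\<^esub> T) = l S + l T) \<and>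
     (\<forall>c. \<forall>S\<in>carrier (clifford sc q V).
        l (clifford_class sc q V (word c []) \<otimes>\<^bsub>clifford sc q V\<^esub> S) = c * l S) \<and>
     (\<forall>f\<in>carrier (free_algebra Vk). range f \<subseteq> range to_ac \<longrightarrow>
        l (clifford_class sc q V f) \<in> range to_ac)}"

text \<open>The algebraic group \<open>Spin(Q, E\<^sub>0)\<close> over \<open>k\<close>, by its \<open>K\<close>-points, and its coordinates. The
  space \<open>E\<^sub>0\<close> over \<open>K\<close> has the \<open>k\<close>-form \<open>E\<^sub>0\<close> over \<open>k\<close>.\<close>

definition Spin_E0 :: "'k::field octonions \<Rightarrow> 'k ^ 3 \<Rightarrow> 'k ^ 8 ^ 3 ^ 3 \<Rightarrow>
    (('k alg_closure ^ 8 ^ 3 ^ 3) list \<Rightarrow> 'k alg_closure) set monoid" where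
  "Spin_E0 C \<gamma> w = spin_group mscale (albert_Q (octonions_ac C) (vec_ac \<gamma>))
     (E0 (octonions_ac C) (vec_ac \<gamma>) (mat_ac w))"

definition Spin_E0_coords :: "'k::field octonions \<Rightarrow> 'k ^ 3 \<Rightarrow> 'k ^ 8 ^ 3 ^ 3 \<Rightarrow>
    ((('k alg_closure ^ 8 ^ 3 ^ 3) list \<Rightarrow> 'k alg_closure) set \<Rightarrow> 'k alg_closure) set" where
  "Spin_E0_coords C \<gamma> w = clifford_coords mscale (albert_Q (octonions_ac C) (vec_ac \<gamma>))
     (E0 (octonions_ac C) (vec_ac \<gamma>) (mat_ac w)) (mat_ac ` E0 C \<gamma> w)"

end

theory Submission
  imports Defs "HOL-Analysis.Determinants"
begin

text \<open>Let \<open>f = e - w\<close>. Multiplication by \<open>w\<close> has the eigenvalues 1, 0 and 1/2 on the Albert algebra over the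
  algebraic closure \<open>K\<close>, with eigenspaces \<open>K w\<close>, \<open>K f + E\<^sub>0\<close> and \<open>E\<^sub>1\<close>. The generic cubic equation gives the
  multiplication rules between these spaces, and above all \<open>(2a)(2a x) = Q(a) x\<close> for \<open>a\<close> in \<open>E\<^sub>0\<close> and \<open>x\<close> in \<open>E\<^sub>1\<close>
  (\<open>clifford_relation\<close>). So \<open>E\<^sub>1\<close> is a module over the Clifford algebra of \<open>E\<^sub>0\<close>. The same rules determine
  the dimensions 9 and 16 of \<open>E\<^sub>0\<close> and \<open>E\<^sub>1\<close> (\<open>dim_V0\<close>), where the total dimension 27 comes from coordinates.

  Nine anticommuting vectors have 256 even products. Those other than 1 have trace 0, so the products are
  orthogonal for the trace form and hence a basis of the matrices of size 16 (\<open>P_span\<close>). Therefore the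
  even Clifford algebra is the algebra of all endomorphisms of \<open>E\<^sub>1\<close> (\<open>cong_even\<close>, \<open>ev_lift\<close>).

  An automorphism fixing \<open>w\<close> preserves \<open>E\<^sub>0\<close>, \<open>E\<^sub>1\<close> and the form, and on \<open>E\<^sub>1\<close> it normalizes the operators of
  \<open>E\<^sub>0\<close> (\<open>stab_mx_T\<close>). The element of the even Clifford algebra that acts on \<open>E\<^sub>1\<close> in the same way is thus an
  element of the spin group: the reversal corresponds to the adjoint operator. Conversely, an isometry
  of \<open>E\<^sub>1\<close> that normalizes the operators of \<open>E\<^sub>0\<close> extends to an automorphism, because the products within
  \<open>E\<^sub>1\<close> are determined by the form and by the action of \<open>E\<^sub>0\<close> (\<open>stab_exists\<close>). This identifies the stabilizer
  of \<open>w\<close> with the spin group (\<open>phi_iso\<close>).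

  The involution \<open>r\<close> is central in the stabilizer, so on \<open>E\<^sub>1\<close> it commutes with all matrices and is \<open>-1\<close>,
  while it is the identity on \<open>E\<^sub>0\<close> (\<open>central_involution\<close>). An automorphism commuting with \<open>r\<close> fixes \<open>w\<close>
  (\<open>centralizer_fixes_idempotent\<close>), hence the fixed points of \<open>\<sigma>\<close> are the stabilizer.

  For the structure over the base field all bases are chosen over the base field. The spin element of
  \<open>g\<close> then has coefficients that are traces of the matrix of \<open>g\<close> against rational matrices
  (\<open>phi_regular\<close>). In the other direction \<open>g\<close> acts on \<open>E\<^sub>1\<close> by the matrix of its spin element and on \<open>E\<^sub>0\<close> by
  conjugation, and the inverse matrix is the adjoint one, so all coordinates of \<open>g\<close> are polynomials in
  the entries of one matrix (\<open>phi_inverse_regular\<close>).\<close>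

(* the notation for coefficients of power series hides the one for components of vectors *)
no_notation fps_nth (infixl "$" 75)

section \<open>Orthogonal bases\<close>

locale bilinear_space = vector_space scale
  for scale :: "'f::field \<Rightarrow> 'v::ab_group_add \<Rightarrow> 'v" (infixr "\<star>" 75) +
  fixes bil :: "'v \<Rightarrow> 'v \<Rightarrow> 'f"
  assumes two_neq_0: "(2::'f) \<noteq> 0"
    and bil_add_left: "bil (x + y) z = bil x z + bil y z"
    and bil_scale_left: "bil (c \<star> x) z = c * bil x z"
    and bil_sym: "bil x y = bil y x"
begin

lemma four_neq_0: "(4::'f) \<noteq> 0"
proof -
  have "(4::'f) = 2 * 2" by simp
  then show ?thesis using two_neq_0 by (metis mult_eq_0_iff)
qed

lemma bil_add_right: "bil z (x + y) = bil z x + bil z y"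
  by (metis bil_add_left bil_sym)

lemma bil_scale_right: "bil z (c \<star> x) = c * bil z x"
  by (metis bil_scale_left bil_sym)

lemma bil_zero_left: "bil 0 z = 0"
  using bil_scale_left[of 0 0 z] by simp

lemma bil_zero_right: "bil z 0 = 0"
  using bil_zero_left bil_sym by metis

lemma bil_minus_left: "bil (- x) z = - bil x z"
  using bil_scale_left[of "-1" x z] by simp

lemma bil_minus_right: "bil z (- x) = - bil z x"
  using bil_minus_left bil_sym by metis

lemma bil_diff_left: "bil (x - y) z = bil x z - bil y z"
  using bil_add_left[of x "- y" z] by (simp add: bil_minus_left)

lemma bil_diff_right: "bil z (x - y) = bil z x - bil z y"
  using bil_diff_left bil_sym by metis

lemmas bil_simps = bil_add_left bil_add_right bil_scale_left bil_scale_right bil_zero_left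
  bil_zero_right bil_minus_left bil_minus_right bil_diff_left bil_diff_right

lemma bil_sum_left: "bil (\<Sum>i\<in>I. g i) z = (\<Sum>i\<in>I. bil (g i) z)"
  by (induction I rule: infinite_finite_induct) (simp_all add: bil_simps)

lemma bil_sum_right: "bil z (\<Sum>i\<in>I. g i) = (\<Sum>i\<in>I. bil z (g i))"
  by (induction I rule: infinite_finite_induct) (simp_all add: bil_simps)

definition nondegenerate_on :: "'v set \<Rightarrow> bool" where
  "nondegenerate_on U \<longleftrightarrow> (\<forall>x\<in>U. (\<forall>y\<in>U. bil x y = 0) \<longrightarrow> x = 0)"

definition orthogonal_system :: "'v set \<Rightarrow> bool" where
  "orthogonal_system B \<longleftrightarrow>
     finite B \<and> (\<forall>x\<in>B. bil x x \<noteq> 0) \<and> (\<forall>x\<in>B. \<forall>y\<in>B. x \<noteq> y \<longrightarrow> bil x y = 0)"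

definition orthogonal_basis :: "'v set \<Rightarrow> 'v set \<Rightarrow> bool" where
  "orthogonal_basis B U \<longleftrightarrow> orthogonal_system B \<and> B \<subseteq> U \<and> U \<subseteq> span B"

lemma bil_sum_orthogonal_system:
  assumes "orthogonal_system B" "b \<in> B"
  shows "bil (\<Sum>x\<in>B. c x \<star> x) b = c b * bil b b"
proof -
  have "bil (\<Sum>x\<in>B. c x \<star> x) b = (\<Sum>x\<in>B. if x = b then c b * bil b b else 0)"
    using assms unfolding bil_sum_left orthogonal_system_def
    by (intro sum.cong) (auto simp: bil_simps)
  also have "\<dots> = c b * bil b b"
    using assms by (simp add: orthogonal_system_def)
  finally show ?thesis .
qed

lemma orthogonal_system_independent:
  assumes B: "orthogonal_system B"
  shows "independent B"
proof (rule independent_if_scalars_zero)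
  show "finite B" using B by (simp add: orthogonal_system_def)
next
  fix c b assume "(\<Sum>x\<in>B. c x \<star> x) = 0" and b: "b \<in> B"
  then have "c b * bil b b = 0"
    using bil_sum_orthogonal_system[OF B b, of c] by (simp add: bil_simps)
  then show "c b = 0"
    using B b by (simp add: orthogonal_system_def)
qed

lemma orthogonal_expansion:
  assumes B: "orthogonal_system B" and x: "x \<in> span B"
  shows "x = (\<Sum>b\<in>B. (bil x b / bil b b) \<star> b)"
proof -
  have fin: "finite B" using B by (simp add: orthogonal_system_def)
  then obtain c where c: "x = (\<Sum>b\<in>B. c b \<star> b)"
    using x by (auto simp: span_finite)
  have "bil x b / bil b b = c b" if "b \<in> B" for b
    using bil_sum_orthogonal_system[OF B that, of c] B that
    by (simp add: c[symmetric] orthogonal_system_def)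
  then have "(\<Sum>b\<in>B. (bil x b / bil b b) \<star> b) = (\<Sum>b\<in>B. c b \<star> b)"
    by (intro sum.cong) auto
  then show ?thesis using c by simp
qed

lemma orthogonal_basis_card_eq_dim:
  assumes "orthogonal_basis B U"
  shows "card B = dim U"
  using assms orthogonal_system_independent basis_card_eq_dim
  by (auto simp: orthogonal_basis_def)

text \<open>A maximal orthogonal system in a nondegenerate space spans: a nonzero vector orthogonal to
  the system pairs nontrivially with another such vector, and then one of the two, or their sum,
  is anisotropic because \<open>2 \<noteq> 0\<close>.\<close>

lemma orthogonal_basis_exists:
  assumes U: "subspace U" and nd: "nondegenerate_on U" and S: "finite S" "U \<subseteq> span S"
  shows "\<exists>B. orthogonal_basis B U"
proof -
  define P where "P B \<longleftrightarrow> orthogonal_system B \<and> B \<subseteq> U" for B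
  have bound: "card B < Suc (card S)" if "P B" for B
    using that independent_span_bound[OF S(1) orthogonal_system_independent, of B]
      order_trans[OF _ S(2), of B]
    by (auto simp: P_def)
  have "P {}" by (simp add: P_def orthogonal_system_def)
  then obtain B where B: "P B" and max: "\<And>B'. P B' \<Longrightarrow> card B' \<le> card B"
    using ex_has_greatest_nat[of P "{}" card "Suc (card S)"] bound by (metis less_imp_le)
  have os: "orthogonal_system B" and BU: "B \<subseteq> U" and fin: "finite B"
    using B by (auto simp: P_def orthogonal_system_def)
  define pr where "pr x = x - (\<Sum>b\<in>B. (bil x b / bil b b) \<star> b)" for x
  have pr_orth: "bil (pr x) b = 0" if "b \<in> B" for x b
    using bil_sum_orthogonal_system[OF os that, of "\<lambda>b. bil x b / bil b b"] os that
    by (simp add: pr_def bil_simps orthogonal_system_def)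
  have pr_U: "pr x \<in> U" if "x \<in> U" for x
    unfolding pr_def using U BU that
    by (intro subspace_diff[OF U] that subspace_sum[OF U] subspace_scale[OF U]) auto
  have isotropic: "bil v v = 0" if v: "v \<in> U" and orth: "\<And>b. b \<in> B \<Longrightarrow> bil v b = 0" for v
  proof (rule ccontr)
    assume nz: "bil v v \<noteq> 0"
    have notin: "v \<notin> B" using orth nz by auto
    have "P (insert v B)"
      using os BU v orth nz bil_sym by (auto simp: P_def orthogonal_system_def)
    then show False using max[of "insert v B"] notin fin by simp
  qed
  have "x \<in> span B" if x: "x \<in> U" for x
  proof -
    have "bil (pr x) y = 0" if y: "y \<in> U" for y
    proof -
      have "bil (pr x + pr y) (pr x + pr y) = 0" "bil (pr x) (pr x) = 0" "bil (pr y) (pr y) = 0"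
        by (intro isotropic subspace_add[OF U] pr_U x y; simp add: bil_simps pr_orth)+
      then have "2 * bil (pr x) (pr y) = 0"
        by (simp add: bil_simps bil_sym[of "pr y" "pr x"])
      then have "bil (pr x) (pr y) = 0"
        using two_neq_0 by simp
      moreover have "bil (pr x) (pr y) = bil (pr x) y"
        unfolding pr_def[of y] bil_diff_right bil_sum_right bil_scale_right
        by (simp add: pr_orth)
      ultimately show ?thesis by simp
    qed
    then have "pr x = 0"
      using nd pr_U[OF x] unfolding nondegenerate_on_def by blast
    then have "x = (\<Sum>b\<in>B. (bil x b / bil b b) \<star> b)"
      by (simp add: pr_def)
    also have "\<dots> \<in> span B"
      by (intro span_sum span_scale span_base)
    finally show ?thesis .
  qed
  then show ?thesis
    using B by (auto simp: P_def orthogonal_basis_def)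
qed

end

section \<open>Peirce decomposition in cubic Jordan algebras\<close>

text \<open>The assumption \<open>cubic\<close> is the generic cubic equation of \<open>x\<close>, paired with vectors \<open>u\<close> orthogonal
  to \<open>e\<close> so that its constant term drops out.\<close>

locale cubic_jordan = bilinear_space scale bil
  for scale :: "'f::field \<Rightarrow> 'v::ab_group_add \<Rightarrow> 'v" (infixr "\<star>" 75)
    and bil :: "'v \<Rightarrow> 'v \<Rightarrow> 'f" +
  fixes A :: "'v set" and mul :: "'v \<Rightarrow> 'v \<Rightarrow> 'v" (infixl "\<diamond>" 70) and e :: 'v
  assumes mul_add_left: "(x + y) \<diamond> z = x \<diamond> z + y \<diamond> z"
    and mul_scale_left: "(c \<star> x) \<diamond> z = c \<star> (x \<diamond> z)"
    and mul_comm: "x \<diamond> y = y \<diamond> x"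
    and mul_unit: "e \<diamond> x = x"
    and A_subspace: "subspace A"
    and e_A: "e \<in> A"
    and mul_A: "x \<in> A \<Longrightarrow> y \<in> A \<Longrightarrow> x \<diamond> y \<in> A"
    and bil_e_e: "bil e e = 3"
    and nondegenerate_A: "nondegenerate_on A"
    and bil_mul: "x \<in> A \<Longrightarrow> y \<in> A \<Longrightarrow> z \<in> A \<Longrightarrow> bil (x \<diamond> y) z = bil x (y \<diamond> z)"
    and cubic: "x \<in> A \<Longrightarrow> u \<in> A \<Longrightarrow> bil u e = 0 \<Longrightarrow>
      2 * bil (x \<diamond> x) (x \<diamond> u) =
        2 * bil x e * bil (x \<diamond> x) u + (bil x x - bil x e * bil x e) * bil x u"
begin

lemma mul_add_right: "z \<diamond> (x + y) = z \<diamond> x + z \<diamond> y"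
  by (metis mul_add_left mul_comm)

lemma mul_scale_right: "z \<diamond> (c \<star> x) = c \<star> (z \<diamond> x)"
  by (metis mul_scale_left mul_comm)

lemma mul_zero_left: "0 \<diamond> z = 0"
  using mul_scale_left[of 0 0 z] by simp

lemma mul_zero_right: "z \<diamond> 0 = 0"
  using mul_zero_left mul_comm by metis

lemma mul_minus_left: "(- x) \<diamond> z = - (x \<diamond> z)"
  using mul_scale_left[of "-1" x z] by simp

lemma mul_minus_right: "z \<diamond> (- x) = - (z \<diamond> x)"
  using mul_minus_left mul_comm by metis

lemma mul_diff_left: "(x - y) \<diamond> z = x \<diamond> z - y \<diamond> z"
  using mul_add_left[of x "- y" z] by (simp add: mul_minus_left)

lemma mul_diff_right: "z \<diamond> (x - y) = z \<diamond> x - z \<diamond> y"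
  using mul_diff_left mul_comm by metis

lemma mul_unit_right: "x \<diamond> e = x"
  using mul_unit mul_comm by metis

lemmas mul_simps = mul_add_left mul_add_right mul_scale_left mul_scale_right mul_zero_left
  mul_zero_right mul_minus_left mul_minus_right mul_diff_left mul_diff_right mul_unit
  mul_unit_right

lemmas A_closed = e_A mul_A subspace_add[OF A_subspace] subspace_diff[OF A_subspace]
  subspace_scale[OF A_subspace] subspace_0[OF A_subspace] subspace_neg[OF A_subspace]

lemma eqI:
  assumes "x \<in> A" "y \<in> A" "\<And>u. u \<in> A \<Longrightarrow> bil x u = bil y u"
  shows "x = y"
proof -
  have "x - y \<in> A" "\<forall>u\<in>A. bil (x - y) u = 0"
    using assms by (simp_all add: A_closed bil_simps)
  then have "x - y = 0"
    using nondegenerate_A unfolding nondegenerate_on_def by blast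
  then show ?thesis by simp
qed

text \<open>The cubic equation determines \<open>x\<^sup>2 x\<close> only modulo \<open>e\<close>, because in characteristic 3 the unit
  lies in its own orthogonal complement. The missing multiple of \<open>e\<close> is left as an unknown that
  every application below eliminates by pairing with a suitable vector.\<close>

lemma cubic_polarized:
  assumes A: "x \<in> A" "y \<in> A" "z \<in> A"
  obtains \<nu> where "\<And>u. 2 * (bil ((x \<diamond> y) \<diamond> z) u + bil ((y \<diamond> z) \<diamond> x) u + bil ((z \<diamond> x) \<diamond> y) u) =
    2 * (bil z e * bil (x \<diamond> y) u + bil x e * bil (y \<diamond> z) u + bil y e * bil (z \<diamond> x) u)
    + (bil x y - bil x e * bil y e) * bil z u
    + (bil y z - bil y e * bil z e) * bil x u
    + (bil z x - bil z e * bil x e) * bil y u + \<nu> * bil e u"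
proof -
  define v where "v = 2 \<star> ((x \<diamond> y) \<diamond> z + (y \<diamond> z) \<diamond> x + (z \<diamond> x) \<diamond> y)
    - 2 \<star> (bil z e \<star> (x \<diamond> y) + bil x e \<star> (y \<diamond> z) + bil y e \<star> (z \<diamond> x))
    - (bil x y - bil x e * bil y e) \<star> z - (bil y z - bil y e * bil z e) \<star> x
    - (bil z x - bil z e * bil x e) \<star> y"
  have vA: "v \<in> A" unfolding v_def using A by (intro A_closed)
  have v0: "bil v u = 0" if u: "u \<in> A" "bil u e = 0" for u
  proof -
    define P where "P x = 2 * bil (x \<diamond> x) (x \<diamond> u) - 2 * bil x e * bil (x \<diamond> x) u
      - (bil x x - bil x e * bil x e) * bil x u" for x
    have P0: "P x = 0" if "x \<in> A" for x
      using cubic[OF that u] by (simp add: P_def)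
    have "P (x + y + z) - P (x + y) - P (x + z) - P (y + z) + P x + P y + P z = 0"
      using A by (simp add: P0 A_closed)
    moreover have "P (x + y + z) - P (x + y) - P (x + z) - P (y + z) + P x + P y + P z
      = 2 * (2 * (bil (x \<diamond> y) (z \<diamond> u) + bil (y \<diamond> z) (x \<diamond> u) + bil (z \<diamond> x) (y \<diamond> u))
    - 2 * (bil z e * bil (x \<diamond> y) u + bil x e * bil (y \<diamond> z) u + bil y e * bil (z \<diamond> x) u)
    - (bil x y - bil x e * bil y e) * bil z u
    - (bil y z - bil y e * bil z e) * bil x u
    - (bil z x - bil z e * bil x e) * bil y u)"
      unfolding P_def bil_simps mul_simps mul_comm[of y x] mul_comm[of z x] mul_comm[of z y]
        bil_sym[of y x] bil_sym[of z x] bil_sym[of z y]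
      by (simp add: algebra_simps)
    moreover have "bil ((x \<diamond> y) \<diamond> z) u = bil (x \<diamond> y) (z \<diamond> u)"
      "bil ((y \<diamond> z) \<diamond> x) u = bil (y \<diamond> z) (x \<diamond> u)"
      "bil ((z \<diamond> x) \<diamond> y) u = bil (z \<diamond> x) (y \<diamond> u)"
      using A u by (simp_all add: bil_mul A_closed)
    ultimately have "2 * bil v u = 0"
      unfolding v_def bil_simps by simp
    then show ?thesis using two_neq_0 by simp
  qed
  have "\<exists>\<nu>. v = \<nu> \<star> e"
  proof (cases "e = 0")
    case True
    then have "x' = 0" for x' :: 'v using mul_unit[of x'] by (simp add: mul_simps)
    then have "v = 0 \<star> e" by simp
    then show ?thesis ..
  next
    case False
    then obtain u0 where u0: "u0 \<in> A" "bil e u0 \<noteq> 0"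
      using nondegenerate_A e_A unfolding nondegenerate_on_def by metis
    have "v = (bil v u0 / bil e u0) \<star> e"
    proof (rule eqI)
      fix u assume u: "u \<in> A"
      have "bil v (u - (bil e u / bil e u0) \<star> u0) = 0"
        using u u0 by (intro v0) (simp_all add: A_closed bil_simps bil_sym[of u0 e] bil_sym[of u e])
      then show "bil v u = bil ((bil v u0 / bil e u0) \<star> e) u"
        using u0 by (simp add: bil_simps field_simps)
    qed (use vA in \<open>simp_all add: A_closed\<close>)
    then show ?thesis by blast
  qed
  then obtain \<nu> where \<nu>: "v = \<nu> \<star> e" by blast
  show ?thesis
  proof (rule that[of \<nu>])
    fix u
    have "bil v u = \<nu> * bil e u" by (simp add: \<nu> bil_simps)
    then show "2 * (bil ((x \<diamond> y) \<diamond> z) u + bil ((y \<diamond> z) \<diamond> x) u + bil ((z \<diamond> x) \<diamond> y) u) =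
    2 * (bil z e * bil (x \<diamond> y) u + bil x e * bil (y \<diamond> z) u + bil y e * bil (z \<diamond> x) u)
    + (bil x y - bil x e * bil y e) * bil z u
    + (bil y z - bil y e * bil z e) * bil x u
    + (bil z x - bil z e * bil x e) * bil y u + \<nu> * bil e u"
      unfolding v_def bil_simps by (simp add: algebra_simps)
  qed
qed

end

locale peirce = cubic_jordan scale bil A mul e
  for scale :: "'f::field \<Rightarrow> 'v::ab_group_add \<Rightarrow> 'v" (infixr "\<star>" 75)
    and bil :: "'v \<Rightarrow> 'v \<Rightarrow> 'f" and A and mul (infixl "\<diamond>" 70) and e +
  fixes w :: 'v
  assumes w_A: "w \<in> A" and w_idem: "w \<diamond> w = w" and bil_w_w: "bil w w = 1"
begin

text \<open>The zero eigenspace of multiplication by \<open>w\<close> is spanned by \<open>e - w\<close> and \<open>V0\<close>; together with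
  the half space \<open>V1\<close> and \<open>w\<close> itself it exhausts \<open>A\<close>.\<close>

definition V0 :: "'v set" where "V0 = {a \<in> A. bil a e = 0 \<and> w \<diamond> a = 0}"
definition V1 :: "'v set" where "V1 = {x \<in> A. w \<diamond> x = (1/2) \<star> x}"

lemma bil_w_e: "bil w e = 1" "bil e w = 1"
  using bil_mul[OF w_A w_A e_A] bil_w_w bil_sym[of e w] by (simp_all add: w_idem mul_simps)

lemma half: "(1/2 + 1/2 :: 'f) = 1" "x / 2 + x / 2 = (x::'f)" "2 * (x / 2) = (x::'f)"
  using two_neq_0 by (simp_all add: field_simps)

lemma V0_subspace: "subspace V0"
  unfolding V0_def by (rule subspaceI) (auto simp: A_closed bil_simps mul_simps)

lemma V1_subspace: "subspace V1"
  unfolding V1_def by (rule subspaceI) (auto simp: A_closed bil_simps mul_simps scale_right_distrib mult.commute)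

lemmas V0_closed = subspace_add[OF V0_subspace] subspace_diff[OF V0_subspace]
  subspace_scale[OF V0_subspace] subspace_0[OF V0_subspace] subspace_neg[OF V0_subspace]

lemmas V1_closed = subspace_add[OF V1_subspace] subspace_diff[OF V1_subspace]
  subspace_scale[OF V1_subspace] subspace_0[OF V1_subspace] subspace_neg[OF V1_subspace]

lemma V0_D:
  assumes "a \<in> V0"
  shows "a \<in> A" "bil a e = 0" "bil e a = 0" "w \<diamond> a = 0" "a \<diamond> w = 0" "bil a w = 0" "bil w a = 0"
proof -
  show *: "a \<in> A" "bil a e = 0" "w \<diamond> a = 0" "bil e a = 0" "a \<diamond> w = 0"
    using assms bil_sym[of e a] mul_comm[of a w] by (simp_all add: V0_def)
  have "bil w a = bil (w \<diamond> w) a" by (simp add: w_idem)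
  also have "\<dots> = 0" using bil_mul[OF w_A w_A *(1)] * by (simp add: bil_simps)
  finally show "bil w a = 0" "bil a w = 0" using bil_sym by metis+
qed

lemma V1_D:
  assumes "x \<in> V1"
  shows "x \<in> A" "w \<diamond> x = (1/2) \<star> x" "x \<diamond> w = (1/2) \<star> x" "bil x w = 0" "bil w x = 0"
    "bil x e = 0" "bil e x = 0"
proof -
  show *: "x \<in> A" "w \<diamond> x = (1/2) \<star> x" "x \<diamond> w = (1/2) \<star> x"
    using assms mul_comm[of x w] by (simp_all add: V1_def)
  have "bil w x = bil w x / 2"
    using bil_mul[OF w_A w_A *(1)] * by (simp add: bil_simps w_idem)
  then have "bil w x / 2 = 0"
    using half(2)[of "bil w x"] by (metis add_cancel_right_left)
  then show wx: "bil w x = 0" "bil x w = 0"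
    using two_neq_0 bil_sym[of x w] by auto
  have "bil e (w \<diamond> x) = bil w x"
    using bil_mul[OF e_A w_A *(1)] by (simp add: mul_simps)
  then show "bil e x = 0" "bil x e = 0"
    using wx * two_neq_0 bil_sym[of x e] by (simp_all add: bil_simps)
qed

lemma V0_V1_orthogonal: assumes "a \<in> V0" "x \<in> V1" shows "bil a x = 0" "bil x a = 0"
proof -
  have "bil (a \<diamond> w) x = bil a (w \<diamond> x)"
    using assms by (intro bil_mul w_A) (auto simp: V0_def V1_def)
  then show "bil a x = 0" "bil x a = 0"
    using V0_D[OF assms(1)] V1_D[OF assms(2)] two_neq_0 bil_sym[of x a] by (auto simp: bil_simps)
qed

text \<open>Multiplication by \<open>w\<close> has the eigenvalues 0, 1/2 and 1; the last one occurs on multiples of \<open>w\<close>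
  alone because \<open>w\<close> is primitive. This follows from the cubic identity for \<open>w\<close>, \<open>w\<close>, \<open>z\<close>.\<close>

lemma w_w_mul:
  assumes z: "z \<in> A"
  shows "w \<diamond> (w \<diamond> z) = (1/2) \<star> (w \<diamond> z) + (bil w z / 2) \<star> w"
proof (rule eqI)
  obtain \<nu> where \<nu>: "\<And>u. 2 * (bil ((w \<diamond> w) \<diamond> z) u + bil ((w \<diamond> z) \<diamond> w) u + bil ((z \<diamond> w) \<diamond> w) u) =
    2 * (bil z e * bil (w \<diamond> w) u + bil w e * bil (w \<diamond> z) u + bil w e * bil (z \<diamond> w) u)
    + (bil w w - bil w e * bil w e) * bil z u
    + (bil w z - bil w e * bil z e) * bil w u
    + (bil z w - bil z e * bil w e) * bil w u + \<nu> * bil e u"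
    using cubic_polarized[OF w_A w_A z] by blast
  have \<nu>': "4 * bil (w \<diamond> (w \<diamond> z)) u = 2 * bil (w \<diamond> z) u + 2 * bil w z * bil w u + \<nu> * bil e u" for u
    using \<nu>[of u] unfolding bil_w_w bil_w_e w_idem mul_comm[of z w] mul_comm[of "w \<diamond> z" w] bil_sym[of z w]
    by (simp add: algebra_simps)
  have "bil (w \<diamond> (w \<diamond> z)) w = bil w z" "bil (w \<diamond> z) w = bil w z"
    using bil_mul[of "w \<diamond> z" w w] bil_mul[of z w w] z w_A bil_sym[of z w]
    by (simp_all add: A_closed mul_comm[of z w] mul_comm[of "w \<diamond> z" w] w_idem)
  then have "\<nu> = 0" using \<nu>'[of w] by (simp add: bil_w_w bil_w_e)
  then have "2 * (2 * bil (w \<diamond> (w \<diamond> z)) u) = 2 * (bil (w \<diamond> z) u + bil w z * bil w u)" for u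
    using \<nu>'[of u] by (simp add: algebra_simps)
  then have "2 * bil (w \<diamond> (w \<diamond> z)) u = bil (w \<diamond> z) u + bil w z * bil w u" for u
    using two_neq_0 by (metis mult_left_cancel)
  then show "bil (w \<diamond> (w \<diamond> z)) u = bil ((1/2) \<star> (w \<diamond> z) + (bil w z / 2) \<star> w) u" for u
    using two_neq_0 by (simp add: bil_simps field_simps)
qed (use z w_A in \<open>simp_all add: A_closed\<close>)

definition pr1 :: "'v \<Rightarrow> 'v" where "pr1 z = 2 \<star> (w \<diamond> z) - (2 * bil w z) \<star> w"
definition pr0 :: "'v \<Rightarrow> 'v" where
  "pr0 z = z - pr1 z - bil w z \<star> w - ((bil e z - bil w z) / 2) \<star> (e - w)"

lemma peirce_decomposition:
  "z = bil w z \<star> w + ((bil e z - bil w z) / 2) \<star> (e - w) + pr0 z + pr1 z"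
  by (simp add: pr0_def)

lemma pr1_V1: assumes z: "z \<in> A" shows "pr1 z \<in> V1"
proof -
  have "w \<diamond> pr1 z = (1/2) \<star> pr1 z"
  proof (rule eqI)
    fix u
    show "bil (w \<diamond> pr1 z) u = bil ((1/2) \<star> pr1 z) u"
      unfolding pr1_def mul_simps w_w_mul[OF z] w_idem bil_simps
      using two_neq_0 by (simp add: field_simps)
  qed (use z w_A in \<open>simp_all add: A_closed pr1_def\<close>)
  then show ?thesis using z w_A by (simp add: V1_def A_closed pr1_def)
qed

lemma pr0_V0: assumes z: "z \<in> A" shows "pr0 z \<in> V0"
proof -
  have 1: "pr1 z \<in> V1" by (rule pr1_V1[OF z])
  have "w \<diamond> pr0 z = 0"
    unfolding pr0_def mul_simps V1_D(2)[OF 1] w_idem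
    using two_neq_0 by (simp add: pr1_def scale_right_diff_distrib)
  moreover have "bil (pr0 z) e = 0"
    using V1_D[OF 1] bil_w_e two_neq_0 unfolding pr0_def bil_simps bil_e_e
    by (simp add: bil_sym[of z e] field_simps)
  ultimately show ?thesis
    using z w_A V1_D(1)[OF 1] by (simp add: V0_def A_closed pr0_def)
qed

lemma V0_nondegenerate: "nondegenerate_on V0"
  unfolding nondegenerate_on_def
proof (intro ballI impI)
  fix a assume a: "a \<in> V0" and *: "\<forall>b\<in>V0. bil a b = 0"
  show "a = 0"
  proof (rule eqI)
    fix u assume u: "u \<in> A"
    have "bil a u = bil a (bil w u \<star> w + ((bil e u - bil w u) / 2) \<star> (e - w) + pr0 u + pr1 u)"
      by (subst peirce_decomposition[of u]) (rule refl)
    also have "\<dots> = 0"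
      unfolding bil_simps using * pr0_V0[OF u] V0_D[OF a] V0_V1_orthogonal[OF a pr1_V1[OF u]] by simp
    finally show "bil a u = bil 0 u" by (simp add: bil_simps)
  qed (use V0_D[OF a] in \<open>simp_all add: A_closed\<close>)
qed

lemma V1_nondegenerate: "nondegenerate_on V1"
  unfolding nondegenerate_on_def
proof (intro ballI impI)
  fix a assume a: "a \<in> V1" and *: "\<forall>b\<in>V1. bil a b = 0"
  show "a = 0"
  proof (rule eqI)
    fix u assume u: "u \<in> A"
    have "bil a u = bil a (bil w u \<star> w + ((bil e u - bil w u) / 2) \<star> (e - w) + pr0 u + pr1 u)"
      by (subst peirce_decomposition[of u]) (rule refl)
    also have "\<dots> = 0"
      unfolding bil_simps using * pr1_V1[OF u] V1_D[OF a] V0_V1_orthogonal[OF pr0_V0[OF u] a] by simp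
    finally show "bil a u = bil 0 u" by (simp add: bil_simps)
  qed (use V1_D[OF a] in \<open>simp_all add: A_closed\<close>)
qed

text \<open>By the cubic identity for \<open>a\<close>, \<open>b\<close>, \<open>w\<close> the vector \<open>w (ab)\<close> differs from \<open>ab\<close> by a multiple of
  \<open>e - w\<close>, so it is fixed by \<open>w\<close>. Since \<open>ab\<close> is orthogonal to \<open>w\<close>, it is also halved by \<open>w\<close>, and
  therefore vanishes.\<close>

lemma V0_mul_V0:
  assumes a: "a \<in> V0" and b: "b \<in> V0"
  shows "a \<diamond> b = (bil a b / 2) \<star> (e - w)"
proof -
  note A = V0_D[OF a] V0_D[OF b]
  obtain \<nu> where \<nu>: "\<And>u. 2 * (bil ((a \<diamond> b) \<diamond> w) u + bil ((b \<diamond> w) \<diamond> a) u + bil ((w \<diamond> a) \<diamond> b) u) =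
    2 * (bil w e * bil (a \<diamond> b) u + bil a e * bil (b \<diamond> w) u + bil b e * bil (w \<diamond> a) u)
    + (bil a b - bil a e * bil b e) * bil w u
    + (bil b w - bil b e * bil w e) * bil a u
    + (bil w a - bil w e * bil a e) * bil b u + \<nu> * bil e u"
    using cubic_polarized[OF A(1) A(8) w_A] by blast
  have *: "2 * bil (w \<diamond> (a \<diamond> b)) u = 2 * bil (a \<diamond> b) u + bil a b * bil w u + \<nu> * bil e u" for u
    using \<nu>[of u] unfolding A bil_w_w bil_w_e mul_simps bil_simps mul_comm[of "a \<diamond> b" w]
    by (simp add: algebra_simps)
  have abA: "a \<diamond> b \<in> A" using A by (simp add: A_closed)
  have abw: "bil (a \<diamond> b) w = 0" using bil_mul[OF A(1) A(8) w_A] A by (simp add: bil_simps)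
  have "bil (w \<diamond> (a \<diamond> b)) w = 0"
    using bil_mul[OF abA w_A w_A] abw w_idem by (simp add: mul_comm[of w "a \<diamond> b"])
  then have \<nu>0: "\<nu> = - bil a b"
    using *[of w] abw by (simp add: bil_w_w bil_w_e add_eq_0_iff)
  have 1: "w \<diamond> (a \<diamond> b) = a \<diamond> b - (bil a b / 2) \<star> (e - w)"
  proof (rule eqI)
    fix u
    show "bil (w \<diamond> (a \<diamond> b)) u = bil (a \<diamond> b - (bil a b / 2) \<star> (e - w)) u"
      using *[of u] two_neq_0 unfolding \<nu>0 bil_simps by (simp add: field_simps)
  qed (use abA w_A in \<open>simp_all add: A_closed\<close>)
  have "w \<diamond> (w \<diamond> (a \<diamond> b)) = w \<diamond> (a \<diamond> b)"
    using arg_cong[OF 1, of "\<lambda>v. w \<diamond> v"] by (simp add: mul_simps w_idem)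
  then have "(1/2) \<star> (w \<diamond> (a \<diamond> b)) = w \<diamond> (a \<diamond> b)"
    using w_w_mul[OF abA] abw by (simp add: bil_sym[of w "a \<diamond> b"])
  then have "(1/2) \<star> (w \<diamond> (a \<diamond> b)) = 1 \<star> (w \<diamond> (a \<diamond> b))" by simp
  moreover have "1/2 \<noteq> (1::'f)"
    using half(1) by (metis add_cancel_right_left zero_neq_one)
  ultimately have "w \<diamond> (a \<diamond> b) = 0"
    using scale_cancel_right by blast
  then show ?thesis using 1 by simp
qed

lemma V0_mul_V1:
  assumes a: "a \<in> V0" and x: "x \<in> V1"
  shows "a \<diamond> x \<in> V1"
proof -
  note A = V0_D[OF a] V1_D[OF x]
  have axA: "a \<diamond> x \<in> A" using A by (simp add: A_closed)
  obtain \<nu> where \<nu>: "\<And>u. 2 * (bil ((w \<diamond> a) \<diamond> x) u + bil ((a \<diamond> x) \<diamond> w) u + bil ((x \<diamond> w) \<diamond> a) u) =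
    2 * (bil x e * bil (w \<diamond> a) u + bil w e * bil (a \<diamond> x) u + bil a e * bil (x \<diamond> w) u)
    + (bil w a - bil w e * bil a e) * bil x u
    + (bil a x - bil a e * bil x e) * bil w u
    + (bil x w - bil x e * bil w e) * bil a u + \<nu> * bil e u"
    using cubic_polarized[OF w_A A(1) A(8)] by blast
  have *: "2 * bil (w \<diamond> (a \<diamond> x)) u = bil (a \<diamond> x) u + \<nu> * bil e u" for u
    using \<nu>[of u] half(3) unfolding A bil_w_w bil_w_e mul_simps bil_simps mul_comm[of "a \<diamond> x" w] mul_comm[of x a]
      V0_V1_orthogonal[OF a x]
    by (simp add: algebra_simps)
  have axw: "bil (a \<diamond> x) w = 0"
    using bil_mul[of x a w] A w_A by (simp add: bil_simps mul_comm[of x a])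
  have "bil (w \<diamond> (a \<diamond> x)) w = 0"
    using bil_mul[OF axA w_A w_A] axw w_idem by (simp add: mul_comm[of w "a \<diamond> x"])
  then have \<nu>0: "\<nu> = 0" using *[of w] axw by (simp add: bil_w_e)
  have "w \<diamond> (a \<diamond> x) = (1/2) \<star> (a \<diamond> x)"
  proof (rule eqI)
    fix u
    show "bil (w \<diamond> (a \<diamond> x)) u = bil ((1/2) \<star> (a \<diamond> x)) u"
      using *[of u] two_neq_0 unfolding \<nu>0 bil_simps by (simp add: field_simps)
  qed (use axA w_A in \<open>simp_all add: A_closed\<close>)
  then show ?thesis using axA by (simp add: V1_def)
qed

lemma e_w_mul_V1: assumes "x \<in> V1" shows "(e - w) \<diamond> x = (1/2) \<star> x"
proof -
  have "(e - w) \<diamond> x = 1 \<star> x - (1/2) \<star> x" using V1_D[OF assms] by (simp add: mul_simps)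
  also have "\<dots> = (1 - 1/2) \<star> x" by (simp only: scale_left_diff_distrib)
  also have "1 - 1/2 = (1/2::'f)" using two_neq_0 by (simp add: field_simps)
  finally show ?thesis .
qed

text \<open>This is the Clifford relation: the operators \<open>x \<mapsto> 2 ax\<close> on the half space \<open>V1\<close> square to
  the quadratic form on \<open>V0\<close>.\<close>

lemma clifford_relation:
  assumes a: "a \<in> V0" and b: "b \<in> V0" and x: "x \<in> V1"
  shows "a \<diamond> (b \<diamond> x) + b \<diamond> (a \<diamond> x) = (bil a b / 4) \<star> x"
proof -
  note A = V0_D[OF a] V0_D[OF b] V1_D[OF x]
  note inV = V0_mul_V1[OF a V0_mul_V1[OF b x]] V0_mul_V1[OF b V0_mul_V1[OF a x]]
  obtain \<nu> where \<nu>: "\<And>u. 2 * (bil ((a \<diamond> b) \<diamond> x) u + bil ((b \<diamond> x) \<diamond> a) u + bil ((x \<diamond> a) \<diamond> b) u) =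
    2 * (bil x e * bil (a \<diamond> b) u + bil a e * bil (b \<diamond> x) u + bil b e * bil (x \<diamond> a) u)
    + (bil a b - bil a e * bil b e) * bil x u
    + (bil b x - bil b e * bil x e) * bil a u
    + (bil x a - bil x e * bil a e) * bil b u + \<nu> * bil e u"
    using cubic_polarized[OF A(1) A(8) A(15)] by blast
  have abx: "(a \<diamond> b) \<diamond> x = (bil a b / 4) \<star> x"
    unfolding V0_mul_V0[OF a b] mul_scale_left e_w_mul_V1[OF x] scale_scale
    by simp
  have *: "2 * bil (a \<diamond> (b \<diamond> x) + b \<diamond> (a \<diamond> x)) u = 2 * (bil a b / 4 * bil x u) + \<nu> * bil e u" for u
  proof -
    define q where "q = bil a b / 4 * bil x u"
    have "q = bil a b * bil x u / 2 / 2" by (simp add: q_def)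
    then have q: "bil a b * bil x u = 2 * q + 2 * q"
      by (simp only: half)
    show ?thesis
      using \<nu>[of u] unfolding abx A bil_simps V0_V1_orthogonal[OF a x] V0_V1_orthogonal[OF b x]
        mul_comm[of "b \<diamond> x" a] mul_comm[of x a] mul_comm[of "a \<diamond> x" b] q_def[symmetric]
      by (simp add: algebra_simps q)
  qed
  have "\<nu> = 0"
    using *[of w] inV V1_D(4)[OF inV(1)] V1_D(4)[OF inV(2)] A by (simp add: bil_simps bil_w_e)
  show ?thesis
  proof (rule eqI)
    fix u
    show "bil (a \<diamond> (b \<diamond> x) + b \<diamond> (a \<diamond> x)) u = bil ((bil a b / 4) \<star> x) u"
      unfolding bil_scale_left using *[of u] two_neq_0 \<open>\<nu> = 0\<close>
      by (metis add_0_right mult_left_cancel mult_zero_left)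
  qed (use V1_D(1)[OF inV(1)] V1_D(1)[OF inV(2)] A in \<open>simp_all add: A_closed\<close>)
qed

lemma V1_mul_V1_w:
  assumes x: "x \<in> V1" and y: "y \<in> V1"
  shows "w \<diamond> (x \<diamond> y) = (bil x y / 2) \<star> w"
proof -
  note A = V1_D[OF x] V1_D[OF y]
  have xyA: "x \<diamond> y \<in> A" using A by (simp add: A_closed)
  obtain \<nu> where \<nu>: "\<And>u. 2 * (bil ((x \<diamond> y) \<diamond> w) u + bil ((y \<diamond> w) \<diamond> x) u + bil ((w \<diamond> x) \<diamond> y) u) =
    2 * (bil w e * bil (x \<diamond> y) u + bil x e * bil (y \<diamond> w) u + bil y e * bil (w \<diamond> x) u)
    + (bil x y - bil x e * bil y e) * bil w u
    + (bil y w - bil y e * bil w e) * bil x u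
    + (bil w x - bil w e * bil x e) * bil y u + \<nu> * bil e u"
    using cubic_polarized[OF A(1) A(8) w_A] by blast
  have *: "2 * bil (w \<diamond> (x \<diamond> y)) u = bil x y * bil w u + \<nu> * bil e u" for u
    using \<nu>[of u] half(3) unfolding A bil_w_w bil_w_e mul_simps bil_simps mul_comm[of "x \<diamond> y" w] mul_comm[of y x]
    by (simp add: algebra_simps)
  have "bil (x \<diamond> y) w = bil x y / 2"
    using bil_mul[OF A(1) A(8) w_A] A by (simp add: bil_simps)
  then have "bil (w \<diamond> (x \<diamond> y)) w = bil x y / 2"
    using bil_mul[OF xyA w_A w_A] w_idem by (simp add: mul_comm[of w "x \<diamond> y"])
  then have "2 * bil (w \<diamond> (x \<diamond> y)) w = bil x y"
    by (simp only: half(3))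
  then have \<nu>0: "\<nu> = 0" using *[of w] by (simp add: bil_w_e bil_w_w)
  show ?thesis
  proof (rule eqI)
    fix u
    show "bil (w \<diamond> (x \<diamond> y)) u = bil ((bil x y / 2) \<star> w) u"
      using *[of u] two_neq_0 unfolding \<nu>0 bil_simps by (simp add: field_simps)
  qed (use xyA w_A in \<open>simp_all add: A_closed\<close>)
qed

text \<open>Only the component of \<open>xy\<close> in \<open>V0\<close> is not determined by the form alone.\<close>

lemma V1_mul_V1:
  assumes x: "x \<in> V1" and y: "y \<in> V1"
  shows "x \<diamond> y = (bil x y / 2) \<star> w + (bil x y / 4) \<star> (e - w) + pr0 (x \<diamond> y)"
proof -
  note A = V1_D[OF x] V1_D[OF y]
  have w: "bil w (x \<diamond> y) = bil x y / 2"
    using bil_mul[OF A(1) A(8) w_A] A bil_sym[of w "x \<diamond> y"] by (simp add: bil_simps)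
  have e: "bil e (x \<diamond> y) = bil x y"
    using bil_mul[OF e_A A(1) A(8)] by (simp add: mul_simps)
  have "pr1 (x \<diamond> y) = 0"
    unfolding pr1_def V1_mul_V1_w[OF x y] w by simp
  moreover have "(bil x y - bil x y / 2) / 2 = bil x y / 4"
    using half(2)[of "bil x y"] by (metis add_diff_cancel_left' divide_divide_eq_left mult_2
      numeral_Bit0 one_add_one)
  ultimately show ?thesis
    using peirce_decomposition[of "x \<diamond> y"] unfolding w e by (simp only: add_0_right)
qed

end

section \<open>Dimensions of the Peirce components\<close>

context bilinear_space begin

lemma anisotropic_exists:
  assumes U: "subspace U" and nd: "nondegenerate_on U" and x: "x \<in> U" "x \<noteq> 0"
  shows "\<exists>y\<in>U. bil y y \<noteq> 0"
proof (rule ccontr)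
  assume *: "\<not> ?thesis"
  have "bil x y = 0" if y: "y \<in> U" for y
  proof -
    have "bil (x + y) (x + y) = 0" "bil x x = 0" "bil y y = 0"
      using * x y subspace_add[OF U] by blast+
    then have "2 * bil x y = 0" by (simp add: bil_simps bil_sym[of y x])
    then show ?thesis using two_neq_0 by simp
  qed
  then show False using nd x unfolding nondegenerate_on_def by blast
qed

lemma orthogonal_basis_nonempty:
  assumes "orthogonal_basis B U" "x \<in> U" "x \<noteq> 0"
  shows "card B \<noteq> 0"
  using assms by (auto simp: orthogonal_basis_def orthogonal_system_def)

lemma orthogonal_system_Un:
  assumes "orthogonal_system B" "orthogonal_system B'" "\<And>x y. x \<in> B \<Longrightarrow> y \<in> B' \<Longrightarrow> bil x y = 0"
  shows "orthogonal_system (B \<union> B') \<and> card (B \<union> B') = card B + card B'"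
proof -
  have "B \<inter> B' = {}"
    using assms by (auto simp: orthogonal_system_def)
  moreover have "bil y x = 0" if "x \<in> B" "y \<in> B'" for x y
    using assms(3)[OF that] bil_sym by metis
  ultimately show ?thesis
    using assms by (auto simp: orthogonal_system_def card_Un_disjoint)
qed

lemma orthogonal_system_singleton: "bil x x \<noteq> 0 \<Longrightarrow> orthogonal_system {x}"
  by (simp add: orthogonal_system_def)

end

text \<open>An idempotent \<open>u\<close> for which \<open>u A\<close> consists of multiples of \<open>u\<close> splits off as a direct factor. The
  product of a field with the Jordan algebra of a quadratic form satisfies the cubic identity too
  and may have any dimension, so it has to be excluded before dimensions can be counted.\<close>

locale peirce27 = peirce scale bil A mul e w
  for scale :: "'f::field \<Rightarrow> 'v::ab_group_add \<Rightarrow> 'v" (infixr "\<star>" 75)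
    and bil :: "'v \<Rightarrow> 'v \<Rightarrow> 'f" and A and mul (infixl "\<diamond>" 70) and e and w +
  assumes square_root: "\<exists>d::'f. d * d = c"
    and A_basis: "\<exists>S. finite S \<and> independent S \<and> span S = A \<and> card S = 27"
    and no_central_idempotent:
      "u \<in> A \<Longrightarrow> u \<diamond> u = u \<Longrightarrow> bil u u = 1 \<Longrightarrow> \<exists>x\<in>A. \<forall>c. u \<diamond> x \<noteq> c \<star> u"
begin

lemma orthogonal_basis_in_A:
  assumes "subspace U" "nondegenerate_on U" "U \<subseteq> A"
  shows "\<exists>B. orthogonal_basis B U"
proof -
  obtain S where "finite S" "span S = A" using A_basis by blast
  then show ?thesis using orthogonal_basis_exists[OF assms(1,2), of S] assms(3) by simp
qed

lemma V1_nonzero: "\<exists>x\<in>V1. x \<noteq> 0"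
proof (rule ccontr)
  assume *: "\<not> ?thesis"
  have "w \<diamond> z = bil w z \<star> w" if z: "z \<in> A" for z
  proof -
    have "pr1 z = 0" using * pr1_V1[OF z] by blast
    then have "2 \<star> (w \<diamond> z) = 2 \<star> (bil w z \<star> w)"
      by (simp add: pr1_def)
    then show ?thesis using two_neq_0 scale_cancel_left by blast
  qed
  then show False using no_central_idempotent[OF w_A w_idem bil_w_w] by metis
qed

lemma bil_f_f: "bil (e - w) (e - w) = 2"
  by (simp add: bil_simps bil_e_e bil_w_e bil_w_w)

lemma f_f: "(e - w) \<diamond> (e - w) = e - w"
  by (simp add: mul_simps w_idem)

lemma f_V0: "a \<in> V0 \<Longrightarrow> (e - w) \<diamond> a = a"
  by (simp add: mul_simps V0_D)

text \<open>If \<open>V0\<close> were zero, the square of an anisotropic \<open>x\<close> in \<open>V1\<close> would lie in the span of \<open>w\<close> and \<open>e - w\<close>, and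
  the cubic identity would force \<open>\<langle>x,x\<rangle> = 0\<close>.\<close>

lemma V0_nonzero: "\<exists>a\<in>V0. a \<noteq> 0"
proof (rule ccontr)
  assume *: "\<not> ?thesis"
  obtain x where x: "x \<in> V1" "bil x x \<noteq> 0"
    using V1_nonzero anisotropic_exists[OF V1_subspace V1_nondegenerate] by blast
  note X = V1_D[OF x(1)]
  have "pr0 (x \<diamond> x) = 0"
    using * pr0_V0[of "x \<diamond> x"] X by (auto simp: A_closed)
  then have xx: "x \<diamond> x = (bil x x / 2) \<star> w + (bil x x / 4) \<star> (e - w)"
    using V1_mul_V1[OF x(1) x(1)] by simp
  have b: "bil (x \<diamond> x) (x \<diamond> x) = bil x x / 2 * (bil x x / 2) + bil x x / 4 * (bil x x / 4 * 2)"
    unfolding xx unfolding bil_simps bil_e_e bil_w_e bil_w_w by (simp add: algebra_simps)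
  have c: "2 * bil (x \<diamond> x) (x \<diamond> x) = bil x x * bil x x"
    using cubic[OF X(1) X(1)] X by simp
  define p where "p = bil x x / 4"
  have p: "bil x x = 4 * p" "bil x x / 2 = 2 * p" "bil x x / 4 = p"
    using two_neq_0 four_neq_0 by (simp_all add: p_def field_simps)
  have "2 * (2 * p * (2 * p) + p * (p * 2)) = 4 * p * (4 * p)"
    using c unfolding b p(2,3) by (simp only: p(1))
  moreover have "4 * (p * p) = 4 * p * (4 * p) - 2 * (2 * p * (2 * p) + p * (p * 2))"
    by (simp add: algebra_simps)
  ultimately have "4 * (p * p) = 0" by (simp only: diff_self)
  then show False using four_neq_0 x(2) p(1) by simp
qed

text \<open>For \<open>a\<close> in \<open>V0\<close> with \<open>Q(a) = 1\<close> multiplication by \<open>2a\<close> is an involution of \<open>V1\<close>; its eigenspaces for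
  1 and -1 are \<open>half_space a\<close> and \<open>half_space (- a)\<close>.\<close>

definition half_space :: "'v \<Rightarrow> 'v set" where
  "half_space a = {x \<in> V1. a \<diamond> x = (1/2) \<star> x}"

definition orth :: "'v \<Rightarrow> 'v set" where
  "orth a = {b \<in> V0. bil a b = 0}"

lemma orth_uminus: "orth (- a) = orth a"
  by (simp add: orth_def bil_simps)

lemma half_space_subspace: "subspace (half_space a)"
  unfolding half_space_def
  by (rule subspaceI) (auto simp: V1_closed mul_simps scale_right_distrib mult.commute)

lemma orth_subspace: "subspace (orth a)"
  unfolding orth_def by (rule subspaceI) (auto simp: V0_closed bil_simps)

context
  fixes a assumes a: "a \<in> V0" and bil_a_a: "bil a a = 2"
begin

lemma uminus_a: "- a \<in> V0" "bil (- a) (- a) = 2"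
  using a bil_a_a by (simp_all add: V0_closed bil_simps)

lemma a_a: "a \<diamond> a = e - w"
  using V0_mul_V0[OF a a] bil_a_a two_neq_0 by simp

lemma a_a_mul: "x \<in> V1 \<Longrightarrow> a \<diamond> (a \<diamond> x) = (1/4) \<star> x"
proof -
  assume x: "x \<in> V1"
  have "2 \<star> (a \<diamond> (a \<diamond> x)) = (1 + 1) \<star> (a \<diamond> (a \<diamond> x))" by simp
  also have "\<dots> = (2/4) \<star> x"
    using clifford_relation[OF a a x] bil_a_a by (simp only: scale_left_distrib scale_one)
  also have "\<dots> = 2 \<star> ((1/4) \<star> x)" by simp
  finally show ?thesis using two_neq_0 scale_cancel_left by blast
qed

lemma half_space_orthogonal:
  assumes x: "x \<in> half_space a" and y: "y \<in> half_space (- a)"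
  shows "bil x y = 0"
proof -
  have X: "x \<in> V1" "a \<diamond> x = (1/2) \<star> x" "y \<in> V1" "a \<diamond> y = - ((1/2) \<star> y)"
    using x y by (auto simp: half_space_def mul_simps minus_equation_iff[of "a \<diamond> y"])
  have "bil (x \<diamond> a) y = bil x (a \<diamond> y)"
    using X by (intro bil_mul V1_D(1) V0_D(1) a)
  then have "bil x y / 2 = - (bil x y / 2)"
    using X by (simp add: mul_comm[of x a] bil_simps)
  then have "bil x y / 2 + bil x y / 2 = 0" by (simp only: eq_neg_iff_add_eq_0)
  then show ?thesis by (simp only: half)
qed

lemma half_space_decomposition:
  assumes x: "x \<in> V1"
  shows "\<exists>y\<in>half_space a. \<exists>z\<in>half_space (- a). x = y + z"
proof (intro bexI)
  have ax: "a \<diamond> x \<in> V1" by (rule V0_mul_V1[OF a x])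
  show "x = ((1/2) \<star> x + a \<diamond> x) + ((1/2) \<star> x - a \<diamond> x)"
    by (simp add: scale_left_distrib[symmetric] half)
  show "(1/2) \<star> x + a \<diamond> x \<in> half_space a"
    unfolding half_space_def using x ax
    by (simp add: V1_closed mul_simps a_a_mul scale_right_distrib add.commute)
  show "(1/2) \<star> x - a \<diamond> x \<in> half_space (- a)"
    unfolding half_space_def using x ax
    by (simp add: V1_closed mul_simps a_a_mul scale_right_diff_distrib)
qed

lemma half_space_nondegenerate: "nondegenerate_on (half_space a)"
  unfolding nondegenerate_on_def
proof (intro ballI impI)
  fix x assume x: "x \<in> half_space a" and *: "\<forall>y\<in>half_space a. bil x y = 0"
  have "bil x y = 0" if "y \<in> V1" for y
    using half_space_decomposition[OF that] * half_space_orthogonal[OF x] by (auto simp: bil_simps)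
  then show "x = 0"
    using V1_nondegenerate x unfolding nondegenerate_on_def half_space_def by blast
qed

lemma orth_decomposition:
  assumes b: "b \<in> V0"
  shows "b - (bil a b / 2) \<star> a \<in> orth a"
  using a b bil_a_a two_neq_0 by (simp add: orth_def V0_closed bil_simps)

lemma orth_nondegenerate: "nondegenerate_on (orth a)"
  unfolding nondegenerate_on_def
proof (intro ballI impI)
  fix x assume x: "x \<in> orth a" and *: "\<forall>y\<in>orth a. bil x y = 0"
  have "bil x y = 0" if "y \<in> V0" for y
    using orth_decomposition[OF that] * x by (auto simp: bil_simps orth_def bil_sym[of x a])
  then show "x = 0"
    using V0_nondegenerate x unfolding nondegenerate_on_def orth_def by blast
qed

lemma orth_mul:
  assumes b: "b \<in> orth a" and x: "x \<in> half_space a"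
  shows "b \<diamond> x \<in> half_space (- a)"
proof -
  have B: "b \<in> V0" "bil a b = 0" "x \<in> V1" "a \<diamond> x = (1/2) \<star> x"
    using b x by (auto simp: orth_def half_space_def)
  have "a \<diamond> (b \<diamond> x) + b \<diamond> (a \<diamond> x) = 0"
    using clifford_relation[OF a B(1,3)] B by simp
  then have "- (a \<diamond> (b \<diamond> x)) = (1/2) \<star> (b \<diamond> x)"
    using B by (simp add: mul_simps add_eq_0_iff)
  then show ?thesis
    using V0_mul_V1[OF B(1,3)] by (simp add: half_space_def mul_simps)
qed

lemma bil_orth_mul:
  assumes b: "b \<in> orth a" and c: "c \<in> orth a" and x: "x \<in> half_space a"
  shows "bil (b \<diamond> x) (c \<diamond> x) = bil b c * bil x x / 8"
proof -
  have B: "b \<in> V0" "c \<in> V0" "x \<in> V1"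
    using b c x by (auto simp: orth_def half_space_def)
  note A = V0_D(1)[OF B(1)] V0_D(1)[OF B(2)] V1_D(1)[OF B(3)]
  have "bil (c \<diamond> (b \<diamond> x)) x = bil (b \<diamond> x) (c \<diamond> x)" "bil (b \<diamond> (c \<diamond> x)) x = bil (c \<diamond> x) (b \<diamond> x)"
    using A by (simp_all add: bil_mul A_closed mul_comm[of c "b \<diamond> x"] mul_comm[of b "c \<diamond> x"])
  then have "2 * bil (b \<diamond> x) (c \<diamond> x) = bil (c \<diamond> (b \<diamond> x) + b \<diamond> (c \<diamond> x)) x"
    by (simp add: bil_simps bil_sym[of "c \<diamond> x"])
  also have "\<dots> = bil b c * bil x x / 4"
    using clifford_relation[OF B(2,1,3)] by (simp add: bil_simps bil_sym[of c b])
  also have "\<dots> = 2 * (bil b c * bil x x / 4 / 2)" by (simp only: half)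
  finally have "bil (b \<diamond> x) (c \<diamond> x) = bil b c * bil x x / 4 / 2"
    using two_neq_0 mult_left_cancel by metis
  then show ?thesis by simp
qed

lemma pr0_square:
  assumes x: "x \<in> half_space a"
  shows "pr0 (x \<diamond> x) = (bil x x / 4) \<star> a"
proof -
  have X: "x \<in> V1" "a \<diamond> x = (1/2) \<star> x" "x \<diamond> a = (1/2) \<star> x"
    using x mul_comm[of x a] by (auto simp: half_space_def)
  have xA: "x \<in> A" "x \<diamond> x \<in> A" using V1_D[OF X(1)] by (auto simp: A_closed)
  have p: "pr0 (x \<diamond> x) \<in> V0" by (rule pr0_V0[OF xA(2)])
  have bilb: "bil (pr0 (x \<diamond> x)) b = bil x (b \<diamond> x)" if b: "b \<in> V0" for b
  proof -
    have "bil (x \<diamond> x) b = bil (pr0 (x \<diamond> x)) b"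
      using arg_cong[OF V1_mul_V1[OF X(1) X(1)], of "\<lambda>v. bil v b"] V0_D[OF b]
      by (simp add: bil_simps)
    then show ?thesis using bil_mul[OF xA(1) xA(1) V0_D(1)[OF b]] by (simp add: mul_comm[of x b])
  qed
  have "pr0 (x \<diamond> x) - (bil x x / 4) \<star> a = 0"
  proof -
    have "bil (pr0 (x \<diamond> x) - (bil x x / 4) \<star> a) b = 0" if b: "b \<in> V0" for b
    proof -
      define d where "d = b - (bil a b / 2) \<star> a"
      have d: "d \<in> orth a" unfolding d_def by (rule orth_decomposition[OF b])
      then have d0: "bil x (d \<diamond> x) = 0" by (intro half_space_orthogonal x orth_mul)
      have "bil x (b \<diamond> x) = bil x (((bil a b / 2) \<star> a + d) \<diamond> x)" by (simp add: d_def)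
      also have "\<dots> = bil a b / 2 * (bil x x / 2)"
        using d0 X by (simp add: mul_simps bil_simps)
      finally show ?thesis using bilb[OF b] by (simp add: bil_simps)
    qed
    then show ?thesis
      using V0_nondegenerate p a unfolding nondegenerate_on_def by (meson V0_closed(2) V0_closed(3))
  qed
  then show ?thesis by simp
qed

text \<open>The product \<open>xy\<close> is a multiple of the preimage of \<open>y\<close>: the cubic identity for \<open>x\<close>, \<open>x\<close>, \<open>y\<close> evaluates
  \<open>(xy)x\<close>, once \<open>x\<^sup>2\<close> is known from the previous lemma.\<close>

lemma orth_mul_surj:
  assumes x: "x \<in> half_space a" "bil x x \<noteq> 0" and y: "y \<in> half_space (- a)"
  shows "\<exists>b\<in>orth a. b \<diamond> x = y"
proof -
  have X: "x \<in> V1" "a \<diamond> x = (1/2) \<star> x" "y \<in> V1" "- (a \<diamond> y) = (1/2) \<star> y"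
    using x y by (auto simp: half_space_def mul_simps)
  have ay: "a \<diamond> y = - ((1/2) \<star> y)" using X(4) by (metis add.inverse_inverse)
  note A = V1_D[OF X(1)] V1_D[OF X(3)]
  have xy0: "bil x y = 0" by (rule half_space_orthogonal[OF x(1) y])
  define b where "b = x \<diamond> y"
  have bV0: "b \<in> V0"
    using V1_mul_V1[OF X(1,3)] xy0 pr0_V0[of "x \<diamond> y"] A by (simp add: b_def A_closed)
  have "bil b a = bil x (y \<diamond> a)"
    unfolding b_def using A V0_D(1)[OF a] by (intro bil_mul)
  also have "\<dots> = 0" using ay xy0 by (simp add: mul_comm[of y a] bil_simps)
  finally have borth: "b \<in> orth a" using bV0 by (simp add: orth_def bil_sym[of a b])
  define p where "p = bil x x / 8"
  have p: "bil x x / 4 = 2 * p" "bil x x / 2 = 4 * p" "bil x x = 8 * p" "p \<noteq> 0"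
  proof -
    have e8: "(8::'f) = 2 * 4" by simp
    have n8: "(8::'f) \<noteq> 0" unfolding e8 using two_neq_0 four_neq_0 by (metis mult_eq_0_iff)
    show "bil x x / 4 = 2 * p" "bil x x / 2 = 4 * p" "bil x x = 8 * p" "p \<noteq> 0"
      using n8 two_neq_0 four_neq_0 x(2) by (simp_all add: p_def field_simps)
  qed
  have xxy: "(x \<diamond> x) \<diamond> y = (2 * p) \<star> y"
  proof -
    have "(x \<diamond> x) \<diamond> y = (4 * p) \<star> (w \<diamond> y) + (2 * p) \<star> ((e - w) \<diamond> y) + (2 * p) \<star> (a \<diamond> y)"
      using V1_mul_V1[OF X(1) X(1)] pr0_square[OF x(1)] p by (metis mul_add_left mul_scale_left)
    also have "\<dots> = (4 * p) \<star> ((1/2) \<star> y)"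
      unfolding e_w_mul_V1[OF X(3)] ay V1_D(2)[OF X(3)] by simp
    also have "\<dots> = (2 * p) \<star> y"
      using two_neq_0 by (simp add: field_simps)
    finally show ?thesis .
  qed
  obtain \<nu> where \<nu>: "\<And>u. 2 * (bil ((x \<diamond> x) \<diamond> y) u + bil ((x \<diamond> y) \<diamond> x) u + bil ((y \<diamond> x) \<diamond> x) u) =
    2 * (bil y e * bil (x \<diamond> x) u + bil x e * bil (x \<diamond> y) u + bil x e * bil (y \<diamond> x) u)
    + (bil x x - bil x e * bil x e) * bil y u
    + (bil x y - bil x e * bil y e) * bil x u
    + (bil y x - bil y e * bil x e) * bil x u + \<nu> * bil e u"
    using cubic_polarized[OF A(1) A(1) A(8)] by blast
  have *: "4 * bil (b \<diamond> x) u = 4 * p * bil y u + \<nu> * bil e u" for u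
    using \<nu>[of u] unfolding xxy mul_comm[of y x] A b_def[symmetric] bil_sym[of y x] xy0 bil_simps p(3)
    by (simp add: algebra_simps)
  have bx: "b \<diamond> x \<in> V1" by (rule V0_mul_V1[OF bV0 X(1)])
  have "\<nu> = 0" using *[of w] V1_D(4)[OF bx] A by (simp add: bil_w_e)
  then have **: "4 * bil (b \<diamond> x) u = 4 * (p * bil y u)" for u
    using *[of u] by simp
  have "b \<diamond> x = p \<star> y"
  proof (rule eqI)
    show "bil (b \<diamond> x) u = bil (p \<star> y) u" for u
      using **[of u] four_neq_0 by (simp add: bil_simps)
  qed (use A V1_D(1)[OF bx] in \<open>simp_all add: A_closed\<close>)
  then have "((1/p) \<star> b) \<diamond> x = y"
    using p(4) by (simp add: mul_simps)
  moreover have "(1/p) \<star> b \<in> orth a" by (rule subspace_scale[OF orth_subspace borth])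
  ultimately show ?thesis by blast
qed

text \<open>Multiplication by an anisotropic vector of one half space is a similitude of \<open>orth a\<close> onto
  the other half space.\<close>

lemma card_orth_eq_card_half_space:
  assumes x: "x \<in> half_space a" "x \<noteq> 0"
    and B: "orthogonal_basis B (orth a)" and B': "orthogonal_basis B' (half_space (- a))"
  shows "card B' = card B"
proof -
  obtain y where y: "y \<in> half_space a" "bil y y \<noteq> 0"
    using anisotropic_exists[OF half_space_subspace half_space_nondegenerate x] by blast
  have n8: "(8::'f) \<noteq> 0"
  proof -
    have e8: "(8::'f) = 2 * 4" by simp
    show n8: "(8::'f) \<noteq> 0" unfolding e8 using two_neq_0 four_neq_0 by (metis mult_eq_0_iff)
  qed
  let ?h = "\<lambda>b. b \<diamond> y"
  have BU: "B \<subseteq> orth a" "finite B" "orth a \<subseteq> span B" using B by (auto simp: orthogonal_basis_def orthogonal_system_def)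
  have ne: "bil (?h b) (?h b) \<noteq> 0" if "b \<in> B" for b
    using bil_orth_mul[of b b y] y BU that B n8 by (auto simp: orthogonal_basis_def orthogonal_system_def)
  have or: "bil (?h b) (?h c) = 0" if "b \<in> B" "c \<in> B" "b \<noteq> c" for b c
    using bil_orth_mul[of b c y] y BU that B n8 by (auto simp: orthogonal_basis_def orthogonal_system_def)
  have inj: "inj_on ?h B" unfolding inj_on_def using ne or by metis
  have "orthogonal_system (?h ` B)"
    using ne or BU by (fastforce simp: orthogonal_system_def)
  moreover have "?h ` B \<subseteq> half_space (- a)"
    using BU orth_mul[OF _ y(1)] by auto
  moreover have "half_space (- a) \<subseteq> span (?h ` B)"
  proof
    fix z assume "z \<in> half_space (- a)"
    then obtain b where b: "b \<in> orth a" "?h b = z" using orth_mul_surj[OF y] by blast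
    then have "b \<in> span B" using BU by blast
    then have "?h b \<in> span (?h ` B)"
    proof (induction rule: span_induct_alt)
      case base then show ?case by (simp add: mul_simps span_zero)
    next
      case (step c v u)
      then show ?case unfolding mul_simps by (intro span_add span_scale) (auto intro: span_base)
    qed
    then show "z \<in> span (?h ` B)" using b by simp
  qed
  ultimately have "orthogonal_basis (?h ` B) (half_space (- a))"
    by (simp add: orthogonal_basis_def)
  then have "card (?h ` B) = card B'"
    using B' orthogonal_basis_card_eq_dim by metis
  then show ?thesis using inj by (simp add: card_image)
qed

end

text \<open>If a half space vanished, the similitude would leave nothing of \<open>V0\<close> but the line of \<open>a\<close>, and
  \<open>(e - w + a)/2\<close> would be an idempotent that splits off.\<close>

lemma half_space_nonzero:
  assumes a: "a \<in> V0" "bil a a = 2"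
  shows "\<exists>x\<in>half_space a. x \<noteq> 0"
proof (rule ccontr)
  assume *: "\<not> ?thesis"
  note ma = uminus_a[OF a]
  have V1: "V1 = half_space (- a)"
    using half_space_decomposition[OF a] * by (fastforce simp: half_space_def)
  then obtain x where x: "x \<in> half_space (- a)" "x \<noteq> 0" using V1_nonzero by blast
  have "0 \<in> half_space a" using subspace_0[OF half_space_subspace] .
  then have ob: "orthogonal_basis {} (half_space (- (- a)))"
    using * by (auto simp: orthogonal_basis_def orthogonal_system_def)
  obtain B where B: "orthogonal_basis B (orth (- a))"
    using orthogonal_basis_in_A[OF orth_subspace orth_nondegenerate[OF ma]] V0_D by (auto simp: orth_def)
  have "card B = 0"
    using card_orth_eq_card_half_space[OF ma x B ob] by simp
  then have D0: "orth a \<subseteq> {0}"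
    using B orthogonal_basis_nonempty[OF B] by (auto simp: orth_uminus)
  define u where "u = (1/2) \<star> (e - w + a)"
  have uA: "u \<in> A" unfolding u_def using V0_D[OF a(1)] w_A by (simp add: A_closed)
  have aa: "a \<diamond> a = e - w" by (rule a_a[OF a])
  have fa: "(e - w) \<diamond> a = a" "a \<diamond> (e - w) = a"
    using f_V0[OF a(1)] mul_comm[of a "e - w"] by simp_all
  have ua: "u \<diamond> a = u" "u \<diamond> (e - w) = u"
    unfolding u_def mul_scale_left mul_add_left fa aa f_f by (simp_all add: add.commute)
  have uw: "u \<diamond> w = 0"
    unfolding u_def using V0_D[OF a(1)] by (simp add: mul_simps w_idem)
  have uu: "u \<diamond> u = u"
  proof -
    have "u \<diamond> u = (1/2) \<star> (u + u)"
      by (subst (2) u_def) (simp only: mul_scale_right mul_add_right ua)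
    also have "\<dots> = (1/2 + 1/2) \<star> u" by (simp only: scale_right_distrib scale_left_distrib)
    finally show ?thesis by (simp only: half scale_one)
  qed
  have buu: "bil u u = 1"
  proof -
    have "bil (e - w) a = 0" using V0_D[OF a(1)] by (simp add: bil_simps)
    then have "bil u u = (1/2) * ((1/2) * (2 + 2))"
      unfolding u_def bil_scale_left bil_scale_right bil_add_left bil_add_right bil_f_f a(2)
      by (simp add: bil_sym[of a "e - w"] two_neq_0 four_neq_0)
    also have "\<dots> = 1" using two_neq_0 four_neq_0 by simp
    finally show ?thesis .
  qed
  have "\<exists>c. u \<diamond> z = c \<star> u" if z: "z \<in> A" for z
  proof -
    have "pr0 z - (bil a (pr0 z) / 2) \<star> a = 0"
      using D0 orth_decomposition[OF a pr0_V0[OF z]] by blast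
    then have p0: "pr0 z = (bil a (pr0 z) / 2) \<star> a" by simp
    have p1: "u \<diamond> pr1 z = 0"
    proof -
      have "pr1 z \<in> half_space (- a)" using V1 pr1_V1[OF z] by simp
      then have "a \<diamond> pr1 z = - ((1/2) \<star> pr1 z)"
        by (auto simp: half_space_def mul_simps minus_equation_iff[of "a \<diamond> pr1 z"])
      then show ?thesis unfolding u_def using e_w_mul_V1[OF pr1_V1[OF z]]
        by (simp add: mul_scale_left mul_add_left)
    qed
    have "u \<diamond> z = u \<diamond> (bil w z \<star> w + ((bil e z - bil w z) / 2) \<star> (e - w) + pr0 z + pr1 z)"
      by (subst peirce_decomposition[of z]) (rule refl)
    also have "\<dots> = ((bil e z - bil w z) / 2) \<star> u + (bil a (pr0 z) / 2) \<star> u"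
      unfolding mul_add_right p1 by (subst p0) (simp add: mul_scale_right uw ua)
    finally show ?thesis by (metis scale_left_distrib)
  qed
  then show False using no_central_idempotent[OF uA uu buu] by metis
qed

text \<open>The space \<open>orth a\<close> and the two half spaces of \<open>a\<close> have the same dimension \<open>d\<close>. Hence
  \<open>27 = 2 + (1 + d) + 2 d\<close> and \<open>d = 8\<close>.\<close>

lemma dim_V0: "dim V0 = 9" and dim_V1: "dim V1 = 16"
proof -
  obtain a0 where a0: "a0 \<in> V0" "bil a0 a0 \<noteq> 0"
    using V0_nonzero anisotropic_exists[OF V0_subspace V0_nondegenerate] by blast
  obtain d where d: "d * d = 2 / bil a0 a0" using square_root by blast
  define a where "a = d \<star> a0"
  have "bil a a = d * d * bil a0 a0" by (simp add: a_def bil_simps)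
  then have a: "a \<in> V0" "bil a a = 2" using a0 d by (simp_all add: a_def V0_closed)
  note ma = uminus_a[OF a]
  have sub: "orth a \<subseteq> A" "half_space b \<subseteq> A" for b
    using V0_D V1_D by (auto simp: orth_def half_space_def)
  obtain B where B: "orthogonal_basis B (orth a)"
    using orthogonal_basis_in_A[OF orth_subspace orth_nondegenerate[OF a] sub(1)] by blast
  obtain B1 where B1: "orthogonal_basis B1 (half_space a)"
    using orthogonal_basis_in_A[OF half_space_subspace half_space_nondegenerate[OF a] sub(2)] by blast
  obtain B2 where B2: "orthogonal_basis B2 (half_space (- a))"
    using orthogonal_basis_in_A[OF half_space_subspace half_space_nondegenerate[OF ma] sub(2)] by blast
  obtain x1 x2 where "x1 \<in> half_space a" "x1 \<noteq> 0" "x2 \<in> half_space (- a)" "x2 \<noteq> 0"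
    using half_space_nonzero[OF a] half_space_nonzero[OF ma] by blast
  then have cards: "card B2 = card B" "card B1 = card B"
    using card_orth_eq_card_half_space[OF a _ _ B B2] card_orth_eq_card_half_space[OF ma, of x2 B B1] B B1
    by (simp_all add: orth_uminus)
  have S: "orthogonal_system B" "orthogonal_system B1" "orthogonal_system B2"
    "B \<subseteq> orth a" "B1 \<subseteq> half_space a" "B2 \<subseteq> half_space (- a)"
    "orth a \<subseteq> span B" "half_space a \<subseteq> span B1" "half_space (- a) \<subseteq> span B2"
    using B B1 B2 by (simp_all add: orthogonal_basis_def)
  have V1B: "orthogonal_system (B1 \<union> B2) \<and> card (B1 \<union> B2) = card B1 + card B2"
    using S half_space_orthogonal[OF a] by (intro orthogonal_system_Un) blast+
  have b1: "orthogonal_basis (B1 \<union> B2) V1"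
    unfolding orthogonal_basis_def
  proof (intro conjI)
    show "B1 \<union> B2 \<subseteq> V1" using S by (auto simp: half_space_def)
    show "V1 \<subseteq> span (B1 \<union> B2)"
    proof
      fix x assume "x \<in> V1"
      then obtain y z where "y \<in> half_space a" "z \<in> half_space (- a)" "x = y + z"
        using half_space_decomposition[OF a] by blast
      then show "x \<in> span (B1 \<union> B2)" using S unfolding span_Un by blast
    qed
  qed (use V1B in simp)
  have V0B: "orthogonal_system ({a} \<union> B) \<and> card ({a} \<union> B) = card {a} + card B"
    using S a two_neq_0 by (intro orthogonal_system_Un orthogonal_system_singleton) (auto simp: orth_def)
  have b0: "orthogonal_basis ({a} \<union> B) V0"
    unfolding orthogonal_basis_def
  proof (intro conjI subsetI)
    fix b assume b: "b \<in> V0"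
    have "b = (bil a b / 2) \<star> a + (b - (bil a b / 2) \<star> a)" by simp
    moreover have "b - (bil a b / 2) \<star> a \<in> span B" using S orth_decomposition[OF a b] by blast
    ultimately show "b \<in> span ({a} \<union> B)"
      unfolding span_Un span_singleton by blast
  qed (use V0B S a in \<open>auto simp: orth_def\<close>)
  let ?W = "{w} \<union> ({e - w} \<union> (({a} \<union> B) \<union> (B1 \<union> B2)))"
  let ?U = "({a} \<union> B) \<union> (B1 \<union> B2)"
  have mem0: "x \<in> V0" if "x \<in> {a} \<union> B" for x
    using b0 that unfolding orthogonal_basis_def by blast
  have mem1: "x \<in> V1" if "x \<in> B1 \<union> B2" for x
    using b1 that unfolding orthogonal_basis_def by blast
  have W01: "orthogonal_system ?U \<and> card ?U = card ({a} \<union> B) + card (B1 \<union> B2)"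
    using V0B V1B by (intro orthogonal_system_Un) (simp_all only: mem0 mem1 V0_V1_orthogonal)
  have perp: "bil w y = 0 \<and> bil e y = 0" if "y \<in> ?U" for y
    using that
  proof (rule UnE)
    assume "y \<in> {a} \<union> B"
    from V0_D[OF mem0[OF this]] show ?thesis by simp
  next
    assume "y \<in> B1 \<union> B2"
    from V1_D[OF mem1[OF this]] show ?thesis by simp
  qed
  have W2: "orthogonal_system ({e - w} \<union> ?U) \<and> card ({e - w} \<union> ?U) = card {e - w} + card ?U"
    using W01 bil_f_f two_neq_0 perp
    by (intro orthogonal_system_Un orthogonal_system_singleton) (simp_all only: singleton_iff bil_simps, simp_all)
  have perp': "bil w y = 0" if "y \<in> {e - w} \<union> ?U" for y
    using that
  proof (rule UnE)
    assume "y \<in> {e - w}"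
    then show ?thesis by (simp add: bil_simps bil_w_e bil_w_w)
  qed (use perp in blast)
  have W3: "orthogonal_system ?W \<and> card ?W = card {w} + card ({e - w} \<union> ?U)"
    using W2 bil_w_w perp'
    by (intro orthogonal_system_Un orthogonal_system_singleton) (simp_all only: singleton_iff, simp_all)
  have "orthogonal_basis ?W A"
    unfolding orthogonal_basis_def
  proof (intro conjI subsetI)
    fix z assume z: "z \<in> A"
    have "pr0 z + pr1 z \<in> span (({a} \<union> B) \<union> (B1 \<union> B2))"
      unfolding span_Un[of "{a} \<union> B"]
      using subsetD[of V0 "span ({a} \<union> B)" "pr0 z"] subsetD[of V1 "span (B1 \<union> B2)" "pr1 z"]
        pr0_V0[OF z] pr1_V1[OF z] b0 b1 unfolding orthogonal_basis_def by blast
    then have "((bil e z - bil w z) / 2) \<star> (e - w) + (pr0 z + pr1 z) \<in> span ({e - w} \<union> (({a} \<union> B) \<union> (B1 \<union> B2)))"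
      unfolding span_Un[of "{e - w}"] span_singleton by blast
    then have "bil w z \<star> w + (((bil e z - bil w z) / 2) \<star> (e - w) + (pr0 z + pr1 z)) \<in> span ?W"
      unfolding span_Un[of "{w}"] span_singleton by blast
    then show "z \<in> span ?W"
      using peirce_decomposition[of z] by (simp add: add.assoc)
  next
    fix z assume "z \<in> ?W"
    then have "z = w \<or> z = e - w \<or> z \<in> {a} \<union> B \<or> z \<in> B1 \<union> B2" by blast
    then show "z \<in> A"
      using mem0 mem1 w_A V0_D(1) V1_D(1) A_closed(4)[OF e_A w_A] by metis
  qed (use W3 in simp)
  then have "card ?W = dim A" by (rule orthogonal_basis_card_eq_dim)
  also have "\<dots> = 27"
  proof -
    obtain S where S: "independent S" "span S = A" "card S = 27" using A_basis by blast
    show ?thesis using dim_span_eq_card_independent[OF S(1)] S by simp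
  qed
  finally have "3 + 3 * card B = 27"
    unfolding conjunct2[OF W3] conjunct2[OF W2] conjunct2[OF W01] conjunct2[OF V0B]
      conjunct2[OF V1B] cards card.insert_remove card.empty by simp
  then have card_B: "card B = 8" by simp
  then show "dim V0 = 9" "dim V1 = 16"
    unfolding orthogonal_basis_card_eq_dim[OF b0, symmetric] orthogonal_basis_card_eq_dim[OF b1, symmetric]
      conjunct2[OF V0B] conjunct2[OF V1B] cards card_B by simp_all
qed

end

section \<open>Identities in octonion algebras\<close>

locale octonion =
  fixes C :: "'f::field octonions"
  assumes octonion_C: "octonion_algebra C"
    and two_nz: "(2::'f) \<noteq> 0"
begin

abbreviation m :: "'f ^ 8 \<Rightarrow> 'f ^ 8 \<Rightarrow> 'f ^ 8" where "m \<equiv> omult C"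
abbreviation b :: "'f ^ 8 \<Rightarrow> 'f ^ 8 \<Rightarrow> 'f" where "b \<equiv> polar (onorm C)"
abbreviation n :: "'f ^ 8 \<Rightarrow> 'f" where "n \<equiv> onorm C"
abbreviation cj :: "'f ^ 8 \<Rightarrow> 'f ^ 8" where "cj \<equiv> oconj C"
abbreviation I :: "'f ^ 8" where "I \<equiv> oone C"

lemma m_add: "m x (y + z) = m x y + m x z" "m (x + y) z = m x z + m y z"
  and m_scale: "m x (c *s y) = c *s m x y" "m (c *s x) y = c *s m x y"
  and m_one [simp]: "m I x = x" "m x I = x"
  and n_scale: "n (c *s x) = c\<^sup>2 * n x"
  and b_add_right: "b x (y + z) = b x y + b x z"
  and b_scale_right: "b x (c *s y) = c * b x y"
  and b_nondegenerate: "(\<And>y. b x y = 0) \<Longrightarrow> x = 0"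
  and n_mult: "n (m x y) = n x * n y"
proof -
  note oc = octonion_C[unfolded octonion_algebra_def]
  have 1: "Vector_Spaces.linear (*s) (*s) (m x)" for x using oc by (elim conjE) (erule spec)
  have 2: "Vector_Spaces.linear (*s) (*s) (\<lambda>x. m x y)" for y using oc by (elim conjE) (erule spec)
  have 3: "Vector_Spaces.linear (*s) (*) (b x)" for x using oc by (elim conjE) (erule spec)
  show "m x (y + z) = m x y + m x z" "m x (c *s y) = c *s m x y"
    using 1[of x] unfolding Vector_Spaces.linear_iff by metis+
  show "m (x + y) z = m x z + m y z" "m (c *s x) y = c *s m x y"
    using 2[of z] 2[of y] unfolding Vector_Spaces.linear_iff by metis+
  show "b x (y + z) = b x y + b x z" "b x (c *s y) = c * b x y"
    using 3[of x] unfolding Vector_Spaces.linear_iff by metis+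
  show "m I x = x" "m x I = x" using oc by simp_all
  show "n (c *s x) = c\<^sup>2 * n x" using oc by (elim conjE) metis
  show "n (m x y) = n x * n y" using oc by (elim conjE) metis
  show "x = 0" if "\<And>y. b x y = 0" using oc that by (elim conjE) metis
qed

lemma b_sym: "b x y = b y x"
  by (simp add: polar_def add.commute)

sublocale oct: bilinear_space "(*s)" b
proof
  show "b (x + y) z = b x z + b y z" for x y z
    by (metis b_sym b_add_right)
  show "b (c *s x) z = c * b x z" for c x z
    by (metis b_sym b_scale_right)
qed (auto simp: b_sym two_nz)

lemmas b_simps = oct.bil_simps

lemma b_self: "b x x = 2 * n x"
proof -
  have "x + x = 2 *s x" by (simp add: vec_eq_iff)
  then have "n (x + x) = 4 * n x" by (simp add: n_scale power2_eq_square)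
  then show ?thesis by (simp add: polar_def)
qed

lemma m_zero [simp]: "m 0 x = 0" "m x 0 = 0"
  using m_scale(2)[of 0 0 x] m_scale(1)[of x 0 0] by simp_all

lemma m_neg: "m (- x) y = - m x y" "m x (- y) = - m x y"
  using m_scale(2)[of "-1" x y] m_scale(1)[of x "-1" y] by (simp_all add: vector_smult_lneg)

lemma m_diff: "m (x - y) z = m x z - m y z" "m z (x - y) = m z x - m z y"
  using m_add(2)[of x "- y" z] m_add(1)[of z x "- y"] by (simp_all add: m_neg)

lemma b_eqI: "(\<And>z. b x z = b y z) \<Longrightarrow> x = y"
  using b_nondegenerate[of "x - y"] by (simp add: b_simps)

lemma b_mult_left: "b (m x y) (m x z) = n x * b y z"
  unfolding polar_def m_add(1)[symmetric] n_mult by (simp add: algebra_simps)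

lemma b_mult_right: "b (m x z) (m y z) = b x y * n z"
  unfolding polar_def m_add(2)[symmetric] n_mult by (simp add: algebra_simps)

lemma b_mult_mult: "b (m x y) (m u z) + b (m u y) (m x z) = b x u * b y z"
proof -
  have "b (m (x + u) y) (m (x + u) z) = n (x + u) * b y z" by (rule b_mult_left)
  moreover have "n (x + u) = b x u + n x + n u" by (simp add: polar_def)
  ultimately show ?thesis
    by (simp add: m_add b_simps b_mult_left algebra_simps)
qed

lemma n_one: "n I = 1"
proof -
  have "n I \<noteq> 0"
  proof
    assume "n I = 0"
    then have "n x = 0" for x using n_mult[of I x] by simp
    then have "b x y = 0" for x y by (simp add: polar_def)
    then have "(x::'f^8) = 0" for x using b_nondegenerate by blast
    then have "axis 1 (1::'f) = (0 :: 'f^8)" by blast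
    then show False by (simp add: axis_eq_0_iff)
  qed
  then show ?thesis using n_mult[of I I] by simp
qed

lemma b_one_one: "b I I = 2"
  by (simp add: b_self n_one)

lemma I_nonzero: "I \<noteq> 0"
  using b_one_one two_nz by (auto simp: b_simps)

lemma cj_def': "cj x = b x I *s I - x"
  by (simp add: oconj_def)

lemma cj_add: "cj (x + y) = cj x + cj y"
  by (simp add: cj_def' b_simps vector_sadd_rdistrib)

lemma cj_scale: "cj (c *s x) = c *s cj x"
  by (simp add: cj_def' b_simps vec_eq_iff algebra_simps)

lemma cj_zero [simp]: "cj 0 = 0"
  using cj_scale[of 0 0] by simp

lemma cj_cj [simp]: "cj (cj x) = x"
  by (simp add: cj_def' b_simps b_one_one vec_eq_iff algebra_simps)

lemma b_cj: "b (cj x) y = b x (cj y)"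
  by (simp add: cj_def' b_simps b_sym[of I])

lemma b_cj_cj: "b (cj x) (cj y) = b x y"
  by (simp add: b_cj)

lemma n_cj: "n (cj x) = n x"
proof -
  have "2 * n (cj x) = 2 * n x"
    using b_cj_cj[of x x] by (simp add: b_self)
  then show ?thesis using two_nz by simp
qed

lemma b_mult_adjoint_left: "b (m x y) z = b y (m (cj x) z)"
proof -
  have "b (m x y) z + b y (m x z) = b x I * b y z"
    using b_mult_mult[of x y I z] by simp
  then show ?thesis by (simp add: cj_def' m_diff m_scale b_simps algebra_simps)
qed

lemma b_mult_adjoint_right: "b (m x y) z = b x (m z (cj y))"
proof -
  have "b (m x y) (m z I) + b (m z y) (m x I) = b x z * b y I"
    by (rule b_mult_mult)
  then show ?thesis
    by (simp add: cj_def' m_diff m_scale b_simps algebra_simps b_sym[of "m z y"])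
qed

lemma cj_mult: "cj (m x y) = m (cj y) (cj x)"
proof (rule b_eqI)
  fix z
  have "b (cj (m x y)) z = b y (m (cj x) (cj z))"
    by (simp add: b_cj b_mult_adjoint_left)
  also have "\<dots> = b (m y z) (cj x)"
    by (simp add: b_mult_adjoint_right)
  also have "\<dots> = b (m (cj y) (cj x)) z"
    using b_mult_adjoint_left[of "cj y" "cj x" z] by (simp add: b_sym)
  finally show "b (cj (m x y)) z = b (m (cj y) (cj x)) z" .
qed

lemma m_cj_self: "m x (cj x) = n x *s I" "m (cj x) x = n x *s I"
proof -
  have 1: "m (cj x) x = n x *s I" for x
  proof (rule b_eqI)
    show "b (m (cj x) x) z = b (n x *s I) z" for z
      using b_mult_left[of x I z] b_mult_adjoint_left[of "cj x" x z]
      by (simp add: b_simps)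
  qed
  then show "m (cj x) x = n x *s I" .
  show "m x (cj x) = n x *s I" using 1[of "cj x"] by (simp add: n_cj)
qed

lemma m_cj: "m x (cj y) + m y (cj x) = b x y *s I" "m (cj x) y + m (cj y) x = b x y *s I"
proof -
  have n: "n (x + y) = b x y + n x + n y" by (simp add: polar_def)
  show "m x (cj y) + m y (cj x) = b x y *s I"
    using m_cj_self(1)[of "x + y"] unfolding n
    by (simp add: cj_add m_add m_cj_self vector_sadd_rdistrib algebra_simps)
  show "m (cj x) y + m (cj y) x = b x y *s I"
    using m_cj_self(2)[of "x + y"] unfolding n
    by (simp add: cj_add m_add m_cj_self vector_sadd_rdistrib algebra_simps)
qed

text \<open>The trilinear form through which the off-diagonal entries of a product enter the trace form.\<close>

definition t :: "'f ^ 8 \<Rightarrow> 'f ^ 8 \<Rightarrow> 'f ^ 8 \<Rightarrow> 'f" where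
  "t x y z = b (cj (m x y)) z"

lemma t_cyclic: "t x y z = t y z x"
proof -
  have "t x y z = b y (m (cj x) (cj z))"
    by (simp add: t_def b_cj b_mult_adjoint_left)
  also have "\<dots> = t y z x"
    by (simp add: t_def b_cj b_mult_adjoint_right)
  finally show ?thesis .
qed

lemma b_cj_mult_mult: "2 * b (cj (m x y)) (cj (m x z)) = b x x * b y z"
  "2 * b (cj (m x z)) (cj (m y z)) = b x y * b z z"
  by (simp_all add: b_cj_cj b_mult_left b_mult_right b_self)

end

section \<open>The Albert algebra as a cubic Jordan algebra\<close>

lemma vector_space_mscale: "vector_space (mscale :: 'f::field \<Rightarrow> 'f ^ 'n ^ 'm ^ 'l \<Rightarrow> 'f ^ 'n ^ 'm ^ 'l)"
  by unfold_locales (auto simp: mscale_def vec_eq_iff algebra_simps)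

lemma mscale_nth: "mscale a x $ i $ j = a *s (x $ i $ j)"
  by (simp add: mscale_def)

locale albert_algebra = octonion C for C :: "'f::field octonions" +
  fixes \<gamma> :: "'f ^ 3"
  assumes \<gamma>_nz: "\<gamma> $ 1 \<noteq> 0" "\<gamma> $ 2 \<noteq> 0" "\<gamma> $ 3 \<noteq> 0"
begin

text \<open>The weights of the off-diagonal coordinates in \<open>Q\<close>. Their product is 1, which is why \<open>\<gamma>\<close>
  disappears from the identities below.\<close>

definition al1 :: 'f where "al1 = inverse (\<gamma>$3) * \<gamma>$2"
definition al2 :: 'f where "al2 = inverse (\<gamma>$1) * \<gamma>$3"
definition al3 :: 'f where "al3 = inverse (\<gamma>$2) * \<gamma>$1"

lemma al_nz: "al1 \<noteq> 0" "al2 \<noteq> 0" "al3 \<noteq> 0"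
  using \<gamma>_nz by (simp_all add: al1_def al2_def al3_def)

lemma al_prod: "al1 * al2 * al3 = 1" "al2 * al3 * al1 = 1" "al3 * al1 * al2 = 1"
  using \<gamma>_nz by (simp_all add: al1_def al2_def al3_def field_simps)

abbreviation H where "H \<equiv> hermitian C \<gamma>"
abbreviation A where "A \<equiv> albert C \<gamma>"

lemma H_nth:
  "H f1 f2 f3 c1 c2 c3 $ 1 $ 1 = f1 *s I" "H f1 f2 f3 c1 c2 c3 $ 1 $ 2 = c3"
  "H f1 f2 f3 c1 c2 c3 $ 1 $ 3 = al2 *s cj c2"
  "H f1 f2 f3 c1 c2 c3 $ 2 $ 1 = al3 *s cj c3" "H f1 f2 f3 c1 c2 c3 $ 2 $ 2 = f2 *s I"
  "H f1 f2 f3 c1 c2 c3 $ 2 $ 3 = c1"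
  "H f1 f2 f3 c1 c2 c3 $ 3 $ 1 = c2" "H f1 f2 f3 c1 c2 c3 $ 3 $ 2 = al1 *s cj c1"
  "H f1 f2 f3 c1 c2 c3 $ 3 $ 3 = f3 *s I"
  by (simp_all add: hermitian_def al1_def al2_def al3_def)

lemma mat_eqI:
  fixes x y :: "'f ^ 8 ^ 3 ^ 3"
  assumes "x $ 1 $ 1 = y $ 1 $ 1" "x $ 1 $ 2 = y $ 1 $ 2" "x $ 1 $ 3 = y $ 1 $ 3"
    "x $ 2 $ 1 = y $ 2 $ 1" "x $ 2 $ 2 = y $ 2 $ 2" "x $ 2 $ 3 = y $ 2 $ 3"
    "x $ 3 $ 1 = y $ 3 $ 1" "x $ 3 $ 2 = y $ 3 $ 2" "x $ 3 $ 3 = y $ 3 $ 3"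
  shows "x = y"
  using assms by (simp add: vec_eq_iff[of x] vec_eq_iff[of "x $ _"] forall_3)

lemma mat_ext:
  fixes x y :: "'f ^ 8 ^ 3 ^ 3"
  assumes "\<And>i j. x $ i $ j = y $ i $ j"
  shows "x = y"
  using assms by (metis vec_eq_iff)

text \<open>The diagonal scalar \<open>f\<^sub>i\<close>, recovered from the entry \<open>f\<^sub>i\<close> times the unit because \<open>\<langle>1,1\<rangle> = 2\<close>.\<close>

definition cf :: "3 \<Rightarrow> 'f ^ 8 ^ 3 ^ 3 \<Rightarrow> 'f" where "cf i x = b (x $ i $ i) I / 2"

lemma cf_H: "cf 1 (H f1 f2 f3 c1 c2 c3) = f1" "cf 2 (H f1 f2 f3 c1 c2 c3) = f2"
  "cf 3 (H f1 f2 f3 c1 c2 c3) = f3"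
  using two_nz by (simp_all add: cf_def H_nth b_simps b_one_one)

lemma H_inject: "H f1 f2 f3 c1 c2 c3 = H g1 g2 g3 d1 d2 d3 \<longleftrightarrow>
  f1 = g1 \<and> f2 = g2 \<and> f3 = g3 \<and> c1 = d1 \<and> c2 = d2 \<and> c3 = d3"
  by (metis cf_H H_nth(2,6,7))

lemma H_A: "H f1 f2 f3 c1 c2 c3 \<in> A"
  unfolding albert_def by blast

lemma A_cases:
  assumes "x \<in> A"
  obtains f1 f2 f3 c1 c2 c3 where "x = H f1 f2 f3 c1 c2 c3"
  using assms by (auto simp: albert_def)

lemma H_add: "H f1 f2 f3 c1 c2 c3 + H g1 g2 g3 d1 d2 d3 =
  H (f1 + g1) (f2 + g2) (f3 + g3) (c1 + d1) (c2 + d2) (c3 + d3)"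
  by (rule mat_eqI) (simp_all add: H_nth cj_add vector_sadd_rdistrib vector_add_ldistrib)

lemma H_scale: "mscale a (H f1 f2 f3 c1 c2 c3) = H (a * f1) (a * f2) (a * f3) (a *s c1) (a *s c2) (a *s c3)"
  by (rule mat_eqI) (simp_all add: H_nth cj_scale mscale_nth vector_smult_assoc mult.commute)

lemma H_zero: "H 0 0 0 0 0 0 = 0"
  by (rule mat_eqI) (simp_all add: H_nth)

text \<open>The trace form, which is the polar form of \<open>Q\<close>. The formula makes it bilinear on all matrices,
  whereas \<open>Q\<close> is meaningful on Hermitian ones.\<close>

definition tf :: "'f ^ 8 ^ 3 ^ 3 \<Rightarrow> 'f ^ 8 ^ 3 ^ 3 \<Rightarrow> 'f" where
  "tf x y = cf 1 x * cf 1 y + cf 2 x * cf 2 y + cf 3 x * cf 3 y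
     + al1 * b (x $ 2 $ 3) (y $ 2 $ 3) + al2 * b (x $ 3 $ 1) (y $ 3 $ 1)
     + al3 * b (x $ 1 $ 2) (y $ 1 $ 2)"

lemma tf_H: "tf (H f1 f2 f3 c1 c2 c3) (H g1 g2 g3 d1 d2 d3) =
  f1 * g1 + f2 * g2 + f3 * g3 + al1 * b c1 d1 + al2 * b c2 d2 + al3 * b c3 d3"
  unfolding tf_def cf_H H_nth ..

lemma albert_Q_eq: assumes "x \<in> A" shows "albert_Q C \<gamma> x = tf x x / 2"
proof -
  obtain f1 f2 f3 c1 c2 c3 where x: "x = H f1 f2 f3 c1 c2 c3"
    using assms by (rule A_cases)
  have "albert_Q C \<gamma> x = (1/2) * (f1\<^sup>2 + f2\<^sup>2 + f3\<^sup>2) + al1 * n c1 + al2 * n c2 + al3 * n c3"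
    unfolding albert_Q_def x al1_def al2_def al3_def
    by (rule the_equality) (auto simp: H_inject)
  also have "\<dots> = tf x x / 2"
    using two_nz unfolding x tf_H b_self by (simp add: power2_eq_square field_simps)
  finally show ?thesis .
qed

lemma omatmult_nth: "omatmult C x y $ i $ j =
  m (x $ i $ 1) (y $ 1 $ j) + m (x $ i $ 2) (y $ 2 $ j) + m (x $ i $ 3) (y $ 3 $ j)"
  unfolding omatmult_def by (simp only: vec_lambda_beta sum_3)

lemma albert_mult_nth: "albert_mult C x y $ i $ j = (1/2) *s
  (m (x $ i $ 1) (y $ 1 $ j) + m (x $ i $ 2) (y $ 2 $ j) + m (x $ i $ 3) (y $ 3 $ j)
  + (m (y $ i $ 1) (x $ 1 $ j) + m (y $ i $ 2) (x $ 2 $ j) + m (y $ i $ 3) (x $ 3 $ j)))"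
  unfolding albert_mult_def mscale_nth vector_add_component omatmult_nth ..

lemma diagonal_entry:
  assumes "p1 + q1 = u *s I" "p2 + q2 = v *s I" "p3 + q3 = s *s I"
  shows "(1/2) *s (p1 + p2 + p3 + (q1 + q2 + q3)) = ((1/2) * (u + v + s)) *s I"
proof -
  have "p1 + p2 + p3 + (q1 + q2 + q3) = (p1 + q1) + (p2 + q2) + (p3 + q3)"
    by (simp only: ac_simps)
  then show ?thesis
    unfolding assms by (simp only: vector_sadd_rdistrib[symmetric] vector_smult_assoc)
qed

lemma half_sum: "(1/2) *s (x + x) = (x :: 'f ^ 8)"
  using two_nz by (simp add: vec_eq_iff field_simps)

lemma mult_H: "albert_mult C (H f1 f2 f3 c1 c2 c3) (H g1 g2 g3 d1 d2 d3) =
  H ((1/2) * (2 * (f1 * g1) + al3 * b c3 d3 + al2 * b c2 d2))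
    ((1/2) * (2 * (f2 * g2) + al3 * b c3 d3 + al1 * b c1 d1))
    ((1/2) * (2 * (f3 * g3) + al2 * b c2 d2 + al1 * b c1 d1))
    ((1/2) *s ((f2 + f3) *s d1 + (g2 + g3) *s c1 + (al2 * al3) *s cj (m c2 d3 + m d2 c3)))
    ((1/2) *s ((f1 + f3) *s d2 + (g1 + g3) *s c2 + (al3 * al1) *s cj (m c3 d1 + m d3 c1)))
    ((1/2) *s ((f1 + f2) *s d3 + (g1 + g2) *s c3 + (al1 * al2) *s cj (m c1 d2 + m d1 c2)))"
  (is "?L = H ?h1 ?h2 ?h3 ?m1 ?m2 ?m3")
proof (rule mat_eqI)
  have d: "al3 *s x + al3 *s y = (al3 * u) *s I" if "x + y = u *s I" for x y u
    using that by (metis vector_add_ldistrib vector_smult_assoc)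
  have d1: "al1 *s x + al1 *s y = (al1 * u) *s I" if "x + y = u *s I" for x y u
    using that by (metis vector_add_ldistrib vector_smult_assoc)
  have d2: "al2 *s x + al2 *s y = (al2 * u) *s I" if "x + y = u *s I" for x y u
    using that by (metis vector_add_ldistrib vector_smult_assoc)
  have ff: "f *s (g *s I) + g *s (f *s I) = (2 * (g * f)) *s I" for f g
    by (simp add: vec_eq_iff algebra_simps)
  have c': "m (cj x) y + m (cj y) x = b x y *s I" "m x (cj y) + m y (cj x) = b x y *s I" for x y
    using m_cj by simp_all
  show "?L $ 1 $ 1 = H ?h1 ?h2 ?h3 ?m1 ?m2 ?m3 $ 1 $ 1"
    unfolding albert_mult_nth H_nth m_scale m_one
    by (rule diagonal_entry) (simp_all only: d d2 ff c')
  show "?L $ 2 $ 2 = H ?h1 ?h2 ?h3 ?m1 ?m2 ?m3 $ 2 $ 2"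
  proof -
    have "?L $ 2 $ 2 = ((1/2) * (al3 * b c3 d3 + 2 * (f2 * g2) + al1 * b c1 d1)) *s I"
      unfolding albert_mult_nth H_nth m_scale m_one
      by (rule diagonal_entry) (simp_all only: d d1 ff c')
    then show ?thesis by (simp add: H_nth algebra_simps)
  qed
  show "?L $ 3 $ 3 = H ?h1 ?h2 ?h3 ?m1 ?m2 ?m3 $ 3 $ 3"
  proof -
    have "?L $ 3 $ 3 = ((1/2) * (al2 * b c2 d2 + al1 * b c1 d1 + 2 * (f3 * g3))) *s I"
      unfolding albert_mult_nth H_nth m_scale m_one
      by (rule diagonal_entry) (simp_all only: d2 d1 ff c')
    then show ?thesis by (simp add: H_nth algebra_simps)
  qed
  have off': "(1/2) * (a * c * g + f * (a * d) + x + (a * d * f' + g' * (a * c) + y)) =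
      a * ((1/2) * ((f + f') * d + (g + g') * c + k * (x + y)))"
    if "a * k = 1" for f g f' g' c d k x y a :: 'f
  proof -
    have "a * ((1/2) * ((f + f') * d + (g + g') * c + k * (x + y))) =
      (1/2) * (a * ((f + f') * d + (g + g') * c) + (a * k) * (x + y))"
      by (simp only: algebra_simps)
    then show ?thesis unfolding that by (simp only: algebra_simps) simp
  qed
  note entry = albert_mult_nth H_nth cj_scale cj_add cj_cj cj_mult m_scale m_one vec_eq_iff
      vector_add_component vector_smult_component
  show "?L $ 1 $ 2 = H ?h1 ?h2 ?h3 ?m1 ?m2 ?m3 $ 1 $ 2"
    "?L $ 2 $ 3 = H ?h1 ?h2 ?h3 ?m1 ?m2 ?m3 $ 2 $ 3"
    "?L $ 3 $ 1 = H ?h1 ?h2 ?h3 ?m1 ?m2 ?m3 $ 3 $ 1"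
    unfolding entry by (simp_all only: algebra_simps simp_thms)
  have al: "al3 * (al1 * al2) = 1" "al1 * (al2 * al3) = 1" "al2 * (al3 * al1) = 1"
    using al_prod by (simp_all only: mult.assoc)
  show "?L $ 2 $ 1 = H ?h1 ?h2 ?h3 ?m1 ?m2 ?m3 $ 2 $ 1"
    unfolding entry using off'[OF al(1), where c = "cj c3 $ i" and d = "cj d3 $ i" and g = g1 and f = f2
        and f' = f1 and g' = g2 and x = "m c1 d2 $ i" and y = "m d1 c2 $ i" for i]
    by (simp only: ac_simps simp_thms)
  show "?L $ 3 $ 2 = H ?h1 ?h2 ?h3 ?m1 ?m2 ?m3 $ 3 $ 2"
    unfolding entry using off'[OF al(2), where c = "cj c1 $ i" and d = "cj d1 $ i" and g = g2 and f = f3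
        and f' = f2 and g' = g3 and x = "m c2 d3 $ i" and y = "m d2 c3 $ i" for i]
    by (simp only: ac_simps simp_thms)
  show "?L $ 1 $ 3 = H ?h1 ?h2 ?h3 ?m1 ?m2 ?m3 $ 1 $ 3"
    unfolding entry using off'[OF al(3), where c = "cj c2 $ i" and d = "cj d2 $ i" and g = g3 and f = f1
        and f' = f3 and g' = g1 and x = "m c3 d1 $ i" and y = "m d3 c1 $ i" for i]
    by (simp only: ac_simps simp_thms)
qed

text \<open>The right-hand side is symmetric in the three matrices, so the trace form is associative.\<close>

lemma tf_mult_H:
  "2 * tf (albert_mult C (H f1 f2 f3 c1 c2 c3) (H g1 g2 g3 d1 d2 d3)) (H h1 h2 h3 p1 p2 p3) =
    2 * (f1 * g1 * h1 + f2 * g2 * h2 + f3 * g3 * h3)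
    + al1 * ((f2 + f3) * b d1 p1 + (g2 + g3) * b c1 p1 + (h2 + h3) * b c1 d1)
    + al2 * ((f1 + f3) * b d2 p2 + (g1 + g3) * b c2 p2 + (h1 + h3) * b c2 d2)
    + al3 * ((f1 + f2) * b d3 p3 + (g1 + g2) * b c3 p3 + (h1 + h2) * b c3 d3)
    + t p1 c2 d3 + t p1 d2 c3 + t d1 p2 c3 + t c1 p2 d3 + t c1 d2 p3 + t d1 c2 p3"
proof -
  have two: "2 * ((1/2) * x) = x" for x :: 'f using two_nz by simp
  have T: "b (cj (m x y)) z = t z x y" "b (cj (m x y)) z = t y z x" "b (cj (m x y)) z = t x y z" for x y z
    using t_cyclic[of z x y] t_cyclic[of x y z] by (simp_all add: t_def)
  have al: "al1 * (al2 * al3 * z) = z" "al2 * (al3 * al1 * z) = z" "al3 * (al1 * al2 * z) = z" for z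
    using al_prod by (simp_all add: mult.assoc[symmetric])
  have "2 * tf (albert_mult C (H f1 f2 f3 c1 c2 c3) (H g1 g2 g3 d1 d2 d3)) (H h1 h2 h3 p1 p2 p3)
   = (2 * (f1 * g1) + al3 * b c3 d3 + al2 * b c2 d2) * h1
    + (2 * (f2 * g2) + al3 * b c3 d3 + al1 * b c1 d1) * h2
    + (2 * (f3 * g3) + al2 * b c2 d2 + al1 * b c1 d1) * h3
    + al1 * ((f2 + f3) * b d1 p1 + (g2 + g3) * b c1 p1)
    + al1 * (al2 * al3 * (b (cj (m c2 d3)) p1 + b (cj (m d2 c3)) p1))
    + al2 * ((f1 + f3) * b d2 p2 + (g1 + g3) * b c2 p2)
    + al2 * (al3 * al1 * (b (cj (m c3 d1)) p2 + b (cj (m d3 c1)) p2))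
    + al3 * ((f1 + f2) * b d3 p3 + (g1 + g2) * b c3 p3)
    + al3 * (al1 * al2 * (b (cj (m c1 d2)) p3 + b (cj (m d1 c2)) p3))"
    unfolding mult_H tf_H b_simps cj_add distrib_left two
      mult.assoc[of "1/2"] mult.left_commute[of _ "1/2"]
    by (simp add: algebra_simps two_nz)
  also have "\<dots> = (2 * (f1 * g1) + al3 * b c3 d3 + al2 * b c2 d2) * h1
    + (2 * (f2 * g2) + al3 * b c3 d3 + al1 * b c1 d1) * h2
    + (2 * (f3 * g3) + al2 * b c2 d2 + al1 * b c1 d1) * h3
    + al1 * ((f2 + f3) * b d1 p1 + (g2 + g3) * b c1 p1)
    + (t p1 c2 d3 + t p1 d2 c3)
    + al2 * ((f1 + f3) * b d2 p2 + (g1 + g3) * b c2 p2)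
    + (t d1 p2 c3 + t c1 p2 d3)
    + al3 * ((f1 + f2) * b d3 p3 + (g1 + g2) * b c3 p3)
    + (t c1 d2 p3 + t d1 c2 p3)"
    unfolding al T(1)[of _ _ p1] T(2)[of _ _ p2] T(3)[of _ _ p3] ..
  finally show ?thesis by (simp add: algebra_simps)
qed

text \<open>One off-diagonal contribution to \<open>\<langle>x\<^sup>2, x u\<rangle>\<close>, scaled so that only the products of the
  three weights, which are 1, remain.\<close>

lemma off_diagonal_pairing:
  assumes "a1 * a2 * a3 = 1"
  shows "4 * (a1 * b (F *s c1 + (a2 * a3) *s cj (m c2 c3))
      ((1/2) *s (F *s d1 + G *s c1 + (a2 * a3) *s cj (m c2 d3 + m d2 c3)))) =
    2 * (F * F * (a1 * b c1 d1) + F * G * (a1 * b c1 c1)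
      + F * (t c1 c2 d3 + t c1 d2 c3) + F * t d1 c2 c3 + G * t c1 c2 c3)
      + (a2 * b c2 c2) * (a3 * b c3 d3) + (a2 * b c2 d2) * (a3 * b c3 c3)"
proof -
  define R where "R = F * F * b c1 d1 + F * G * b c1 c1
      + F * (a2 * a3) * (b (cj (m c2 d3)) c1 + b (cj (m d2 c3)) c1)
      + (a2 * a3) * (F * b (cj (m c2 c3)) d1 + G * b (cj (m c2 c3)) c1)"
  define S where "S = b (cj (m c2 c3)) (cj (m c2 d3)) + b (cj (m c2 c3)) (cj (m d2 c3))"
  have two: "2 * ((1/2) * x) = x" for x :: 'f using two_nz by simp
  have T: "b (cj (m x y)) z = t z x y" for x y z
    using t_cyclic[of z x y] by (simp add: t_def)
  have al: "a1 * (a2 * a3) = 1" using assms by (simp add: mult.assoc)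
  have "b (F *s c1 + (a2 * a3) *s cj (m c2 c3))
      ((1/2) *s (F *s d1 + G *s c1 + (a2 * a3) *s cj (m c2 d3 + m d2 c3))) =
      (1/2) * (R + (a2 * a3) * (a2 * a3) * S)" (is "?z = _")
    unfolding b_simps cj_add R_def S_def
    by (simp add: algebra_simps b_sym[of c1 "cj _"])
  have four: "4 * (a1 * z) = 2 * (a1 * (2 * z))" for z :: 'f by simp
  have "4 * (a1 * b (F *s c1 + (a2 * a3) *s cj (m c2 c3))
      ((1/2) *s (F *s d1 + G *s c1 + (a2 * a3) *s cj (m c2 d3 + m d2 c3)))) =
      2 * (a1 * (2 * ((1/2) * (R + (a2 * a3) * (a2 * a3) * S))))"
    unfolding four \<open>?z = _\<close> ..
  also have "\<dots> = 2 * (a1 * R) + (a1 * (a2 * a3)) * (a2 * a3) * (2 * S)"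
    unfolding two by (simp add: algebra_simps)
  also have "2 * S = b c2 c2 * b c3 d3 + b c2 d2 * b c3 c3"
    unfolding S_def distrib_left b_cj_mult_mult ..
  also have "a1 * R = F * F * (a1 * b c1 d1) + F * G * (a1 * b c1 c1)
      + F * (a1 * (a2 * a3)) * (t c1 c2 d3 + t c1 d2 c3)
      + (a1 * (a2 * a3)) * (F * t d1 c2 c3 + G * t c1 c2 c3)"
    unfolding R_def T by (simp only: algebra_simps)
  finally show ?thesis unfolding al by (simp add: algebra_simps)
qed

sublocale ms: vector_space "mscale :: 'f \<Rightarrow> 'f ^ 8 ^ 3 ^ 3 \<Rightarrow> 'f ^ 8 ^ 3 ^ 3"
  by (rule vector_space_mscale)

sublocale ab: bilinear_space mscale tf
proof
  show "tf (x + y) z = tf x z + tf y z" for x y z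
    unfolding tf_def cf_def by (simp add: b_simps add_divide_distrib distrib_left distrib_right ac_simps)
  show "tf (mscale c x) z = c * tf x z" for c x z
    unfolding tf_def cf_def mscale_nth b_simps by (simp add: distrib_left ac_simps)
  show "tf x y = tf y x" for x y
    unfolding tf_def by (simp add: mult.commute b_sym[of "y $ _ $ _"])
qed (rule two_nz)

lemma A_subspace: "ms.subspace A"
proof (rule ms.subspaceI)
  show "0 \<in> A" using H_A[of 0 0 0 0 0 0] by (simp add: H_zero)
qed (auto elim!: A_cases simp: H_add H_scale H_A)

lemma albert_mult_add: "albert_mult C (x + y) z = albert_mult C x z + albert_mult C y z"
proof (rule mat_ext)
  show "albert_mult C (x + y) z $ i $ j = (albert_mult C x z + albert_mult C y z) $ i $ j" for i j
    unfolding vector_add_component albert_mult_nth m_add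
    by (simp add: vec_eq_iff algebra_simps)
qed

lemma albert_mult_scale: "albert_mult C (mscale c x) z = mscale c (albert_mult C x z)"
proof (rule mat_ext)
  show "albert_mult C (mscale c x) z $ i $ j = mscale c (albert_mult C x z) $ i $ j" for i j
    unfolding mscale_nth albert_mult_nth m_scale
    by (simp add: vec_eq_iff algebra_simps)
qed

lemma albert_mult_comm: "albert_mult C x y = albert_mult C y x"
  by (simp add: albert_mult_def add.commute)

lemma one_H: "albert_one C \<gamma> = H 1 1 1 0 0 0"
  by (simp add: albert_one_def)

lemma albert_mult_one: "albert_mult C (albert_one C \<gamma>) x = x"
proof (rule mat_ext)
  have h: "(1/2) *s (2 * z) = z" for z :: "'f ^ 8"
    using half_sum[of z] by (simp only: mult_2)
  show "albert_mult C (albert_one C \<gamma>) x $ i $ j = x $ i $ j" for i j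
    using exhaust_3[of i] exhaust_3[of j]
    by (auto simp: albert_mult_nth one_H H_nth m_scale h)
qed

lemma albert_one_A: "albert_one C \<gamma> \<in> A"
  unfolding one_H by (rule H_A)

lemma albert_mult_A: "x \<in> A \<Longrightarrow> y \<in> A \<Longrightarrow> albert_mult C x y \<in> A"
  by (auto elim!: A_cases simp: mult_H H_A)

lemma tf_nondegenerate: "ab.nondegenerate_on A"
  unfolding ab.nondegenerate_on_def
proof (intro ballI impI)
  fix x assume "x \<in> A" and *: "\<forall>y\<in>A. tf x y = 0"
  then obtain f1 f2 f3 c1 c2 c3 where x: "x = H f1 f2 f3 c1 c2 c3" by (elim A_cases)
  have H: "tf x (H g1 g2 g3 d1 d2 d3) = 0" for g1 g2 g3 d1 d2 d3 using * H_A by blast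
  have "f1 = 0" "f2 = 0" "f3 = 0"
    using H[of 1 0 0 0 0 0] H[of 0 1 0 0 0 0] H[of 0 0 1 0 0 0] unfolding x tf_H by (simp_all add: b_simps)
  moreover have "c1 = 0" "c2 = 0" "c3 = 0"
    using H[of 0 0 0 _ 0 0] H[of 0 0 0 0 _ 0] H[of 0 0 0 0 0 _] al_nz unfolding x tf_H
    by (auto intro!: b_nondegenerate simp: b_simps)
  ultimately show "x = 0" unfolding x by (simp add: H_zero)
qed

lemma tf_mult_assoc:
  assumes "x \<in> A" "y \<in> A" "z \<in> A"
  shows "tf (albert_mult C x y) z = tf x (albert_mult C y z)"
proof -
  obtain f1 f2 f3 c1 c2 c3 g1 g2 g3 d1 d2 d3 h1 h2 h3 p1 p2 p3 where x:
    "x = H f1 f2 f3 c1 c2 c3" "y = H g1 g2 g3 d1 d2 d3" "z = H h1 h2 h3 p1 p2 p3"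
    using assms by (elim A_cases)
  have "2 * tf (albert_mult C x y) z = 2 * tf (albert_mult C y z) x"
    unfolding x tf_mult_H b_sym[of p1] b_sym[of p2] b_sym[of p3] b_sym[of d1 c1] b_sym[of d2 c2] b_sym[of d3 c3]
    by (simp add: algebra_simps)
  then show ?thesis using two_nz by (simp add: ab.bil_sym[of x])
qed

lemma cubic_identity:
  assumes "x \<in> A" "u \<in> A" "tf u (albert_one C \<gamma>) = 0"
  shows "2 * tf (albert_mult C x x) (albert_mult C x u) =
    2 * tf x (albert_one C \<gamma>) * tf (albert_mult C x x) u
    + (tf x x - tf x (albert_one C \<gamma>) * tf x (albert_one C \<gamma>)) * tf x u"
proof -
  obtain f1 f2 f3 c1 c2 c3 g1 g2 g3 d1 d2 d3 where x:
    "x = H f1 f2 f3 c1 c2 c3" "u = H g1 g2 g3 d1 d2 d3"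
    using assms(1,2) by (elim A_cases)
  have "g1 + g2 + g3 = 0" using assms(3) unfolding x one_H tf_H by (simp add: b_simps)
  then have g3: "g3 = - g1 - g2" by (simp add: algebra_simps eq_neg_iff_add_eq_0)
  have two: "2 * ((1/2) * x) = x" for x :: 'f using two_nz by simp
  define \<tau> where "\<tau> = t c1 c2 c3"
  define \<tau>1 where "\<tau>1 = t d1 c2 c3"
  define \<tau>2 where "\<tau>2 = t c1 d2 c3"
  define \<tau>3 where "\<tau>3 = t c1 c2 d3"
  define P1 where "P1 = al1 * b c1 c1"
  define P2 where "P2 = al2 * b c2 c2"
  define P3 where "P3 = al3 * b c3 c3"
  define S1 where "S1 = al1 * b c1 d1"
  define S2 where "S2 = al2 * b c2 d2"
  define S3 where "S3 = al3 * b c3 d3"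
  have cyc: "t c2 c3 c1 = \<tau>" "t c3 c1 c2 = \<tau>" "t c2 c3 d1 = \<tau>1" "t d2 c3 c1 = \<tau>2" "t c2 d3 c1 = \<tau>3"
    "t c3 d1 c2 = \<tau>1" "t c3 c1 d2 = \<tau>2" "t d3 c1 c2 = \<tau>3"
    unfolding \<tau>_def \<tau>1_def \<tau>2_def \<tau>3_def
    using t_cyclic by metis+
  have xx: "albert_mult C x x = H (f1 * f1 + (1/2) * (P3 + P2)) (f2 * f2 + (1/2) * (P3 + P1)) (f3 * f3 + (1/2) * (P2 + P1))
      ((f2 + f3) *s c1 + (al2 * al3) *s cj (m c2 c3))
      ((f1 + f3) *s c2 + (al3 * al1) *s cj (m c3 c1))
      ((f1 + f2) *s c3 + (al1 * al2) *s cj (m c1 c2))"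
    (is "_ = H ?h1 ?h2 ?h3 ?m1 ?m2 ?m3")
  proof -
    have v: "(1/2) *s (p + p + k *s cj (q + q)) = p + k *s cj q" for p q :: "'f ^ 8" and k
      unfolding cj_add using two_nz by (simp add: vec_eq_iff field_simps)
    have s: "(1/2) * (2 * (f * f) + q + r) = f * f + (1/2) * (q + r)" for f q r :: 'f
      using two_nz by (simp add: field_simps)
    show ?thesis
      unfolding x mult_H v s P1_def P2_def P3_def ..
  qed
  let ?k1 = "(1/2) * (2 * (f1 * g1) + S3 + S2)" and ?k2 = "(1/2) * (2 * (f2 * g2) + S3 + S1)"
    and ?k3 = "(1/2) * (2 * (f3 * g3) + S2 + S1)"
  let ?n1 = "(1/2) *s ((f2 + f3) *s d1 + (g2 + g3) *s c1 + (al2 * al3) *s cj (m c2 d3 + m d2 c3))"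
  let ?n2 = "(1/2) *s ((f1 + f3) *s d2 + (g1 + g3) *s c2 + (al3 * al1) *s cj (m c3 d1 + m d3 c1))"
  let ?n3 = "(1/2) *s ((f1 + f2) *s d3 + (g1 + g2) *s c3 + (al1 * al2) *s cj (m c1 d2 + m d1 c2))"
  have xu: "albert_mult C x u = H ?k1 ?k2 ?k3 ?n1 ?n2 ?n3"
    unfolding x mult_H S1_def S2_def S3_def ..
  note pairing = off_diagonal_pairing[OF al_prod(1)] off_diagonal_pairing[OF al_prod(2)]
    off_diagonal_pairing[OF al_prod(3)]
  have n: "4 * (al1 * b ?m1 ?n1) = 2 * ((f2 + f3) * (f2 + f3) * S1 + (f2 + f3) * (g2 + g3) * P1
      + (f2 + f3) * (\<tau>3 + \<tau>2) + (f2 + f3) * \<tau>1 + (g2 + g3) * \<tau>) + P2 * S3 + S2 * P3"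
    "4 * (al2 * b ?m2 ?n2) = 2 * ((f1 + f3) * (f1 + f3) * S2 + (f1 + f3) * (g1 + g3) * P2
      + (f1 + f3) * (\<tau>1 + \<tau>3) + (f1 + f3) * \<tau>2 + (g1 + g3) * \<tau>) + P3 * S1 + S3 * P1"
    "4 * (al3 * b ?m3 ?n3) = 2 * ((f1 + f2) * (f1 + f2) * S3 + (f1 + f2) * (g1 + g2) * P3
      + (f1 + f2) * (\<tau>2 + \<tau>1) + (f1 + f2) * \<tau>3 + (g1 + g2) * \<tau>) + P1 * S2 + S1 * P2"
    unfolding pairing cyc P1_def[symmetric] P2_def[symmetric] P3_def[symmetric] S1_def[symmetric]
      S2_def[symmetric] S3_def[symmetric] \<tau>_def[symmetric] \<tau>1_def[symmetric] \<tau>2_def[symmetric] \<tau>3_def[symmetric]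
    by (rule refl)+
  have L: "4 * tf (albert_mult C x x) (albert_mult C x u) =
    (2 * ?h1) * (2 * ?k1) + (2 * ?h2) * (2 * ?k2) + (2 * ?h3) * (2 * ?k3)
    + 4 * (al1 * b ?m1 ?n1) + 4 * (al2 * b ?m2 ?n2) + 4 * (al3 * b ?m3 ?n3)"
  proof -
    have "4 * (h1 * k1 + h2 * k2 + h3 * k3 + p + q + r) =
      (2 * h1) * (2 * k1) + (2 * h2) * (2 * k2) + (2 * h3) * (2 * k3) + 4 * p + 4 * q + 4 * r"
      for h1 h2 h3 k1 k2 k3 p q r :: 'f by (simp add: algebra_simps)
    then show ?thesis unfolding xx xu tf_H .
  qed
  have h2: "2 * ?h1 = 2 * (f1 * f1) + (P3 + P2)" "2 * ?h2 = 2 * (f2 * f2) + (P3 + P1)"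
    "2 * ?h3 = 2 * (f3 * f3) + (P2 + P1)"
    unfolding distrib_left two by simp_all
  have R1: "2 * tf (albert_mult C x x) u = (2 * ?h1) * g1 + (2 * ?h2) * g2 + (2 * ?h3) * g3
    + 2 * ((f2 + f3) * S1 + \<tau>1) + 2 * ((f1 + f3) * S2 + \<tau>2) + 2 * ((f1 + f2) * S3 + \<tau>3)"
  proof -
    have a: "al1 * (al2 * al3 * z) = z" "al2 * (al3 * al1 * z) = z" "al3 * (al1 * al2 * z) = z" for z
      using al_prod by (simp_all add: mult.assoc[symmetric])
    have T: "b (cj (m x y)) z = t x y z" for x y z by (simp add: t_def)
    have k: "al1 * b ?m1 d1 = (f2 + f3) * S1 + \<tau>1" "al2 * b ?m2 d2 = (f1 + f3) * S2 + \<tau>2"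
      "al3 * b ?m3 d3 = (f1 + f2) * S3 + \<tau>3"
      unfolding b_simps distrib_left[of al1] distrib_left[of al2] distrib_left[of al3] a T cyc S1_def S2_def S3_def
      using cyc by (simp_all add: mult.left_commute \<tau>_def \<tau>1_def \<tau>2_def \<tau>3_def)
    have "2 * (p1 * g1 + p2 * g2 + p3 * g3 + p + q + r) =
      (2 * p1) * g1 + (2 * p2) * g2 + (2 * p3) * g3 + 2 * p + 2 * q + 2 * r"
      for p1 p2 p3 p q r :: 'f by (simp add: algebra_simps)
    then show ?thesis unfolding xx unfolding x(2) tf_H k .
  qed
  have R2: "tf x x = f1 * f1 + f2 * f2 + f3 * f3 + P1 + P2 + P3"
    "tf x u = f1 * g1 + f2 * g2 + f3 * g3 + S1 + S2 + S3"
    "tf x (albert_one C \<gamma>) = f1 + f2 + f3"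
    unfolding x one_H tf_H P1_def P2_def P3_def S1_def S2_def S3_def by (simp_all add: b_simps)
  have "2 * (2 * tf (albert_mult C x x) (albert_mult C x u)) =
    2 * ((f1 + f2 + f3) * (2 * tf (albert_mult C x x) u)
    + (tf x x - (f1 + f2 + f3) * (f1 + f2 + f3)) * tf x u)"
  proof -
    have four: "2 * (2 * z) = 4 * z" for z :: 'f by simp
    show ?thesis
      unfolding four[of "tf _ _"] L n R1 unfolding h2 two R2(1,2) unfolding g3 by (simp add: algebra_simps)
  qed
  then have "2 * tf (albert_mult C x x) (albert_mult C x u) = (f1 + f2 + f3) * (2 * tf (albert_mult C x x) u)
    + (tf x x - (f1 + f2 + f3) * (f1 + f2 + f3)) * tf x u"
    unfolding mult_left_cancel[OF two_nz] .
  then show ?thesis unfolding R2(3) by (simp only: mult.assoc mult.left_commute)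
qed

sublocale cj: cubic_jordan mscale tf A "albert_mult C" "albert_one C \<gamma>"
proof
  show "tf (albert_one C \<gamma>) (albert_one C \<gamma>) = 3"
    unfolding one_H tf_H by (simp add: b_simps)
qed (fact albert_mult_add albert_mult_scale albert_mult_comm albert_mult_one A_subspace
    albert_one_A albert_mult_A tf_nondegenerate tf_mult_assoc cubic_identity)+

lemma A_orthogonal_basis: "\<exists>S. finite S \<and> ms.independent S \<and> ms.span S = A \<and> card S = 27"
proof -
  have nd: "oct.nondegenerate_on UNIV"
    unfolding oct.nondegenerate_on_def using b_nondegenerate by blast
  obtain B where B: "oct.orthogonal_basis B UNIV"
    using oct.orthogonal_basis_exists[OF vec.subspace_UNIV nd finite_cart_basis] by auto
  have cB: "card B = 8"
    using oct.orthogonal_basis_card_eq_dim[OF B] vec_dim_card[where 'n = 8 and 'a = 'f] by simp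
  have osB: "oct.orthogonal_system B" "vec.span B = UNIV"
    using B by (auto simp: oct.orthogonal_basis_def)
  define h1 where "h1 c = H 0 0 0 c 0 0" for c
  define h2 where "h2 c = H 0 0 0 0 c 0" for c
  define h3 where "h3 c = H 0 0 0 0 0 c" for c
  note h = h1_def h2_def h3_def
  have os: "ab.orthogonal_system (h1 ` B)" "ab.orthogonal_system (h2 ` B)" "ab.orthogonal_system (h3 ` B)"
    using osB(1) al_nz by (auto simp: h oct.orthogonal_system_def ab.orthogonal_system_def tf_H b_simps H_inject)
  have inj: "inj_on h1 B" "inj_on h2 B" "inj_on h3 B"
    by (auto simp: inj_on_def h H_inject)
  have c: "card (h1 ` B) = 8" "card (h2 ` B) = 8" "card (h3 ` B) = 8"
    using card_image[OF inj(1)] card_image[OF inj(2)] card_image[OF inj(3)] cB by simp_all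
  have sp: "h1 c \<in> ms.span (h1 ` B)" "h2 c \<in> ms.span (h2 ` B)" "h3 c \<in> ms.span (h3 ` B)" for c
  proof -
    have "c \<in> vec.span B" using osB by simp
    then have "h1 c \<in> ms.span (h1 ` B) \<and> h2 c \<in> ms.span (h2 ` B) \<and> h3 c \<in> ms.span (h3 ` B)"
    proof (induction rule: vec.span_induct_alt)
      case base
      then show ?case by (simp add: h H_zero ms.span_zero)
    next
      case (step a x y)
      have "h1 (a *s x + y) = mscale a (h1 x) + h1 y" "h2 (a *s x + y) = mscale a (h2 x) + h2 y"
        "h3 (a *s x + y) = mscale a (h3 x) + h3 y"
        by (simp_all add: h H_add H_scale)
      then show ?case using step by (auto intro!: ms.span_add ms.span_scale intro: ms.span_base)
    qed
    then show "h1 c \<in> ms.span (h1 ` B)" "h2 c \<in> ms.span (h2 ` B)" "h3 c \<in> ms.span (h3 ` B)" by simp_all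
  qed
  let ?e1 = "H 1 0 0 0 0 0" and ?e2 = "H 0 1 0 0 0 0" and ?e3 = "H 0 0 1 0 0 0"
  let ?S = "h1 ` B \<union> (h2 ` B \<union> (h3 ` B \<union> ({?e1} \<union> ({?e2} \<union> {?e3}))))"
  have s1: "ab.orthogonal_system ({?e2} \<union> {?e3}) \<and> card ({?e2} \<union> {?e3}) = card {?e2} + card {?e3}"
    by (intro ab.orthogonal_system_Un ab.orthogonal_system_singleton) (auto simp: tf_H b_simps)
  have s2: "ab.orthogonal_system ({?e1} \<union> ({?e2} \<union> {?e3})) \<and> card ({?e1} \<union> ({?e2} \<union> {?e3})) = card {?e1} + card ({?e2} \<union> {?e3})"
    by (intro ab.orthogonal_system_Un ab.orthogonal_system_singleton conjunct1[OF s1]) (auto simp: tf_H b_simps)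
  have s3: "ab.orthogonal_system (h3 ` B \<union> ({?e1} \<union> ({?e2} \<union> {?e3}))) \<and>
    card (h3 ` B \<union> ({?e1} \<union> ({?e2} \<union> {?e3}))) = card (h3 ` B) + card ({?e1} \<union> ({?e2} \<union> {?e3}))"
    by (intro ab.orthogonal_system_Un os conjunct1[OF s2]) (auto simp: tf_H b_simps h)
  have s4: "ab.orthogonal_system (h2 ` B \<union> (h3 ` B \<union> ({?e1} \<union> ({?e2} \<union> {?e3})))) \<and>
    card (h2 ` B \<union> (h3 ` B \<union> ({?e1} \<union> ({?e2} \<union> {?e3})))) = card (h2 ` B) + card (h3 ` B \<union> ({?e1} \<union> ({?e2} \<union> {?e3})))"
    by (intro ab.orthogonal_system_Un os conjunct1[OF s3]) (auto simp: tf_H b_simps h)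
  have s5: "ab.orthogonal_system ?S \<and>
    card ?S = card (h1 ` B) + card (h2 ` B \<union> (h3 ` B \<union> ({?e1} \<union> ({?e2} \<union> {?e3}))))"
    by (intro ab.orthogonal_system_Un os conjunct1[OF s4]) (auto simp: tf_H b_simps h)
  have "card ?S = 27"
    unfolding conjunct2[OF s5] conjunct2[OF s4] conjunct2[OF s3] conjunct2[OF s2] conjunct2[OF s1] c by simp
  moreover have "ms.span ?S = A"
  proof (rule ms.span_subspace)
    show "?S \<subseteq> A" by (auto simp: h H_A)
    show "A \<subseteq> ms.span ?S"
    proof
      fix x assume "x \<in> A"
      then obtain f1 f2 f3 c1 c2 c3 where x: "x = H f1 f2 f3 c1 c2 c3" by (elim A_cases)
      have "x = h1 c1 + (h2 c2 + (h3 c3 + (mscale f1 ?e1 + (mscale f2 ?e2 + mscale f3 ?e3))))"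
        unfolding x h H_scale H_add by simp
      also have "\<dots> \<in> ms.span ?S"
        by (intro ms.span_add ms.span_scale set_mp[OF ms.span_mono sp(1)] set_mp[OF ms.span_mono sp(2)]
            set_mp[OF ms.span_mono sp(3)] ms.span_base) auto
      finally show "x \<in> ms.span ?S" .
    qed
  qed (rule A_subspace)
  moreover have "finite ?S" using conjunct1[OF s5] by (simp add: ab.orthogonal_system_def)
  ultimately show ?thesis
    using ab.orthogonal_system_independent[OF conjunct1[OF s5]] by (intro exI[of _ ?S] conjI)
qed

text \<open>Testing \<open>u\<close> against the three diagonal idempotents shows that \<open>u\<close> is one of them; a matrix with a single
  off-diagonal unit then contradicts the assumption.\<close>

lemma no_central_idempotent:
  assumes u: "u \<in> A" "albert_mult C u u = u" "tf u u = 1"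
  shows "\<exists>x\<in>A. \<forall>c. albert_mult C u x \<noteq> mscale c u"
proof (rule ccontr)
  assume "\<not> ?thesis"
  then have *: "\<exists>c. albert_mult C u x = mscale c u" if "x \<in> A" for x using that by blast
  obtain f1 f2 f3 c1 c2 c3 where x: "u = H f1 f2 f3 c1 c2 c3" using u(1) by (elim A_cases)
  have n0: "1/2 \<noteq> (0::'f)" using two_nz by simp
  have n1: "1/2 \<noteq> (1::'f)"
  proof
    assume "1/2 = (1::'f)"
    then have "2 * (1/2) = (2 * 1 :: 'f)" by simp
    then have "(1::'f) = 1 + 1" using two_nz by simp
    then show False by (metis add_cancel_right_right zero_neq_one)
  qed
  have half: "c = 0" if "(1/2) *s c = c" for c :: "'f ^ 8"
  proof -
    have "(1/2) *s c = 1 *s c" using that by simp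
    then show ?thesis using n1 vec.scale_cancel_right by metis
  qed
  have "tf u (albert_one C \<gamma>) = 1"
    using tf_mult_assoc[OF u(1,1) albert_one_A] u(2,3)
    by (simp add: albert_mult_comm[of u "albert_one C \<gamma>"] albert_mult_one)
  then have tr: "f1 + f2 + f3 = 1"
    unfolding x one_H tf_H by (simp add: b_simps)
  have 1: "f1 = 0"
  proof (rule ccontr)
    assume nz: "f1 \<noteq> 0"
    obtain c where "albert_mult C u (H 1 0 0 0 0 0) = mscale c u" using *[OF H_A] by blast
    then have c: "f1 = c * f1" "c * f2 = 0" "c * f3 = 0" "c *s c1 = 0" "(1/2) *s c2 = c *s c2" "(1/2) *s c3 = c *s c3"
      unfolding x mult_H H_scale H_inject using two_nz by (simp_all add: b_simps)
    then have "c = 1" using nz by simp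
    then have z: "f2 = 0" "f3 = 0" "c1 = 0" "c2 = 0" "c3 = 0" using c half by auto
    obtain d where "albert_mult C u (H 0 0 0 0 0 I) = mscale d u" using *[OF H_A] by blast
    then show False
      unfolding x mult_H H_scale H_inject z using nz two_nz I_nonzero by (auto simp: b_simps)
  qed
  have 2: "f2 = 0"
  proof (rule ccontr)
    assume nz: "f2 \<noteq> 0"
    obtain c where "albert_mult C u (H 0 1 0 0 0 0) = mscale c u" using *[OF H_A] by blast
    then have c: "f2 = c * f2" "c * f1 = 0" "c * f3 = 0" "c *s c2 = 0" "(1/2) *s c1 = c *s c1" "(1/2) *s c3 = c *s c3"
      unfolding x mult_H H_scale H_inject using two_nz by (simp_all add: b_simps)
    then have "c = 1" using nz by simp
    then have z: "f1 = 0" "f3 = 0" "c1 = 0" "c2 = 0" "c3 = 0" using c half by auto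
    obtain d where "albert_mult C u (H 0 0 0 0 0 I) = mscale d u" using *[OF H_A] by blast
    then show False
      unfolding x mult_H H_scale H_inject z using nz two_nz I_nonzero by (auto simp: b_simps)
  qed
  have 3: "f3 = 1" using tr 1 2 by simp
  obtain c where "albert_mult C u (H 0 0 1 0 0 0) = mscale c u" using *[OF H_A] by blast
  then have c: "f3 = c * f3" "c * f1 = 0" "c * f2 = 0" "c *s c3 = 0" "(1/2) *s c1 = c *s c1" "(1/2) *s c2 = c *s c2"
    unfolding x mult_H H_scale H_inject using two_nz by (simp_all add: b_simps)
  then have "c = 1" using 3 by simp
  then have z: "f1 = 0" "f2 = 0" "c1 = 0" "c2 = 0" "c3 = 0" using c half by auto
  obtain d where "albert_mult C u (H 0 0 0 I 0 0) = mscale d u" using *[OF H_A] by blast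
  then show False
    unfolding x mult_H H_scale H_inject z 3 using two_nz I_nonzero by (auto simp: b_simps)
qed

end

section \<open>Matrices satisfying Clifford relations\<close>

definition matscale :: "'f::semiring_0 \<Rightarrow> 'f ^ 'n ^ 'm \<Rightarrow> 'f ^ 'n ^ 'm" where
  "matscale c M = (\<chi> i j. c * M $ i $ j)"

lemma matscale_nth [simp]: "matscale c M $ i $ j = c * M $ i $ j"
  by (simp add: matscale_def)

lemma matscale_mult:
  fixes A :: "'f::comm_semiring_1 ^ 'n::finite ^ 'm" and B :: "'f ^ 'k ^ 'n"
  shows "matscale c A ** B = matscale c (A ** B)" "A ** matscale c B = matscale c (A ** B)"
  by (simp_all add: matrix_matrix_mult_def vec_eq_iff sum_distrib_left ac_simps)

lemma matscale_matscale: "matscale c (matscale d (A :: 'f::comm_semiring_1 ^ 'n ^ 'm)) = matscale (c * d) A"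
  by (simp add: vec_eq_iff ac_simps)

lemma matscale_one: "matscale 1 (A :: 'f::comm_semiring_1 ^ 'n ^ 'm) = A"
  by (simp add: vec_eq_iff)

lemma matscale_minus_one: "matscale (- 1) (A :: 'f::comm_ring_1 ^ 'n ^ 'm) = - A"
  by (simp add: vec_eq_iff)

lemma matscale_zero: "matscale 0 (A :: 'f::comm_semiring_1 ^ 'n ^ 'm) = 0" "matscale c (0 :: 'f ^ 'n ^ 'm) = 0"
  by (simp_all add: vec_eq_iff)

lemma matscale_add: "matscale c (A + B :: 'f::comm_semiring_1 ^ 'n ^ 'm) = matscale c A + matscale c B"
  "matscale (c + d) A = matscale c A + matscale d A"
  by (simp_all add: vec_eq_iff algebra_simps)

lemma mat_eq_matscale: "mat c = matscale c (mat 1 :: 'f::comm_semiring_1 ^ 'n ^ 'n)"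
  by (simp add: mat_def vec_eq_iff)

lemma mat_mult_minus:
  fixes A :: "'f::comm_ring_1 ^ 'n::finite ^ 'm" and B :: "'f ^ 'k ^ 'n"
  shows "(- A) ** B = - (A ** B)" "A ** (- B) = - (A ** B)"
  by (simp_all add: matrix_matrix_mult_def vec_eq_iff sum_negf)

lemma mat_mult_add:
  fixes A A' :: "'f::comm_ring_1 ^ 'n::finite ^ 'm" and B B' :: "'f ^ 'k ^ 'n"
  shows "(A + A') ** B = A ** B + A' ** B" "A ** (B + B') = A ** B + A ** B'"
  by (simp_all add: matrix_matrix_mult_def vec_eq_iff sum.distrib distrib_left distrib_right)

lemma mat_mult_zero:
  fixes A :: "'f::comm_ring_1 ^ 'n::finite ^ 'm" and B :: "'f ^ 'k ^ 'n"
  shows "0 ** B = (0 :: 'f ^ 'k ^ 'm)" "A ** 0 = (0 :: 'f ^ 'k ^ 'm)"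
  by (simp_all add: matrix_matrix_mult_def vec_eq_iff)

lemma mat_mult_sum:
  fixes B :: "'f::comm_ring_1 ^ 'k ^ 'n::finite" and f :: "'a \<Rightarrow> 'f ^ 'n ^ 'm"
  shows "(\<Sum>i\<in>S. f i) ** B = (\<Sum>i\<in>S. f i ** B)"
  by (induction S rule: infinite_finite_induct) (simp_all add: mat_mult_zero mat_mult_add)

lemma mat_mult_sum_right:
  fixes B :: "'f::comm_ring_1 ^ 'n::finite ^ 'm" and f :: "'a \<Rightarrow> 'f ^ 'k ^ 'n"
  shows "B ** (\<Sum>i\<in>S. f i) = (\<Sum>i\<in>S. B ** f i)"
  by (induction S rule: infinite_finite_induct) (simp_all add: mat_mult_zero mat_mult_add)

lemma trace_matscale: "trace (matscale c (A :: 'f::comm_semiring_1 ^ 'n ^ 'n)) = c * trace A"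
  by (simp add: trace_def sum_distrib_left)

lemma vector_space_matscale: "vector_space (matscale :: 'f::field \<Rightarrow> 'f ^ 'n ^ 'm \<Rightarrow> _)"
  by unfold_locales (simp_all add: vec_eq_iff algebra_simps)

lemma mat_mult_mat:
  fixes A :: "'f::comm_semiring_1 ^ 'n::finite ^ 'n"
  shows "mat c ** A = matscale c A" "A ** mat c = matscale c A"
  unfolding mat_eq_matscale[of c] matscale_mult by simp_all

lemma matscale_mat: "matscale c (mat d :: 'f::comm_semiring_1 ^ 'n ^ 'n) = mat (c * d)"
  by (simp add: mat_def vec_eq_iff)

lemma axis_axis_nth: "axis i (axis j (1::'f::zero_neq_one)) $ a $ b = (if a = i then if b = j then 1 else 0 else 0)"
  by (simp add: axis_def)

definition sdiff :: "'a set \<Rightarrow> 'a set \<Rightarrow> 'a set" where "sdiff A B = (A - B) \<union> (B - A)"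

primrec clifford_product :: "(nat \<Rightarrow> 'f::field ^ 'n ^ 'n) \<Rightarrow> nat \<Rightarrow> nat set \<Rightarrow> 'f ^ 'n ^ 'n" where
  "clifford_product T 0 S = mat 1"
| "clifford_product T (Suc k) S =
    (if k \<in> S then T k ** clifford_product T k S else clifford_product T k S)"

text \<open>The scalar to which the product of anticommuting factors squares; moving a factor past the smaller
  ones accounts for the sign.\<close>

primrec clifford_square :: "(nat \<Rightarrow> 'f::field) \<Rightarrow> nat \<Rightarrow> nat set \<Rightarrow> 'f" where
  "clifford_square q 0 S = 1"
| "clifford_square q (Suc k) S =
    (if k \<in> S then (-1) ^ card (S \<inter> {..<k}) * q k * clifford_square q k S else clifford_square q k S)"

definition even_subsets :: "nat set set" where
  "even_subsets = {S. S \<subseteq> {..<9} \<and> even (card S)}"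

lemma finite_even_subsets [simp]: "finite even_subsets"
  by (rule finite_subset[of _ "Pow {..<9}"]) (auto simp: even_subsets_def)

text \<open>Toggling the element 0 matches the even subsets with the odd ones.\<close>

lemma card_even_subsets: "card even_subsets = 256"
proof -
  let ?O = "{S. S \<subseteq> {..<9::nat} \<and> odd (card S)}"
  have fin: "finite S" if "S \<subseteq> {..<9::nat}" for S using that finite_subset by blast
  have card_toggle: "even (card (sdiff S {0})) = odd (card S)" "sdiff S {0} \<subseteq> {..<9}"
    if "S \<subseteq> {..<9::nat}" for S
  proof -
    show "even (card (sdiff S {0})) = odd (card S)"
    proof (cases "0 \<in> S")
      case True
      then have "sdiff S {0} = S - {0}" by (auto simp: sdiff_def)
      moreover have "card S = Suc (card (S - {0}))" using card_Suc_Diff1[OF fin[OF that] True] by simp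
      ultimately show ?thesis by simp
    next
      case False
      then have "sdiff S {0} = insert 0 S" by (auto simp: sdiff_def)
      then show ?thesis using fin[OF that] False by simp
    qed
    show "sdiff S {0} \<subseteq> {..<9}" using that by (auto simp: sdiff_def)
  qed
  have twice: "sdiff (sdiff S {0}) {0} = S" for S :: "nat set" by (auto simp: sdiff_def)
  have "bij_betw (\<lambda>S. sdiff S {0}) even_subsets ?O"
    by (rule bij_betw_byWitness[where f' = "\<lambda>S. sdiff S {0}"])
      (use card_toggle twice in \<open>auto simp: even_subsets_def\<close>)
  then have "card even_subsets = card ?O" by (rule bij_betw_same_card)
  moreover have "card (even_subsets \<union> ?O) = card even_subsets + card ?O"
    by (rule card_Un_disjoint) (auto simp: even_subsets_def intro: finite_subset[of _ "Pow {..<9}"])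
  moreover have "even_subsets \<union> ?O = Pow {..<9}" by (auto simp: even_subsets_def)
  ultimately show ?thesis by (simp add: card_Pow)
qed

text \<open>Nine generators have \<open>2\<^sup>8\<close> even products, as many as the dimension \<open>16\<^sup>2\<close> of the space of all
  matrices of size 16.\<close>

locale clifford_generators =
  fixes T :: "nat \<Rightarrow> 'f::field ^ 'n::finite ^ 'n" and q :: "nat \<Rightarrow> 'f"
  assumes two: "(2::'f) \<noteq> 0" and card_n: "CARD('n) = 16"
    and anticommute: "i < 9 \<Longrightarrow> j < 9 \<Longrightarrow> i \<noteq> j \<Longrightarrow> T i ** T j = - (T j ** T i)"
    and square: "i < 9 \<Longrightarrow> T i ** T i = mat (q i)"
    and q_nz: "i < 9 \<Longrightarrow> q i \<noteq> 0"
begin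

abbreviation P where "P \<equiv> clifford_product T"
abbreviation N where "N \<equiv> clifford_square q"

lemma P_cong: "S \<inter> {..<k} = S' \<inter> {..<k} \<Longrightarrow> P k S = P k S'"
proof (induction k)
  case (Suc k)
  have "k \<in> S \<longleftrightarrow> k \<in> S'" using Suc.prems by blast
  moreover have "A \<inter> {..<k} = (A \<inter> {..<Suc k}) \<inter> {..<k}" for A :: "nat set" by auto
  then have "S \<inter> {..<k} = S' \<inter> {..<k}" using Suc.prems by metis
  ultimately show ?case using Suc.IH by simp
qed simp

lemma minus_sign: "- A = matscale (- 1) (A :: 'f ^ 'n ^ 'n)"
  by (simp add: matscale_minus_one)

lemma P_commute:
  assumes "k \<le> 9" "i < 9"
  shows "T i ** P k S = matscale ((-1) ^ card (S \<inter> {..<k} - {i})) (P k S ** T i)"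
  using assms(1)
proof (induction k)
  case 0
  then show ?case by (simp add: matscale_one)
next
  case (Suc k)
  show ?case
  proof (cases "k \<in> S")
    case False
    then have "S \<inter> {..<Suc k} = S \<inter> {..<k}" by (auto simp: less_Suc_eq)
    then show ?thesis using Suc False by simp
  next
    case True
    let ?s = "(-1) ^ card (S \<inter> {..<k} - {i}) :: 'f"
    have IH: "T i ** P k S = matscale ?s (P k S ** T i)" using Suc by simp
    show ?thesis
    proof (cases "k = i")
      case True
      then have s: "S \<inter> {..<Suc k} - {i} = S \<inter> {..<k} - {i}" by auto
      have "T i ** (T i ** P k S) = T i ** matscale ?s (P k S ** T i)"
        using IH by simp
      then show ?thesis using \<open>k \<in> S\<close> True s by (simp add: matscale_mult matrix_mul_assoc)
    next
      case False
      then have "S \<inter> {..<Suc k} - {i} = insert k (S \<inter> {..<k} - {i})" using True by auto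
      then have s: "card (S \<inter> {..<Suc k} - {i}) = Suc (card (S \<inter> {..<k} - {i}))" by simp
      have "T i ** (T k ** P k S) = - (T k ** T i) ** P k S"
        using anticommute[of i k] False Suc.prems assms(2) by (simp add: matrix_mul_assoc)
      also have "\<dots> = - (T k ** (T i ** P k S))" by (simp add: mat_mult_minus matrix_mul_assoc)
      also have "\<dots> = matscale (- ?s) (T k ** P k S ** T i)"
        unfolding IH minus_sign matscale_mult matscale_matscale by (simp add: matrix_mul_assoc)
      finally show ?thesis using True unfolding s by simp
    qed
  qed
qed

lemma P_toggle:
  assumes "i < k" "k \<le> 9"
  shows "\<exists>c. c \<noteq> 0 \<and> T i ** P k S = matscale c (P k (sdiff S {i}))"
  using assms
proof (induction k)
  case (Suc k)
  show ?case
  proof (cases "i = k")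
    case True
    have cong: "P k (sdiff S {k}) = P k S" by (rule P_cong) (auto simp: sdiff_def)
    show ?thesis
    proof (cases "k \<in> S")
      case True
      then have "T k ** (T k ** P k S) = matscale (q k) (P k S)"
        using square[of k] Suc.prems by (simp add: matrix_mul_assoc mat_mult_mat)
      moreover have "k \<notin> sdiff S {k}" using True by (auto simp: sdiff_def)
      ultimately show ?thesis using True \<open>i = k\<close> q_nz[of k] Suc.prems cong by auto
    next
      case False
      then have "k \<in> sdiff S {k}" by (auto simp: sdiff_def)
      then have "T i ** P (Suc k) S = matscale 1 (P (Suc k) (sdiff S {i}))"
        using False \<open>i = k\<close> cong by (simp add: matscale_one)
      then show ?thesis by (intro exI[of _ 1]) simp
    qed
  next
    case False
    then obtain c where c: "c \<noteq> 0" "T i ** P k S = matscale c (P k (sdiff S {i}))"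
      using Suc by auto
    have mem: "k \<in> sdiff S {i} \<longleftrightarrow> k \<in> S" using False by (auto simp: sdiff_def)
    show ?thesis
    proof (cases "k \<in> S")
      case True
      have "T i ** (T k ** P k S) = - (T k ** T i) ** P k S"
        using anticommute[of i k] False Suc.prems by (simp add: matrix_mul_assoc)
      also have "\<dots> = - (T k ** (T i ** P k S))" by (simp add: mat_mult_minus matrix_mul_assoc)
      also have "\<dots> = matscale (- c) (T k ** P k (sdiff S {i}))"
        unfolding c minus_sign matscale_mult matscale_matscale by simp
      finally show ?thesis using True mem c by (intro exI[of _ "- c"]) simp
    next
      case False
      then show ?thesis using c mem by auto
    qed
  qed
qed simp

lemma P_mult: "k \<le> 9 \<Longrightarrow> \<exists>c. c \<noteq> 0 \<and> P k S ** P 9 S' = matscale c (P 9 (sdiff (S \<inter> {..<k}) S'))"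
proof (induction k)
  case 0
  have "sdiff (S \<inter> {..<0}) S' = S'" by (auto simp: sdiff_def)
  then show ?case by (intro exI[of _ 1]) (simp add: matscale_one)
next
  case (Suc k)
  then obtain c where c: "c \<noteq> 0" "P k S ** P 9 S' = matscale c (P 9 (sdiff (S \<inter> {..<k}) S'))"
    by auto
  show ?case
  proof (cases "k \<in> S")
    case True
    obtain d where d: "d \<noteq> 0" "T k ** P 9 (sdiff (S \<inter> {..<k}) S') =
        matscale d (P 9 (sdiff (sdiff (S \<inter> {..<k}) S') {k}))"
      using P_toggle[of k 9] Suc.prems by auto
    have s: "sdiff (sdiff (S \<inter> {..<k}) S') {k} = sdiff (S \<inter> {..<Suc k}) S'"
      using True by (auto simp: sdiff_def less_Suc_eq)
    have "P (Suc k) S ** P 9 S' = T k ** (P k S ** P 9 S')"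
      using True by (simp add: matrix_mul_assoc)
    also have "\<dots> = matscale (c * d) (P 9 (sdiff (S \<inter> {..<Suc k}) S'))"
      unfolding c matscale_mult d matscale_matscale s ..
    finally show ?thesis using c d by (intro exI[of _ "c * d"]) simp
  next
    case False
    then have "S \<inter> {..<Suc k} = S \<inter> {..<k}" by (auto simp: less_Suc_eq)
    then show ?thesis using c False by auto
  qed
qed

lemma P_square: "k \<le> 9 \<Longrightarrow> P k S ** P k S = mat (N k S)"
proof (induction k)
  case (Suc k)
  show ?case
  proof (cases "k \<in> S")
    case True
    let ?s = "(-1) ^ card (S \<inter> {..<k}) :: 'f"
    have ss: "?s * ?s = 1" by (simp add: power_mult_distrib[symmetric])
    have e: "S \<inter> {..<k} - {k} = S \<inter> {..<k}" by auto
    have IH: "P k S ** P k S = mat (N k S)" using Suc by simp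
    have "T k ** P k S = matscale ?s (P k S ** T k)"
      using P_commute[of k k S] Suc.prems unfolding e by simp
    then have "matscale ?s (T k ** P k S) = P k S ** T k"
      by (simp add: matscale_matscale ss matscale_one)
    then have pt: "P k S ** T k = matscale ?s (T k ** P k S)" by simp
    have "(T k ** P k S) ** (T k ** P k S) = T k ** (P k S ** T k) ** P k S"
      by (simp add: matrix_mul_assoc)
    also have "\<dots> = matscale ?s ((T k ** T k) ** (P k S ** P k S))"
      unfolding pt matscale_mult by (simp add: matrix_mul_assoc)
    also have "\<dots> = mat (?s * q k * N k S)"
      unfolding IH using square[of k] Suc.prems
      by (simp add: mat_mult_mat matscale_mat ac_simps)
    finally show ?thesis using True by simp
  qed (use Suc in simp)
qed simp

lemma N_nz: "k \<le> 9 \<Longrightarrow> N k S \<noteq> 0"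
  by (induction k) (auto simp: q_nz)

lemma sixteen_nz: "(16::'f) \<noteq> 0"
proof -
  have "(16::'f) = 2 * (2 * (2 * 2))" by simp
  then show ?thesis using two by (metis mult_eq_0_iff)
qed

lemma trace_one: "trace (mat 1 :: 'f ^ 'n ^ 'n) = 16"
proof -
  have "trace (mat 1 :: 'f ^ 'n ^ 'n) = of_nat CARD('n)" by (simp add: trace_def mat_def)
  then show ?thesis by (simp add: card_n)
qed

text \<open>A nonempty even product anticommutes with each of its factors, so it has trace 0.\<close>

lemma trace_P:
  assumes "S \<in> even_subsets" "S \<noteq> {}"
  shows "trace (P 9 S) = 0"
proof -
  obtain i where i: "i \<in> S" "i < 9" using assms by (auto simp: even_subsets_def)
  have S: "S \<inter> {..<9} = S" "finite S" "even (card S)"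
    using assms finite_subset[of S "{..<9}"] by (auto simp: even_subsets_def)
  have "odd (card (S - {i}))" using S i card_Suc_Diff1[of S i] by (metis even_Suc)
  then have "T i ** P 9 S = - (P 9 S ** T i)"
    using P_commute[of 9 i S] i S by (simp add: matscale_minus_one)
  then have "trace (T i ** P 9 S ** T i) = - trace (P 9 S ** T i ** T i)"
    by (simp add: mat_mult_minus trace_def sum_negf)
  moreover have "trace (T i ** P 9 S ** T i) = trace (P 9 S ** T i ** T i)"
    by (metis trace_mul_sym matrix_mul_assoc)
  moreover have "trace (P 9 S ** T i ** T i) = q i * trace (P 9 S)"
    using square[OF i(2)] by (simp add: matrix_mul_assoc[symmetric] mat_mult_mat trace_matscale)
  ultimately have "q i * trace (P 9 S) = - (q i * trace (P 9 S))" by metis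
  then have "2 * (q i * trace (P 9 S)) = 0" by (simp only: eq_neg_iff_add_eq_0 mult_2)
  then show ?thesis using two q_nz[OF i(2)] by simp
qed

lemma even_sdiff: "S \<in> even_subsets \<Longrightarrow> S' \<in> even_subsets \<Longrightarrow> sdiff S S' \<in> even_subsets"
proof -
  assume S: "S \<in> even_subsets" "S' \<in> even_subsets"
  then have fin: "finite S" "finite S'" using finite_subset[of _ "{..<9::nat}"] by (auto simp: even_subsets_def)
  have "card (sdiff S S') = card (S - S') + card (S' - S)"
    unfolding sdiff_def by (rule card_Un_disjoint) (use fin in auto)
  moreover have "card S = card (S - S') + card (S \<inter> S')" "card S' = card (S' - S) + card (S \<inter> S')"
    using card_Int_Diff[OF fin(1), of S'] card_Int_Diff[OF fin(2), of S]
    by (simp_all only: Int_commute add.commute)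
  moreover have "even (card S)" "even (card S')" "sdiff S S' \<subseteq> {..<9}"
    using S by (auto simp: even_subsets_def sdiff_def)
  ultimately show ?thesis by (simp add: even_subsets_def)
qed

lemma trace_P_P:
  assumes "S \<in> even_subsets" "S' \<in> even_subsets"
  shows "trace (P 9 S ** P 9 S') = (if S = S' then 16 * N 9 S else 0)"
proof (cases "S = S'")
  case True
  then show ?thesis
    using P_square[of 9 S] matscale_mat[of "N 9 S" 1, where 'n = 'n]
    by (metis le_refl mult.commute mult.right_neutral trace_matscale trace_one)
next
  case False
  obtain c where "P 9 S ** P 9 S' = matscale c (P 9 (sdiff (S \<inter> {..<9}) S'))"
    using P_mult[of 9 S S'] by auto
  moreover have "S \<inter> {..<9} = S" using assms by (auto simp: even_subsets_def)
  moreover have "sdiff S S' \<noteq> {}" using False by (auto simp: sdiff_def)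
  ultimately show ?thesis
    using trace_P[OF even_sdiff[OF assms]] False by (simp add: trace_matscale)
qed

sublocale mb: bilinear_space "matscale :: 'f \<Rightarrow> 'f ^ 'n ^ 'n \<Rightarrow> 'f ^ 'n ^ 'n" "\<lambda>A B. trace (A ** B)"
proof (intro bilinear_space.intro bilinear_space_axioms.intro)
  show "vector_space (matscale :: 'f \<Rightarrow> 'f ^ 'n ^ 'n \<Rightarrow> 'f ^ 'n ^ 'n)" by (rule vector_space_matscale)
  show "trace ((A + A') ** B) = trace (A ** B) + trace (A' ** B)" for A A' B :: "'f ^ 'n ^ 'n"
    unfolding mat_mult_add trace_add ..
  show "trace (matscale c A ** B) = c * trace (A ** B)" for c and A B :: "'f ^ 'n ^ 'n"
    unfolding matscale_mult trace_matscale ..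
qed (rule two trace_mul_sym)+

lemma P_orthogonal: "mb.orthogonal_system (P 9 ` even_subsets)" "inj_on (P 9) even_subsets"
proof -
  show "mb.orthogonal_system (P 9 ` even_subsets)"
    using trace_P_P N_nz[of 9] sixteen_nz by (auto simp: mb.orthogonal_system_def)
  show "inj_on (P 9) even_subsets"
  proof (rule inj_onI)
    fix S S' assume S: "S \<in> even_subsets" "S' \<in> even_subsets" "P 9 S = P 9 S'"
    show "S = S'"
    proof (rule ccontr)
      assume "S \<noteq> S'"
      then have "trace (P 9 S ** P 9 S) = 0" using trace_P_P[OF S(1,2)] S(3) by simp
      then show False using trace_P_P[OF S(1,1)] N_nz[of 9 S] sixteen_nz by simp
    qed
  qed
qed

text \<open>The 256 even products are linearly independent in a space of dimension \<open>16\<^sup>2\<close>.\<close>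

lemma P_span: "mb.span (P 9 ` even_subsets) = UNIV"
proof -
  define U where "U = (\<lambda>(i, j). axis i (axis j 1) :: 'f ^ 'n ^ 'n) ` UNIV"
  have U: "finite U" "card U \<le> 256"
  proof -
    show "finite U" by (simp add: U_def)
    have "card U \<le> CARD('n \<times> 'n)" unfolding U_def by (rule card_image_le) simp
    then show "card U \<le> 256" by (simp add: card_n)
  qed
  have span: "M \<in> mb.span U" for M
  proof -
    have "M = (\<Sum>i\<in>UNIV. \<Sum>j\<in>UNIV. matscale (M $ i $ j) (axis i (axis j 1)))"
    proof -
      have "(\<Sum>j\<in>UNIV. M $ i $ j * axis i (axis j (1::'f)) $ a $ b) = (if i = a then M $ i $ b else 0)" for i a b
        by (cases "i = a") (simp_all add: axis_def mult_delta_right)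
      then show ?thesis by (simp add: vec_eq_iff)
    qed
    also have "\<dots> \<in> mb.span U"
      by (intro mb.span_sum mb.span_scale mb.span_base) (auto simp: U_def)
    finally show ?thesis .
  qed
  have ind: "mb.independent (P 9 ` even_subsets)"
    by (rule mb.orthogonal_system_independent[OF P_orthogonal(1)])
  have "M \<in> mb.span (P 9 ` even_subsets)" for M
  proof (rule ccontr)
    assume M: "M \<notin> mb.span (P 9 ` even_subsets)"
    then have "mb.independent (insert M (P 9 ` even_subsets))"
      using ind by (rule mb.independent_insertI)
    then have "card (insert M (P 9 ` even_subsets)) \<le> card U"
      using mb.independent_span_bound[OF U(1)] span by blast
    moreover have "M \<notin> P 9 ` even_subsets" using M mb.span_base by blast
    ultimately show False
      using U P_orthogonal(2) card_even_subsets by (simp add: card_image)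
  qed
  then show ?thesis by blast
qed

definition coeff_P :: "nat set \<Rightarrow> 'f ^ 'n ^ 'n \<Rightarrow> 'f" where
  "coeff_P S M = trace (M ** P 9 S) / (16 * N 9 S)"

lemma P_expansion: "M = (\<Sum>S\<in>even_subsets. matscale (coeff_P S M) (P 9 S))"
proof -
  have "M = (\<Sum>b\<in>P 9 ` even_subsets. matscale (trace (M ** b) / trace (b ** b)) b)"
    using mb.orthogonal_expansion[OF P_orthogonal(1)] P_span by blast
  also have "\<dots> = (\<Sum>S\<in>even_subsets. matscale (trace (M ** P 9 S) / trace (P 9 S ** P 9 S)) (P 9 S))"
    by (simp add: sum.reindex P_orthogonal(2))
  also have "\<dots> = (\<Sum>S\<in>even_subsets. matscale (coeff_P S M) (P 9 S))"
    by (intro sum.cong) (simp_all add: coeff_P_def trace_P_P)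
  finally show ?thesis .
qed

lemma P_independent:
  assumes "(\<Sum>S\<in>even_subsets. matscale (c S) (P 9 S)) = 0" "S \<in> even_subsets"
  shows "c S = 0"
proof -
  have "trace ((\<Sum>S\<in>even_subsets. matscale (c S) (P 9 S)) ** P 9 S)
    = (\<Sum>S'\<in>even_subsets. c S' * trace (P 9 S' ** P 9 S))"
    unfolding mb.bil_sum_left by (simp add: matscale_mult trace_matscale)
  also have "\<dots> = (\<Sum>S'\<in>even_subsets. if S' = S then c S * (16 * N 9 S) else 0)"
    using assms(2) by (intro sum.cong) (simp_all add: trace_P_P)
  also have "\<dots> = c S * (16 * N 9 S)" using assms(2) by simp
  finally have "c S * (16 * N 9 S) = 0" using assms(1) by (simp add: mat_mult_zero trace_def)
  then show ?thesis using N_nz[of 9 S] sixteen_nz by simp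
qed

text \<open>Every matrix is a combination of even products, so only scalars commute with all of them.\<close>

lemma commute_scalar:
  assumes M: "\<And>i j. i < 9 \<Longrightarrow> j < 9 \<Longrightarrow> i \<noteq> j \<Longrightarrow> M ** (T i ** T j) = T i ** T j ** M"
  shows "\<exists>c. M = mat c"
proof -
  have 1: "(even (card (S \<inter> {..<k})) \<longrightarrow> M ** P k S = P k S ** M) \<and>
      (odd (card (S \<inter> {..<k})) \<longrightarrow> (\<forall>i. k \<le> i \<longrightarrow> i < 9 \<longrightarrow> M ** (T i ** P k S) = T i ** P k S ** M))"
    if "k \<le> 9" for k S
    using that
  proof (induction k)
    case (Suc k)
    show ?case
    proof (cases "k \<in> S")
      case False
      then have "S \<inter> {..<Suc k} = S \<inter> {..<k}" by (auto simp: less_Suc_eq)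
      then show ?thesis using Suc False by simp
    next
      case True
      then have "S \<inter> {..<Suc k} = insert k (S \<inter> {..<k})" by (auto simp: less_Suc_eq)
      then have c: "card (S \<inter> {..<Suc k}) = Suc (card (S \<inter> {..<k}))" by simp
      show ?thesis
      proof (intro conjI impI allI)
        assume "even (card (S \<inter> {..<Suc k}))"
        then have "odd (card (S \<inter> {..<k}))" using c by simp
        then show "M ** P (Suc k) S = P (Suc k) S ** M" using Suc True by simp
      next
        fix i assume i: "odd (card (S \<inter> {..<Suc k}))" "Suc k \<le> i" "i < 9"
        then have "M ** P k S = P k S ** M" using Suc c by simp
        moreover have "M ** (T i ** T k) = T i ** T k ** M" using M[of i k] i by simp
        ultimately have "M ** (T i ** T k) ** P k S = T i ** T k ** (P k S ** M)"
          by (simp add: matrix_mul_assoc[symmetric])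
        then show "M ** (T i ** P (Suc k) S) = T i ** P (Suc k) S ** M"
          using True by (simp add: matrix_mul_assoc)
      qed
    qed
  qed simp
  have 2: "M ** P 9 S = P 9 S ** M" if "S \<in> even_subsets" for S
  proof -
    have "S \<inter> {..<9} = S" using that by (auto simp: even_subsets_def)
    then show ?thesis using 1[of 9 S] that by (simp add: even_subsets_def)
  qed
  have comm: "M ** A = A ** M" for A
  proof -
    have "M ** (\<Sum>S\<in>even_subsets. matscale (coeff_P S A) (P 9 S)) =
        (\<Sum>S\<in>even_subsets. matscale (coeff_P S A) (P 9 S)) ** M"
      unfolding mat_mult_sum mat_mult_sum_right by (intro sum.cong) (simp_all add: matscale_mult 2)
    then show ?thesis using P_expansion[of A] by simp
  qed
  obtain i0 :: 'n where True by blast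
  have "M $ i $ j = mat (M $ i0 $ i0) $ i $ j" for i j
  proof -
    have e: "(M ** axis j (axis i0 1)) $ i $ i0 = M $ i $ j"
      "(axis j (axis i0 1) ** M) $ i $ i0 = (if i = j then M $ i0 $ i0 else 0)"
    proof -
      show "(M ** axis j (axis i0 1)) $ i $ i0 = M $ i $ j"
        by (simp add: matrix_matrix_mult_def axis_axis_nth mult_delta_right)
      show "(axis j (axis i0 1) ** M) $ i $ i0 = (if i = j then M $ i0 $ i0 else 0)"
        by (cases "i = j") (simp_all add: matrix_matrix_mult_def axis_axis_nth mult_delta_left)
    qed
    show ?thesis using comm[of "axis j (axis i0 1)"] e by (simp add: mat_def)
  qed
  then have "M = mat (M $ i0 $ i0)" unfolding vec_eq_iff by (intro allI)
  then show ?thesis ..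
qed

end

section \<open>The free algebra\<close>

definition conv :: "('v list \<Rightarrow> 'f::field) \<Rightarrow> ('v list \<Rightarrow> 'f) \<Rightarrow> 'v list \<Rightarrow> 'f" where
  "conv f g u = (\<Sum>i\<le>length u. f (take i u) * g (drop i u))"

lemma free_algebra_simps:
  "carrier (free_algebra V) = {f. finite {u. f u \<noteq> 0} \<and> {u. f u \<noteq> 0} \<subseteq> lists V}"
  "monoid.mult (free_algebra V) = conv"
  "\<one>\<^bsub>free_algebra V\<^esub> = word 1 []" "\<zero>\<^bsub>free_algebra V\<^esub> = (\<lambda>_. 0)"
  "add (free_algebra V) = (\<lambda>f g u. f u + g u)"
  by (auto simp: free_algebra_def conv_def word_def fun_eq_iff)

lemma word_closed: "u \<in> lists V \<Longrightarrow> word c u \<in> carrier (free_algebra V)"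
proof -
  assume u: "u \<in> lists V"
  have "{x. word c u x \<noteq> 0} \<subseteq> {u}" by (auto simp: word_def)
  then show ?thesis using u finite_subset[of _ "{u}"] by (auto simp: free_algebra_simps)
qed

lemma free_add_closed:
  assumes "f \<in> carrier (free_algebra V)" "g \<in> carrier (free_algebra V)"
  shows "(\<lambda>u. f u + g u) \<in> carrier (free_algebra V)"
proof -
  have "{u. f u + g u \<noteq> 0} \<subseteq> {u. f u \<noteq> 0} \<union> {u. g u \<noteq> 0}" by auto
  then show ?thesis
    using assms finite_subset[of "{u. f u + g u \<noteq> 0}" "{u. f u \<noteq> 0} \<union> {u. g u \<noteq> 0}"]
    by (auto simp: free_algebra_simps)
qed

lemma free_zero_closed: "(\<lambda>_. 0) \<in> carrier (free_algebra V)"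
  by (simp add: free_algebra_simps)

lemma free_algebra_induct [consumes 1, case_names word add]:
  assumes f: "f \<in> carrier (free_algebra V)"
    and word: "\<And>c u. u \<in> lists V \<Longrightarrow> Q (word c u)"
    and add: "\<And>f g. f \<in> carrier (free_algebra V) \<Longrightarrow> g \<in> carrier (free_algebra V) \<Longrightarrow>
      Q f \<Longrightarrow> Q g \<Longrightarrow> Q (\<lambda>u. f u + g u)"
  shows "Q f"
proof -
  have "finite S \<Longrightarrow> S \<subseteq> lists V \<Longrightarrow> {u. f u \<noteq> 0} \<subseteq> S \<Longrightarrow> Q f" for S f
  proof (induction S arbitrary: f rule: finite_induct)
    case empty
    then have "f = word 0 []" by (auto simp: word_def fun_eq_iff)
    then show ?case using word[of "[]" 0] by simp
  next
    case (insert u S)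
    let ?g = "f(u := 0)"
    have sub: "{x. ?g x \<noteq> 0} \<subseteq> S" using insert.prems by auto
    have g: "?g \<in> carrier (free_algebra V)"
      using sub insert.prems insert.hyps finite_subset[OF sub] by (auto simp: free_algebra_simps)
    have Qg: "Q ?g" by (rule insert.IH[OF _ sub]) (use insert.prems in auto)
    have "Q (\<lambda>x. word (f u) u x + ?g x)"
      using insert.prems by (intro add word word_closed g Qg) auto
    moreover have "(\<lambda>x. word (f u) u x + ?g x) = f" by (auto simp: word_def fun_eq_iff)
    ultimately show ?case by simp
  qed
  then show ?thesis using f by (auto simp: free_algebra_simps)
qed

lemma conv_word: "conv (word c x) (word d y) = word (c * d) (x @ y)"
proof
  fix u
  have iff: "(take i u = x \<and> drop i u = y) \<longleftrightarrow> (i = length x \<and> u = x @ y)" if "i \<le> length u" for i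
    using that by (auto simp: append_take_drop_id)
  have "(if take i u = x then c else 0) * (if drop i u = y then d else 0) =
      (if i = length x then (if u = x @ y then c * d else 0) else 0)" if "i \<le> length u" for i
  proof -
    have "(if take i u = x then c else 0) * (if drop i u = y then d else 0) =
        (if take i u = x \<and> drop i u = y then c * d else 0)" by simp
    then show ?thesis unfolding iff[OF that] by simp
  qed
  then have "conv (word c x) (word d y) u =
      (\<Sum>i\<le>length u. if i = length x then (if u = x @ y then c * d else 0) else 0)"
    unfolding conv_def word_def by (intro sum.cong) simp_all
  also have "\<dots> = word (c * d) (x @ y) u" by (auto simp: word_def)
  finally show "conv (word c x) (word d y) u = word (c * d) (x @ y) u" .
qed

lemma conv_add: "conv (\<lambda>u. f u + g u) h = (\<lambda>u. conv f h u + conv g h u)"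
  "conv h (\<lambda>u. f u + g u) = (\<lambda>u. conv h f u + conv h g u)"
  by (simp_all add: conv_def fun_eq_iff algebra_simps sum.distrib)

lemma conv_scale: "conv (\<lambda>u. c * f u) g = (\<lambda>u. c * conv f g u)" "conv f (\<lambda>u. c * g u) = (\<lambda>u. c * conv f g u)"
  by (simp_all add: conv_def fun_eq_iff sum_distrib_left ac_simps)

lemma conv_diff: "conv (\<lambda>u. f u - g u) h = (\<lambda>u. conv f h u - conv g h u)"
  "conv h (\<lambda>u. f u - g u) = (\<lambda>u. conv h f u - conv h g u)"
  by (simp_all add: conv_def fun_eq_iff algebra_simps sum_subtractf)

lemma conv_closed:
  assumes "f \<in> carrier (free_algebra V)" "g \<in> carrier (free_algebra V)"
  shows "conv f g \<in> carrier (free_algebra V)"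
  using assms(1)
proof (induction rule: free_algebra_induct)
  case (word c u)
  show ?case using assms(2)
  proof (induction rule: free_algebra_induct)
    case (word d v)
    then show ?case using \<open>u \<in> lists V\<close> by (simp add: conv_word word_closed)
  qed (simp add: conv_add free_add_closed)
qed (simp add: conv_add free_add_closed)

lemma conv_assoc:
  assumes "f \<in> carrier (free_algebra V)" "g \<in> carrier (free_algebra V)" "h \<in> carrier (free_algebra V)"
  shows "conv (conv f g) h = conv f (conv g h)"
  using assms(1)
proof (induction rule: free_algebra_induct)
  case (word c u)
  show ?case using assms(2)
  proof (induction rule: free_algebra_induct)
    case (word d v)
    show ?case using assms(3)
      by (induction rule: free_algebra_induct) (simp_all add: conv_add conv_word mult.assoc)
  qed (simp add: conv_add)
qed (simp add: conv_add)

lemma conv_one: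
  assumes "f \<in> carrier (free_algebra V)"
  shows "conv (word 1 []) f = f" "conv f (word 1 []) = f"
  using assms by (induction rule: free_algebra_induct) (simp_all add: conv_word conv_add)

lemma scale_word: "(\<lambda>x. c * word d u x) = word (c * d) u"
  by (auto simp: word_def fun_eq_iff)

lemma conv_scalar:
  assumes "f \<in> carrier (free_algebra V)"
  shows "conv (word c []) f = (\<lambda>u. c * f u)" "conv f (word c []) = (\<lambda>u. c * f u)"
  using assms
  by (induction rule: free_algebra_induct)
    (simp_all add: conv_word conv_add scale_word algebra_simps)

lemma free_scale_closed: "f \<in> carrier (free_algebra V) \<Longrightarrow> (\<lambda>u. c * f u) \<in> carrier (free_algebra V)"
  using conv_closed[OF word_closed[of "[]"], of V f c] conv_scalar(1)[of f V c] by simp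

lemma free_diff_closed:
  "f \<in> carrier (free_algebra V) \<Longrightarrow> g \<in> carrier (free_algebra V) \<Longrightarrow> (\<lambda>u. f u - g u) \<in> carrier (free_algebra V)"
  using free_add_closed[OF _ free_scale_closed[of g V "-1"], of f] by simp

lemma free_sum_closed:
  "(\<And>i. i \<in> S \<Longrightarrow> f i \<in> carrier (free_algebra V)) \<Longrightarrow> (\<lambda>u. \<Sum>i\<in>S. f i u) \<in> carrier (free_algebra V)"
  by (induction S rule: infinite_finite_induct) (simp_all add: free_zero_closed free_add_closed)

lemma free_algebra_ring: "ring (free_algebra V :: ('v list \<Rightarrow> 'f::field) ring)"
proof (rule ringI)
  show "abelian_group (free_algebra V :: ('v list \<Rightarrow> 'f) ring)"
  proof (rule abelian_groupI)
    fix f :: "'v list \<Rightarrow> 'f" assume f: "f \<in> carrier (free_algebra V)"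
    show "\<exists>g\<in>carrier (free_algebra V). g \<oplus>\<^bsub>free_algebra V\<^esub> f = \<zero>\<^bsub>free_algebra V\<^esub>"
      using free_scale_closed[OF f, of "-1"] by (intro bexI[of _ "\<lambda>u. -1 * f u"]) (auto simp: free_algebra_simps)
  qed (simp_all add: free_algebra_simps(2-) free_add_closed free_zero_closed algebra_simps)
  show "monoid (free_algebra V :: ('v list \<Rightarrow> 'f) ring)"
    by (rule monoidI) (simp_all add: free_algebra_simps(2-) conv_closed conv_assoc conv_one word_closed)
qed (simp_all add: free_algebra_simps(2-) conv_add)

lemma free_algebra_minus:
  assumes "f \<in> carrier (free_algebra V)" "g \<in> carrier (free_algebra V)"
  shows "f \<ominus>\<^bsub>free_algebra V\<^esub> g = (\<lambda>u. f u - g u)"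
proof -
  interpret F: ring "free_algebra V" by (rule free_algebra_ring)
  have "\<ominus>\<^bsub>free_algebra V\<^esub> g = (\<lambda>u. -1 * g u)"
    using assms(2) free_scale_closed[OF assms(2), of "-1"]
    by (intro F.minus_equality) (simp_all add: free_algebra_simps(4,5))
  then show ?thesis by (simp add: a_minus_def free_algebra_simps(5))
qed

lemma word_rev: "(word c u) \<circ> rev = word c (rev u)"
  by (auto simp: word_def fun_eq_iff)

lemma rev_closed: "f \<in> carrier (free_algebra V) \<Longrightarrow> f \<circ> rev \<in> carrier (free_algebra V)"
proof (induction rule: free_algebra_induct)
  case (word c u)
  then show ?case by (simp add: word_rev word_closed in_lists_conv_set)
next
  case (add f g)
  then show ?case using free_add_closed[of "f \<circ> rev" V "g \<circ> rev"] by (simp add: comp_def)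
qed

lemma conv_rev:
  assumes "f \<in> carrier (free_algebra V)" "g \<in> carrier (free_algebra V)"
  shows "conv f g \<circ> rev = conv (g \<circ> rev) (f \<circ> rev)"
  using assms(1)
proof (induction rule: free_algebra_induct)
  case (word c u)
  show ?case using assms(2)
  proof (induction rule: free_algebra_induct)
    case (word d v)
    then show ?case by (simp add: conv_word word_rev mult.commute)
  next
    case (add f g)
    then show ?case by (simp add: conv_add comp_def fun_eq_iff)
  qed
next
  case (add f g)
  then show ?case by (simp add: conv_add comp_def fun_eq_iff)
qed

section \<open>The Clifford algebra and its spin module\<close>

definition even_fun :: "('v list \<Rightarrow> 'f::zero) \<Rightarrow> bool" where
  "even_fun f \<longleftrightarrow> (\<forall>u. f u \<noteq> 0 \<longrightarrow> even (length u))"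

definition odd_fun :: "('v list \<Rightarrow> 'f::zero) \<Rightarrow> bool" where
  "odd_fun f \<longleftrightarrow> (\<forall>u. f u \<noteq> 0 \<longrightarrow> odd (length u))"

lemma conv_nonzero:
  assumes "conv f g u \<noteq> 0"
  shows "\<exists>x y. u = x @ y \<and> f x \<noteq> 0 \<and> g y \<noteq> 0"
proof -
  obtain i where "f (take i u) * g (drop i u) \<noteq> 0"
    using assms unfolding conv_def by (meson sum.not_neutral_contains_not_neutral)
  then show ?thesis by (intro exI[of _ "take i u"] exI[of _ "drop i u"]) auto
qed

lemma even_conv: "even_fun f \<Longrightarrow> even_fun g \<Longrightarrow> even_fun (conv f g)"
  "odd_fun f \<Longrightarrow> odd_fun g \<Longrightarrow> even_fun (conv f g)"
  "odd_fun f \<Longrightarrow> even_fun g \<Longrightarrow> odd_fun (conv f g)"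
  "even_fun f \<Longrightarrow> odd_fun g \<Longrightarrow> odd_fun (conv f g)"
  by (auto simp: even_fun_def odd_fun_def dest!: conv_nonzero)

lemma even_fun_simps:
  "even (length u) \<Longrightarrow> even_fun (word c u)" "odd (length u) \<Longrightarrow> odd_fun (word c u)"
  by (auto simp: even_fun_def odd_fun_def word_def)

lemma even_fun_diff: "even_fun f \<Longrightarrow> even_fun g \<Longrightarrow> even_fun (\<lambda>u. f u - g u :: 'f::group_add)"
  unfolding even_fun_def by (metis diff_self)

lemma odd_fun_diff: "odd_fun f \<Longrightarrow> odd_fun g \<Longrightarrow> odd_fun (\<lambda>u. f u - g u :: 'f::group_add)"
  unfolding odd_fun_def by (metis diff_self)

lemma even_fun_rev: "even_fun f \<Longrightarrow> even_fun (f \<circ> rev)"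
  unfolding even_fun_def by (metis comp_apply length_rev)

locale clifford_ring = vector_space sc
  for sc :: "'f::field \<Rightarrow> 'v::ab_group_add \<Rightarrow> 'v" +
  fixes q :: "'v \<Rightarrow> 'f" and V :: "'v set"
  assumes V_subspace: "subspace V"
begin

abbreviation F where "F \<equiv> (free_algebra V :: ('v list \<Rightarrow> 'f) ring)"
abbreviation J where "J \<equiv> clifford_ideal sc q V"
abbreviation Cl where "Cl \<equiv> clifford sc q V"
abbreviation cl where "cl \<equiv> clifford_class sc q V"

definition relators :: "('v list \<Rightarrow> 'f) set" where
  "relators = {\<lambda>u. word 1 [x + y] u - word 1 [x] u - word 1 [y] u | x y. x \<in> V \<and> y \<in> V} \<union>
      {\<lambda>u. word 1 [sc a x] u - word a [x] u | a x. x \<in> V} \<union>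
      {\<lambda>u. word 1 [x, x] u - word (q x) [] u | x. x \<in> V}"

lemma J_eq: "J = Idl\<^bsub>F\<^esub> relators"
  by (simp add: clifford_ideal_def relators_def)

lemma V_add: "x \<in> V \<Longrightarrow> y \<in> V \<Longrightarrow> x + y \<in> V" and V_scale: "x \<in> V \<Longrightarrow> sc c x \<in> V"
  and V_zero: "0 \<in> V"
  using V_subspace by (simp_all add: subspace_def)

lemma relators_closed: "relators \<subseteq> carrier F"
  unfolding relators_def
  by (auto intro!: free_diff_closed word_closed V_add V_scale)

sublocale F: ring F by (rule free_algebra_ring)

lemma J_ideal: "ideal J F"
  unfolding J_eq by (rule F.genideal_ideal[OF relators_closed])

sublocale J: ideal J F by (rule J_ideal)

lemma J_relators: "f \<in> relators \<Longrightarrow> f \<in> J"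
  unfolding J_eq using F.genideal_self[OF relators_closed] by blast

lemma J_minimal: "ideal K F \<Longrightarrow> relators \<subseteq> K \<Longrightarrow> J \<subseteq> K"
  unfolding J_eq by (rule F.genideal_minimal)

lemma J_closed: "f \<in> J \<Longrightarrow> f \<in> carrier F"
  by (rule J.a_Hcarr)

lemma J_add: "f \<in> J \<Longrightarrow> g \<in> J \<Longrightarrow> (\<lambda>u. f u + g u) \<in> J"
  using J.a_closed[of f g] by (simp add: free_algebra_simps)

lemma J_conv: "f \<in> J \<Longrightarrow> g \<in> carrier F \<Longrightarrow> conv g f \<in> J" "f \<in> J \<Longrightarrow> g \<in> carrier F \<Longrightarrow> conv f g \<in> J"
  using J.I_l_closed[of f g] J.I_r_closed[of f g] by (simp_all add: free_algebra_simps)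

lemma J_scale: "f \<in> J \<Longrightarrow> (\<lambda>u. c * f u) \<in> J"
  using J_conv(1)[of f "word c []"] conv_scalar(1)[OF J_closed, of f c] word_closed[of "[]" V c] by simp

lemma J_zero: "(\<lambda>_. 0) \<in> J"
  using J.zero_closed by (simp add: free_algebra_simps)

definition cong :: "('v list \<Rightarrow> 'f) \<Rightarrow> ('v list \<Rightarrow> 'f) \<Rightarrow> bool" where
  "cong f g \<longleftrightarrow> f \<in> carrier F \<and> g \<in> carrier F \<and> (\<lambda>u. f u - g u) \<in> J"

lemma cong_refl: "f \<in> carrier F \<Longrightarrow> cong f f"
  by (simp add: cong_def J_zero)

lemma cong_sym: "cong f g \<Longrightarrow> cong g f"
  using J_scale[of "\<lambda>u. f u - g u" "-1"] by (simp add: cong_def)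

lemma cong_trans: "cong f g \<Longrightarrow> cong g h \<Longrightarrow> cong f h"
  using J_add[of "\<lambda>u. f u - g u" "\<lambda>u. g u - h u"] by (simp add: cong_def)

lemma cong_add: "cong f g \<Longrightarrow> cong f' g' \<Longrightarrow> cong (\<lambda>u. f u + f' u) (\<lambda>u. g u + g' u)"
  using J_add[of "\<lambda>u. f u - g u" "\<lambda>u. f' u - g' u"] by (simp add: cong_def free_add_closed algebra_simps)

lemma cong_scale: "cong f g \<Longrightarrow> cong (\<lambda>u. c * f u) (\<lambda>u. c * g u)"
  using J_scale[of "\<lambda>u. f u - g u" c] by (simp add: cong_def free_scale_closed algebra_simps)

lemma cong_conv_left: "cong f g \<Longrightarrow> h \<in> carrier F \<Longrightarrow> cong (conv h f) (conv h g)"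
  using J_conv(1)[of "\<lambda>u. f u - g u" h] by (simp add: cong_def conv_closed conv_diff)

lemma cong_conv_right: "cong f g \<Longrightarrow> h \<in> carrier F \<Longrightarrow> cong (conv f h) (conv g h)"
  using J_conv(2)[of "\<lambda>u. f u - g u" h] by (simp add: cong_def conv_closed conv_diff)

lemma cong_conv: "cong f g \<Longrightarrow> cong f' g' \<Longrightarrow> cong (conv f f') (conv g g')"
  by (rule cong_trans[OF cong_conv_right cong_conv_left]) (auto simp: cong_def)

lemma cl_eq_iff: "f \<in> carrier F \<Longrightarrow> g \<in> carrier F \<Longrightarrow> cl f = cl g \<longleftrightarrow> cong f g"
  using F.quotient_eq_iff_same_a_r_cos[OF J_ideal, of f g]
  by (simp add: clifford_class_def cong_def free_algebra_minus)

lemma cl_mult: "f \<in> carrier F \<Longrightarrow> g \<in> carrier F \<Longrightarrow> cl f \<otimes>\<^bsub>Cl\<^esub> cl g = cl (conv f g)"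
  using J.rcoset_mult_add[of f g] by (simp add: clifford_def FactRing_def clifford_class_def free_algebra_simps)

lemma cl_add: "f \<in> carrier F \<Longrightarrow> g \<in> carrier F \<Longrightarrow> cl f \<oplus>\<^bsub>Cl\<^esub> cl g = cl (\<lambda>u. f u + g u)"
  using J.a_rcos_sum[of f g] by (simp add: clifford_def FactRing_def clifford_class_def free_algebra_simps)

lemma cl_carrier: "carrier Cl = cl ` carrier F"
  by (auto simp: clifford_def FactRing_def clifford_class_def A_RCOSETS_def')

lemma cl_one: "\<one>\<^bsub>Cl\<^esub> = cl (word 1 [])"
  by (simp add: clifford_def FactRing_def clifford_class_def free_algebra_simps)

lemma Cl_ring: "ring Cl"
  unfolding clifford_def by (rule J.quotient_is_ring)

sublocale Cl: ring Cl by (rule Cl_ring)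

lemma cl_closed: "f \<in> carrier F \<Longrightarrow> cl f \<in> carrier Cl"
  by (simp add: cl_carrier)

lemma word_V_closed: "set u \<subseteq> V \<Longrightarrow> word c u \<in> carrier F"
  by (rule word_closed) auto

lemma cong_vec_add:
  assumes "x \<in> V" "y \<in> V"
  shows "cong (word 1 [x + y]) (\<lambda>u. word 1 [x] u + word 1 [y] u)"
proof -
  have "(\<lambda>u. word 1 [x + y] u - word 1 [x] u - word 1 [y] u) \<in> J"
    using assms by (intro J_relators) (auto simp: relators_def)
  then show ?thesis
    using assms by (simp add: cong_def word_V_closed free_add_closed V_add diff_diff_eq)
qed

lemma cong_vec_scale:
  assumes "x \<in> V"
  shows "cong (word 1 [sc a x]) (word a [x])"
proof -
  have "(\<lambda>u. word 1 [sc a x] u - word a [x] u) \<in> J"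
    using assms by (intro J_relators) (auto simp: relators_def)
  then show ?thesis
    using assms by (simp add: cong_def word_V_closed V_scale)
qed

lemma cong_square:
  assumes "x \<in> V"
  shows "cong (word 1 [x, x]) (word (q x) [])"
proof -
  have "(\<lambda>u. word 1 [x, x] u - word (q x) [] u) \<in> J"
    using assms by (intro J_relators) (auto simp: relators_def)
  then show ?thesis
    using assms by (simp add: cong_def word_V_closed)
qed

lemma cong_anticommute:
  assumes x: "x \<in> V" and y: "y \<in> V" and q: "q (x + y) = q x + q y"
  shows "cong (word 1 [x, y]) (word (- 1) [y, x])"
proof -
  have W: "word c u \<in> carrier F" if "set u \<subseteq> {x, y, x + y}" for c u
    using that x y V_add by (intro word_V_closed) auto
  have "cong (conv (word 1 [x + y]) (word 1 [x + y]))
      (conv (\<lambda>u. word 1 [x] u + word 1 [y] u) (\<lambda>u. word 1 [x] u + word 1 [y] u))"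
    by (intro cong_conv cong_vec_add x y)
  then have "cong (word 1 [x + y, x + y])
      (\<lambda>u. (word 1 [x, x] u + word 1 [x, y] u) + (word 1 [y, x] u + word 1 [y, y] u))"
    unfolding conv_add conv_word by (simp add: ac_simps)
  moreover have "cong (word 1 [x + y, x + y]) (word (q x + q y) [])"
    using cong_square[OF V_add[OF x y]] q by simp
  ultimately have 1: "cong (\<lambda>u. (word 1 [x, x] u + word 1 [x, y] u) + (word 1 [y, x] u + word 1 [y, y] u))
      (word (q x + q y) [])"
    using cong_trans cong_sym by blast
  have 2: "cong (\<lambda>u. -1 * word 1 [x, x] u) (\<lambda>u. -1 * word (q x) [] u)"
    "cong (\<lambda>u. -1 * word 1 [y, y] u) (\<lambda>u. -1 * word (q y) [] u)"
    "cong (\<lambda>u. -1 * word 1 [y, x] u) (\<lambda>u. -1 * word 1 [y, x] u)"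
    by (intro cong_scale cong_square cong_refl x y W; simp)+
  have "cong (\<lambda>u. (((word 1 [x, x] u + word 1 [x, y] u) + (word 1 [y, x] u + word 1 [y, y] u))
        + -1 * word 1 [x, x] u) + (-1 * word 1 [y, y] u + -1 * word 1 [y, x] u))
     (\<lambda>u. (word (q x + q y) [] u + -1 * word (q x) [] u) + (-1 * word (q y) [] u + -1 * word 1 [y, x] u))"
    by (intro cong_add 1 2)
  moreover have "(\<lambda>u. (((word 1 [x, x] u + word 1 [x, y] u) + (word 1 [y, x] u + word 1 [y, y] u))
        + -1 * word 1 [x, x] u) + (-1 * word 1 [y, y] u + -1 * word 1 [y, x] u)) = (word 1 [x, y] :: _ \<Rightarrow> 'f)"
    by (simp add: fun_eq_iff)
  moreover have "(\<lambda>u. (word (q x + q y) [] u + -1 * word (q x) [] u) + (-1 * word (q y) [] u + -1 * word 1 [y, x] u))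
      = word (- 1) [y, x]"
    by (auto simp: fun_eq_iff word_def)
  ultimately show ?thesis by simp
qed

text \<open>Reversal preserves the defining relations, so it acts on the cosets.\<close>

lemma J_rev: "f \<in> J \<Longrightarrow> f \<circ> rev \<in> J"
proof -
  let ?K = "{f \<in> carrier F. f \<circ> rev \<in> J}"
  have comp_add: "(\<lambda>u. f u + g u) \<circ> rev = (\<lambda>u. (f \<circ> rev) u + (g \<circ> rev) u)" for f g :: "'v list \<Rightarrow> 'f"
    by (simp add: fun_eq_iff)
  have "ideal ?K F"
  proof (rule idealI)
    show "ring F" by (rule free_algebra_ring)
    show "subgroup ?K (add_monoid F)"
    proof (rule F.add.subgroupI)
      fix f assume f: "f \<in> ?K"
      then have "\<ominus>\<^bsub>F\<^esub> f = (\<lambda>u. -1 * f u)"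
        using free_scale_closed[of f V "-1"]
        by (intro F.minus_equality) (simp_all add: free_algebra_simps(4,5))
      moreover have "(\<lambda>u. -1 * f u) \<circ> rev = (\<lambda>u. -1 * (f \<circ> rev) u)" by (simp add: fun_eq_iff)
      then have "(\<lambda>u. -1 * f u) \<circ> rev \<in> J" using J_scale[of "f \<circ> rev" "-1"] f by simp
      ultimately show "\<ominus>\<^bsub>F\<^esub> f \<in> ?K" using f free_scale_closed[of f V "-1"] by simp
    next
      have "(\<lambda>_. 0) \<circ> rev = (\<lambda>_::'v list. 0 :: 'f)" by (simp add: fun_eq_iff)
      then show "?K \<noteq> {}" using J_zero free_zero_closed[of V] by auto
    next
      fix f g assume "f \<in> ?K" "g \<in> ?K"
      then show "f \<oplus>\<^bsub>F\<^esub> g \<in> ?K"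
        using J_add[of "f \<circ> rev" "g \<circ> rev"] unfolding free_algebra_simps(5)
        by (simp add: free_add_closed comp_add del: o_apply)
    qed auto
    show "g \<otimes>\<^bsub>F\<^esub> f \<in> ?K" "f \<otimes>\<^bsub>F\<^esub> g \<in> ?K" if "f \<in> ?K" "g \<in> carrier F" for f g
      using that J_conv[of "f \<circ> rev" "g \<circ> rev"] rev_closed[of g V] conv_rev[of f V g] conv_rev[of g V f]
      by (simp_all add: free_algebra_simps(2) conv_closed)
  qed
  moreover have "relators \<subseteq> ?K"
  proof
    fix r assume r: "r \<in> relators"
    have w: "word c u (rev x) = word c (rev u) x" for c :: 'f and u x :: "'v list"
      using word_rev[of c u] by (metis comp_apply)
    have "r \<circ> rev = r"
      using r unfolding relators_def by (auto simp: comp_def w)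
    then show "r \<in> ?K" using r J_relators relators_closed by auto
  qed
  ultimately have "J \<subseteq> ?K" by (rule J_minimal)
  then show "f \<in> J \<Longrightarrow> f \<circ> rev \<in> J" by blast
qed

lemma clifford_rev_cl:
  assumes f: "f \<in> carrier F"
  shows "clifford_rev (cl f) = cl (f \<circ> rev)"
proof -
  have cl: "cl g = {\<lambda>u. h u + g u | h. h \<in> J}" for g
    by (auto simp: clifford_class_def a_r_coset_def' free_algebra_simps)
  show ?thesis
  proof (intro equalityI subsetI)
    fix g assume "g \<in> clifford_rev (cl f)"
    then obtain h where h: "h \<in> J" "g = (\<lambda>u. h u + f u) \<circ> rev"
      unfolding clifford_rev_def cl by blast
    then have "g = (\<lambda>u. (h \<circ> rev) u + (f \<circ> rev) u)" by (simp add: comp_def)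
    then show "g \<in> cl (f \<circ> rev)" unfolding cl using J_rev[OF h(1)] by blast
  next
    fix g assume "g \<in> cl (f \<circ> rev)"
    then obtain h where h: "h \<in> J" "g = (\<lambda>u. h u + (f \<circ> rev) u)"
      unfolding cl by blast
    then have "g = (\<lambda>u. (h \<circ> rev) u + f u) \<circ> rev" by (simp add: comp_def)
    then show "g \<in> clifford_rev (cl f)" unfolding clifford_rev_def cl using J_rev[OF h(1)] by blast
  qed
qed

end

text \<open>The basis is kept as a parameter, so that it can be chosen over the base field later.\<close>

locale clifford_module = clifford_ring sc q V
  for sc :: "'f::field \<Rightarrow> 'v::ab_group_add \<Rightarrow> 'v" and q :: "'v \<Rightarrow> 'f" and V :: "'v set" +
  fixes T :: "'v \<Rightarrow> 'f ^ 'n::finite ^ 'n" and b :: "nat \<Rightarrow> 'v"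
  assumes two: "(2::'f) \<noteq> 0" and card_n: "CARD('n) = 16"
    and T_add: "x \<in> V \<Longrightarrow> y \<in> V \<Longrightarrow> T (x + y) = T x + T y"
    and T_scale: "x \<in> V \<Longrightarrow> T (sc c x) = matscale c (T x)"
    and T_square: "x \<in> V \<Longrightarrow> T x ** T x = mat (q x)"
    and b_V: "i < 9 \<Longrightarrow> b i \<in> V"
    and b_anticommute: "i < 9 \<Longrightarrow> j < 9 \<Longrightarrow> i \<noteq> j \<Longrightarrow> T (b i) ** T (b j) = - (T (b j) ** T (b i))"
    and b_q: "i < 9 \<Longrightarrow> q (b i) \<noteq> 0"
    and b_span: "v \<in> V \<Longrightarrow> \<exists>c. v = (\<Sum>i<9. sc (c i) (b i))"
begin

sublocale gen: clifford_generators "\<lambda>i. T (b i)" "\<lambda>i. q (b i)"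
proof
  show "T (b i) ** T (b j) = - (T (b j) ** T (b i))" if "i < 9" "j < 9" "i \<noteq> j" for i j
    using that by (rule b_anticommute)
  show "T (b i) ** T (b i) = mat (q (b i))" if "i < 9" for i
    using T_square[OF b_V[OF that]] .
  show "q (b i) \<noteq> 0" if "i < 9" for i
    using that by (rule b_q)
qed (rule two card_n)+

definition mp :: "'v list \<Rightarrow> 'f ^ 'n ^ 'n" where
  "mp u = foldr (\<lambda>v M. T v ** M) u (mat 1)"

lemma mp_simps: "mp [] = mat 1" "mp (v # u) = T v ** mp u"
  by (simp_all add: mp_def)

lemma mp_append: "mp (u @ v) = mp u ** mp v"
  by (induction u) (simp_all add: mp_simps matrix_mul_assoc)

definition ev :: "('v list \<Rightarrow> 'f) \<Rightarrow> 'f ^ 'n ^ 'n" where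
  "ev f = (\<Sum>u | f u \<noteq> 0. matscale (f u) (mp u))"

lemma ev_superset:
  assumes "finite S" "{u. f u \<noteq> 0} \<subseteq> S"
  shows "ev f = (\<Sum>u\<in>S. matscale (f u) (mp u))"
  unfolding ev_def using assms by (intro sum.mono_neutral_left) (auto simp: matscale_zero)

lemma ev_word: "ev (word c u) = matscale c (mp u)"
proof -
  have "{x. word c u x \<noteq> 0} \<subseteq> {u}" by (auto simp: word_def)
  then have "ev (word c u) = matscale (word c u u) (mp u)"
    using ev_superset[of "{u}" "word c u"] by simp
  then show ?thesis by (simp add: word_def)
qed

lemma ev_add:
  assumes "f \<in> carrier F" "g \<in> carrier F"
  shows "ev (\<lambda>u. f u + g u) = ev f + ev g"
proof -
  let ?S = "{u. f u \<noteq> 0} \<union> {u. g u \<noteq> 0}"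
  have fin: "finite ?S" using assms by (auto simp: free_algebra_simps)
  have "ev (\<lambda>u. f u + g u) = (\<Sum>u\<in>?S. matscale (f u + g u) (mp u))"
    by (rule ev_superset[OF fin]) auto
  also have "\<dots> = (\<Sum>u\<in>?S. matscale (f u) (mp u)) + (\<Sum>u\<in>?S. matscale (g u) (mp u))"
    by (simp add: matscale_add sum.distrib)
  also have "\<dots> = ev f + ev g"
    using ev_superset[OF fin, of f] ev_superset[OF fin, of g] by simp
  finally show ?thesis .
qed

lemma ev_conv:
  assumes f: "f \<in> carrier F" and g: "g \<in> carrier F"
  shows "ev (conv f g) = ev f ** ev g"
  using f
proof (induction rule: free_algebra_induct)
  case (word c u)
  show ?case using g
  proof (induction rule: free_algebra_induct)
    case (word d v)
    then show ?case by (simp add: conv_word ev_word matscale_mult matscale_matscale mp_append mult.commute)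
  next
    case (add f g)
    then show ?case using \<open>u \<in> lists V\<close>
      by (simp add: conv_add ev_add conv_closed word_closed mat_mult_add)
  qed
next
  case (add f f')
  then show ?case using g by (simp add: conv_add ev_add conv_closed mat_mult_add)
qed

lemma ev_scale: "f \<in> carrier F \<Longrightarrow> ev (\<lambda>u. c * f u) = matscale c (ev f)"
  using ev_conv[of "word c []" f] conv_scalar(1)[of f V c] word_closed[of "[]" V c]
  by (simp add: ev_word mp_simps matscale_mult)

lemma ev_diff: "f \<in> carrier F \<Longrightarrow> g \<in> carrier F \<Longrightarrow> ev (\<lambda>u. f u - g u) = ev f - ev g"
  using ev_add[of f "\<lambda>u. -1 * g u"] ev_scale[of g "-1"] free_scale_closed[of g V "-1"]
  by (simp add: matscale_minus_one)

lemma ev_zero: "ev (\<lambda>_. 0) = 0"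
  by (simp add: ev_def)

lemma ev_sum: "(\<And>i. i \<in> S \<Longrightarrow> f i \<in> carrier F) \<Longrightarrow> ev (\<lambda>u. \<Sum>i\<in>S. f i u) = (\<Sum>i\<in>S. ev (f i))"
  by (induction S rule: infinite_finite_induct) (simp_all add: ev_zero ev_add free_sum_closed)

lemma ev_J: "f \<in> J \<Longrightarrow> ev f = 0"
proof -
  let ?K = "{f \<in> carrier F. ev f = 0}"
  have "ideal ?K F"
  proof (rule idealI)
    show "ring F" by (rule free_algebra_ring)
    show "subgroup ?K (add_monoid F)"
    proof (rule F.add.subgroupI)
      fix f assume f: "f \<in> ?K"
      then have "\<ominus>\<^bsub>F\<^esub> f = (\<lambda>u. -1 * f u)"
        using free_scale_closed[of f V "-1"]
        by (intro F.minus_equality) (simp_all add: free_algebra_simps(4,5))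
      then show "\<ominus>\<^bsub>F\<^esub> f \<in> ?K" using f free_scale_closed[of f V "-1"] ev_scale[of f "-1"] by (simp add: matscale_zero)
    next
      show "?K \<noteq> {}" using free_zero_closed[of V] ev_zero by auto
    next
      fix f g assume "f \<in> ?K" "g \<in> ?K"
      then show "f \<oplus>\<^bsub>F\<^esub> g \<in> ?K"
        unfolding free_algebra_simps(5) by (simp add: free_add_closed ev_add)
    qed auto
    show "g \<otimes>\<^bsub>F\<^esub> f \<in> ?K" "f \<otimes>\<^bsub>F\<^esub> g \<in> ?K" if "f \<in> ?K" "g \<in> carrier F" for f g
      using that by (simp_all add: free_algebra_simps(2) conv_closed ev_conv mat_mult_zero)
  qed
  moreover have "relators \<subseteq> ?K"
  proof
    fix r assume r: "r \<in> relators"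
    then consider x y where "x \<in> V" "y \<in> V" "r = (\<lambda>u. word 1 [x + y] u - word 1 [x] u - word 1 [y] u)"
      | a x where "x \<in> V" "r = (\<lambda>u. word 1 [sc a x] u - word a [x] u)"
      | x where "x \<in> V" "r = (\<lambda>u. word 1 [x, x] u - word (q x) [] u)"
      unfolding relators_def by blast
    then have "ev r = 0"
    proof cases
      case 1
      then show ?thesis
        by (simp add: ev_diff free_diff_closed word_V_closed V_add ev_word mp_simps T_add matscale_one)
    next
      case 2
      then show ?thesis
        by (simp add: ev_diff word_V_closed V_scale ev_word mp_simps T_scale matscale_one)
    next
      case 3
      then show ?thesis
        by (simp add: ev_diff word_V_closed ev_word mp_simps T_square matscale_one matscale_mat)
    qed
    then show "r \<in> ?K" using r relators_closed by auto
  qed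
  ultimately have "J \<subseteq> ?K" by (rule J_minimal)
  then show "f \<in> J \<Longrightarrow> ev f = 0" by blast
qed

lemma ev_cong: "cong f g \<Longrightarrow> ev f = ev g"
  using ev_J[of "\<lambda>u. f u - g u"] ev_diff[of f g] by (simp add: cong_def)

lemma q_b_add: assumes "i < 9" "j < 9" "i \<noteq> j" shows "q (b i + b j) = q (b i) + q (b j)"
proof -
  note V = b_V[OF assms(1)] b_V[OF assms(2)]
  have "(mat (q (b i + b j)) :: 'f ^ 'n ^ 'n) = (T (b i) + T (b j)) ** (T (b i) + T (b j))"
    using T_square[OF V_add[OF V]] T_add[OF V] by simp
  also have "\<dots> = T (b i) ** T (b i) + T (b j) ** T (b i) + (T (b i) ** T (b j) + T (b j) ** T (b j))"
    unfolding mat_mult_add ..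
  also have "\<dots> = mat (q (b i)) + mat (q (b j))"
    unfolding b_anticommute[OF assms] T_square[OF V(1)] T_square[OF V(2)] by simp
  finally have "(mat (q (b i + b j)) :: 'f ^ 'n ^ 'n) $ k $ k = (mat (q (b i)) + mat (q (b j))) $ k $ k" for k
    by (rule arg_cong)
  then show ?thesis by (simp add: mat_def)
qed

text \<open>The word without repetitions that represents a set of basis vectors, matching the order of the
  factors in \<open>clifford_product\<close>.\<close>

primrec W :: "nat \<Rightarrow> nat set \<Rightarrow> 'v list" where
  "W 0 S = []"
| "W (Suc k) S = (if k \<in> S then b k # W k S else W k S)"

lemma W_V: "k \<le> 9 \<Longrightarrow> set (W k S) \<subseteq> V"
  by (induction k) (auto simp: b_V)

lemma mp_W: "mp (W k S) = gen.P k S"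
  by (induction k) (simp_all add: mp_simps)

lemma W_cong: "S \<inter> {..<k} = S' \<inter> {..<k} \<Longrightarrow> W k S = W k S'"
proof (induction k)
  case (Suc k)
  have "k \<in> S \<longleftrightarrow> k \<in> S'" using Suc.prems by blast
  moreover have "A \<inter> {..<k} = (A \<inter> {..<Suc k}) \<inter> {..<k}" for A :: "nat set" by auto
  then have "S \<inter> {..<k} = S' \<inter> {..<k}" using Suc.prems by metis
  ultimately show ?case using Suc.IH by simp
qed simp

lemma length_W: "length (W k S) = card (S \<inter> {..<k})"
proof (induction k)
  case (Suc k)
  show ?case
  proof (cases "k \<in> S")
    case True
    then have "S \<inter> {..<Suc k} = insert k (S \<inter> {..<k})" by (auto simp: less_Suc_eq)
    then show ?thesis using Suc True by simp
  next
    case False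
    then have "S \<inter> {..<Suc k} = S \<inter> {..<k}" by (auto simp: less_Suc_eq)
    then show ?thesis using Suc False by simp
  qed
qed simp

lemma W_toggle:
  assumes "i < k" "k \<le> 9"
  shows "\<exists>c. cong (word 1 (b i # W k S)) (word c (W k (sdiff S {i})))"
  using assms
proof (induction k)
  case (Suc k)
  have Wc: "word c (W k S') \<in> carrier F" for c S' using W_V[of k] Suc.prems by (intro word_V_closed) auto
  have bc: "word c [b j] \<in> carrier F" if "j \<le> k" for c j
    using that Suc.prems by (intro word_V_closed) (auto simp: b_V)
  have cons: "word c (x # u) = conv (word 1 [x]) (word c u)" for c x u by (simp add: conv_word)
  show ?case
  proof (cases "i = k")
    case True
    have eq: "W k (sdiff S {k}) = W k S" by (rule W_cong) (auto simp: sdiff_def)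
    show ?thesis
    proof (cases "k \<in> S")
      case True
      have "cong (conv (word 1 [b k, b k]) (word 1 (W k S))) (conv (word (q (b k)) []) (word 1 (W k S)))"
        using Suc.prems by (intro cong_conv_right cong_square Wc b_V) simp
      then have "cong (word 1 (b k # b k # W k S)) (word (q (b k)) (W k S))"
        by (simp add: conv_word)
      moreover have "k \<notin> sdiff S {k}" using True by (auto simp: sdiff_def)
      ultimately show ?thesis using True \<open>i = k\<close> eq by auto
    next
      case False
      then have "k \<in> sdiff S {k}" by (auto simp: sdiff_def)
      then have "W (Suc k) (sdiff S {i}) = b i # W (Suc k) S" using False \<open>i = k\<close> eq by simp
      moreover have "word 1 (b i # W (Suc k) S) \<in> carrier F"
        using W_V[of "Suc k" S] b_V[of i] Suc.prems by (intro word_V_closed) auto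
      ultimately show ?thesis by (intro exI[of _ 1]) (simp add: cong_refl)
    qed
  next
    case False
    then obtain c where c: "cong (word 1 (b i # W k S)) (word c (W k (sdiff S {i})))"
      using Suc by auto
    have mem: "k \<in> sdiff S {i} \<longleftrightarrow> k \<in> S" using False by (auto simp: sdiff_def)
    show ?thesis
    proof (cases "k \<in> S")
      case True
      have "cong (word 1 [b i, b k]) (word (- 1) [b k, b i])"
        using False Suc.prems by (intro cong_anticommute b_V q_b_add) auto
      then have "cong (conv (word 1 [b i, b k]) (word 1 (W k S))) (conv (word (- 1) [b k, b i]) (word 1 (W k S)))"
        by (intro cong_conv_right Wc)
      moreover have "cong (conv (word (- 1) [b k]) (word 1 (b i # W k S)))
          (conv (word (- 1) [b k]) (word c (W k (sdiff S {i}))))"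
        by (intro cong_conv_left c bc) simp
      ultimately have "cong (word 1 (b i # b k # W k S)) (word (- c) (b k # W k (sdiff S {i})))"
        unfolding conv_word by (auto intro: cong_trans)
      then show ?thesis using True mem by auto
    next
      case False
      then show ?thesis using c mem by auto
    qed
  qed
qed simp

definition parity_sets :: "bool \<Rightarrow> nat set set" where
  "parity_sets p = {S. S \<subseteq> {..<9} \<and> even (card S) = p}"

lemma finite_parity_sets [simp]: "finite (parity_sets p)"
  by (rule finite_subset[of _ "Pow {..<9}"]) (auto simp: parity_sets_def)

lemma parity_sets_True: "parity_sets True = even_subsets"
  by (auto simp: parity_sets_def even_subsets_def)

text \<open>The elements congruent to combinations of repetition-free basis words of one parity. Left
  multiplication by a basis vector permutes these words up to scalars, so all words are covered.\<close>

definition normal_form :: "bool \<Rightarrow> ('v list \<Rightarrow> 'f) set" where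
  "normal_form p = {f. \<exists>c. cong f (\<lambda>u. \<Sum>S\<in>parity_sets p. c S * word 1 (W 9 S) u)}"

lemma normal_form_cong: "f \<in> normal_form p \<Longrightarrow> cong g f \<Longrightarrow> g \<in> normal_form p"
proof -
  assume "f \<in> normal_form p" "cong g f"
  then obtain c where "cong f (\<lambda>u. \<Sum>S\<in>parity_sets p. c S * word 1 (W 9 S) u)"
    by (auto simp: normal_form_def)
  from cong_trans[OF \<open>cong g f\<close> this] show "g \<in> normal_form p" unfolding normal_form_def by blast
qed

lemma normal_form_add: "f \<in> normal_form p \<Longrightarrow> g \<in> normal_form p \<Longrightarrow> (\<lambda>u. f u + g u) \<in> normal_form p"
proof -
  assume "f \<in> normal_form p" "g \<in> normal_form p"
  then obtain c d where "cong f (\<lambda>u. \<Sum>S\<in>parity_sets p. c S * word 1 (W 9 S) u)"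
    "cong g (\<lambda>u. \<Sum>S\<in>parity_sets p. d S * word 1 (W 9 S) u)" by (auto simp: normal_form_def)
  from cong_add[OF this] show ?thesis
    unfolding normal_form_def by (auto simp: sum.distrib[symmetric] distrib_right[symmetric] intro!: exI[of _ "\<lambda>S. c S + d S"])
qed

lemma normal_form_scale: "f \<in> normal_form p \<Longrightarrow> (\<lambda>u. a * f u) \<in> normal_form p"
proof -
  assume "f \<in> normal_form p"
  then obtain c where "cong f (\<lambda>u. \<Sum>S\<in>parity_sets p. c S * word 1 (W 9 S) u)" by (auto simp: normal_form_def)
  from cong_scale[OF this, of a] show ?thesis
    unfolding normal_form_def by (auto simp: sum_distrib_left mult.assoc[symmetric] intro!: exI[of _ "\<lambda>S. a * c S"])
qed

lemma normal_form_W: "S \<in> parity_sets p \<Longrightarrow> word c (W 9 S) \<in> normal_form p"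
proof -
  assume S: "S \<in> parity_sets p"
  have "(\<lambda>u. \<Sum>S'\<in>parity_sets p. (if S' = S then c else 0) * word 1 (W 9 S') u) = word c (W 9 S)"
  proof
    fix u
    have "(\<Sum>S'\<in>parity_sets p. (if S' = S then c else 0) * word 1 (W 9 S') u)
      = (\<Sum>S'\<in>parity_sets p. if S' = S then c * word 1 (W 9 S) u else 0)"
      by (intro sum.cong) auto
    also have "\<dots> = word c (W 9 S) u" using S by (simp add: word_def)
    finally show "(\<Sum>S'\<in>parity_sets p. (if S' = S then c else 0) * word 1 (W 9 S') u) = word c (W 9 S) u" .
  qed
  moreover have "cong (word c (W 9 S)) (word c (W 9 S))"
    by (intro cong_refl word_V_closed W_V) simp
  ultimately show ?thesis
    unfolding normal_form_def by (intro CollectI exI[of _ "\<lambda>S'. if S' = S then c else 0"]) (simp only:)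
qed

lemma normal_form_zero: "(\<lambda>_. 0) \<in> normal_form p"
  unfolding normal_form_def by (intro CollectI exI[of _ "\<lambda>_. 0"]) (simp add: cong_refl free_zero_closed)

lemma normal_form_sum: "(\<And>i. i \<in> S \<Longrightarrow> f i \<in> normal_form p) \<Longrightarrow> (\<lambda>u. \<Sum>i\<in>S. f i u) \<in> normal_form p"
  by (induction S rule: infinite_finite_induct) (simp_all add: normal_form_zero normal_form_add)

lemma parity_toggle: "S \<in> parity_sets p \<Longrightarrow> i < 9 \<Longrightarrow> sdiff S {i} \<in> parity_sets (\<not> p)"
proof -
  assume S: "S \<in> parity_sets p" "i < 9"
  have fin: "finite S" using S finite_subset by (auto simp: parity_sets_def)
  show ?thesis
  proof (cases "i \<in> S")
    case True
    then have "sdiff S {i} = S - {i}" by (auto simp: sdiff_def)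
    moreover have "card S = Suc (card (S - {i}))" using card_Suc_Diff1[OF fin True] by simp
    ultimately show ?thesis using S by (auto simp: parity_sets_def)
  next
    case False
    then have "sdiff S {i} = insert i S" by (auto simp: sdiff_def)
    then show ?thesis using S fin False by (auto simp: parity_sets_def)
  qed
qed

lemma normal_form_conv_b:
  assumes f: "f \<in> normal_form p" and i: "i < 9"
  shows "conv (word 1 [b i]) f \<in> normal_form (\<not> p)"
proof -
  have bi: "word 1 [b i] \<in> carrier F" using i by (intro word_V_closed) (simp add: b_V)
  obtain c where c: "cong f (\<lambda>u. \<Sum>S\<in>parity_sets p. c S * word 1 (W 9 S) u)" using f by (auto simp: normal_form_def)
  have conv_sum: "conv (word 1 [b i]) (\<lambda>u. \<Sum>S\<in>Y. c S * word 1 (W 9 S) u) =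
      (\<lambda>u. \<Sum>S\<in>Y. c S * word 1 (b i # W 9 S) u)" for Y
    by (induction Y rule: infinite_finite_induct)
      (simp_all add: conv_add conv_scale conv_word, simp_all add: conv_def fun_eq_iff)
  have "word 1 (b i # W 9 S) \<in> normal_form (\<not> p)" if S: "S \<in> parity_sets p" for S
  proof -
    obtain d where "cong (word 1 (b i # W 9 S)) (word d (W 9 (sdiff S {i})))"
      using W_toggle[of i 9 S] i by auto
    then show ?thesis by (rule normal_form_cong[OF normal_form_W[OF parity_toggle[OF S i]]])
  qed
  then have "(\<lambda>u. \<Sum>S\<in>parity_sets p. c S * word 1 (b i # W 9 S) u) \<in> normal_form (\<not> p)"
    by (intro normal_form_sum normal_form_scale)
  then show ?thesis
    using normal_form_cong cong_conv_left[OF c bi] by (simp add: conv_sum)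
qed

lemma cong_vec_sum:
  assumes "finite S" "\<And>i. i \<in> S \<Longrightarrow> i < 9"
  shows "cong (word 1 [\<Sum>i\<in>S. sc (c i) (b i)]) (\<lambda>u. \<Sum>i\<in>S. c i * word 1 [b i] u)"
  using assms
proof (induction S rule: finite_induct)
  case empty
  have "cong (word 1 [sc 0 0]) (word 0 [0])" by (rule cong_vec_scale[OF V_zero])
  moreover have "word 0 [0::'v] = (\<lambda>_. 0 :: 'f)" by (simp add: word_def fun_eq_iff)
  ultimately show ?case by simp
next
  case (insert i S)
  have mem: "(\<Sum>i\<in>S. sc (c i) (b i)) \<in> V"
    by (intro subspace_sum[OF V_subspace] V_scale b_V) (use insert in auto)
  have "cong (word 1 [sc (c i) (b i)]) (\<lambda>u. c i * word 1 [b i] u)"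
    using cong_vec_scale[of "b i" "c i"] insert b_V by (simp add: scale_word)
  then have "cong (\<lambda>u. word 1 [sc (c i) (b i)] u + word 1 [\<Sum>i\<in>S. sc (c i) (b i)] u)
      (\<lambda>u. c i * word 1 [b i] u + (\<Sum>i\<in>S. c i * word 1 [b i] u))"
    using insert by (intro cong_add) auto
  moreover have "cong (word 1 [sc (c i) (b i) + (\<Sum>i\<in>S. sc (c i) (b i))])
      (\<lambda>u. word 1 [sc (c i) (b i)] u + word 1 [\<Sum>i\<in>S. sc (c i) (b i)] u)"
    by (intro cong_vec_add mem V_scale b_V) (use insert in auto)
  ultimately show ?case using insert cong_trans by simp
qed

lemma word_normal_form: "u \<in> lists V \<Longrightarrow> word c u \<in> normal_form (even (length u))"
proof (induction u arbitrary: c)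
  case Nil
  have W0: "W k {} = []" for k by (induction k) simp_all
  have "word c (W 9 {}) \<in> normal_form True" by (rule normal_form_W) (simp add: parity_sets_def)
  then show ?case unfolding W0 by simp
next
  case (Cons v u)
  have u: "word c u \<in> carrier F" using Cons.prems by (intro word_closed) simp
  obtain d where v: "v = (\<Sum>i<9. sc (d i) (b i))" using b_span[of v] Cons.prems by auto
  have "cong (conv (word 1 [v]) (word c u)) (conv (\<lambda>x. \<Sum>i<9. d i * word 1 [b i] x) (word c u))"
    unfolding v by (intro cong_conv_right cong_vec_sum u) auto
  moreover have "conv (\<lambda>x. \<Sum>i\<in>Y. d i * word 1 [b i] x) (word c u) =
      (\<lambda>x. \<Sum>i\<in>Y. d i * conv (word 1 [b i]) (word c u) x)" for Y
    by (induction Y rule: infinite_finite_induct)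
      (simp_all add: conv_add conv_scale, simp_all add: conv_def fun_eq_iff)
  moreover have "(\<lambda>x. \<Sum>i<9. d i * conv (word 1 [b i]) (word c u) x) \<in> normal_form (\<not> even (length u))"
    using Cons by (intro normal_form_sum normal_form_scale normal_form_conv_b) auto
  ultimately have "conv (word 1 [v]) (word c u) \<in> normal_form (\<not> even (length u))"
    using normal_form_cong by simp
  then show ?case by (simp add: conv_word)
qed

lemma even_normal_form: "f \<in> carrier F \<Longrightarrow> even_fun f \<Longrightarrow> f \<in> normal_form True"
proof -
  assume f: "f \<in> carrier F" "even_fun f"
  let ?S = "{u. f u \<noteq> 0}"
  have fin: "finite ?S" "?S \<subseteq> lists V" using f by (auto simp: free_algebra_simps)
  have "(\<lambda>x. \<Sum>u\<in>?S. word (f u) u x) \<in> normal_form True"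
  proof (rule normal_form_sum)
    fix u assume u: "u \<in> ?S"
    then have "even (length u)" using f(2) by (simp add: even_fun_def)
    then show "word (f u) u \<in> normal_form True" using word_normal_form[of u "f u"] u fin by auto
  qed
  moreover have "(\<lambda>x. \<Sum>u\<in>?S. word (f u) u x) = f"
  proof
    fix x
    have "(\<Sum>u\<in>?S. word (f u) u x) = (\<Sum>u\<in>?S. if u = x then f x else 0)"
      by (intro sum.cong) (auto simp: word_def)
    also have "\<dots> = f x" using fin(1) by simp
    finally show "(\<Sum>u\<in>?S. word (f u) u x) = f x" .
  qed
  ultimately show ?thesis by simp
qed

text \<open>The representation is faithful on the even part: modulo the ideal an even element is a
  combination of the 256 even basis products, whose matrices are independent.\<close>

lemma ev_even_injective:
  assumes f: "f \<in> carrier F" "even_fun f" "ev f = 0"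
  shows "f \<in> J"
proof -
  obtain c where c: "cong f (\<lambda>u. \<Sum>S\<in>even_subsets. c S * word 1 (W 9 S) u)"
    using even_normal_form[OF f(1,2)] by (auto simp: normal_form_def parity_sets_True)
  have Wc: "word 1 (W 9 S) \<in> carrier F" for S by (intro word_V_closed W_V) simp
  have "(\<Sum>S\<in>even_subsets. matscale (c S) (gen.P 9 S)) = ev (\<lambda>u. \<Sum>S\<in>even_subsets. c S * word 1 (W 9 S) u)"
    by (simp add: ev_sum free_scale_closed Wc ev_scale ev_word mp_W matscale_one)
  also have "\<dots> = 0" using ev_cong[OF c] f by simp
  finally have "c S = 0" if "S \<in> even_subsets" for S using gen.P_independent that by blast
  then have "(\<lambda>u. \<Sum>S\<in>even_subsets. c S * word 1 (W 9 S) u) = (\<lambda>_. 0)" by simp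
  then show ?thesis using c by (simp add: cong_def)
qed

text \<open>Multiplication by an anisotropic vector turns odd elements into even ones.\<close>

lemma ev_odd_injective:
  assumes f: "f \<in> carrier F" "odd_fun f" "ev f = 0"
  shows "f \<in> J"
proof -
  have bc: "word c [b 0] \<in> carrier F" for c by (intro word_V_closed) (simp add: b_V)
  have "conv (word 1 [b 0]) f \<in> J"
    using f bc[of 1] by (intro ev_even_injective even_conv(2) even_fun_simps)
      (simp_all add: conv_closed ev_conv mat_mult_zero)
  then have "conv (word 1 [b 0]) (conv (word 1 [b 0]) f) \<in> J" by (rule J_conv(1)[OF _ bc])
  then have 1: "conv (word 1 [b 0, b 0]) f \<in> J"
    using conv_assoc[OF bc bc f(1), of 1 1] by (simp add: conv_word)
  have "cong (conv (word 1 [b 0, b 0]) f) (conv (word (q (b 0)) []) f)"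
    by (intro cong_conv_right cong_square b_V f) simp
  then have "(\<lambda>u. conv (word 1 [b 0, b 0]) f u - q (b 0) * f u) \<in> J"
    by (simp add: cong_def conv_scalar(1)[OF f(1)])
  then have "(\<lambda>u. conv (word 1 [b 0, b 0]) f u + -1 * (conv (word 1 [b 0, b 0]) f u - q (b 0) * f u)) \<in> J"
    by (intro J_add[OF 1] J_scale)
  then have "(\<lambda>u. q (b 0) * f u) \<in> J" by simp
  then have "(\<lambda>u. inverse (q (b 0)) * (q (b 0) * f u)) \<in> J" by (rule J_scale)
  moreover have "(\<lambda>u. inverse (q (b 0)) * (q (b 0) * f u)) = f"
    using b_q[of 0] by (simp add: fun_eq_iff)
  ultimately show ?thesis by simp
qed

lemma cong_even: "f \<in> carrier F \<Longrightarrow> g \<in> carrier F \<Longrightarrow> even_fun f \<Longrightarrow> even_fun g \<Longrightarrow> ev f = ev g \<Longrightarrow> cong f g"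
  unfolding cong_def using ev_even_injective[of "\<lambda>u. f u - g u"]
  by (simp add: free_diff_closed even_fun_diff ev_diff)

lemma cong_odd: "f \<in> carrier F \<Longrightarrow> g \<in> carrier F \<Longrightarrow> odd_fun f \<Longrightarrow> odd_fun g \<Longrightarrow> ev f = ev g \<Longrightarrow> cong f g"
  unfolding cong_def using ev_odd_injective[of "\<lambda>u. f u - g u"]
  by (simp add: free_diff_closed odd_fun_diff ev_diff)

text \<open>An even preimage of a matrix. Its coefficients are traces, which makes it a rational expression
  in the matrix.\<close>

definition lift :: "'f ^ 'n ^ 'n \<Rightarrow> 'v list \<Rightarrow> 'f" where
  "lift M = (\<lambda>u. \<Sum>S\<in>even_subsets. gen.coeff_P S M * word 1 (W 9 S) u)"

lemma lift_closed: "lift M \<in> carrier F"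
  unfolding lift_def by (intro free_sum_closed free_scale_closed word_V_closed W_V) simp

lemma lift_even: "even_fun (lift M)"
  unfolding even_fun_def
proof (intro allI impI)
  fix u assume "lift M u \<noteq> 0"
  then obtain S where S: "S \<in> even_subsets" "gen.coeff_P S M * word 1 (W 9 S) u \<noteq> 0"
    unfolding lift_def by (meson sum.not_neutral_contains_not_neutral)
  then have "u = W 9 S" by (auto simp: word_def split: if_splits)
  moreover have "S \<inter> {..<9} = S" "even (card S)" using S(1) by (auto simp: even_subsets_def)
  ultimately show "even (length u)" by (simp add: length_W)
qed

lemma ev_lift: "ev (lift M) = M"
proof -
  have Wc: "word 1 (W 9 S) \<in> carrier F" for S by (intro word_V_closed W_V) simp
  have "ev (lift M) = (\<Sum>S\<in>even_subsets. matscale (gen.coeff_P S M) (gen.P 9 S))"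
    unfolding lift_def by (simp add: ev_sum free_scale_closed Wc ev_scale ev_word mp_W matscale_one)
  then show ?thesis using gen.P_expansion[of M] by simp
qed

end

section \<open>Scalar extension to the algebraic closure\<close>

lemma to_ac_eq_0_iff: "to_ac x = 0 \<longleftrightarrow> x = 0"
proof
  assume "to_ac x = 0"
  show "x = 0"
  proof (rule ccontr)
    assume "x \<noteq> 0"
    then have "to_ac (x * inverse x) = 1" by simp
    then show False using \<open>to_ac x = 0\<close> by simp
  qed
qed simp

lemma to_ac_inj: "to_ac x = to_ac y \<longleftrightarrow> x = y"
  using to_ac_eq_0_iff[of "x - y"] by simp

lemma vec_ac_nth [simp]: "vec_ac x $ i = to_ac (x $ i)"
  by (simp add: vec_ac_def)

lemma vec_ac_simps: "vec_ac (x + y) = vec_ac x + vec_ac y" "vec_ac (c *s x) = to_ac c *s vec_ac x"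
  "vec_ac 0 = 0" "vec_ac (x - y) = vec_ac x - vec_ac y"
  by (simp_all add: vec_eq_iff)

lemma vec_ac_axis: "vec_ac (axis i 1) = axis i 1"
  by (simp add: vec_eq_iff axis_def)

lemma vec_ac_sum: "vec_ac (\<Sum>i\<in>S. f i) = (\<Sum>i\<in>S. vec_ac (f i))"
  by (induction S rule: infinite_finite_induct) (simp_all add: vec_ac_simps)

lemma mat_ac_nth: "mat_ac x $ i $ j = vec_ac (x $ i $ j)"
  by (simp add: mat_ac_def)

lemma linear_extension:
  fixes f g :: "'a::field ^ 'n \<Rightarrow> 'b::ab_group_add"
  assumes f: "\<And>x y. f (x + y) = f x + f y" "\<And>c x. f (c *s x) = s c (f x)"
    and g: "\<And>x y. g (x + y) = g x + g y" "\<And>c x. g (c *s x) = s c (g x)"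
    and eq: "\<And>i. f (axis i 1) = g (axis i 1)"
  shows "f x = g x"
proof -
  have f0: "f 0 = 0" using f(1)[of 0 0] by simp
  have g0: "g 0 = 0" using g(1)[of 0 0] by simp
  have "f (\<Sum>i\<in>S. (x $ i) *s axis i 1) = g (\<Sum>i\<in>S. (x $ i) *s axis i 1)" for S
    by (induction S rule: infinite_finite_induct) (simp_all add: f0 g0 f g eq)
  then show ?thesis using basis_expansion[of x] by metis
qed

context octonion
begin

abbreviation D where "D \<equiv> octonions_ac C"

lemma two_nz_ac: "(2::'f alg_closure) \<noteq> 0"
  using two_nz to_ac_eq_0_iff[of "2::'f"] by simp

lemma omult_ac: "omult D x y = (\<Sum>i\<in>UNIV. \<Sum>j\<in>UNIV. (x $ i * y $ j) *s vec_ac (m (axis i 1) (axis j 1)))"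
  by (simp add: octonions_ac_def)

lemma oone_ac: "oone D = vec_ac I"
  by (simp add: octonions_ac_def)

lemma onorm_ac: "onorm D x = (1/2) * (\<Sum>i\<in>UNIV. \<Sum>j\<in>UNIV. x $ i * x $ j * to_ac (b (axis i 1) (axis j 1)))"
  by (simp add: octonions_ac_def)

lemma omult_ac_linear:
  "omult D (x + y) z = omult D x z + omult D y z" "omult D (c *s x) z = c *s omult D x z"
  "omult D z (x + y) = omult D z x + omult D z y" "omult D z (c *s x) = c *s omult D z x"
  by (simp_all add: omult_ac vec_eq_iff sum.distrib[symmetric] sum_distrib_left algebra_simps)

text \<open>The base extension of the polar form \<open>b\<close>. It turns out to be the polar form of the extended norm.\<close>

definition bK :: "'f alg_closure ^ 8 \<Rightarrow> 'f alg_closure ^ 8 \<Rightarrow> 'f alg_closure" where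
  "bK x y = (\<Sum>i\<in>UNIV. \<Sum>j\<in>UNIV. x $ i * y $ j * to_ac (b (axis i 1) (axis j 1)))"

lemma bK_linear:
  "bK (x + y) z = bK x z + bK y z" "bK (c *s x) z = c * bK x z"
  "bK z (x + y) = bK z x + bK z y" "bK z (c *s x) = c * bK z x"
  by (simp_all add: bK_def sum.distrib[symmetric] sum_distrib_left algebra_simps)

lemma bK_sym: "bK x y = bK y x"
proof -
  have "bK x y = (\<Sum>j\<in>UNIV. \<Sum>i\<in>UNIV. x $ i * y $ j * to_ac (b (axis i 1) (axis j 1)))"
    unfolding bK_def by (rule sum.swap)
  also have "\<dots> = bK y x"
    unfolding bK_def
  proof (intro sum.cong refl)
    show "x $ i * y $ j * to_ac (b (axis i 1) (axis j 1)) = y $ j * x $ i * to_ac (b (axis j 1) (axis i 1))" for i j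
      unfolding b_sym[of "axis i 1" "axis j 1"] by (simp only: mult.commute)
  qed
  finally show ?thesis .
qed

lemma onorm_ac_bK: "onorm D x = (1/2) * bK x x"
  by (simp add: onorm_ac bK_def)

lemma bK_self: "bK x x = 2 * onorm D x"
proof -
  have "2 * ((1/2) * z) = z" for z :: "'f alg_closure" using two_nz_ac by simp
  then show ?thesis unfolding onorm_ac_bK by simp
qed

lemma polar_ac: "polar (onorm D) x y = bK x y"
proof -
  have "2 * polar (onorm D) x y = bK (x + y) (x + y) - bK x x - bK y y"
    unfolding polar_def bK_self by (simp only: right_diff_distrib)
  also have "\<dots> = 2 * bK x y"
    unfolding bK_linear bK_sym[of y x] by simp
  finally show ?thesis unfolding mult_left_cancel[OF two_nz_ac] .
qed

lemma m_expand: "m x y = (\<Sum>i\<in>UNIV. \<Sum>j\<in>UNIV. (x $ i * y $ j) *s m (axis i 1) (axis j 1))"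
proof -
  have s: "m (\<Sum>i\<in>S. f i) y = (\<Sum>i\<in>S. m (f i) y)" "m y (\<Sum>i\<in>S. f i) = (\<Sum>i\<in>S. m y (f i))"
    for S :: "8 set" and f y
    by (induction S rule: infinite_finite_induct) (simp_all add: m_add)
  have "m x y = m (\<Sum>i\<in>UNIV. (x $ i) *s axis i 1) (\<Sum>j\<in>UNIV. (y $ j) *s axis j 1)"
    by (simp only: basis_expansion)
  also have "\<dots> = (\<Sum>i\<in>UNIV. \<Sum>j\<in>UNIV. (x $ i * y $ j) *s m (axis i 1) (axis j 1))"
    unfolding s(1) unfolding s(2) m_scale by (simp add: vec_eq_iff sum_distrib_left ac_simps)
  finally show ?thesis .
qed

lemma b_expand: "b x y = (\<Sum>i\<in>UNIV. \<Sum>j\<in>UNIV. x $ i * y $ j * b (axis i 1) (axis j 1))"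
proof -
  have "b x y = b (\<Sum>i\<in>UNIV. (x $ i) *s axis i 1) (\<Sum>j\<in>UNIV. (y $ j) *s axis j 1)"
    by (simp only: basis_expansion)
  also have "\<dots> = (\<Sum>i\<in>UNIV. \<Sum>j\<in>UNIV. x $ i * y $ j * b (axis i 1) (axis j 1))"
    unfolding oct.bil_sum_left unfolding oct.bil_sum_right b_simps
    by (simp add: sum_distrib_left ac_simps)
  finally show ?thesis .
qed

lemma omult_vec_ac: "omult D (vec_ac x) (vec_ac y) = vec_ac (m x y)"
  by (subst m_expand) (simp add: omult_ac vec_ac_sum vec_ac_simps)

lemma bK_vec_ac: "bK (vec_ac x) (vec_ac y) = to_ac (b x y)"
  by (subst b_expand) (simp add: bK_def to_ac_sum)

text \<open>The multiplicativity of the norm is transferred in its fully polarized form: both sides are linear in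
  each variable, so equality on basis vectors suffices.\<close>

lemma composition_ac: "bK (omult D x y) (omult D u z) + bK (omult D u y) (omult D x z) = bK x u * bK y z"
proof -
  define \<phi> where "\<phi> x y u z = bK (omult D x y) (omult D u z) + bK (omult D u y) (omult D x z) - bK x u * bK y z" for x y u z
  have lin:
    "\<phi> (x + x') y u z = \<phi> x y u z + \<phi> x' y u z" "\<phi> (c *s x) y u z = c * \<phi> x y u z"
    "\<phi> x (y + y') u z = \<phi> x y u z + \<phi> x y' u z" "\<phi> x (c *s y) u z = c * \<phi> x y u z"
    "\<phi> x y (u + u') z = \<phi> x y u z + \<phi> x y u' z" "\<phi> x y (c *s u) z = c * \<phi> x y u z"
    "\<phi> x y u (z + z') = \<phi> x y u z + \<phi> x y u z'" "\<phi> x y u (c *s z) = c * \<phi> x y u z"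
    for x x' y y' u u' z z' c
    unfolding \<phi>_def omult_ac_linear bK_linear by (simp_all add: algebra_simps)
  have 0: "\<phi> (axis i 1) (axis j 1) (axis k 1) (axis l 1) = 0" for i j k l
    unfolding \<phi>_def vec_ac_axis[symmetric] omult_vec_ac bK_vec_ac
    using b_mult_mult[of "axis i 1" "axis j 1" "axis k 1" "axis l 1"]
    by (simp flip: to_ac_add to_ac_mult to_ac_diff)
  have 1: "\<phi> x (axis j 1) (axis k 1) (axis l 1) = 0" for x j k l
    by (rule linear_extension[where s = "(*)" and g = "\<lambda>_. 0"]) (simp_all add: lin 0)
  have 2: "\<phi> x y (axis k 1) (axis l 1) = 0" for x y k l
    by (rule linear_extension[where s = "(*)" and g = "\<lambda>_. 0"]) (simp_all add: lin 1)
  have 3: "\<phi> x y u (axis l 1) = 0" for x y u l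
    by (rule linear_extension[where s = "(*)" and g = "\<lambda>_. 0"]) (simp_all add: lin 2)
  have "\<phi> x y u z = 0"
    by (rule linear_extension[where s = "(*)" and g = "\<lambda>_. 0"]) (simp_all add: lin 3)
  then show ?thesis by (simp add: \<phi>_def)
qed

text \<open>The Gram matrix is invertible already over the base field.\<close>

lemma bK_nondegenerate:
  assumes "\<And>y. bK x y = 0"
  shows "x = 0"
proof -
  define G :: "'f ^ 8 ^ 8" where "G = (\<chi> i j. b (axis i 1) (axis j 1))"
  have "v = 0" if "G *v v = 0" for v
  proof (rule b_nondegenerate)
    fix y
    have Gv: "(\<Sum>j\<in>UNIV. b (axis i 1) (axis j 1) * v $ j) = 0" for i
      using that by (simp add: G_def matrix_vector_mult_def vec_eq_iff)
    have "b y v = (\<Sum>i\<in>UNIV. y $ i * (\<Sum>j\<in>UNIV. b (axis i 1) (axis j 1) * v $ j))"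
      by (subst b_expand) (simp add: sum_distrib_left ac_simps)
    then show "b v y = 0" by (simp add: Gv b_sym[of v y])
  qed
  then obtain G' where "G' ** G = mat 1"
    using matrix_left_invertible_ker[of G] by blast
  then have GG: "G ** G' = mat 1" by (simp add: matrix_left_right_inverse)
  have "x $ i = 0" for i
  proof -
    have d: "(\<Sum>l\<in>UNIV. b (axis j 1) (axis l 1) * G' $ l $ i) = (if j = i then 1 else 0)" for j
      using arg_cong[OF GG, of "\<lambda>M. M $ j $ i"] by (simp add: matrix_matrix_mult_def G_def mat_def)
    have "bK x (vec_ac (\<chi> l. G' $ l $ i)) =
        (\<Sum>j\<in>UNIV. x $ j * to_ac (\<Sum>l\<in>UNIV. b (axis j 1) (axis l 1) * G' $ l $ i))"
      unfolding bK_def by (simp add: to_ac_sum sum_distrib_left ac_simps)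
    also have "\<dots> = (\<Sum>j\<in>UNIV. if j = i then x $ j else 0)"
      unfolding d by (intro sum.cong) auto
    finally show ?thesis using assms by simp
  qed
  then show ?thesis by (simp add: vec_eq_iff)
qed

lemma octonion_algebra_ac: "octonion_algebra D"
proof -
  have unit1: "omult D (oone D) x = x" for x
    unfolding oone_ac
  proof (rule linear_extension[where s = "(*s)" and g = "\<lambda>x. x"])
    show "omult D (vec_ac I) (axis i 1) = axis i 1" for i
      unfolding vec_ac_axis[symmetric] omult_vec_ac by simp
  qed (simp_all add: omult_ac_linear)
  have unit2: "omult D x (oone D) = x" for x
    unfolding oone_ac
  proof (rule linear_extension[where s = "(*s)" and g = "\<lambda>x. x" and f = "\<lambda>x. omult D x (vec_ac I)"])
    show "omult D (axis i 1) (vec_ac I) = axis i 1" for i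
      unfolding vec_ac_axis[symmetric] omult_vec_ac by simp
  qed (simp_all add: omult_ac_linear)
  have vs1: "vector_space ((*s) :: 'f alg_closure \<Rightarrow> 'f alg_closure ^ 8 \<Rightarrow> _)"
    by (rule vec.vector_space_axioms)
  have vs2: "vector_space ((*) :: 'f alg_closure \<Rightarrow> _ \<Rightarrow> _)"
    by (rule vector_space_over_itself.vector_space_axioms)
  have nm: "onorm D (omult D x y) = onorm D x * onorm D y" for x y
  proof -
    have "2 * (2 * onorm D (omult D x y)) = 2 * (2 * (onorm D x * onorm D y))"
      using composition_ac[of x y x y] by (simp add: bK_self)
    then show ?thesis unfolding mult_left_cancel[OF two_nz_ac] .
  qed
  show ?thesis
    unfolding octonion_algebra_def Vector_Spaces.linear_iff polar_ac
  proof (intro conjI allI impI)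
    show "onorm D (a *s x) = a\<^sup>2 * onorm D x" for a x
      unfolding onorm_ac_bK bK_linear power2_eq_square by (simp only: ac_simps)
    show "x = 0" if "\<forall>y. bK x y = 0" for x
      using that by (intro bK_nondegenerate) blast
  qed (rule omult_ac_linear unit1 unit2 nm bK_linear vs1 vs2)+
qed

lemma octonion_ac: "octonion D"
  by unfold_locales (rule octonion_algebra_ac two_nz_ac)+

lemma oconj_ac: "oconj D (vec_ac x) = vec_ac (cj x)"
  by (simp add: oconj_def polar_ac oone_ac bK_vec_ac vec_ac_simps)

end

context albert_algebra
begin

lemma vec_ac_gamma_nz: "vec_ac \<gamma> $ 1 \<noteq> 0" "vec_ac \<gamma> $ 2 \<noteq> 0" "vec_ac \<gamma> $ 3 \<noteq> 0"
  using \<gamma>_nz by (simp_all add: to_ac_eq_0_iff)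

lemma polar_albert_Q:
  assumes "x \<in> A" "y \<in> A"
  shows "polar (albert_Q C \<gamma>) x y = tf x y"
proof -
  have two: "2 * (z / 2) = z" for z :: 'f using two_nz by simp
  have "2 * polar (albert_Q C \<gamma>) x y = tf (x + y) (x + y) - tf x x - tf y y"
    unfolding polar_def albert_Q_eq[OF cj.A_closed(3)[OF assms]] albert_Q_eq[OF assms(1)]
      albert_Q_eq[OF assms(2)] right_diff_distrib two ..
  also have "\<dots> = 2 * tf x y"
    unfolding ab.bil_simps ab.bil_sym[of y x] by simp
  finally show ?thesis unfolding mult_left_cancel[OF two_nz] .
qed

lemma albert_algebra_ac: "albert_algebra D (vec_ac \<gamma>)"
  by (intro albert_algebra.intro octonion_ac albert_algebra_axioms.intro vec_ac_gamma_nz)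

end

locale albert_extension = albert_algebra C \<gamma> for C :: "'f::field octonions" and \<gamma>
begin

sublocale K: albert_algebra D "vec_ac \<gamma>"
  by (rule albert_algebra_ac)

lemma mat_ac_simps: "mat_ac (x + y) = mat_ac x + mat_ac y" "mat_ac (x - y) = mat_ac x - mat_ac y"
  "mat_ac (mscale c x) = mscale (to_ac c) (mat_ac x)" "mat_ac 0 = 0"
  by (simp_all add: vec_eq_iff mat_ac_nth mscale_nth)

lemma mat_ac_H: "mat_ac (H f1 f2 f3 c1 c2 c3) =
    K.H (to_ac f1) (to_ac f2) (to_ac f3) (vec_ac c1) (vec_ac c2) (vec_ac c3)"
  by (rule K.mat_eqI)
    (simp_all add: mat_ac_nth H_nth K.H_nth vec_ac_simps oone_ac oconj_ac
      al1_def al2_def al3_def K.al1_def K.al2_def K.al3_def)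

lemma mat_ac_A: "x \<in> A \<Longrightarrow> mat_ac x \<in> K.A"
  by (auto elim!: A_cases simp: mat_ac_H K.H_A)

lemma mat_ac_one: "mat_ac (albert_one C \<gamma>) = albert_one D (vec_ac \<gamma>)"
  by (simp add: one_H K.one_H mat_ac_H vec_ac_simps)

lemma mat_ac_mult: "mat_ac (albert_mult C x y) = albert_mult D (mat_ac x) (mat_ac y)"
  by (rule K.mat_ext)
    (simp add: mat_ac_nth albert_mult_nth K.albert_mult_nth vec_ac_simps omult_vec_ac)

lemma tf_mat_ac: "K.tf (mat_ac x) (mat_ac y) = to_ac (tf x y)"
  by (simp add: K.tf_def tf_def K.cf_def cf_def polar_ac mat_ac_nth bK_vec_ac oone_ac
      al1_def al2_def al3_def K.al1_def K.al2_def K.al3_def)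

lemma A_span_ac: "K.A \<subseteq> K.ms.span (mat_ac ` A)"
proof
  fix z assume "z \<in> K.A"
  then obtain f1 f2 f3 c1 c2 c3 where z: "z = K.H f1 f2 f3 c1 c2 c3" by (elim K.A_cases)
  have base: "mat_ac (H g1 g2 g3 d1 d2 d3) \<in> K.ms.span (mat_ac ` A)" for g1 g2 g3 d1 d2 d3
    by (intro K.ms.span_base imageI H_A)
  have H0: "K.H 0 0 0 0 0 0 = 0" by (rule K.H_zero)
  have e: "K.H f1 f2 f3 0 0 0 = mscale f1 (mat_ac (H 1 0 0 0 0 0)) + mscale f2 (mat_ac (H 0 1 0 0 0 0))
      + mscale f3 (mat_ac (H 0 0 1 0 0 0))"
    by (simp add: mat_ac_H vec_ac_simps K.H_scale K.H_add)
  have 1: "K.H 0 0 0 c 0 0 \<in> K.ms.span (mat_ac ` A)" "K.H 0 0 0 0 c 0 \<in> K.ms.span (mat_ac ` A)"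
    "K.H 0 0 0 0 0 c \<in> K.ms.span (mat_ac ` A)" for c
  proof -
    have s: "K.H 0 0 0 (\<Sum>i\<in>S. (c $ i) *s axis i 1) 0 0 \<in> K.ms.span (mat_ac ` A) \<and>
        K.H 0 0 0 0 (\<Sum>i\<in>S. (c $ i) *s axis i 1) 0 \<in> K.ms.span (mat_ac ` A) \<and>
        K.H 0 0 0 0 0 (\<Sum>i\<in>S. (c $ i) *s axis i 1) \<in> K.ms.span (mat_ac ` A)" for S
    proof (induction S rule: infinite_finite_induct)
      case (insert i S)
      have "K.H 0 0 0 ((c $ i) *s axis i 1 + d) 0 0 = mscale (c $ i) (mat_ac (H 0 0 0 (axis i 1) 0 0)) + K.H 0 0 0 d 0 0"
        "K.H 0 0 0 0 ((c $ i) *s axis i 1 + d) 0 = mscale (c $ i) (mat_ac (H 0 0 0 0 (axis i 1) 0)) + K.H 0 0 0 0 d 0"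
        "K.H 0 0 0 0 0 ((c $ i) *s axis i 1 + d) = mscale (c $ i) (mat_ac (H 0 0 0 0 0 (axis i 1))) + K.H 0 0 0 0 0 d" for d
        by (simp_all add: mat_ac_H vec_ac_simps vec_ac_axis K.H_scale K.H_add)
      then show ?case using insert by (auto intro!: K.ms.span_add K.ms.span_scale base)
    qed (simp_all add: H0 K.ms.span_zero)
    show "K.H 0 0 0 c 0 0 \<in> K.ms.span (mat_ac ` A)" "K.H 0 0 0 0 c 0 \<in> K.ms.span (mat_ac ` A)"
      "K.H 0 0 0 0 0 c \<in> K.ms.span (mat_ac ` A)"
      using s[of UNIV] by (simp_all add: basis_expansion)
  qed
  have "z = K.H f1 f2 f3 0 0 0 + (K.H 0 0 0 c1 0 0 + (K.H 0 0 0 0 c2 0 + K.H 0 0 0 0 0 c3))"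
    by (simp add: z K.H_add)
  also have "\<dots> \<in> K.ms.span (mat_ac ` A)"
    unfolding e by (intro K.ms.span_add K.ms.span_scale base 1)
  finally show "z \<in> K.ms.span (mat_ac ` A)" .
qed

end

text \<open>A primitive idempotent defined over the base field, with the Peirce decompositions over the
  base field and over its algebraic closure.\<close>

locale albert_idempotent = albert_extension C \<gamma> for C :: "'f::field octonions" and \<gamma> +
  fixes w :: "'f ^ 8 ^ 3 ^ 3"
  assumes w: "primitive_idempotent C \<gamma> w"
begin

lemma w_props: "w \<in> A" "albert_mult C w w = w" "tf w w = 1"
proof -
  show *: "w \<in> A" "albert_mult C w w = w" using w by (simp_all add: primitive_idempotent_def)
  have "albert_Q C \<gamma> w = 1/2" using w unfolding primitive_idempotent_def by blast
  then have "tf w w / 2 = 1/2" unfolding albert_Q_eq[OF *(1)] .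
  then show "tf w w = 1" using two_nz by simp
qed

sublocale p: peirce mscale tf A "albert_mult C" "albert_one C \<gamma>" w
  by unfold_locales (rule w_props)+

abbreviation wK where "wK \<equiv> mat_ac w"

sublocale pK: peirce27 mscale K.tf K.A "albert_mult D" "albert_one D (vec_ac \<gamma>)" wK
proof unfold_locales
  show "wK \<in> K.A" by (rule mat_ac_A[OF w_props(1)])
  show "albert_mult D wK wK = wK" by (simp add: w_props mat_ac_mult[symmetric])
  show "K.tf wK wK = 1" by (simp add: tf_mat_ac w_props)
  show "\<exists>d. d * d = c" for c :: "'f alg_closure"
    using nth_root_exists[of 2 c] by (auto simp: power2_eq_square)
  show "\<exists>S. finite S \<and> K.ms.independent S \<and> K.ms.span S = K.A \<and> card S = 27"
    by (rule K.A_orthogonal_basis)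
  show "u \<in> K.A \<Longrightarrow> albert_mult D u u = u \<Longrightarrow> K.tf u u = 1 \<Longrightarrow>
      \<exists>x\<in>K.A. \<forall>c. albert_mult D u x \<noteq> mscale c u" for u
    by (rule K.no_central_idempotent)
qed

lemma V0_eq: "p.V0 = E0 C \<gamma> w"
  unfolding p.V0_def E0_def using polar_albert_Q[OF _ albert_one_A] by auto

lemma VK0_eq: "pK.V0 = E0 D (vec_ac \<gamma>) wK"
  unfolding pK.V0_def E0_def using K.polar_albert_Q[OF _ K.albert_one_A] by auto

lemma mat_ac_pr1: "pK.pr1 (mat_ac z) = mat_ac (p.pr1 z)"
  unfolding p.pr1_def pK.pr1_def by (simp add: mat_ac_simps mat_ac_mult tf_mat_ac)

lemma mat_ac_pr0: "pK.pr0 (mat_ac z) = mat_ac (p.pr0 z)"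
  unfolding p.pr0_def pK.pr0_def mat_ac_pr1
  by (simp add: mat_ac_simps tf_mat_ac mat_ac_one[symmetric])

lemma mat_ac_V: "a \<in> p.V0 \<Longrightarrow> mat_ac a \<in> pK.V0" "x \<in> p.V1 \<Longrightarrow> mat_ac x \<in> pK.V1"
proof -
  show "a \<in> p.V0 \<Longrightarrow> mat_ac a \<in> pK.V0"
    unfolding p.V0_def pK.V0_def
    by (auto simp: mat_ac_A mat_ac_one[symmetric] tf_mat_ac mat_ac_mult[symmetric] mat_ac_simps)
  show "x \<in> p.V1 \<Longrightarrow> mat_ac x \<in> pK.V1"
    unfolding p.V1_def pK.V1_def
    by (auto simp: mat_ac_A mat_ac_mult[symmetric] mat_ac_simps)
qed

lemma pr_linear: "pK.pr1 (x + y) = pK.pr1 x + pK.pr1 y" "pK.pr1 (mscale c x) = mscale c (pK.pr1 x)"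
  "pK.pr0 (x + y) = pK.pr0 x + pK.pr0 y" "pK.pr0 (mscale c x) = mscale c (pK.pr0 x)"
proof -
  show 1: "pK.pr1 (x + y) = pK.pr1 x + pK.pr1 y" for x y
    unfolding pK.pr1_def K.cj.mul_simps K.ab.bil_simps
    by (simp add: K.ms.scale_right_distrib distrib_left K.ms.scale_left_distrib)
  show 2: "pK.pr1 (mscale c x) = mscale c (pK.pr1 x)" for c x
    unfolding pK.pr1_def K.cj.mul_simps K.ab.bil_simps
    by (simp add: K.ms.scale_right_diff_distrib ac_simps)
  show "pK.pr0 (x + y) = pK.pr0 x + pK.pr0 y"
    unfolding pK.pr0_def 1 K.ab.bil_simps
    by (simp add: K.ms.scale_left_distrib K.ms.scale_left_diff_distrib diff_divide_distrib add_divide_distrib)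
  show "pK.pr0 (mscale c x) = mscale c (pK.pr0 x)"
    unfolding pK.pr0_def 2 K.ab.bil_simps
    by (simp add: K.ms.scale_right_diff_distrib right_diff_distrib[symmetric])
qed

lemma pr_fixed: "a \<in> pK.V0 \<Longrightarrow> pK.pr0 a = a" "x \<in> pK.V1 \<Longrightarrow> pK.pr1 x = x"
proof -
  show "pK.pr0 a = a" if "a \<in> pK.V0"
    using pK.V0_D[OF that] by (simp add: pK.pr0_def pK.pr1_def)
  show "pK.pr1 x = x" if "x \<in> pK.V1"
    using pK.V1_D[OF that] K.two_nz by (simp add: pK.pr1_def)
qed

lemma VK_span: "pK.V0 \<subseteq> K.ms.span (mat_ac ` p.V0)" "pK.V1 \<subseteq> K.ms.span (mat_ac ` p.V1)"
proof -
  have s: "pK.pr0 z \<in> K.ms.span (mat_ac ` p.V0) \<and> pK.pr1 z \<in> K.ms.span (mat_ac ` p.V1)"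
    if "z \<in> K.ms.span (mat_ac ` A)" for z
    using that
  proof (induction rule: K.ms.span_induct_alt)
    case base
    then show ?case using pr_linear(2,4)[of 0 0] K.ms.span_zero by simp
  next
    case (step c x y)
    then obtain x' where "x' \<in> A" "x = mat_ac x'" by blast
    then have "pK.pr0 x \<in> K.ms.span (mat_ac ` p.V0)" "pK.pr1 x \<in> K.ms.span (mat_ac ` p.V1)"
      using p.pr0_V0 p.pr1_V1 by (auto simp: mat_ac_pr0 mat_ac_pr1 intro: K.ms.span_base)
    then show ?case using step by (simp add: pr_linear K.ms.span_add K.ms.span_scale)
  qed
  show "pK.V0 \<subseteq> K.ms.span (mat_ac ` p.V0)" "pK.V1 \<subseteq> K.ms.span (mat_ac ` p.V1)"
  proof -
    show "pK.V0 \<subseteq> K.ms.span (mat_ac ` p.V0)"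
    proof
      fix z assume z: "z \<in> pK.V0"
      then have "z \<in> K.ms.span (mat_ac ` A)" using A_span_ac pK.V0_D(1) by blast
      from s[OF this] show "z \<in> K.ms.span (mat_ac ` p.V0)" unfolding pr_fixed(1)[OF z] by blast
    qed
    show "pK.V1 \<subseteq> K.ms.span (mat_ac ` p.V1)"
    proof
      fix z assume z: "z \<in> pK.V1"
      then have "z \<in> K.ms.span (mat_ac ` A)" using A_span_ac pK.V1_D(1) by blast
      from s[OF this] show "z \<in> K.ms.span (mat_ac ` p.V1)" unfolding pr_fixed(2)[OF z] by blast
    qed
  qed
qed

text \<open>An orthogonal basis over the base field stays one over the closure, which is where the
  dimensions are known.\<close>

lemma orthogonal_basis_ac:
  assumes B: "ab.orthogonal_basis B U" and UK: "mat_ac ` U \<subseteq> UK" "UK \<subseteq> K.ms.span (mat_ac ` U)"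
  shows "K.ab.orthogonal_basis (mat_ac ` B) UK" "inj_on mat_ac B"
proof -
  have "K.ms.span (mat_ac ` U) \<subseteq> K.ms.span (mat_ac ` B)"
  proof (rule K.ms.span_minimal)
    show "mat_ac ` U \<subseteq> K.ms.span (mat_ac ` B)"
    proof
      fix z assume "z \<in> mat_ac ` U"
      then obtain u where u: "u \<in> ms.span B" "z = mat_ac u"
        using B by (auto simp: ab.orthogonal_basis_def)
      from u(1) have "mat_ac u \<in> K.ms.span (mat_ac ` B)"
      proof (induction rule: ms.span_induct_alt)
        case base
        then show ?case by (simp add: mat_ac_simps K.ms.span_zero)
      next
        case (step c x y)
        then have "mat_ac x \<in> K.ms.span (mat_ac ` B)" by (auto intro: K.ms.span_base)
        then show ?case using step by (simp add: mat_ac_simps K.ms.span_add K.ms.span_scale)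
      qed
      then show "z \<in> K.ms.span (mat_ac ` B)" using u by simp
    qed
  qed simp
  moreover have "K.ab.orthogonal_system (mat_ac ` B)"
    using B by (auto simp: ab.orthogonal_basis_def ab.orthogonal_system_def K.ab.orthogonal_system_def
        tf_mat_ac to_ac_eq_0_iff)
  ultimately show "K.ab.orthogonal_basis (mat_ac ` B) UK"
    using B UK image_mono[of B U mat_ac]
    unfolding ab.orthogonal_basis_def K.ab.orthogonal_basis_def by blast
  show "inj_on mat_ac B"
    by (auto simp: inj_on_def vec_eq_iff mat_ac_nth to_ac_inj)
qed

lemma rational_bases:
  "\<exists>b. (\<forall>i<9. b i \<in> p.V0) \<and> K.ab.orthogonal_basis ((\<lambda>i. mat_ac (b i)) ` {..<9}) pK.V0
    \<and> inj_on (\<lambda>i. mat_ac (b i)) {..<9::nat}"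
  "\<exists>x. (\<forall>i::16. x i \<in> p.V1) \<and> K.ab.orthogonal_basis ((\<lambda>i. mat_ac (x i)) ` UNIV) pK.V1
    \<and> inj (\<lambda>i. mat_ac (x i))"
proof -
  obtain S where S: "finite S" "ms.span S = A" using A_orthogonal_basis by blast
  have VA: "p.V0 \<subseteq> A" "p.V1 \<subseteq> A" using p.V0_D(1) p.V1_D(1) by blast+
  obtain B0 where B0: "ab.orthogonal_basis B0 p.V0"
    using ab.orthogonal_basis_exists[OF p.V0_subspace p.V0_nondegenerate S(1)] VA S(2) by blast
  obtain B1 where B1: "ab.orthogonal_basis B1 p.V1"
    using ab.orthogonal_basis_exists[OF p.V1_subspace p.V1_nondegenerate S(1)] VA S(2) by blast
  have im: "mat_ac ` p.V0 \<subseteq> pK.V0" "mat_ac ` p.V1 \<subseteq> pK.V1" using mat_ac_V by blast+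
  note ob0 = orthogonal_basis_ac[OF B0 im(1) VK_span(1)]
  note ob1 = orthogonal_basis_ac[OF B1 im(2) VK_span(2)]
  have c: "card B0 = 9" "card B1 = 16"
    using K.ab.orthogonal_basis_card_eq_dim[OF ob0(1)] K.ab.orthogonal_basis_card_eq_dim[OF ob1(1)]
      pK.dim_V0 pK.dim_V1 card_image[OF ob0(2)] card_image[OF ob1(2)] by simp_all
  have fin: "finite B0" "finite B1" using c card.infinite by fastforce+
  obtain b where b: "bij_betw b {..<9::nat} B0"
    using ex_bij_betw_nat_finite[OF fin(1)] c by (auto simp: lessThan_atLeast0)
  have "card (UNIV :: 16 set) = card B1" using c by simp
  then obtain x where x: "bij_betw x (UNIV :: 16 set) B1"
    using finite_same_card_bij[of "UNIV :: 16 set" B1] fin by auto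
  have sub: "B0 \<subseteq> p.V0" "B1 \<subseteq> p.V1" using B0 B1 by (auto simp: ab.orthogonal_basis_def)
  have "(\<lambda>i. mat_ac (b i)) ` {..<9} = mat_ac ` B0" "(\<lambda>i. mat_ac (x i)) ` UNIV = mat_ac ` B1"
    using b x by (auto simp: bij_betw_def image_image[symmetric])
  moreover have "inj_on (\<lambda>i. mat_ac (b i)) {..<9}" "inj (\<lambda>i. mat_ac (x i))"
    using comp_inj_on[of b "{..<9}" mat_ac] comp_inj_on[of x UNIV mat_ac] b x ob0(2) ob1(2)
    by (simp_all add: bij_betw_def comp_def)
  moreover have "\<forall>i<9. b i \<in> p.V0" "\<forall>i. x i \<in> p.V1"
    using b x sub by (auto simp: bij_betw_def)
  ultimately show "\<exists>b. (\<forall>i<9. b i \<in> p.V0) \<and> K.ab.orthogonal_basis ((\<lambda>i. mat_ac (b i)) ` {..<9}) pK.V0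
      \<and> inj_on (\<lambda>i. mat_ac (b i)) {..<9::nat}"
    "\<exists>x. (\<forall>i::16. x i \<in> p.V1) \<and> K.ab.orthogonal_basis ((\<lambda>i. mat_ac (x i)) ` UNIV) pK.V1
      \<and> inj (\<lambda>i. mat_ac (x i))"
    using ob0(1) ob1(1) by (metis (no_types, lifting))+
qed

end

section \<open>The stabilizer of a primitive idempotent\<close>

text \<open>The half space as a Clifford module of \<open>V0\<close>, written in matrices with respect to an orthogonal
  basis \<open>xs\<close> of the half space.\<close>

locale spin_rep = peirce27 scale bil A mul e w
  for scale :: "'f::field \<Rightarrow> 'v::ab_group_add \<Rightarrow> 'v" (infixr "\<star>" 75)
    and bil :: "'v \<Rightarrow> 'v \<Rightarrow> 'f" and A and mul (infixl "\<diamond>" 70) and e and w +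
  fixes q :: "'v \<Rightarrow> 'f" and b :: "nat \<Rightarrow> 'v" and xs :: "'n::finite \<Rightarrow> 'v"
  assumes card_n: "CARD('n) = 16"
    and q_V0: "a \<in> V0 \<Longrightarrow> q a = bil a a / 2"
    and b_basis: "orthogonal_basis (b ` {..<9}) V0" "inj_on b {..<9}"
    and xs_basis: "orthogonal_basis (range xs) V1" "inj xs"
begin

lemma b_V0: "i < 9 \<Longrightarrow> b i \<in> V0"
  using b_basis by (auto simp: orthogonal_basis_def)

lemma b_orth: "i < 9 \<Longrightarrow> j < 9 \<Longrightarrow> i \<noteq> j \<Longrightarrow> bil (b i) (b j) = 0"
proof -
  assume ij: "i < 9" "j < 9" "i \<noteq> j"
  then have "b i \<noteq> b j" using inj_onD[OF b_basis(2), of i j] by auto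
  then show ?thesis using b_basis(1) ij by (auto simp: orthogonal_basis_def orthogonal_system_def)
qed

lemma b_nz: "i < 9 \<Longrightarrow> bil (b i) (b i) \<noteq> 0"
  using b_basis by (auto simp: orthogonal_basis_def orthogonal_system_def)

lemma xs_V1: "xs i \<in> V1"
  using xs_basis by (auto simp: orthogonal_basis_def)

lemma xs_orth: "i \<noteq> j \<Longrightarrow> bil (xs i) (xs j) = 0"
proof -
  assume "i \<noteq> j"
  then have "xs i \<noteq> xs j" using injD[OF xs_basis(2), of i j] by auto
  then show ?thesis using xs_basis(1) by (auto simp: orthogonal_basis_def orthogonal_system_def)
qed

abbreviation N where "N i \<equiv> bil (xs i) (xs i)"

lemma N_nz: "N i \<noteq> 0"
  using xs_basis by (auto simp: orthogonal_basis_def orthogonal_system_def)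

definition coord :: "'v \<Rightarrow> 'n \<Rightarrow> 'f" where "coord v i = bil v (xs i) / N i"

lemma coord_simps: "coord (u + v) i = coord u i + coord v i" "coord (c \<star> v) i = c * coord v i"
  by (simp_all add: coord_def bil_simps add_divide_distrib)

lemma coord_xs: "coord (xs j) i = (if i = j then 1 else 0)"
  using N_nz xs_orth by (simp add: coord_def)

lemma xs_expand: assumes "v \<in> V1" shows "v = (\<Sum>i\<in>UNIV. coord v i \<star> xs i)"
proof -
  have "v = (\<Sum>x\<in>range xs. (bil v x / bil x x) \<star> x)"
    using xs_basis(1) assms by (intro orthogonal_expansion) (auto simp: orthogonal_basis_def)
  then show ?thesis by (simp add: sum.reindex xs_basis(2) coord_def)
qed

lemma bil_xs: "coord v i * N i = bil v (xs i)"
  using N_nz by (simp add: coord_def)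

lemma parseval: assumes "u \<in> V1" shows "bil u v = (\<Sum>i\<in>UNIV. coord u i * bil (xs i) v)"
  by (subst xs_expand[OF assms]) (simp add: bil_sum_left bil_simps)

lemma V1_eqI:
  assumes "u \<in> V1" "v \<in> V1" "\<And>i. coord u i = coord v i"
  shows "u = v"
  using xs_expand[OF assms(1)] xs_expand[OF assms(2)] assms(3) by simp

definition mx :: "('v \<Rightarrow> 'v) \<Rightarrow> 'f ^ 'n ^ 'n" where "mx g = (\<chi> i j. coord (g (xs j)) i)"

definition app :: "'f ^ 'n ^ 'n \<Rightarrow> 'v \<Rightarrow> 'v" where
  "app M v = (\<Sum>i\<in>UNIV. (\<Sum>j\<in>UNIV. M $ i $ j * coord v j) \<star> xs i)"

lemma app_V1: "app M v \<in> V1"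
  unfolding app_def by (intro subspace_sum[OF V1_subspace] V1_closed xs_V1)

lemma coord_sum: "coord (\<Sum>k\<in>S. g k) i = (\<Sum>k\<in>S. coord (g k) i)"
  unfolding coord_def by (simp add: bil_sum_left sum_divide_distrib)

lemma coord_app: "coord (app M v) i = (\<Sum>j\<in>UNIV. M $ i $ j * coord v j)"
proof -
  have "coord (app M v) i = (\<Sum>k\<in>UNIV. (\<Sum>j\<in>UNIV. M $ k $ j * coord v j) * coord (xs k) i)"
    unfolding app_def coord_sum coord_simps ..
  then show ?thesis by (simp add: coord_xs mult_delta_right)
qed

lemma app_add: "app M (u + v) = app M u + app M v"
  by (rule V1_eqI) (simp_all add: app_V1 V1_closed coord_app coord_simps distrib_left sum.distrib)

lemma app_scale: "app M (c \<star> v) = c \<star> app M v"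
  by (rule V1_eqI) (simp_all add: app_V1 V1_closed coord_app coord_simps sum_distrib_left ac_simps)

lemma app_mult: "app (M ** M') v = app M (app M' v)"
  by (rule V1_eqI)
    (simp_all add: app_V1 coord_app matrix_matrix_mult_def sum_distrib_left sum_distrib_right ac_simps,
     subst sum.swap, simp add: ac_simps)

lemma app_mat: "v \<in> V1 \<Longrightarrow> app (mat c) v = c \<star> v"
  by (rule V1_eqI) (simp_all add: app_V1 V1_closed coord_app coord_simps mat_def mult_delta_left)

lemma mx_app: "mx (app M) = M"
  by (simp add: mx_def vec_eq_iff coord_app coord_xs mult_delta_right)

lemma mx_cong: "(\<And>v. v \<in> V1 \<Longrightarrow> g v = h v) \<Longrightarrow> mx g = mx h"
  by (simp add: mx_def vec_eq_iff xs_V1)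

lemma app_eqI: "(\<And>v. v \<in> V1 \<Longrightarrow> app M v = app M' v) \<Longrightarrow> M = M'"
  using mx_cong[of "app M" "app M'"] by (simp add: mx_app)

definition V1_linear :: "('v \<Rightarrow> 'v) \<Rightarrow> bool" where
  "V1_linear g \<longleftrightarrow> (\<forall>v\<in>V1. g v \<in> V1) \<and> (\<forall>u\<in>V1. \<forall>v\<in>V1. g (u + v) = g u + g v) \<and>
    (\<forall>c. \<forall>v\<in>V1. g (c \<star> v) = c \<star> g v)"

lemma app_mx:
  assumes g: "V1_linear g" and v: "v \<in> V1"
  shows "app (mx g) v = g v"
proof -
  have g0: "g 0 = 0"
    using g subspace_0[OF V1_subspace] unfolding V1_linear_def by (metis scale_zero_left)
  have sum: "g (\<Sum>i\<in>S. coord v i \<star> xs i) = (\<Sum>i\<in>S. coord v i \<star> g (xs i))" for S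
  proof (induction S rule: infinite_finite_induct)
    case (insert i S)
    have "(\<Sum>i\<in>S. coord v i \<star> xs i) \<in> V1" "coord v i \<star> xs i \<in> V1"
      by (intro subspace_sum[OF V1_subspace] V1_closed xs_V1)+
    then show ?case using insert g xs_V1 unfolding V1_linear_def by simp
  qed (simp_all add: g0)
  have "g v = (\<Sum>i\<in>UNIV. coord v i \<star> g (xs i))"
    by (subst xs_expand[OF v]) (rule sum)
  then have "coord (g v) k = coord (app (mx g) v) k" for k
    by (simp add: coord_sum coord_simps coord_app mx_def mult.commute)
  then show ?thesis using g v by (intro V1_eqI app_V1) (auto simp: V1_linear_def)
qed

lemma mx_comp:
  assumes "V1_linear g" "V1_linear h"
  shows "mx (\<lambda>v. g (h v)) = mx g ** mx h"
proof (rule app_eqI)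
  fix v assume v: "v \<in> V1"
  have "V1_linear (\<lambda>v. g (h v))" using assms by (auto simp: V1_linear_def)
  then show "app (mx (\<lambda>v. g (h v))) v = app (mx g ** mx h) v"
    using assms v by (simp add: app_mx app_mult V1_linear_def)
qed

lemma mx_id: "mx (\<lambda>v. v) = mat 1"
  by (simp add: mx_def vec_eq_iff mat_def coord_xs)

text \<open>The factor 2 makes \<open>T a\<close> square to \<open>Q(a)\<close>.\<close>

definition T :: "'v \<Rightarrow> 'f ^ 'n ^ 'n" where "T a = mx (\<lambda>v. 2 \<star> (a \<diamond> v))"

lemma V1_linear_mul: "a \<in> V0 \<Longrightarrow> V1_linear (\<lambda>v. 2 \<star> (a \<diamond> v))"
  by (auto simp: V1_linear_def V0_mul_V1 V1_closed mul_simps scale_right_distrib mult.commute)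

lemma app_T: "a \<in> V0 \<Longrightarrow> v \<in> V1 \<Longrightarrow> app (T a) v = 2 \<star> (a \<diamond> v)"
  unfolding T_def by (rule app_mx[OF V1_linear_mul])

lemma T_add: "T (a + a') = T a + T a'"
  by (simp add: T_def mx_def vec_eq_iff mul_simps coord_simps distrib_left)

lemma T_scale: "T (c \<star> a) = matscale c (T a)"
  by (simp add: T_def mx_def vec_eq_iff mul_simps coord_simps)

lemma app_plus: "app (M + M') v = app M v + app M' v"
  by (rule V1_eqI) (simp_all add: app_V1 V1_closed coord_app coord_simps distrib_right sum.distrib)

lemma T_T: assumes a: "a \<in> V0" and c: "c \<in> V0" shows "T a ** T c + T c ** T a = mat (bil a c)"
proof (rule app_eqI)
  fix v assume v: "v \<in> V1"
  note ac = V0_mul_V1[OF a v] V0_mul_V1[OF c v]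
  have "app (T a ** T c + T c ** T a) v = 4 \<star> (a \<diamond> (c \<diamond> v) + c \<diamond> (a \<diamond> v))"
    using a c v ac V1_closed(3)
    by (simp add: app_plus app_mult app_T mul_simps scale_right_distrib)
  also have "\<dots> = bil a c \<star> v"
    using four_neq_0 by (simp add: clifford_relation[OF a c v])
  finally show "app (T a ** T c + T c ** T a) v = app (mat (bil a c)) v"
    using v by (simp add: app_mat)
qed

lemma T_square: assumes a: "a \<in> V0" shows "T a ** T a = mat (q a)"
proof -
  have "matscale 2 (T a ** T a) = mat (bil a a)"
    using T_T[OF a a] by (simp add: vec_eq_iff)
  then have "matscale (1/2) (matscale 2 (T a ** T a)) = matscale (1/2) (mat (bil a a))" by simp
  then show ?thesis
    using two_neq_0 unfolding q_V0[OF a] by (simp add: matscale_matscale matscale_one matscale_mat)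
qed

lemma mat_inject: "(mat c :: 'f ^ 'n ^ 'n) = mat d \<longleftrightarrow> c = d"
proof
  assume "(mat c :: 'f ^ 'n ^ 'n) = mat d"
  then have "(mat c :: 'f ^ 'n ^ 'n) $ i $ i = mat d $ i $ i" for i by simp
  then show "c = d" by (simp add: mat_def)
qed simp

lemma mat_zero: "(mat 0 :: 'f ^ 'n ^ 'n) = 0"
  by (simp add: mat_def vec_eq_iff)

lemma T_zero_imp: assumes a: "a \<in> V0" and "T a = 0" shows "a = 0"
proof -
  have "bil a c = 0" if "c \<in> V0" for c
    using T_T[OF a that] assms(2) mat_inject[of "bil a c" 0] by (simp add: mat_mult_zero mat_zero)
  then show ?thesis using V0_nondegenerate a unfolding nondegenerate_on_def by blast
qed

lemma T_inject: assumes "a \<in> V0" "c \<in> V0" "T a = T c" shows "a = c"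
proof -
  have "T (a - c) + T c = T a" by (simp add: T_add[symmetric])
  then have "T (a - c) = 0" using assms(3) by simp
  then have "a - c = 0" using assms by (intro T_zero_imp V0_closed)
  then show ?thesis by simp
qed

sublocale cm: clifford_module scale q V0 T b
proof unfold_locales
  show "subspace V0" by (rule V0_subspace)
  show "T (b i) ** T (b j) = - (T (b j) ** T (b i))" if "i < 9" "j < 9" "i \<noteq> j" for i j
    using T_T[OF b_V0 b_V0, of i j] b_orth[OF that] that by (simp add: mat_zero eq_neg_iff_add_eq_0)
  show "q (b i) \<noteq> 0" if "i < 9" for i
    unfolding q_V0[OF b_V0[OF that]] using b_nz[OF that] two_neq_0 by simp
  show "\<exists>c. v = (\<Sum>i<9. c i \<star> b i)" if "v \<in> V0" for v
  proof -
    have "v = (\<Sum>x\<in>b ` {..<9}. (bil v x / bil x x) \<star> x)"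
      using b_basis(1) that by (intro orthogonal_expansion) (auto simp: orthogonal_basis_def)
    then have "v = (\<Sum>i<9. (bil v (b i) / bil (b i) (b i)) \<star> b i)"
      by (simp add: sum.reindex b_basis(2))
    then show ?thesis by (rule exI[of _ "\<lambda>i. bil v (b i) / bil (b i) (b i)"])
  qed
qed (simp_all add: two_neq_0 card_n T_add T_scale T_square b_V0)

text \<open>The adjoint with respect to the form on the half space, which is diagonal in the basis \<open>xs\<close>.\<close>

definition adj :: "'f ^ 'n ^ 'n \<Rightarrow> 'f ^ 'n ^ 'n" where
  "adj M = (\<chi> i j. M $ j $ i * N j / N i)"

lemma adj_mult: "adj (M ** M') = adj M' ** adj M"
proof -
  have "(\<Sum>k\<in>UNIV. M $ j $ k * M' $ k $ i) * N j / N i =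
      (\<Sum>k\<in>UNIV. M' $ k $ i * N k / N i * (M $ j $ k * N j / N k))" for i j
    unfolding sum_distrib_right sum_divide_distrib
    by (intro sum.cong) (use N_nz in \<open>simp_all add: field_simps\<close>)
  then show ?thesis by (simp add: adj_def vec_eq_iff matrix_matrix_mult_def)
qed

lemma adj_add: "adj (M + M') = adj M + adj M'"
  by (simp add: adj_def vec_eq_iff distrib_right add_divide_distrib)

lemma adj_scale: "adj (matscale c M) = matscale c (adj M)"
  by (simp add: adj_def vec_eq_iff)

lemma adj_one: "adj (mat 1) = mat 1"
  using N_nz by (auto simp: adj_def vec_eq_iff mat_def)

lemma adj_T: assumes a: "a \<in> V0" shows "adj (T a) = T a"
proof -
  have "T a $ j $ i * N j / N i = T a $ i $ j" for i j
  proof -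
    have A: "a \<in> A" "xs i \<in> A" "xs j \<in> A" using a xs_V1 V0_D(1) V1_D(1) by auto
    have "bil (a \<diamond> xs i) (xs j) = bil (a \<diamond> xs j) (xs i)"
      using bil_mul[OF A(2,1,3)] bil_sym[of "xs i" "a \<diamond> xs j"] by (simp add: mul_comm[of "xs i" a])
    then show ?thesis using N_nz[of i] N_nz[of j]
      by (simp add: T_def mx_def coord_def bil_simps)
  qed
  then show ?thesis by (simp add: adj_def vec_eq_iff)
qed

lemma bil_app_app: assumes u: "u \<in> V1" and v: "v \<in> V1" and M: "adj M ** M = mat 1"
  shows "bil (app M u) (app M v) = bil u v"
proof -
  have bil_app: "bil (app M u) v = bil u (app (adj M) v)" if uv: "u \<in> V1" "v \<in> V1" for u v
  proof -
    have "bil (app M u) v = (\<Sum>i\<in>UNIV. (\<Sum>j\<in>UNIV. M $ i $ j * coord u j) * (coord v i * N i))"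
      using parseval[OF app_V1, of M u v] by (simp add: coord_app bil_xs bil_sym[of "xs _" v])
    also have "\<dots> = (\<Sum>j\<in>UNIV. \<Sum>i\<in>UNIV. M $ i $ j * coord u j * (coord v i * N i))"
      unfolding sum_distrib_right by (rule sum.swap)
    also have "\<dots> = (\<Sum>j\<in>UNIV. coord u j * (coord (app (adj M) v) j * N j))"
      unfolding coord_app adj_def sum_distrib_left sum_distrib_right
      by (intro sum.cong) (use N_nz in \<open>simp_all add: field_simps\<close>)
    also have "\<dots> = bil u (app (adj M) v)"
      using parseval[OF uv(1), of "app (adj M) v"] by (simp add: bil_xs bil_sym[of "xs _" "app _ _"])
    finally show ?thesis .
  qed
  have "bil (app M u) (app M v) = bil u (app (adj M ** M) v)"
    using bil_app[OF u app_V1] by (simp add: app_mult)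
  then show ?thesis using v by (simp add: M app_mat)
qed

lemma bil_pr0_mult:
  assumes x: "x \<in> V1" and y: "y \<in> V1" and a: "a \<in> V0"
  shows "bil (pr0 (x \<diamond> y)) a = bil x (a \<diamond> y)"
proof -
  have "bil (x \<diamond> y) a = bil (pr0 (x \<diamond> y)) a"
    using arg_cong[OF V1_mul_V1[OF x y], of "\<lambda>v. bil v a"] V0_D[OF a] by (simp add: bil_simps)
  then show ?thesis
    using bil_mul[OF V1_D(1)[OF x] V1_D(1)[OF y] V0_D(1)[OF a]] by (simp add: mul_comm[of y a])
qed

definition is_aut :: "('v \<Rightarrow> 'v) \<Rightarrow> bool" where
  "is_aut g \<longleftrightarrow> bij_betw g A A \<and> (\<forall>x\<in>A. \<forall>y\<in>A. g (x + y) = g x + g y) \<and>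
    (\<forall>c. \<forall>x\<in>A. g (c \<star> x) = c \<star> g x) \<and> (\<forall>x\<in>A. \<forall>y\<in>A. g (x \<diamond> y) = g x \<diamond> g y)"

definition stab :: "('v \<Rightarrow> 'v) \<Rightarrow> bool" where "stab g \<longleftrightarrow> is_aut g \<and> g w = w"

lemma autD:
  assumes "is_aut g"
  shows "x \<in> A \<Longrightarrow> g x \<in> A" "x \<in> A \<Longrightarrow> y \<in> A \<Longrightarrow> g (x + y) = g x + g y"
    "x \<in> A \<Longrightarrow> g (c \<star> x) = c \<star> g x" "x \<in> A \<Longrightarrow> y \<in> A \<Longrightarrow> g (x \<diamond> y) = g x \<diamond> g y"
    "inj_on g A" "g ` A = A"
  using assms unfolding is_aut_def bij_betw_def by auto

lemma aut_zero: "is_aut g \<Longrightarrow> g 0 = 0"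
  using autD(3)[of g 0 0] A_closed(6) by simp

lemma aut_minus: "is_aut g \<Longrightarrow> x \<in> A \<Longrightarrow> g (- x) = - g x"
  using autD(3)[of g x "-1"] by simp

lemma aut_diff: "is_aut g \<Longrightarrow> x \<in> A \<Longrightarrow> y \<in> A \<Longrightarrow> g (x - y) = g x - g y"
  using autD(2)[of g x "- y"] aut_minus[of g y] by (simp add: A_closed)

lemma aut_e: assumes g: "is_aut g" shows "g e = e"
proof -
  obtain y where y: "y \<in> A" "g y = e" using autD(6)[OF g] e_A by (metis imageE)
  have "g (e \<diamond> y) = g e \<diamond> g y" by (rule autD(4)[OF g e_A y(1)])
  then show ?thesis using y by (simp add: mul_simps)
qed

text \<open>An automorphism fixing \<open>w\<close> preserves both Peirce components and the form on each of them,
  because the form can be read off from products.\<close>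

lemma stab_V0: assumes g: "stab g" and a: "a \<in> V0" shows "g a \<in> V0"
proof -
  have ga: "is_aut g" "g w = w" "g e = e" using g aut_e by (auto simp: stab_def)
  note A = V0_D[OF a]
  have gA: "g a \<in> A" by (rule autD(1)[OF ga(1) A(1)])
  have fA: "e - w \<in> A" using A_closed w_A by auto
  have wga: "w \<diamond> g a = 0"
    using autD(4)[OF ga(1) w_A A(1)] ga A aut_zero[OF ga(1)] by simp
  (* a priori the zero eigenvector g a has a component c along e - w; comparing squares shows that
     c or the remaining part a' vanishes *)
  define c where "c = bil e (g a) / 2"
  define a' where "a' = g a - c \<star> (e - w)"
  have bw: "bil w (g a) = 0"
    using bil_mul[OF w_A w_A gA] wga by (simp add: w_idem bil_simps)
  have wf: "w \<diamond> (e - w) = 0" by (simp add: mul_simps w_idem)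
  have a': "a' \<in> V0"
    unfolding V0_def a'_def c_def using gA fA wga wf two_neq_0
    by (simp add: A_closed mul_simps bil_simps bil_e_e bil_w_e bil_sym[of "g a" e])
  have "g (a \<diamond> a) = (bil a a / 2) \<star> (e - w)"
    unfolding V0_mul_V0[OF a a] using ga fA aut_diff[OF ga(1) e_A w_A] by (simp add: autD(3)[OF ga(1)])
  moreover have "g (a \<diamond> a) = (c \<star> (e - w) + a') \<diamond> (c \<star> (e - w) + a')"
    using autD(4)[OF ga(1) A(1) A(1)] by (simp add: a'_def)
  moreover have "(c \<star> (e - w) + a') \<diamond> (c \<star> (e - w) + a') =
      (c * c + bil a' a' / 2) \<star> (e - w) + (2 * c) \<star> a'"
  proof -
    have "a' + a' = 2 \<star> a'" using scale_left_distrib[of 1 1 a'] by simp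
    then have "(2 * c) \<star> a' = c \<star> a' + c \<star> a'"
      by (metis mult.commute scale_right_distrib scale_scale)
    moreover have "a' \<diamond> (e - w) = a'" using f_V0[OF a'] mul_comm[of a' "e - w"] by simp
    ultimately show ?thesis
      using V0_mul_V0[OF a' a'] f_V0[OF a'] f_f
      by (simp add: mul_add_left mul_add_right mul_scale_left mul_scale_right scale_left_distrib
          scale_right_distrib ac_simps)
  qed
  ultimately have eq: "(bil a a / 2) \<star> (e - w) = (c * c + bil a' a' / 2) \<star> (e - w) + (2 * c) \<star> a'" by simp
  then have "(2 * c) \<star> a' = (bil a a / 2 - (c * c + bil a' a' / 2)) \<star> (e - w)"
    by (simp add: scale_left_diff_distrib)
  then have "bil ((2 * c) \<star> a') e = (bil a a / 2 - (c * c + bil a' a' / 2)) * 2"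
    by (simp add: bil_simps bil_e_e bil_w_e)
  then have "(bil a a / 2 - (c * c + bil a' a' / 2)) * 2 = 0" using V0_D[OF a'] by (simp add: bil_simps)
  then have "(2 * c) \<star> a' = 0" using \<open>(2 * c) \<star> a' = _\<close> two_neq_0 by simp
  then have "c = 0 \<or> a' = 0" using two_neq_0 by simp
  then show ?thesis
  proof
    assume "c = 0"
    then show ?thesis using a' by (simp add: a'_def)
  next
    assume "a' = 0"
    then have "g a = g (c \<star> (e - w))"
      using ga fA aut_diff[OF ga(1) e_A w_A] by (simp add: a'_def autD(3)[OF ga(1)])
    then have "a = c \<star> (e - w)"
      using autD(5)[OF ga(1)] A(1) fA by (auto simp: inj_on_def A_closed)
    then have "c = 0" using A(2) two_neq_0 by (simp add: bil_simps bil_e_e bil_w_e)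
    then show ?thesis using a' by (simp add: a'_def)
  qed
qed

lemma stab_V1: assumes g: "stab g" and x: "x \<in> V1" shows "g x \<in> V1"
proof -
  have ga: "is_aut g" "g w = w" using g by (auto simp: stab_def)
  have "w \<diamond> g x = (1/2) \<star> g x"
    using autD(4)[OF ga(1) w_A V1_D(1)[OF x]] autD(3)[OF ga(1) V1_D(1)[OF x]] ga V1_D(2)[OF x] by simp
  then show ?thesis using autD(1)[OF ga(1) V1_D(1)[OF x]] by (simp add: V1_def)
qed

lemma w_nz: "w \<noteq> 0"
  using bil_w_w by (auto simp: bil_simps)

lemma stab_bil_V1: assumes g: "stab g" and x: "x \<in> V1" and y: "y \<in> V1" shows "bil (g x) (g y) = bil x y"
proof -
  have ga: "is_aut g" "g w = w" using g by (auto simp: stab_def)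
  have A: "x \<in> A" "y \<in> A" "x \<diamond> y \<in> A" using x y V1_D(1) by (auto simp: A_closed)
  have "g (w \<diamond> (x \<diamond> y)) = w \<diamond> (g x \<diamond> g y)"
    using autD(4)[OF ga(1)] A w_A ga by simp
  then have "(bil x y / 2) \<star> w = (bil (g x) (g y) / 2) \<star> w"
    using V1_mul_V1_w[OF x y] V1_mul_V1_w[OF stab_V1[OF g x] stab_V1[OF g y]] autD(3)[OF ga(1) w_A] ga by simp
  then show ?thesis using w_nz two_neq_0 by simp
qed

lemma stab_V1_linear: "stab g \<Longrightarrow> V1_linear g"
  using stab_V1 autD(2,3)[of g] V1_D(1) by (auto simp: V1_linear_def stab_def)

lemma stab_mx_T: assumes g: "stab g" and a: "a \<in> V0" shows "mx g ** T a = T (g a) ** mx g"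
proof (rule app_eqI)
  fix v assume v: "v \<in> V1"
  have ga: "is_aut g" using g by (simp add: stab_def)
  have A: "a \<in> A" "v \<in> A" "a \<diamond> v \<in> A" using a v V0_D(1) V1_D(1) by (auto simp: A_closed)
  have "app (mx g ** T a) v = g (2 \<star> (a \<diamond> v))"
    using app_mx[OF stab_V1_linear[OF g]] V0_mul_V1[OF a v] V1_closed(3) by (simp add: app_mult app_T[OF a v])
  also have "\<dots> = 2 \<star> (g a \<diamond> g v)" using A by (simp add: autD(3,4)[OF ga])
  also have "\<dots> = app (T (g a) ** mx g) v"
    using app_mx[OF stab_V1_linear[OF g] v] app_T[OF stab_V0[OF g a] stab_V1[OF g v]] by (simp add: app_mult)
  finally show "app (mx g ** T a) v = app (T (g a) ** mx g) v" .
qed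

lemma stab_adj: assumes g: "stab g" shows "adj (mx g) ** mx g = mat 1" "mx g ** adj (mx g) = mat 1"
proof -
  have "(\<Sum>k\<in>UNIV. coord (g (xs i)) k * N k / N i * coord (g (xs j)) k) = (if i = j then 1 else 0)" for i j
  proof -
    have "(\<Sum>k\<in>UNIV. coord (g (xs i)) k * N k / N i * coord (g (xs j)) k) =
        (\<Sum>k\<in>UNIV. coord (g (xs i)) k * bil (xs k) (g (xs j))) / N i"
      unfolding sum_divide_distrib
    proof (intro sum.cong refl)
      fix k
      have "bil (xs k) (g (xs j)) = coord (g (xs j)) k * N k" by (simp add: bil_xs bil_sym)
      then show "coord (g (xs i)) k * N k / N i * coord (g (xs j)) k = coord (g (xs i)) k * bil (xs k) (g (xs j)) / N i"
        by simp
    qed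
    also have "\<dots> = bil (g (xs i)) (g (xs j)) / N i"
      using parseval[OF stab_V1[OF g xs_V1]] by simp
    also have "\<dots> = (if i = j then 1 else 0)"
      using stab_bil_V1[OF g xs_V1 xs_V1] N_nz xs_orth by simp
    finally show ?thesis .
  qed
  then show "adj (mx g) ** mx g = mat 1"
    by (simp add: vec_eq_iff matrix_matrix_mult_def adj_def mx_def mat_def)
  then show "mx g ** adj (mx g) = mat 1" by (simp add: matrix_left_right_inverse)
qed

text \<open>Conversely, an isometry of the half space that normalizes the Clifford vectors extends to an
  automorphism: the products within \<open>V1\<close> are recovered from the form and the action of \<open>V0\<close>.\<close>

lemma stab_exists:
  assumes M: "adj M ** M = mat 1"
    and fwd: "\<And>a. a \<in> V0 \<Longrightarrow> \<exists>a'\<in>V0. M ** T a = T a' ** M"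
    and bwd: "\<And>a'. a' \<in> V0 \<Longrightarrow> \<exists>a\<in>V0. M ** T a = T a' ** M"
  shows "\<exists>g. stab g \<and> mx g = M \<and> (\<forall>x. x \<notin> A \<longrightarrow> g x = undefined)"
proof -
  have M': "M ** adj M = mat 1" using M by (simp add: matrix_left_right_inverse)
  obtain \<theta> where \<theta>: "\<And>a. a \<in> V0 \<Longrightarrow> \<theta> a \<in> V0" "\<And>a. a \<in> V0 \<Longrightarrow> M ** T a = T (\<theta> a) ** M"
    using fwd by metis
  have T\<theta>: "T (\<theta> a) = M ** T a ** adj M" if "a \<in> V0" for a
    using \<theta>(2)[OF that] M' by (simp add: matrix_mul_assoc[symmetric])
  have \<theta>_unique: "\<theta> a = a'" if "a \<in> V0" "a' \<in> V0" "M ** T a = T a' ** M" for a a'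
  proof -
    have "T a' = M ** T a ** adj M" using that(3) M' by (simp add: matrix_mul_assoc[symmetric])
    then show ?thesis using T\<theta>[OF that(1)] T_inject[OF \<theta>(1)[OF that(1)] that(2)] by simp
  qed
  have \<theta>_add: "\<theta> (a + a') = \<theta> a + \<theta> a'" if "a \<in> V0" "a' \<in> V0" for a a'
    by (rule \<theta>_unique) (simp_all add: that V0_closed \<theta> T_add mat_mult_add)
  have \<theta>_scale: "\<theta> (c \<star> a) = c \<star> \<theta> a" if "a \<in> V0" for a c
    by (rule \<theta>_unique) (simp_all add: that V0_closed \<theta> T_scale matscale_mult)
  have \<theta>_surj: "\<exists>a\<in>V0. \<theta> a = a'" if "a' \<in> V0" for a'
    using bwd[OF that] \<theta>_unique[OF _ that] by blast
  have \<theta>_bil: "bil (\<theta> a) (\<theta> a') = bil a a'" if "a \<in> V0" "a' \<in> V0" for a a'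
  proof -
    have "mat (bil (\<theta> a) (\<theta> a')) = T (\<theta> a) ** T (\<theta> a') + T (\<theta> a') ** T (\<theta> a)"
      using T_T \<theta>(1) that by simp
    also have "\<dots> = M ** (T a ** (adj M ** M) ** T a') ** adj M + M ** (T a' ** (adj M ** M) ** T a) ** adj M"
      using that by (simp add: T\<theta> matrix_mul_assoc)
    also have "\<dots> = M ** (T a ** T a' + T a' ** T a) ** adj M"
      unfolding M by (simp add: mat_mult_add)
    also have "\<dots> = mat (bil a a')"
      using T_T[OF that] M' by (simp add: mat_mult_mat matscale_mult matscale_mat)
    finally show ?thesis by (simp add: mat_inject)
  qed
  have \<theta>0: "\<theta> 0 = 0" using \<theta>_scale[of 0 0] V0_closed(4) by simp
  have app0: "app M 0 = 0" using app_scale[of M 0 0] by simp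
  have \<theta>_app: "\<theta> a \<diamond> app M x = app M (a \<diamond> x)" if "a \<in> V0" "x \<in> V1" for a x
  proof -
    have "2 \<star> (\<theta> a \<diamond> app M x) = app (T (\<theta> a) ** M) x"
      using app_T[OF \<theta>(1)[OF that(1)] app_V1] by (simp add: app_mult)
    also have "\<dots> = 2 \<star> app M (a \<diamond> x)"
      unfolding \<theta>(2)[OF that(1), symmetric] using app_T[OF that] by (simp add: app_mult app_scale)
    finally show ?thesis using two_neq_0 by simp
  qed
  define h where "h v = bil w v \<star> w + ((bil e v - bil w v) / 2) \<star> (e - w) + \<theta> (pr0 v) + app M (pr1 v)" for v
  define f where "f = e - w"
  have fA: "f \<in> A" using A_closed w_A by (auto simp: f_def)
  have comp: "bil w (\<alpha> \<star> w + \<beta> \<star> f + a + x) = \<alpha>" "(bil e (\<alpha> \<star> w + \<beta> \<star> f + a + x) - bil w (\<alpha> \<star> w + \<beta> \<star> f + a + x)) / 2 = \<beta>"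
    "pr0 (\<alpha> \<star> w + \<beta> \<star> f + a + x) = a" "pr1 (\<alpha> \<star> w + \<beta> \<star> f + a + x) = x"
    if ax: "a \<in> V0" "x \<in> V1" for \<alpha> \<beta> a x
  proof -
    note D = V0_D[OF ax(1)] V1_D[OF ax(2)]
    show 1: "bil w (\<alpha> \<star> w + \<beta> \<star> f + a + x) = \<alpha>"
      using D by (simp add: f_def bil_simps bil_w_w bil_w_e)
    show 2: "(bil e (\<alpha> \<star> w + \<beta> \<star> f + a + x) - bil w (\<alpha> \<star> w + \<beta> \<star> f + a + x)) / 2 = \<beta>"
    proof -
      have "bil e (\<alpha> \<star> w + \<beta> \<star> f + a + x) = \<alpha> + \<beta> * 2"
        using D by (simp add: f_def bil_simps bil_w_e bil_e_e)
      then show ?thesis unfolding 1 using two_neq_0 by simp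
    qed
    show 3: "pr1 (\<alpha> \<star> w + \<beta> \<star> f + a + x) = x"
      unfolding pr1_def 1 using D two_neq_0
      by (simp add: f_def mul_simps w_idem scale_right_distrib)
    show "pr0 (\<alpha> \<star> w + \<beta> \<star> f + a + x) = a"
      unfolding pr0_def 3 f_def[symmetric] 2 unfolding 1 by simp
  qed
  have h: "h (\<alpha> \<star> w + \<beta> \<star> f + a + x) = \<alpha> \<star> w + \<beta> \<star> f + \<theta> a + app M x" if "a \<in> V0" "x \<in> V1" for \<alpha> \<beta> a x
    unfolding h_def f_def[symmetric] comp(2-4)[OF that] unfolding comp(1)[OF that] ..
  have decomp: "\<exists>\<alpha> \<beta>. \<exists>a\<in>V0. \<exists>x\<in>V1. v = \<alpha> \<star> w + \<beta> \<star> f + a + x" if "v \<in> A" for v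
    using peirce_decomposition[of v] pr0_V0[OF that] pr1_V1[OF that] unfolding f_def by blast
  have inA: "\<alpha> \<star> w + \<beta> \<star> f + a + x \<in> A" if "a \<in> V0" "x \<in> V1" for \<alpha> \<beta> a x
    using that w_A fA V0_D(1) V1_D(1) by (intro A_closed) auto
  have h_A: "h v \<in> A" if "v \<in> A" for v
    using decomp[OF that] inA[OF \<theta>(1) app_V1] h by fastforce
  have h_add: "h (u + v) = h u + h v" if "u \<in> A" "v \<in> A" for u v
  proof -
    have "pr1 (u + v) = pr1 u + pr1 v"
      by (simp add: pr1_def mul_simps bil_simps scale_right_distrib distrib_left scale_left_distrib)
    moreover have "pr0 (u + v) = pr0 u + pr0 v"
      unfolding pr0_def calculation bil_simps
      by (simp add: scale_left_distrib scale_left_diff_distrib diff_divide_distrib add_divide_distrib)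
    ultimately show ?thesis
      using pr0_V0 that unfolding h_def bil_simps
      by (simp add: \<theta>_add app_add scale_left_distrib scale_left_diff_distrib diff_divide_distrib add_divide_distrib)
  qed
  have h_scale: "h (c \<star> u) = c \<star> h u" if "u \<in> A" for u c
  proof -
    have "pr1 (c \<star> u) = c \<star> pr1 u"
      by (simp add: pr1_def mul_simps bil_simps scale_right_diff_distrib ac_simps)
    moreover have "pr0 (c \<star> u) = c \<star> pr0 u"
      unfolding pr0_def calculation bil_simps
      by (simp add: scale_right_diff_distrib right_diff_distrib[symmetric])
    ultimately show ?thesis
      using pr0_V0[OF that] unfolding h_def bil_simps
      by (simp add: \<theta>_scale app_scale scale_right_distrib right_diff_distrib[symmetric])
  qed
  have z: "0 \<in> V0" "0 \<in> V1" using V0_closed(4) V1_closed(4) by auto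
  have h0: "h 0 = 0" using h_scale[OF A_closed(6), of 0] by simp
  have h_w: "h w = w" using h[OF z, of 1 0] by (simp add: \<theta>0 app0)
  have h_f: "h f = f" using h[OF z, of 0 1] by (simp add: \<theta>0 app0)
  have h_V0: "h a = \<theta> a" if "a \<in> V0" for a using h[OF that z(2), of 0 0] by (simp add: app0)
  have h_V1: "h x = app M x" if "x \<in> V1" for x using h[OF z(1) that, of 0 0] by (simp add: \<theta>0)
  have ff: "f \<diamond> f = f" "w \<diamond> f = 0" "f \<diamond> w = 0"
    using w_idem by (simp_all add: f_def mul_simps)
  have f0: "f \<diamond> a = a" if "a \<in> V0" for a using f_V0[OF that] by (simp add: f_def)
  have f1: "f \<diamond> x = (1/2) \<star> x" if "x \<in> V1" for x using e_w_mul_V1[OF that] by (simp add: f_def)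
  have m00: "h (a \<diamond> a') = \<theta> a \<diamond> \<theta> a'" if "a \<in> V0" "a' \<in> V0" for a a'
    using V0_mul_V0[OF that] V0_mul_V0[OF \<theta>(1)[OF that(1)] \<theta>(1)[OF that(2)]] \<theta>_bil[OF that] h_scale[OF fA] h_f
    by (simp add: f_def)
  have m01: "h (a \<diamond> x) = \<theta> a \<diamond> app M x" if "a \<in> V0" "x \<in> V1" for a x
    using h_V1[OF V0_mul_V1[OF that]] \<theta>_app[OF that] by simp
  have m11: "h (x \<diamond> y) = app M x \<diamond> app M y" if "x \<in> V1" "y \<in> V1" for x y
  proof -
    have xyA: "x \<diamond> y \<in> A" "app M x \<diamond> app M y \<in> A" using that app_V1 V1_D(1) by (auto simp: A_closed)
    note p = pr0_V0[OF xyA(1)] pr0_V0[OF xyA(2)]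
    have "\<theta> (pr0 (x \<diamond> y)) - pr0 (app M x \<diamond> app M y) = 0"
    proof -
      have "bil (\<theta> (pr0 (x \<diamond> y)) - pr0 (app M x \<diamond> app M y)) c = 0" if c: "c \<in> V0" for c
      proof -
        obtain a where a: "a \<in> V0" "\<theta> a = c" using \<theta>_surj[OF c] by blast
        have "bil (\<theta> (pr0 (x \<diamond> y))) (\<theta> a) = bil x (a \<diamond> y)"
          using \<theta>_bil[OF p(1) a(1)] bil_pr0_mult[OF \<open>x \<in> V1\<close> \<open>y \<in> V1\<close> a(1)] by simp
        moreover have "bil (pr0 (app M x \<diamond> app M y)) (\<theta> a) = bil (app M x) (app M (a \<diamond> y))"
          using bil_pr0_mult[OF app_V1 app_V1 \<theta>(1)[OF a(1)]] \<theta>_app[OF a(1) \<open>y \<in> V1\<close>] by simp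
        moreover have "bil (app M x) (app M (a \<diamond> y)) = bil x (a \<diamond> y)"
          by (rule bil_app_app[OF \<open>x \<in> V1\<close> V0_mul_V1[OF a(1) \<open>y \<in> V1\<close>] M])
        ultimately show ?thesis using a(2) by (simp add: bil_simps)
      qed
      then show ?thesis
        using V0_nondegenerate V0_closed(2)[OF \<theta>(1)[OF p(1)] p(2)] unfolding nondegenerate_on_def by blast
    qed
    then have pr: "\<theta> (pr0 (x \<diamond> y)) = pr0 (app M x \<diamond> app M y)" by simp
    have "x \<diamond> y = (bil x y / 2) \<star> w + (bil x y / 4) \<star> f + pr0 (x \<diamond> y) + 0"
      using V1_mul_V1[OF that] by (simp add: f_def)
    then have "h (x \<diamond> y) = (bil x y / 2) \<star> w + (bil x y / 4) \<star> f + pr0 (app M x \<diamond> app M y)"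
      using h[OF p(1) z(2), of "bil x y / 2" "bil x y / 4"] by (simp add: pr app0)
    also have "\<dots> = app M x \<diamond> app M y"
      using V1_mul_V1[OF app_V1 app_V1, of M x M y] bil_app_app[OF that M] by (simp add: f_def)
    finally show ?thesis .
  qed
  have h_mul: "h (u \<diamond> v) = h u \<diamond> h v" if u: "u \<in> A" and v: "v \<in> A" for u v
  proof -
    obtain \<alpha> \<beta> a x where U: "u = \<alpha> \<star> w + \<beta> \<star> f + a + x" "a \<in> V0" "x \<in> V1"
      using decomp[OF u] by blast
    obtain \<alpha>' \<beta>' a' x' where Vd: "v = \<alpha>' \<star> w + \<beta>' \<star> f + a' + x'" "a' \<in> V0" "x' \<in> V1"
      using decomp[OF v] by blast
    note AA = w_A fA V0_D(1)[OF U(2)] V1_D(1)[OF U(3)] V0_D(1)[OF Vd(2)] V1_D(1)[OF Vd(3)]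
    note D = V0_D[OF U(2)] V1_D[OF U(3)] V0_D[OF Vd(2)] V1_D[OF Vd(3)]
    note D' = V0_D[OF \<theta>(1)[OF U(2)]] V1_D[OF app_V1, of M x] V0_D[OF \<theta>(1)[OF Vd(2)]] V1_D[OF app_V1, of M x']
    have mf: "a \<diamond> f = a" "a' \<diamond> f = a'" "x \<diamond> f = (1/2) \<star> x" "x' \<diamond> f = (1/2) \<star> x'"
      "\<theta> a \<diamond> f = \<theta> a" "app M x \<diamond> f = (1/2) \<star> app M x"
      using f0 f1 U Vd \<theta>(1) app_V1 by (simp_all add: mul_comm[of _ f])
    show ?thesis
      unfolding U(1) Vd(1) h[OF U(2,3)] h[OF Vd(2,3)] mul_add_left mul_add_right mul_scale_left mul_scale_right
      using AA D D'
      by (simp add: h_add h_scale A_closed h_w h_f h_V0 h_V1 U Vd f0 f1 mf ff w_idem \<theta>(1) app_V1 m00 m01 m11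
          mul_comm[of x a'] mul_comm[of "app M x" "\<theta> a'"] h0)
  qed
  have h_inj: "inj_on h A"
  proof (rule inj_onI)
    fix u v assume u: "u \<in> A" and v: "v \<in> A" and eq: "h u = h v"
    obtain \<alpha> \<beta> a x where U: "u - v = \<alpha> \<star> w + \<beta> \<star> f + a + x" "a \<in> V0" "x \<in> V1"
      using decomp[of "u - v"] u v by (auto simp: A_closed)
    have "h ((u - v) + v) = h (u - v) + h v" using u v by (intro h_add A_closed)
    then have "h (u - v) = 0" using eq by simp
    then have 0: "\<alpha> \<star> w + \<beta> \<star> f + \<theta> a + app M x = 0 \<star> w + 0 \<star> f + 0 + 0" using U h by simp
    note c = comp[OF \<theta>(1)[OF U(2)] app_V1, of \<alpha> \<beta> M x] and c0 = comp[OF z, of 0 0]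
    have "\<alpha> = 0" "\<beta> = 0" "\<theta> a = 0" "app M x = 0"
      by (rule trans[OF c(1)[unfolded 0, symmetric] c0(1)] trans[OF c(2)[unfolded 0, symmetric] c0(2)]
          trans[OF c(3)[unfolded 0, symmetric] c0(3)] trans[OF c(4)[unfolded 0, symmetric] c0(4)])+
    moreover have "a = 0" using \<open>\<theta> a = 0\<close> \<theta>_bil[OF U(2)] V0_nondegenerate U(2)
      unfolding nondegenerate_on_def by (simp add: bil_simps)
    moreover have "x = app (adj M ** M) x" using U by (simp add: M app_mat)
    then have "x = 0" using \<open>app M x = 0\<close> app_scale[of "adj M" 0 0] by (simp add: app_mult)
    ultimately show "u = v" using U by simp
  qed
  have h_surj: "h ` A = A"
  proof (intro equalityI subsetI)
    fix v assume v: "v \<in> A"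
    obtain \<alpha> \<beta> a' x' where V': "v = \<alpha> \<star> w + \<beta> \<star> f + a' + x'" "a' \<in> V0" "x' \<in> V1"
      using decomp[OF v] by blast
    obtain a where a: "a \<in> V0" "\<theta> a = a'" using \<theta>_surj[OF V'(2)] by blast
    have "app M (app (adj M) x') = x'" using V' M' by (simp add: app_mult[symmetric] app_mat)
    then have "h (\<alpha> \<star> w + \<beta> \<star> f + a + app (adj M) x') = v"
      using h[OF a(1) app_V1] a V' by simp
    then show "v \<in> h ` A" using inA[OF a(1) app_V1] by (metis imageI)
  qed (use h_A in auto)
  define g where "g = restrict h A"
  have "is_aut g"
    unfolding is_aut_def
  proof (intro conjI)
    show "bij_betw g A A" using h_inj h_surj by (auto simp: bij_betw_def g_def inj_on_def image_def)
  qed (auto simp: g_def A_closed h_add h_scale h_mul)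
  moreover have "g w = w" using w_A h_w by (simp add: g_def)
  moreover have "mx g = M"
  proof -
    have "mx g = mx (app M)" using V1_D(1) h_V1 by (intro mx_cong) (simp add: g_def)
    then show ?thesis by (simp add: mx_app)
  qed
  ultimately show ?thesis by (auto simp: stab_def g_def intro!: exI[of _ g])
qed

end

context spin_rep
begin

section \<open>The spin representation of the stabilizer\<close>

definition stab_group :: "('v \<Rightarrow> 'v) monoid" where
  "stab_group = BijGroup A\<lparr>carrier := {g \<in> Bij A. stab g}\<rparr>"

lemma stab_group_carrier: "carrier stab_group = {g \<in> Bij A. stab g}"
  by (simp add: stab_group_def)

lemma stab_group_mult: "g \<in> Bij A \<Longrightarrow> h \<in> Bij A \<Longrightarrow> g \<otimes>\<^bsub>stab_group\<^esub> h = compose A g h"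
  by (simp add: stab_group_def BijGroup_def)

lemma stab_group_one: "\<one>\<^bsub>stab_group\<^esub> = (\<lambda>x\<in>A. x)"
  by (simp add: stab_group_def BijGroup_def)

lemma stab_compose: assumes "stab g" "stab h" shows "stab (compose A g h)"
proof -
  have g: "is_aut g" "g w = w" and h: "is_aut h" "h w = w" using assms by (auto simp: stab_def)
  have "bij_betw (compose A g h) A A"
    using g h by (intro bij_betw_compose) (auto simp: is_aut_def)
  then show ?thesis
    using autD[OF g(1)] autD[OF h(1)] w_A g(2) h(2)
    unfolding stab_def is_aut_def by (auto simp: compose_def A_closed)
qed

lemma stab_restrict_inv: assumes g: "stab g" shows "stab (\<lambda>x\<in>A. inv_into A g x)"
proof -
  let ?h = "\<lambda>x\<in>A. inv_into A g x"
  have ga: "is_aut g" "g w = w" using g by (auto simp: stab_def)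
  have bij: "bij_betw g A A" using ga by (simp add: is_aut_def)
  have hA: "?h x \<in> A" "g (?h x) = x" if "x \<in> A" for x
    using that bij by (auto simp: bij_betw_def inv_into_into f_inv_into_f)
  have eq: "?h x = y" if "y \<in> A" "g y = x" for x y
    using that bij autD(1)[OF ga(1)] by (auto simp: bij_betw_def inv_into_f_f)
  have "bij_betw ?h A A"
    using bij_betw_inv_into[OF bij] bij_betw_cong[of A ?h "inv_into A g" A] by simp
  moreover have "?h (x + y) = ?h x + ?h y" if "x \<in> A" "y \<in> A" for x y
    using that hA by (intro eq) (simp_all add: A_closed autD(2)[OF ga(1)])
  moreover have "?h (c \<star> x) = c \<star> ?h x" if "x \<in> A" for x c
    using that hA by (intro eq) (simp_all add: A_closed autD(3)[OF ga(1)])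
  moreover have "?h (x \<diamond> y) = ?h x \<diamond> ?h y" if "x \<in> A" "y \<in> A" for x y
    using that hA by (intro eq) (simp_all add: A_closed autD(4)[OF ga(1)])
  moreover have "?h w = w" using ga w_A by (intro eq)
  ultimately show ?thesis unfolding stab_def is_aut_def by blast
qed

lemma stab_id: "stab (\<lambda>x\<in>A. x)"
  unfolding stab_def is_aut_def by (auto simp: A_closed w_A bij_betw_def inj_on_def)

lemma stab_group_subgroup: "subgroup {g \<in> Bij A. stab g} (BijGroup A)"
proof -
  interpret B: group "BijGroup A" by (rule group_BijGroup)
  show ?thesis
  proof (rule B.subgroupI)
    show "{g \<in> Bij A. stab g} \<subseteq> carrier (BijGroup A)" by (auto simp: BijGroup_def)
    show "{g \<in> Bij A. stab g} \<noteq> {}" using stab_id id_Bij[of A] by auto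
    show "inv\<^bsub>BijGroup A\<^esub> g \<in> {g \<in> Bij A. stab g}" if "g \<in> {g \<in> Bij A. stab g}" for g
      using that stab_restrict_inv[of g] restrict_inv_into_Bij[of g A] by (simp add: inv_BijGroup)
    show "g \<otimes>\<^bsub>BijGroup A\<^esub> h \<in> {g \<in> Bij A. stab g}"
      if "g \<in> {g \<in> Bij A. stab g}" "h \<in> {g \<in> Bij A. stab g}" for g h
      using that stab_compose[of g h] compose_Bij[of g A h] by (simp add: BijGroup_def)
  qed
qed

lemma stab_group_group: "group stab_group"
  unfolding stab_group_def by (rule subgroup.subgroup_is_group[OF stab_group_subgroup group_BijGroup])

lemma mx_compose:
  assumes "stab g" "stab h"
  shows "mx (compose A g h) = mx g ** mx h"
proof -
  have "mx (compose A g h) = mx (\<lambda>v. g (h v))"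
    by (rule mx_cong) (simp add: compose_def V1_D(1))
  then show ?thesis using mx_comp[OF stab_V1_linear stab_V1_linear] assms by simp
qed

lemma stab_V0_surj: assumes g: "g \<in> Bij A" "stab g" and a: "a \<in> V0" shows "\<exists>a'\<in>V0. g a' = a"
proof
  have aA: "a \<in> A" by (rule V0_D(1)[OF a])
  show "(\<lambda>x\<in>A. inv_into A g x) a \<in> V0" by (rule stab_V0[OF stab_restrict_inv[OF g(2)] a])
  show "g ((\<lambda>x\<in>A. inv_into A g x) a) = a"
    using g(1) aA by (auto simp: Bij_def bij_betw_def f_inv_into_f)
qed

lemma clifford_even_eq: "clifford_even scale q V0 = cm.cl ` {f \<in> carrier cm.F. even_fun f}"
  by (simp add: clifford_even_def even_fun_def)

lemma clifford_vec_eq: "clifford_vec scale q V0 a = cm.cl (word 1 [a])"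
  by (simp add: clifford_vec_def)

lemma spin_group_simps:
  "carrier (spin_group scale q V0) = {s \<in> Units cm.Cl. s \<in> clifford_even scale q V0 \<and>
       (\<lambda>x. s \<otimes>\<^bsub>cm.Cl\<^esub> x \<otimes>\<^bsub>cm.Cl\<^esub> inv\<^bsub>cm.Cl\<^esub> s) ` clifford_vec scale q V0 ` V0 = clifford_vec scale q V0 ` V0 \<and>
       s \<otimes>\<^bsub>cm.Cl\<^esub> clifford_rev s = \<one>\<^bsub>cm.Cl\<^esub>}"
  "monoid.mult (spin_group scale q V0) = monoid.mult cm.Cl"
  "\<one>\<^bsub>spin_group scale q V0\<^esub> = \<one>\<^bsub>cm.Cl\<^esub>"
  by (simp_all add: spin_group_def Let_def units_of_def)

lemma word1_closed: "a \<in> V0 \<Longrightarrow> word c [a] \<in> carrier cm.F"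
  by (rule cm.word_V_closed) simp

lemma word0_closed: "word c [] \<in> carrier cm.F"
  by (rule cm.word_V_closed) simp

lemma ev_word0: "cm.ev (word c []) = mat c"
  by (simp add: cm.ev_word cm.mp_simps matscale_mat)

lemma ev_word1: "cm.ev (word 1 [a]) = T a"
  by (simp add: cm.ev_word cm.mp_simps matscale_one)

text \<open>Clifford vectors act by self-adjoint matrices, so reversal corresponds to the adjoint.\<close>

lemma ev_rev: "f \<in> carrier cm.F \<Longrightarrow> cm.ev (f \<circ> rev) = adj (cm.ev f)"
proof (induction rule: free_algebra_induct)
  case (word c u)
  have "set u \<subseteq> V0 \<Longrightarrow> cm.mp (rev u) = adj (cm.mp u)" for u
    by (induction u) (simp_all add: cm.mp_simps cm.mp_append adj_one adj_mult adj_T)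
  then show ?case using word by (simp add: word_rev cm.ev_word adj_scale in_lists_conv_set subset_iff)
next
  case (add f g)
  have "(\<lambda>u. f u + g u) \<circ> rev = (\<lambda>u. (f \<circ> rev) u + (g \<circ> rev) u)" by (simp add: fun_eq_iff)
  then show ?case using add by (simp add: cm.ev_add rev_closed adj_add del: o_apply)
qed

definition phi :: "('v \<Rightarrow> 'v) \<Rightarrow> ('v list \<Rightarrow> 'f) set" where
  "phi g = cm.cl (cm.lift (mx g))"

lemma cl_eq_even:
  assumes "f \<in> carrier cm.F" "g \<in> carrier cm.F" "even_fun f" "even_fun g" "cm.ev f = cm.ev g"
  shows "cm.cl f = cm.cl g"
  using cm.cong_even[OF assms] cm.cl_eq_iff[OF assms(1,2)] by simp

lemma cl_ev: "f \<in> carrier cm.F \<Longrightarrow> g \<in> carrier cm.F \<Longrightarrow> cm.cl f = cm.cl g \<Longrightarrow> cm.ev f = cm.ev g"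
  using cm.cl_eq_iff cm.ev_cong by blast

lemma cl_inverse:
  assumes "f \<in> carrier cm.F" "g \<in> carrier cm.F" "even_fun f" "even_fun g"
    "cm.ev f ** cm.ev g = mat 1"
  shows "cm.cl f \<otimes>\<^bsub>cm.Cl\<^esub> cm.cl g = \<one>\<^bsub>cm.Cl\<^esub>"
  unfolding cm.cl_mult[OF assms(1,2)] cm.cl_one
  using assms by (intro cl_eq_even)
    (simp_all add: conv_closed word0_closed even_conv even_fun_simps cm.ev_conv ev_word0)

lemma cl_conjugate:
  assumes f: "f \<in> carrier cm.F" "even_fun f" and g: "g \<in> carrier cm.F" "even_fun g"
    and inv: "cm.ev f ** cm.ev g = mat 1" and a: "a \<in> V0" "a' \<in> V0"
    and eq: "cm.ev f ** T a = T a' ** cm.ev f"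
  shows "cm.cl f \<otimes>\<^bsub>cm.Cl\<^esub> clifford_vec scale q V0 a \<otimes>\<^bsub>cm.Cl\<^esub> cm.cl g = clifford_vec scale q V0 a'"
proof -
  note W = word1_closed[OF a(1), of 1] word1_closed[OF a(2), of 1]
  have "cm.cong (conv (conv f (word 1 [a])) g) (word 1 [a'])"
  proof (rule cm.cong_odd)
    show "odd_fun (conv (conv f (word 1 [a])) g)"
      using f g by (intro even_conv(3) even_conv(4) even_fun_simps) simp_all
    have "cm.ev (conv (conv f (word 1 [a])) g) = T a' ** (cm.ev f ** cm.ev g)"
      using f g W by (simp add: cm.ev_conv conv_closed ev_word1 eq matrix_mul_assoc)
    then show "cm.ev (conv (conv f (word 1 [a])) g) = cm.ev (word 1 [a'])"
      by (simp add: inv ev_word1)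
  qed (use f g W in \<open>simp_all add: conv_closed even_fun_simps\<close>)
  then show ?thesis
    using f g W by (simp add: clifford_vec_eq cm.cl_mult conv_closed cm.cl_eq_iff)
qed

lemma phi_inverse:
  assumes "stab g"
  shows "phi g \<otimes>\<^bsub>cm.Cl\<^esub> cm.cl (cm.lift (adj (mx g))) = \<one>\<^bsub>cm.Cl\<^esub>"
    "cm.cl (cm.lift (adj (mx g))) \<otimes>\<^bsub>cm.Cl\<^esub> phi g = \<one>\<^bsub>cm.Cl\<^esub>"
  unfolding phi_def
  by (rule cl_inverse[OF cm.lift_closed cm.lift_closed cm.lift_even cm.lift_even],
      simp add: cm.ev_lift stab_adj[OF assms])+

lemma phi_closed: "phi g \<in> carrier cm.Cl"
  unfolding phi_def by (intro cm.cl_closed cm.lift_closed)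

lemma phi_spin:
  assumes g: "g \<in> Bij A" "stab g"
  shows "phi g \<in> carrier (spin_group scale q V0)"
proof -
  let ?s = "phi g" and ?t = "cm.cl (cm.lift (adj (mx g)))"
  have tC: "?t \<in> carrier cm.Cl" by (intro cm.cl_closed cm.lift_closed)
  note inv = phi_inverse[OF g(2)]
  have unit: "?s \<in> Units cm.Cl" unfolding Units_def using phi_closed tC inv by auto
  have inv_s: "inv\<^bsub>cm.Cl\<^esub> ?s = ?t" by (rule cm.Cl.inv_char[OF phi_closed tC inv])
  have conj: "?s \<otimes>\<^bsub>cm.Cl\<^esub> clifford_vec scale q V0 a \<otimes>\<^bsub>cm.Cl\<^esub> inv\<^bsub>cm.Cl\<^esub> ?s = clifford_vec scale q V0 (g a)"
    if a: "a \<in> V0" for a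
    unfolding inv_s unfolding phi_def using stab_adj[OF g(2)] stab_mx_T[OF g(2) a] a stab_V0[OF g(2) a]
    by (intro cl_conjugate cm.lift_closed cm.lift_even) (simp_all add: cm.ev_lift)
  have "(\<lambda>x. ?s \<otimes>\<^bsub>cm.Cl\<^esub> x \<otimes>\<^bsub>cm.Cl\<^esub> inv\<^bsub>cm.Cl\<^esub> ?s) ` clifford_vec scale q V0 ` V0 =
      clifford_vec scale q V0 ` (g ` V0)"
    unfolding image_image using conj by (intro image_cong) auto
  moreover have "g ` V0 = V0" using stab_V0[OF g(2)] stab_V0_surj[OF g] by (auto simp: image_iff)
  moreover have "?s \<in> clifford_even scale q V0"
    unfolding clifford_even_eq phi_def using cm.lift_closed cm.lift_even by blast
  moreover have "?s \<otimes>\<^bsub>cm.Cl\<^esub> clifford_rev ?s = \<one>\<^bsub>cm.Cl\<^esub>"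
    unfolding phi_def cm.clifford_rev_cl[OF cm.lift_closed] using stab_adj[OF g(2)]
    by (intro cl_inverse cm.lift_closed cm.lift_even even_fun_rev rev_closed)
      (simp_all add: ev_rev[OF cm.lift_closed] cm.ev_lift)
  ultimately show ?thesis using unit by (simp add: spin_group_simps)
qed

lemma stab_ext: "g \<in> Bij A \<Longrightarrow> x \<notin> A \<Longrightarrow> g x = undefined"
  by (auto simp: Bij_def extensional_def)

lemma stab_eqI:
  assumes g: "g \<in> Bij A" "stab g" and h: "h \<in> Bij A" "stab h" and M: "mx g = mx h"
  shows "g = h"
proof
  fix x
  show "g x = h x"
  proof (cases "x \<in> A")
    case False
    then show ?thesis using stab_ext[OF g(1)] stab_ext[OF h(1)] by simp
  next
    case True
    have ga: "is_aut g" "g w = w" "g e = e" and ha: "is_aut h" "h w = w" "h e = e"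
      using g h aut_e by (auto simp: stab_def)
    have 1: "g v = h v" if "v \<in> V1" for v
      using app_mx[OF stab_V1_linear[OF g(2)] that] app_mx[OF stab_V1_linear[OF h(2)] that] M by simp
    have 0: "g a = h a" if a: "a \<in> V0" for a
    proof (rule T_inject)
      have "T (g a) ** mx g = T (h a) ** mx g"
        using stab_mx_T[OF g(2) a] stab_mx_T[OF h(2) a] M by simp
      then have "T (g a) ** (mx g ** adj (mx g)) = T (h a) ** (mx g ** adj (mx g))"
        by (simp add: matrix_mul_assoc)
      then show "T (g a) = T (h a)" using stab_adj[OF g(2)] by simp
    qed (use stab_V0 g h a in auto)
    have mem: "pr0 x \<in> V0" "pr1 x \<in> V1" "pr0 x \<in> A" "pr1 x \<in> A"
      using pr0_V0[OF True] pr1_V1[OF True] V0_D(1) V1_D(1) by auto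
    have expand: "k x = bil w x \<star> k w + ((bil e x - bil w x) / 2) \<star> (k e - k w) + k (pr0 x) + k (pr1 x)"
      if k: "is_aut k" for k
    proof -
      have "k x = k (bil w x \<star> w + ((bil e x - bil w x) / 2) \<star> (e - w) + pr0 x + pr1 x)"
        by (subst peirce_decomposition[of x]) (rule refl)
      also have "\<dots> = bil w x \<star> k w + ((bil e x - bil w x) / 2) \<star> (k e - k w) + k (pr0 x) + k (pr1 x)"
        using mem w_A by (simp add: autD(2,3)[OF k] aut_diff[OF k] A_closed)
      finally show ?thesis .
    qed
    show ?thesis using expand[OF ga(1)] expand[OF ha(1)] ga ha 0[OF mem(1)] 1[OF mem(2)] by simp
  qed
qed

text \<open>A spin element is inverse to its reversal, which makes its matrix an isometry of the half space, and
  normalizing the Clifford vectors is the other hypothesis under which the matrix extends to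
  an automorphism.\<close>

lemma phi_surj:
  assumes s: "s \<in> carrier (spin_group scale q V0)"
  shows "\<exists>g\<in>Bij A. stab g \<and> phi g = s"
proof -
  have unit: "s \<in> Units cm.Cl" and ev: "s \<in> clifford_even scale q V0"
    and conj: "(\<lambda>x. s \<otimes>\<^bsub>cm.Cl\<^esub> x \<otimes>\<^bsub>cm.Cl\<^esub> inv\<^bsub>cm.Cl\<^esub> s) ` clifford_vec scale q V0 ` V0 = clifford_vec scale q V0 ` V0"
    and rev: "s \<otimes>\<^bsub>cm.Cl\<^esub> clifford_rev s = \<one>\<^bsub>cm.Cl\<^esub>"
    using s by (auto simp: spin_group_simps)
  obtain f where f: "f \<in> carrier cm.F" "even_fun f" "s = cm.cl f"
    using ev by (auto simp: clifford_even_eq)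
  have "inv\<^bsub>cm.Cl\<^esub> s \<in> carrier cm.Cl" using unit by (rule cm.Cl.Units_inv_closed)
  then obtain f' where f': "f' \<in> carrier cm.F" "inv\<^bsub>cm.Cl\<^esub> s = cm.cl f'"
    by (auto simp: cm.cl_carrier)
  define M where "M = cm.ev f"
  have "cm.cl (conv f (f \<circ> rev)) = cm.cl (word 1 [])"
    using rev f by (simp add: cm.clifford_rev_cl cm.cl_mult rev_closed cm.cl_one)
  then have "cm.ev (conv f (f \<circ> rev)) = mat 1"
    using f cl_ev[of "conv f (f \<circ> rev)" "word 1 []"] by (simp add: conv_closed rev_closed word0_closed ev_word0)
  then have MM: "M ** adj M = mat 1"
    using f by (simp add: cm.ev_conv rev_closed ev_rev M_def)
  have "cm.cl (conv f' f) = cm.cl (word 1 [])"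
    using cm.Cl.Units_l_inv[OF unit] f f' by (simp add: cm.cl_mult cm.cl_one)
  then have "cm.ev (conv f' f) = mat 1"
    using f f' cl_ev[of "conv f' f" "word 1 []"] by (simp add: conv_closed word0_closed ev_word0)
  then have fM: "cm.ev f' ** M = mat 1" using f f' by (simp add: cm.ev_conv M_def)
  have key: "M ** T a = T a' ** M"
    if "s \<otimes>\<^bsub>cm.Cl\<^esub> clifford_vec scale q V0 a \<otimes>\<^bsub>cm.Cl\<^esub> inv\<^bsub>cm.Cl\<^esub> s = clifford_vec scale q V0 a'" "a \<in> V0" "a' \<in> V0" for a a'
  proof -
    note W = word1_closed[OF that(2), of 1] word1_closed[OF that(3), of 1]
    have "cm.cl (conv (conv f (word 1 [a])) f') = cm.cl (word 1 [a'])"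
      using that(1) f f' W by (simp add: clifford_vec_eq cm.cl_mult conv_closed)
    then have "cm.ev (conv (conv f (word 1 [a])) f') = cm.ev (word 1 [a'])"
      using f f' W by (intro cl_ev) (simp_all add: conv_closed)
    then have "M ** T a ** cm.ev f' = T a'"
      using f f' W by (simp add: cm.ev_conv conv_closed ev_word1 M_def)
    then have "M ** T a ** (cm.ev f' ** M) = T a' ** M" by (simp add: matrix_mul_assoc)
    then show ?thesis by (simp add: fM)
  qed
  have "\<exists>g. stab g \<and> mx g = M \<and> (\<forall>x. x \<notin> A \<longrightarrow> g x = undefined)"
  proof (rule stab_exists)
    show "adj M ** M = mat 1" using MM by (simp add: matrix_left_right_inverse)
    show "\<exists>a'\<in>V0. M ** T a = T a' ** M" if a: "a \<in> V0" for a
    proof -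
      have "s \<otimes>\<^bsub>cm.Cl\<^esub> clifford_vec scale q V0 a \<otimes>\<^bsub>cm.Cl\<^esub> inv\<^bsub>cm.Cl\<^esub> s \<in> clifford_vec scale q V0 ` V0"
        using conj a by blast
      then show ?thesis using key a by blast
    qed
    show "\<exists>a\<in>V0. M ** T a = T a' ** M" if a': "a' \<in> V0" for a'
    proof -
      have "clifford_vec scale q V0 a' \<in>
          (\<lambda>x. s \<otimes>\<^bsub>cm.Cl\<^esub> x \<otimes>\<^bsub>cm.Cl\<^esub> inv\<^bsub>cm.Cl\<^esub> s) ` clifford_vec scale q V0 ` V0"
        using conj a' by blast
      then obtain a where "a \<in> V0" "s \<otimes>\<^bsub>cm.Cl\<^esub> clifford_vec scale q V0 a \<otimes>\<^bsub>cm.Cl\<^esub> inv\<^bsub>cm.Cl\<^esub> s = clifford_vec scale q V0 a'"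
        by auto
      then show ?thesis using key a' by blast
    qed
  qed
  then obtain g where g: "stab g" "mx g = M" "\<forall>x. x \<notin> A \<longrightarrow> g x = undefined" by blast
  have "g \<in> Bij A" using g by (auto simp: Bij_def extensional_def stab_def is_aut_def)
  moreover have "phi g = s"
    unfolding phi_def g(2) f(3) using f by (intro cl_eq_even cm.lift_closed cm.lift_even) (simp_all add: cm.ev_lift M_def)
  ultimately show ?thesis using g(1) by blast
qed

lemma phi_mult:
  assumes "g \<in> Bij A" "stab g" "h \<in> Bij A" "stab h"
  shows "phi (compose A g h) = phi g \<otimes>\<^bsub>cm.Cl\<^esub> phi h"
  unfolding phi_def cm.cl_mult[OF cm.lift_closed cm.lift_closed] mx_compose[OF assms(2,4)]
  by (intro cl_eq_even cm.lift_closed cm.lift_even conv_closed even_conv)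
    (simp add: cm.ev_conv cm.lift_closed cm.ev_lift)

lemma phi_iso: "phi \<in> iso stab_group (spin_group scale q V0)"
proof (rule isoI)
  show "phi \<in> hom stab_group (spin_group scale q V0)"
  proof (rule homI)
    show "phi g \<in> carrier (spin_group scale q V0)" if "g \<in> carrier stab_group" for g
      using that phi_spin by (simp add: stab_group_carrier)
    show "phi (g \<otimes>\<^bsub>stab_group\<^esub> h) = phi g \<otimes>\<^bsub>spin_group scale q V0\<^esub> phi h"
      if "g \<in> carrier stab_group" "h \<in> carrier stab_group" for g h
      using that by (simp add: stab_group_carrier stab_group_mult spin_group_simps phi_mult)
  qed
  show "bij_betw phi (carrier stab_group) (carrier (spin_group scale q V0))"
    unfolding bij_betw_def
  proof
    show "inj_on phi (carrier stab_group)"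
    proof (rule inj_onI)
      fix g h assume g: "g \<in> carrier stab_group" and h: "h \<in> carrier stab_group" and eq: "phi g = phi h"
      have "cm.ev (cm.lift (mx g)) = cm.ev (cm.lift (mx h))"
        using eq unfolding phi_def by (intro cl_ev cm.lift_closed)
      then show "g = h" using g h by (intro stab_eqI) (simp_all add: stab_group_carrier cm.ev_lift)
    qed
    show "phi ` carrier stab_group = carrier (spin_group scale q V0)"
      using phi_spin phi_surj by (fastforce simp: stab_group_carrier)
  qed
qed

lemma phi_inv:
  assumes g: "g \<in> carrier stab_group"
  shows "inv\<^bsub>spin_group scale q V0\<^esub> (phi g) = phi (inv\<^bsub>stab_group\<^esub> g)"
proof -
  interpret G: group stab_group by (rule stab_group_group)
  have hom: "phi (x \<otimes>\<^bsub>stab_group\<^esub> y) = phi x \<otimes>\<^bsub>cm.Cl\<^esub> phi y"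
    if "x \<in> carrier stab_group" "y \<in> carrier stab_group" for x y
    using that by (simp add: stab_group_carrier stab_group_mult phi_mult)
  have gi: "inv\<^bsub>stab_group\<^esub> g \<in> carrier stab_group" using g by simp
  have one: "phi \<one>\<^bsub>stab_group\<^esub> = \<one>\<^bsub>cm.Cl\<^esub>"
  proof -
    have "mx (\<lambda>x\<in>A. x) = mat 1" using mx_cong[of "\<lambda>x\<in>A. x" "\<lambda>x. x"] V1_D(1) mx_id by simp
    then show ?thesis unfolding phi_def stab_group_one cm.cl_one
      by (intro cl_eq_even cm.lift_closed cm.lift_even word0_closed even_fun_simps)
        (simp_all add: cm.ev_lift ev_word0)
  qed
  have inv: "phi g \<otimes>\<^bsub>cm.Cl\<^esub> phi (inv\<^bsub>stab_group\<^esub> g) = \<one>\<^bsub>cm.Cl\<^esub>"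
    "phi (inv\<^bsub>stab_group\<^esub> g) \<otimes>\<^bsub>cm.Cl\<^esub> phi g = \<one>\<^bsub>cm.Cl\<^esub>"
    using hom[OF g gi] hom[OF gi g] g one by simp_all
  show ?thesis
    unfolding m_inv_def[of "spin_group scale q V0"] spin_group_simps(2,3)
  proof (rule the_equality)
    show "phi (inv\<^bsub>stab_group\<^esub> g) \<in> carrier (spin_group scale q V0) \<and>
      phi g \<otimes>\<^bsub>cm.Cl\<^esub> phi (inv\<^bsub>stab_group\<^esub> g) = \<one>\<^bsub>cm.Cl\<^esub> \<and> phi (inv\<^bsub>stab_group\<^esub> g) \<otimes>\<^bsub>cm.Cl\<^esub> phi g = \<one>\<^bsub>cm.Cl\<^esub>"
      using gi inv phi_spin by (simp add: stab_group_carrier)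
  next
    fix y assume y: "y \<in> carrier (spin_group scale q V0) \<and> phi g \<otimes>\<^bsub>cm.Cl\<^esub> y = \<one>\<^bsub>cm.Cl\<^esub> \<and> y \<otimes>\<^bsub>cm.Cl\<^esub> phi g = \<one>\<^bsub>cm.Cl\<^esub>"
    then have "y \<in> carrier cm.Cl" by (auto simp: spin_group_simps Units_def)
    then show "y = phi (inv\<^bsub>stab_group\<^esub> g)"
      using cm.Cl.inv_unique[of y "phi g" "phi (inv\<^bsub>stab_group\<^esub> g)"] y inv phi_closed by blast
  qed
qed

section \<open>The centralizer of the central involution\<close>

text \<open>Conjugation by a unit vector is the negative of a reflection. Two of them give an element of the
  spin group, hence an automorphism in the stabilizer.\<close>

lemma T_reflect:
  assumes u: "u \<in> V0" and a: "a \<in> V0" and qu: "q u = 1"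
  shows "T u ** T a ** T u = T (bil a u \<star> u - a)" "bil a u \<star> u - a \<in> V0"
proof -
  show "bil a u \<star> u - a \<in> V0" using u a by (intro V0_closed)
  have "T (bil a u \<star> u - a) + T a = matscale (bil a u) (T u)"
    by (simp add: T_add[symmetric] T_scale[symmetric])
  moreover have "(T u ** T a + T a ** T u) ** T u = matscale (bil a u) (T u)"
    using T_T[OF u a] by (simp add: mat_mult_mat bil_sym)
  moreover have "(T u ** T a + T a ** T u) ** T u = T u ** T a ** T u + T a"
    using T_square[OF u] qu by (simp add: mat_mult_add matrix_mul_assoc[symmetric])
  ultimately show "T u ** T a ** T u = T (bil a u \<star> u - a)" by (metis add_right_cancel)
qed

lemma stab_two_reflections:
  assumes u: "u \<in> V0" "q u = 1" and v: "v \<in> V0" "q v = 1"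
  shows "\<exists>g\<in>Bij A. stab g \<and> mx g = T u ** T v"
proof -
  let ?M = "T u ** T v"
  have uu: "T u ** T u = mat 1" "T v ** T v = mat 1" using T_square u v by simp_all
  have canc: "T u ** (T u ** K) = K" "T v ** (T v ** K) = K" for K :: "'f ^ 'n ^ 'n"
    using uu by (simp_all add: matrix_mul_assoc)
  have "\<exists>g. stab g \<and> mx g = ?M \<and> (\<forall>x. x \<notin> A \<longrightarrow> g x = undefined)"
  proof (rule stab_exists)
    show "adj ?M ** ?M = mat 1"
      by (simp add: adj_mult adj_T u v matrix_mul_assoc[symmetric] uu canc)
    show "\<exists>a'\<in>V0. ?M ** T a = T a' ** ?M" if a: "a \<in> V0" for a
    proof -
      note r1 = T_reflect[OF v(1) a v(2)]
      note r2 = T_reflect[OF u(1) r1(2) u(2)]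
      have "T u ** (T v ** T a ** T v) ** T u ** ?M = ?M ** T a"
        by (simp add: matrix_mul_assoc[symmetric] canc uu)
      then show ?thesis using r1 r2 by metis
    qed
    show "\<exists>a\<in>V0. ?M ** T a = T a' ** ?M" if a': "a' \<in> V0" for a'
    proof -
      note r1 = T_reflect[OF u(1) a' u(2)]
      note r2 = T_reflect[OF v(1) r1(2) v(2)]
      have "?M ** (T v ** (T u ** T a' ** T u) ** T v) = T a' ** ?M"
        by (simp add: matrix_mul_assoc[symmetric] canc uu)
      then show ?thesis using r1 r2 by metis
    qed
  qed
  then obtain g where g: "stab g" "mx g = ?M" "\<forall>x. x \<notin> A \<longrightarrow> g x = undefined" by blast
  have "g \<in> Bij A" using g by (auto simp: Bij_def extensional_def stab_def is_aut_def)
  then show ?thesis using g by blast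
qed

text \<open>A central element of the stabilizer commutes with the products of two unit vectors, hence with
  all even products, and acts on the half space as a scalar; being an involution, by \<open>-1\<close>.\<close>

lemma central_involution:
  assumes r: "r \<in> Bij A" "stab r" and cent: "\<And>g. g \<in> Bij A \<Longrightarrow> stab g \<Longrightarrow> compose A r g = compose A g r"
    and ne: "r \<noteq> (\<lambda>x\<in>A. x)" and inv: "compose A r r = (\<lambda>x\<in>A. x)"
  shows "x \<in> V1 \<Longrightarrow> r x = - x" "a \<in> V0 \<Longrightarrow> r a = a"
proof -
  have comm: "mx r ** (T (b i) ** T (b j)) = T (b i) ** T (b j) ** mx r" if ij: "i < 9" "j < 9" "i \<noteq> j" for i j
  proof -
    have unit: "\<exists>s. s \<noteq> 0 \<and> q (s \<star> b k) = 1" if k: "k < 9" for k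
    proof -
      have qk: "q (b k) \<noteq> 0"
        unfolding q_V0[OF b_V0[OF k]] using b_nz[OF k] two_neq_0 by simp
      obtain s where s: "s * s = inverse (q (b k))" using square_root by blast
      have "q (s \<star> b k) = s * s * q (b k)"
        unfolding q_V0[OF V0_closed(3)[OF b_V0[OF k]]] q_V0[OF b_V0[OF k]] by (simp add: bil_simps)
      then have "q (s \<star> b k) = 1" using qk s by simp
      moreover have "s \<noteq> 0" using s qk by auto
      ultimately show ?thesis by blast
    qed
    obtain s t where s: "s \<noteq> 0" "q (s \<star> b i) = 1" and t: "t \<noteq> 0" "q (t \<star> b j) = 1"
      using unit ij by metis
    obtain g where g: "g \<in> Bij A" "stab g" "mx g = T (s \<star> b i) ** T (t \<star> b j)"
      using stab_two_reflections[OF V0_closed(3)[OF b_V0] s(2) V0_closed(3)[OF b_V0] t(2)] ij by blast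
    have "mx r ** mx g = mx g ** mx r"
      using cent[OF g(1,2)] mx_compose[OF r(2) g(2)] mx_compose[OF g(2) r(2)] by simp
    then have "matscale (s * t) (mx r ** (T (b i) ** T (b j))) = matscale (s * t) (T (b i) ** T (b j) ** mx r)"
      unfolding g(3) by (simp add: T_scale matscale_mult matscale_matscale mult.commute)
    then have "matscale (inverse (s * t)) (matscale (s * t) (mx r ** (T (b i) ** T (b j)))) =
        matscale (inverse (s * t)) (matscale (s * t) (T (b i) ** T (b j) ** mx r))" by simp
    then show ?thesis using s(1) t(1) by (simp add: matscale_matscale matscale_one)
  qed
  obtain c where c: "mx r = mat c"
    using cm.gen.commute_scalar[of "mx r"] comm by blast
  have "mx r ** mx r = mat 1"
    using mx_compose[OF r(2) r(2)] inv mx_cong[of "\<lambda>x\<in>A. x" "\<lambda>x. x"] V1_D(1) mx_id by simp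
  then have "c * c = 1" by (simp add: c mat_mult_mat matscale_mat mat_inject)
  then have "(c - 1) * (c + 1) = 0" by (simp add: algebra_simps)
  then have c1: "c = 1 \<or> c = -1" by (simp add: eq_neg_iff_add_eq_0)
  have "c \<noteq> 1"
  proof
    assume "c = 1"
    then have "mx r = mx (\<lambda>x\<in>A. x)"
      using c mx_cong[of "\<lambda>x\<in>A. x" "\<lambda>x. x"] V1_D(1) mx_id by simp
    then show False using stab_eqI[OF r id_Bij stab_id] ne by simp
  qed
  then have cm1: "c = -1" using c1 by simp
  show "r x = - x" if x: "x \<in> V1"
    using app_mx[OF stab_V1_linear[OF r(2)] x] by (simp add: c app_mat[OF x] cm1)
  show "r a = a" if a: "a \<in> V0"
  proof (rule T_inject[OF stab_V0[OF r(2) a] a])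
    have "matscale c (T a) = matscale c (T (r a))"
      using stab_mx_T[OF r(2) a] by (simp add: c mat_mult_mat)
    then have "matscale (-1) (matscale c (T a)) = matscale (-1) (matscale c (T (r a)))" by simp
    then show "T (r a) = T a" by (simp add: cm1 matscale_matscale matscale_one)
  qed
qed

text \<open>If some nonzero Clifford vector acted as a scalar, the Clifford relation would make all of them
  scalars, although distinct basis vectors anticommute.\<close>

lemma T_not_scalar:
  assumes a: "a \<in> V0" and s: "T a = mat c"
  shows "a = 0"
proof -
  have "c = 0"
  proof (rule ccontr)
    assume c: "c \<noteq> 0"
    have sc: "T (b i) = mat (bil a (b i) / (2 * c))" if i: "i < 9" for i
    proof -
      have "matscale (2 * c) (T (b i)) = mat (bil a (b i))"
        using T_T[OF a b_V0[OF i]] unfolding s mat_mult_mat by (simp add: matscale_add(2)[symmetric])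
      then have "matscale (inverse (2 * c)) (matscale (2 * c) (T (b i))) = matscale (inverse (2 * c)) (mat (bil a (b i)))"
        by simp
      moreover have "inverse (2 * c) * (2 * c) = 1" using c two_neq_0 by simp
      ultimately show ?thesis
        by (simp only: matscale_matscale matscale_one matscale_mat divide_inverse mult.commute)
    qed
    let ?p = "bil a (b 0) / (2 * c)" and ?r = "bil a (b 1) / (2 * c)"
    have lt: "(0::nat) < 9" "(1::nat) < 9" by simp_all
    have tb: "T (b 0) = mat ?p" "T (b 1) = mat ?r" by (rule sc[OF lt(1)], rule sc[OF lt(2)])
    have add: "mat x + mat y = (mat (x + y) :: 'f ^ 'n ^ 'n)" for x y by (simp add: mat_def vec_eq_iff)
    have "mat (?p * ?r + ?r * ?p) = (mat (bil (b 0) (b 1)) :: 'f ^ 'n ^ 'n)"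
      using T_T[OF b_V0[OF lt(1)] b_V0[OF lt(2)]] unfolding tb mat_mult_mat(1) matscale_mat add .
    then have "?p * ?r + ?r * ?p = 0" using b_orth[OF lt] unfolding mat_inject by simp
    moreover have "?p * ?r + ?r * ?p = 2 * (?p * ?r)" by (simp only: mult_2 mult.commute)
    ultimately have "?p = 0 \<or> ?r = 0" using two_neq_0 by (metis mult_eq_0_iff)
    then have "T (b 0) = 0 \<or> T (b 1) = 0" using tb mat_zero by metis
    then have "b 0 = 0 \<or> b 1 = 0" using T_zero_imp b_V0[OF lt(1)] b_V0[OF lt(2)] by blast
    then show False using b_nz[OF lt(1)] b_nz[OF lt(2)] by (metis bil_zero_left)
  qed
  then show ?thesis using s T_zero_imp[OF a] by (simp add: mat_zero)
qed

text \<open>Since \<open>g\<close> commutes with \<open>r\<close>, it preserves the eigenspaces of \<open>r\<close>. Thus \<open>g w\<close> has no component in \<open>V1\<close>, and it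
  acts on \<open>V1\<close> as 1/2, which forces its component in \<open>V0\<close> to act as a scalar and to vanish. Of the two
  remaining idempotents \<open>w\<close> and \<open>e - w\<close> the second is impossible: \<open>g\<close> would map \<open>V0\<close>, of dimension 9, into
  the line of \<open>w\<close>.\<close>

lemma centralizer_fixes_idempotent:
  assumes r: "is_aut r" "r w = w" and r1: "\<And>x. x \<in> V1 \<Longrightarrow> r x = - x" and r0: "\<And>a. a \<in> V0 \<Longrightarrow> r a = a"
    and g: "is_aut g" and comm: "\<And>x. x \<in> A \<Longrightarrow> g (r x) = r (g x)"
  shows "g w = w"
proof -
  define f where "f = e - w"
  have fA: "f \<in> A" using w_A A_closed by (simp add: f_def)
  have rf: "r f = f" using aut_diff[OF r(1) e_A w_A] aut_e[OF r(1)] r(2) by (simp add: f_def)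
  have decomp: "\<exists>\<alpha> \<beta>. \<exists>a\<in>V0. \<exists>x\<in>V1. v = \<alpha> \<star> w + \<beta> \<star> f + a + x" if "v \<in> A" for v
    using peirce_decomposition[of v] pr0_V0[OF that] pr1_V1[OF that] unfolding f_def by blast
  have r_decomp: "r (\<alpha> \<star> w + \<beta> \<star> f + a + x) = \<alpha> \<star> w + \<beta> \<star> f + a - x" if "a \<in> V0" "x \<in> V1" for \<alpha> \<beta> a x
    using that w_A fA V0_D(1)[OF that(1)] V1_D(1)[OF that(2)]
    by (simp add: autD(2,3)[OF r(1)] A_closed r rf r0 r1)
  have double: "z = 0" if "z + z = 0" for z :: 'v
  proof -
    have "2 \<star> z = 0" using that scale_left_distrib[of 1 1 z] by simp
    then show ?thesis using two_neq_0 by simp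
  qed
  have fixed: "\<exists>\<alpha> \<beta>. \<exists>a\<in>V0. v = \<alpha> \<star> w + \<beta> \<star> f + a" if v: "v \<in> A" "r v = v" for v
  proof -
    obtain \<alpha> \<beta> a x where d: "v = \<alpha> \<star> w + \<beta> \<star> f + a + x" "a \<in> V0" "x \<in> V1" using decomp[OF v(1)] by blast
    then have "x = - x" using r_decomp[OF d(2,3), of \<alpha> \<beta>] v(2) by simp
    then have "x + x = 0" by (simp only: eq_neg_iff_add_eq_0)
    then have "x = 0" by (rule double)
    then show ?thesis using d by auto
  qed
  have anti: "v \<in> V1" if v: "v \<in> A" "r v = - v" for v
  proof -
    obtain \<alpha> \<beta> a x where d: "v = \<alpha> \<star> w + \<beta> \<star> f + a + x" "a \<in> V0" "x \<in> V1" using decomp[OF v(1)] by blast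
    have "\<alpha> \<star> w + \<beta> \<star> f + a - x = - (\<alpha> \<star> w + \<beta> \<star> f + a + x)"
      using r_decomp[OF d(2,3), of \<alpha> \<beta>] v(2) unfolding d(1) by (rule trans[OF sym])
    moreover have "u - x = - (u + x) \<Longrightarrow> u + u = 0" for u :: 'v
      using add_eq_0_iff[of u u] by (simp add: eq_diff_eq)
    ultimately have "(\<alpha> \<star> w + \<beta> \<star> f + a) + (\<alpha> \<star> w + \<beta> \<star> f + a) = 0" by blast
    then have "\<alpha> \<star> w + \<beta> \<star> f + a = 0" by (rule double)
    then show ?thesis using d by simp
  qed
  obtain \<alpha> \<beta> a where gw: "g w = \<alpha> \<star> w + \<beta> \<star> f + a" "a \<in> V0"
    using fixed[OF autD(1)[OF g w_A]] comm[OF w_A] r(2) by auto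
  have half_y: "g w \<diamond> y = (1/2) \<star> y" if y: "y \<in> V1" for y
  proof -
    obtain x where x: "x \<in> A" "g x = y" using autD(6)[OF g] V1_D(1)[OF y] by (metis imageE)
    have "g (r x) = g (- x)" using comm[OF x(1)] x r1[OF y] aut_minus[OF g x(1)] by simp
    then have "r x = - x" using autD(5)[OF g] autD(1)[OF r(1) x(1)] x(1) by (auto simp: inj_on_def A_closed)
    then have "x \<in> V1" using anti x(1) by blast
    then have "g (w \<diamond> x) = (1/2) \<star> y" using V1_D(2) autD(3)[OF g x(1)] x(2) by simp
    then show ?thesis using autD(4)[OF g w_A x(1)] x(2) by simp
  qed
  have f1: "f \<diamond> x = (1/2) \<star> x" if "x \<in> V1" for x using e_w_mul_V1[OF that] by (simp add: f_def)
  have ay: "2 \<star> (a \<diamond> y) = (1 - \<alpha> - \<beta>) \<star> y" if y: "y \<in> V1" for y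
  proof -
    have "(\<alpha> / 2 + \<beta> / 2) \<star> y + a \<diamond> y = (1/2) \<star> y"
      using half_y[OF y] V1_D(2)[OF y] f1[OF y] unfolding gw
      by (simp add: mul_add_left mul_scale_left scale_left_distrib)
    then have "a \<diamond> y = (1/2 - (\<alpha> / 2 + \<beta> / 2)) \<star> y" by (simp add: scale_left_diff_distrib eq_diff_eq add.commute)
    moreover have "2 * (1/2 - (\<alpha> / 2 + \<beta> / 2)) = 1 - \<alpha> - \<beta>" using two_neq_0 by (simp add: right_diff_distrib distrib_left)
    ultimately show ?thesis by simp
  qed
  have "T a = mat (1 - \<alpha> - \<beta>)"
    by (rule app_eqI) (simp add: app_T[OF gw(2)] app_mat ay)
  then have a0: "a = 0" by (rule T_not_scalar[OF gw(2)])
  then have gw': "g w = \<alpha> \<star> w + \<beta> \<star> f" using gw by simp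
  have bilw: "bil w f = 0" "bil f f = 2" "bil f w = 0"
    using bil_f_f by (simp_all add: f_def bil_simps bil_w_w bil_w_e)
  have wf: "w \<diamond> f = 0" "f \<diamond> w = 0" "f \<diamond> f = f" using w_idem by (simp_all add: f_def mul_simps)
  have "g w \<diamond> g w = g w" using autD(4)[OF g w_A w_A] w_idem by simp
  then have sq: "(\<alpha> * \<alpha>) \<star> w + (\<beta> * \<beta>) \<star> f = \<alpha> \<star> w + \<beta> \<star> f"
    unfolding gw' by (simp add: mul_add_left mul_add_right mul_scale_left mul_scale_right wf w_idem)
  have al: "\<alpha> * \<alpha> = \<alpha>"
    using arg_cong[OF sq, of "bil w"] by (simp add: bil_simps bilw bil_w_w)
  have be: "\<beta> * \<beta> = \<beta>"
    using arg_cong[OF sq, of "bil f"] two_neq_0 by (simp add: bil_simps bilw)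
  have sum1: "\<alpha> + \<beta> = 1"
  proof -
    have "mat (1 - \<alpha> - \<beta>) = (0 :: 'f ^ 'n ^ 'n)"
      using \<open>T a = _\<close> a0 T_scale[of 0 0] by (simp add: matscale_zero)
    then have "1 - \<alpha> - \<beta> = 0" using mat_inject[of "1 - \<alpha> - \<beta>" 0] by (simp add: mat_zero)
    then show ?thesis by (simp add: algebra_simps)
  qed
  have "\<alpha> = 0 \<or> \<alpha> = 1" using al by (metis mult_cancel_left2 mult.commute)
  then show ?thesis
  proof
    assume "\<alpha> = 1"
    then show ?thesis using sum1 gw' by simp
  next
    assume "\<alpha> = 0"
    then have gwf: "g w = f" using sum1 gw' by simp
    have to_w: "\<exists>c. g a = c \<star> w" if a: "a \<in> V0" for a
    proof -
      have aA: "a \<in> A" by (rule V0_D(1)[OF a])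
      have "r (g a) = g a" using comm[OF aA] r0[OF a] by simp
      then obtain \<alpha> \<beta> a' where d: "g a = \<alpha> \<star> w + \<beta> \<star> f + a'" "a' \<in> V0"
        using fixed[OF autD(1)[OF g aA]] by blast
      have fa: "f \<diamond> a' = a'" using f_V0[OF d(2)] by (simp add: f_def)
      have "f \<diamond> g a = 0" using autD(4)[OF g w_A aA] V0_D(4)[OF a] aut_zero[OF g] gwf by simp
      then have "\<beta> \<star> f + a' = 0"
        unfolding d(1) by (simp add: mul_add_right mul_scale_right wf fa)
      then show ?thesis using d(1) by (metis add.assoc add.right_neutral)
    qed
    have A01: "b 0 \<in> A" "b 1 \<in> A" using V0_D(1) b_V0[of 0] b_V0[of 1] by auto
    obtain c0 c1 where c: "g (b 0) = c0 \<star> w" "g (b 1) = c1 \<star> w" using to_w b_V0[of 0] b_V0[of 1] by force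
    have "g (c1 \<star> b 0 - c0 \<star> b 1) = 0"
      using A01 c by (simp add: aut_diff[OF g] autD(3)[OF g] A_closed mult.commute)
    then have "c1 \<star> b 0 - c0 \<star> b 1 = 0"
      using autD(5)[OF g] A01 aut_zero[OF g] by (metis A_closed(4,5,6) inj_onD)
    then have "bil (c1 \<star> b 0 - c0 \<star> b 1) (b 1) = 0" by (simp add: bil_simps)
    then have "c0 = 0" using b_orth[of 0 1] b_nz[of 1] by (simp add: bil_simps)
    then have "g (b 0) = g 0" using c aut_zero[OF g] by simp
    then have "b 0 = 0" using autD(5)[OF g] A01 A_closed(6) by (metis inj_onD)
    then show ?thesis using b_nz[of 0] by (simp add: bil_simps)
  qed
qed

end

section \<open>Regular functions defined over the base field\<close>

lemma rational_simps:
  "x \<in> range to_ac \<Longrightarrow> y \<in> range to_ac \<Longrightarrow> x + y \<in> range to_ac"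
  "x \<in> range to_ac \<Longrightarrow> y \<in> range to_ac \<Longrightarrow> x * y \<in> range to_ac"
  "x \<in> range to_ac \<Longrightarrow> y \<in> range to_ac \<Longrightarrow> x - y \<in> range to_ac"
  "x \<in> range to_ac \<Longrightarrow> y \<in> range to_ac \<Longrightarrow> x / y \<in> range to_ac"
  "x \<in> range to_ac \<Longrightarrow> - x \<in> range to_ac"
  "0 \<in> range to_ac" "1 \<in> range to_ac" "numeral m \<in> range to_ac"
proof -
  show "x \<in> range to_ac \<Longrightarrow> y \<in> range to_ac \<Longrightarrow> x + y \<in> range to_ac"
    by (elim rangeE, hypsubst, rule range_eqI, rule to_ac_add[symmetric])
  show "x \<in> range to_ac \<Longrightarrow> y \<in> range to_ac \<Longrightarrow> x * y \<in> range to_ac"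
    by (elim rangeE, hypsubst, rule range_eqI, rule to_ac_mult[symmetric])
  show "x \<in> range to_ac \<Longrightarrow> y \<in> range to_ac \<Longrightarrow> x - y \<in> range to_ac"
    by (elim rangeE, hypsubst, rule range_eqI, rule to_ac_diff[symmetric])
  show "x \<in> range to_ac \<Longrightarrow> y \<in> range to_ac \<Longrightarrow> x / y \<in> range to_ac"
    by (elim rangeE, hypsubst, rule range_eqI, rule to_ac_divide[symmetric])
  show "x \<in> range to_ac \<Longrightarrow> - x \<in> range to_ac"
    by (elim rangeE, hypsubst, rule range_eqI, rule to_ac_minus[symmetric])
  show "0 \<in> range to_ac" by (rule range_eqI, rule to_ac_0[symmetric])
  show "1 \<in> range to_ac" by (rule range_eqI, rule to_ac_1[symmetric])
  show "numeral m \<in> range to_ac" by (rule range_eqI, rule to_ac_numeral[symmetric])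
qed

lemma rational_sum: "(\<And>i. i \<in> S \<Longrightarrow> f i \<in> range to_ac) \<Longrightarrow> (\<Sum>i\<in>S. f i) \<in> range to_ac"
  by (induction S rule: infinite_finite_induct) (simp_all add: rational_simps)

lemma rational_power: "x \<in> range to_ac \<Longrightarrow> x ^ n \<in> range to_ac"
  by (induction n) (simp_all add: rational_simps)

definition regular ::
  "('g, 'm) monoid_scheme \<Rightarrow> ('g \<Rightarrow> 'k::field alg_closure) set \<Rightarrow> ('g \<Rightarrow> 'k alg_closure) \<Rightarrow> bool" where
  "regular G L f \<longleftrightarrow> restrict f (carrier G) \<in> coord_ring G L"

lemma regular_iff:
  "regular G L f \<longleftrightarrow>
    (\<exists>p\<in>k_polys (L \<union> {\<lambda>g. l (inv\<^bsub>G\<^esub> g) | l. l \<in> L}). \<forall>g\<in>carrier G. f g = p g)"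
proof -
  have "restrict f (carrier G) = restrict p (carrier G) \<longleftrightarrow> (\<forall>g\<in>carrier G. f g = p g)" for p
    by (metis restrict_apply' restrict_ext)
  then show ?thesis unfolding regular_def coord_ring_def by blast
qed

lemma regular_cong:
  assumes f: "regular G L f" and eq: "\<And>g. g \<in> carrier G \<Longrightarrow> f' g = f g"
  shows "regular G L f'"
proof -
  obtain p where "p \<in> k_polys (L \<union> {\<lambda>g. l (inv\<^bsub>G\<^esub> g) | l. l \<in> L})" "\<forall>g\<in>carrier G. f g = p g"
    using f unfolding regular_iff by blast
  then show ?thesis unfolding regular_iff by (intro bexI[of _ p]) (simp_all add: eq)
qed

lemma regular_const: "c \<in> range to_ac \<Longrightarrow> regular G L (\<lambda>_. c)"
  unfolding regular_iff by (rule bexI[of _ "\<lambda>_. c"]) (auto intro: k_polys.const)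

lemma regular_gen: "l \<in> L \<Longrightarrow> regular G L l" "l \<in> L \<Longrightarrow> regular G L (\<lambda>g. l (inv\<^bsub>G\<^esub> g))"
proof -
  show "l \<in> L \<Longrightarrow> regular G L l"
    unfolding regular_iff by (rule bexI[of _ l]) (auto intro: k_polys.gen)
  show "l \<in> L \<Longrightarrow> regular G L (\<lambda>g. l (inv\<^bsub>G\<^esub> g))"
    unfolding regular_iff by (rule bexI[of _ "\<lambda>g. l (inv\<^bsub>G\<^esub> g)"]) (auto intro: k_polys.gen)
qed

lemma regular_add: "regular G L f \<Longrightarrow> regular G L f' \<Longrightarrow> regular G L (\<lambda>g. f g + f' g)"
  unfolding regular_iff
proof (elim bexE)
  fix p p' assume "p \<in> k_polys (L \<union> {\<lambda>g. l (inv\<^bsub>G\<^esub> g) | l. l \<in> L})"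
    "p' \<in> k_polys (L \<union> {\<lambda>g. l (inv\<^bsub>G\<^esub> g) | l. l \<in> L})"
    "\<forall>g\<in>carrier G. f g = p g" "\<forall>g\<in>carrier G. f' g = p' g"
  then show "\<exists>p\<in>k_polys (L \<union> {\<lambda>g. l (inv\<^bsub>G\<^esub> g) | l. l \<in> L}). \<forall>g\<in>carrier G. f g + f' g = p g"
    by (intro bexI[OF _ k_polys.add[of p _ p']]) simp_all
qed

lemma regular_mult: "regular G L f \<Longrightarrow> regular G L f' \<Longrightarrow> regular G L (\<lambda>g. f g * f' g)"
  unfolding regular_iff
proof (elim bexE)
  fix p p' assume "p \<in> k_polys (L \<union> {\<lambda>g. l (inv\<^bsub>G\<^esub> g) | l. l \<in> L})"
    "p' \<in> k_polys (L \<union> {\<lambda>g. l (inv\<^bsub>G\<^esub> g) | l. l \<in> L})"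
    "\<forall>g\<in>carrier G. f g = p g" "\<forall>g\<in>carrier G. f' g = p' g"
  then show "\<exists>p\<in>k_polys (L \<union> {\<lambda>g. l (inv\<^bsub>G\<^esub> g) | l. l \<in> L}). \<forall>g\<in>carrier G. f g * f' g = p g"
    by (intro bexI[OF _ k_polys.mult[of p _ p']]) simp_all
qed

lemma regular_sum:
  "(\<And>i. i \<in> S \<Longrightarrow> regular G L (f i)) \<Longrightarrow> regular G L (\<lambda>g. \<Sum>i\<in>S. f i g)"
  by (induction S rule: infinite_finite_induct)
    (simp_all add: regular_const regular_add rational_simps)

lemma regular_induct:
  assumes p: "p \<in> k_polys (L \<union> {\<lambda>g. l (inv\<^bsub>G\<^esub> g) | l. l \<in> L})"
    and "\<And>l. l \<in> L \<Longrightarrow> regular H L' (\<lambda>h. l (\<phi> h))"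
    and "\<And>l. l \<in> L \<Longrightarrow> regular H L' (\<lambda>h. l (inv\<^bsub>G\<^esub> (\<phi> h)))"
  shows "regular H L' (\<lambda>h. p (\<phi> h))"
  using p
proof induction
  case (const c)
  then show ?case by (simp add: regular_const)
next
  case (gen p)
  then show ?case using assms(2,3) by auto
qed (simp_all add: regular_add regular_mult)

lemma regular_inv:
  assumes invol: "\<And>g. g \<in> carrier G \<Longrightarrow> inv\<^bsub>G\<^esub> g \<in> carrier G \<and> inv\<^bsub>G\<^esub> (inv\<^bsub>G\<^esub> g) = g"
    and f: "regular G L f"
  shows "regular G L (\<lambda>g. f (inv\<^bsub>G\<^esub> g))"
proof -
  obtain p where p: "p \<in> k_polys (L \<union> {\<lambda>g. l (inv\<^bsub>G\<^esub> g) | l. l \<in> L})" "\<forall>g\<in>carrier G. f g = p g"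
    using f unfolding regular_iff by blast
  have "regular G L (\<lambda>g. p (inv\<^bsub>G\<^esub> g))"
  proof (rule regular_induct[OF p(1)])
    fix l assume l: "l \<in> L"
    show "regular G L (\<lambda>g. l (inv\<^bsub>G\<^esub> g))" by (rule regular_gen(2)[OF l])
    show "regular G L (\<lambda>g. l (inv\<^bsub>G\<^esub> (inv\<^bsub>G\<^esub> g)))"
      by (rule regular_cong[OF regular_gen(1)[OF l]]) (simp add: invol)
  qed
  then show ?thesis by (rule regular_cong) (simp add: invol p)
qed

lemma regular_compose:
  assumes invol: "\<And>h. h \<in> carrier H \<Longrightarrow> inv\<^bsub>H\<^esub> h \<in> carrier H \<and> inv\<^bsub>H\<^esub> (inv\<^bsub>H\<^esub> h) = h"
    and \<phi>: "\<And>h. h \<in> carrier H \<Longrightarrow> \<phi> h \<in> carrier G"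
      "\<And>h. h \<in> carrier H \<Longrightarrow> \<phi> (inv\<^bsub>H\<^esub> h) = inv\<^bsub>G\<^esub> (\<phi> h)"
    and gen: "\<And>l. l \<in> L \<Longrightarrow> regular H L' (\<lambda>h. l (\<phi> h))"
    and f: "f \<in> coord_ring G L"
  shows "restrict (f \<circ> \<phi>) (carrier H) \<in> coord_ring H L'"
proof -
  obtain p where p: "p \<in> k_polys (L \<union> {\<lambda>g. l (inv\<^bsub>G\<^esub> g) | l. l \<in> L})" "f = restrict p (carrier G)"
    using f by (auto simp: coord_ring_def)
  have "regular H L' (\<lambda>h. p (\<phi> h))"
  proof (rule regular_induct[OF p(1)])
    fix l assume l: "l \<in> L"
    show "regular H L' (\<lambda>h. l (\<phi> h))" by (rule gen[OF l])
    have "regular H L' (\<lambda>h. l (\<phi> (inv\<^bsub>H\<^esub> h)))"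
      by (rule regular_inv[where f = "\<lambda>h. l (\<phi> h)", OF _ gen[OF l]]) (rule invol)
    then show "regular H L' (\<lambda>h. l (inv\<^bsub>G\<^esub> (\<phi> h)))"
      by (rule regular_cong) (simp add: \<phi>(2))
  qed
  then have "regular H L' (f \<circ> \<phi>)" by (rule regular_cong) (simp add: p(2) \<phi>(1))
  then show ?thesis by (simp add: regular_def)
qed

text \<open>The coordinates of the inverse come for free, because inversion is a regular function by
  construction and the isomorphism commutes with it.\<close>

lemma alg_group_isoI:
  assumes iso: "\<phi> \<in> iso G H"
    and G: "\<And>g. g \<in> carrier G \<Longrightarrow> inv\<^bsub>G\<^esub> g \<in> carrier G \<and> inv\<^bsub>G\<^esub> (inv\<^bsub>G\<^esub> g) = g"
    and inv: "\<And>g. g \<in> carrier G \<Longrightarrow> inv\<^bsub>H\<^esub> (\<phi> g) = \<phi> (inv\<^bsub>G\<^esub> g)"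
    and fwd: "\<And>l. l \<in> L' \<Longrightarrow> regular G L (\<lambda>g. l (\<phi> g))"
    and bwd: "\<And>l. l \<in> L \<Longrightarrow> regular H L' (\<lambda>h. l (inv_into (carrier G) \<phi> h))"
  shows "alg_group_iso G (coord_ring G L) H (coord_ring H L')"
proof -
  let ?\<psi> = "inv_into (carrier G) \<phi>"
  have bij: "bij_betw \<phi> (carrier G) (carrier H)" using iso by (simp add: iso_def)
  have \<phi>: "\<phi> g \<in> carrier H" "?\<psi> (\<phi> g) = g" if "g \<in> carrier G" for g
    using bij that by (auto simp: bij_betw_def inv_into_f_f)
  have \<psi>: "?\<psi> h \<in> carrier G" "\<phi> (?\<psi> h) = h" if "h \<in> carrier H" for h
    using bij that by (auto simp: bij_betw_def f_inv_into_f inv_into_into)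
  have H: "inv\<^bsub>H\<^esub> h = \<phi> (inv\<^bsub>G\<^esub> (?\<psi> h))" if "h \<in> carrier H" for h
    using inv[OF \<psi>(1)[OF that]] \<psi>(2)[OF that] by simp
  have invH: "inv\<^bsub>H\<^esub> h \<in> carrier H \<and> inv\<^bsub>H\<^esub> (inv\<^bsub>H\<^esub> h) = h" if "h \<in> carrier H" for h
    using G[OF \<psi>(1)[OF that]] \<phi> \<psi>[OF that] by (simp add: H that inv)
  have "restrict (f \<circ> \<phi>) (carrier G) \<in> coord_ring G L" if "f \<in> coord_ring H L'" for f
    by (rule regular_compose[OF G _ _ fwd that]) (simp_all add: \<phi> inv)
  moreover have "restrict (f \<circ> ?\<psi>) (carrier H) \<in> coord_ring H L'" if "f \<in> coord_ring G L" for f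
    by (rule regular_compose[OF invH _ _ bwd that]) (simp_all add: \<psi> H \<phi> G)
  ultimately show ?thesis unfolding alg_group_iso_def using iso by blast
qed

section \<open>Rationality of the spin representation\<close>

definition rational_matrix :: "'k::field alg_closure ^ 'n ^ 'm \<Rightarrow> bool" where
  "rational_matrix M \<longleftrightarrow> (\<forall>i j. M $ i $ j \<in> range to_ac)"

lemma rational_matrix_mult:
  fixes M :: "'k::field alg_closure ^ 'n::finite ^ 'm"
  shows "rational_matrix M \<Longrightarrow> rational_matrix M' \<Longrightarrow> rational_matrix (M ** M')"
  by (simp add: rational_matrix_def matrix_matrix_mult_def rational_sum rational_simps)

lemma rational_matrix_one: "rational_matrix (mat 1)"
  by (simp add: rational_matrix_def mat_def rational_simps)

definition regular_matrix ::
  "('g, 'm) monoid_scheme \<Rightarrow> ('g \<Rightarrow> 'k::field alg_closure) set \<Rightarrow> ('g \<Rightarrow> 'k alg_closure ^ 'n ^ 'p) \<Rightarrow> bool" where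
  "regular_matrix G L F \<longleftrightarrow> (\<forall>i j. regular G L (\<lambda>g. F g $ i $ j))"

lemma regular_matrix_mult:
  fixes F :: "'g \<Rightarrow> 'k::field alg_closure ^ 'n::finite ^ 'm"
  shows "regular_matrix G L F \<Longrightarrow> regular_matrix G L F' \<Longrightarrow> regular_matrix G L (\<lambda>g. F g ** F' g)"
  unfolding regular_matrix_def
  by (auto simp: matrix_matrix_mult_def intro!: regular_sum regular_mult)

lemma regular_matrix_const: "rational_matrix M \<Longrightarrow> regular_matrix G L (\<lambda>_. M)"
  unfolding regular_matrix_def rational_matrix_def by (auto intro!: regular_const)

lemma regular_trace:
  fixes F :: "'g \<Rightarrow> 'k::field alg_closure ^ 'n::finite ^ 'n"
  shows "regular_matrix G L F \<Longrightarrow> regular G L (\<lambda>g. trace (F g))"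
  unfolding regular_matrix_def trace_def by (auto intro!: regular_sum)

text \<open>The set \<open>Ak\<close> consists of the points over the base field; it contains the idempotent and both bases.\<close>

locale rational_spin_rep = spin_rep scale bil A mul e w q b xs
  for scale :: "'k::field alg_closure \<Rightarrow> 'v::ab_group_add \<Rightarrow> 'v" (infixr "\<star>" 75)
    and bil :: "'v \<Rightarrow> 'v \<Rightarrow> 'k alg_closure" and A and mul (infixl "\<diamond>" 70) and e and w
    and q :: "'v \<Rightarrow> 'k alg_closure" and b :: "nat \<Rightarrow> 'v" and xs :: "'n::finite \<Rightarrow> 'v" +
  fixes Ak :: "'v set"
  assumes Ak_A: "Ak \<subseteq> A"
    and Ak_add: "x \<in> Ak \<Longrightarrow> y \<in> Ak \<Longrightarrow> x + y \<in> Ak"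
    and Ak_scale: "c \<in> range to_ac \<Longrightarrow> x \<in> Ak \<Longrightarrow> c \<star> x \<in> Ak"
    and Ak_mul: "x \<in> Ak \<Longrightarrow> y \<in> Ak \<Longrightarrow> x \<diamond> y \<in> Ak"
    and Ak_e: "e \<in> Ak" and Ak_w: "w \<in> Ak"
    and Ak_bil: "x \<in> Ak \<Longrightarrow> y \<in> Ak \<Longrightarrow> bil x y \<in> range to_ac"
    and Ak_b: "i < 9 \<Longrightarrow> b i \<in> Ak"
    and Ak_xs: "xs j \<in> Ak"
begin

lemma Ak_diff: "x \<in> Ak \<Longrightarrow> y \<in> Ak \<Longrightarrow> x - y \<in> Ak"
  using Ak_add[of x "(-1) \<star> y"] Ak_scale[of "-1" y] by (simp add: rational_simps)

lemma Ak_pr: "x \<in> Ak \<Longrightarrow> pr1 x \<in> Ak" "x \<in> Ak \<Longrightarrow> pr0 x \<in> Ak"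
proof -
  show 1: "pr1 x \<in> Ak" if "x \<in> Ak" for x
    unfolding pr1_def using that
    by (intro Ak_diff Ak_add Ak_scale Ak_mul Ak_e Ak_w rational_simps Ak_bil)
  show "pr0 x \<in> Ak" if "x \<in> Ak" for x
    unfolding pr0_def using that 1[OF that]
    by (intro Ak_diff Ak_add Ak_scale Ak_mul Ak_e Ak_w rational_simps Ak_bil)
qed

lemma coord_rational: "x \<in> Ak \<Longrightarrow> coord x i \<in> range to_ac"
  unfolding coord_def by (intro rational_simps Ak_bil Ak_xs)

lemma T_rational: "a \<in> Ak \<Longrightarrow> rational_matrix (T a)"
  unfolding T_def mx_def rational_matrix_def
  by (simp add: coord_rational Ak_scale Ak_mul Ak_xs rational_simps)

lemma mp_rational: "set u \<subseteq> Ak \<Longrightarrow> rational_matrix (cm.mp u)"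
  by (induction u) (simp_all add: cm.mp_simps rational_matrix_one rational_matrix_mult T_rational)

lemma W_Ak: "k \<le> 9 \<Longrightarrow> set (cm.W k S) \<subseteq> V0 \<inter> Ak"
  by (induction k) (auto simp: b_V0 Ak_b)

lemma q_rational: "a \<in> V0 \<Longrightarrow> a \<in> Ak \<Longrightarrow> q a \<in> range to_ac"
  by (simp add: q_V0 Ak_bil rational_simps)

lemma square_rational: "k \<le> 9 \<Longrightarrow> clifford_square (\<lambda>i. q (b i)) k S \<in> range to_ac"
  by (induction k) (auto intro!: rational_simps rational_power q_rational b_V0 Ak_b)

definition aut_coords :: "(('v \<Rightarrow> 'v) \<Rightarrow> 'k alg_closure) set" where
  "aut_coords = {\<lambda>g. l (g a) | l a. a \<in> Ak \<and> (\<forall>x\<in>A. \<forall>y\<in>A. l (x + y) = l x + l y) \<and>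
    (\<forall>c. \<forall>x\<in>A. l (c \<star> x) = c * l x) \<and> (\<forall>x\<in>Ak. l x \<in> range to_ac)}"

abbreviation spin where "spin \<equiv> spin_group scale q V0"
abbreviation spin_coords where "spin_coords \<equiv> clifford_coords scale q V0 (V0 \<inter> Ak)"

text \<open>Matrix entries with respect to a rational basis are among the coordinates of the automorphism group.\<close>

lemma mx_regular: "regular_matrix stab_group aut_coords mx"
  unfolding regular_matrix_def
proof (intro allI)
  fix i j
  have "(\<lambda>g. coord (g (xs j)) i) \<in> aut_coords"
    unfolding aut_coords_def using coord_simps coord_rational Ak_xs
    by (intro CollectI exI[of _ "\<lambda>v. coord v i"] exI[of _ "xs j"]) auto
  then show "regular stab_group aut_coords (\<lambda>g. mx g $ i $ j)"
    using regular_gen(1) by (simp add: mx_def)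
qed

lemma coords_sum:
  assumes l: "l \<in> spin_coords" and f: "\<And>i. i \<in> S \<Longrightarrow> f i \<in> carrier cm.F"
  shows "l (cm.cl (\<lambda>u. \<Sum>i\<in>S. c i * f i u)) = (\<Sum>i\<in>S. c i * l (cm.cl (f i)))"
proof -
  have scale: "l (cm.cl (\<lambda>u. d * g u)) = d * l (cm.cl g)" if "g \<in> carrier cm.F" for d g
  proof -
    have "l (cm.cl (word d []) \<otimes>\<^bsub>cm.Cl\<^esub> cm.cl g) = d * l (cm.cl g)"
      using l cm.cl_closed[OF that] by (simp add: clifford_coords_def)
    then show ?thesis using that by (simp add: cm.cl_mult word0_closed conv_scalar)
  qed
  have add: "l (cm.cl (\<lambda>u. g u + h u)) = l (cm.cl g) + l (cm.cl h)"
    if "g \<in> carrier cm.F" "h \<in> carrier cm.F" for g h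
    using l cm.cl_closed that by (simp add: clifford_coords_def cm.cl_add[symmetric])
  have "l (cm.cl (\<lambda>_. 0)) = 0" using scale[OF free_zero_closed, of 0] by simp
  then show ?thesis
    using f
    by (induction S rule: infinite_finite_induct)
      (simp_all add: add scale free_scale_closed free_sum_closed)
qed

text \<open>The spin element of \<open>g\<close> is a rational linear combination of products of basis vectors whose
  coefficients are traces of the matrix of \<open>g\<close> against rational matrices.\<close>

lemma phi_regular:
  assumes l: "l \<in> spin_coords"
  shows "regular stab_group aut_coords (\<lambda>g. l (phi g))"
proof -
  let ?c = "\<lambda>S. l (cm.cl (word 1 (cm.W 9 S)))"
  have c: "?c S \<in> range to_ac" for S
  proof -
    have "word 1 (cm.W 9 S) \<in> carrier (free_algebra (V0 \<inter> Ak))"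
      using W_Ak[of 9 S] by (intro word_closed) (simp add: in_lists_conv_set subset_iff)
    moreover have "range (word 1 (cm.W 9 S) :: 'v list \<Rightarrow> 'k alg_closure) \<subseteq> range to_ac"
      by (auto simp: word_def rational_simps)
    ultimately show ?thesis using l unfolding clifford_coords_def by blast
  qed
  have P: "rational_matrix (cm.gen.P 9 S)" for S
    using mp_rational[of "cm.W 9 S"] W_Ak[of 9 S] by (simp add: cm.mp_W)
  have "l (phi g) = (\<Sum>S\<in>even_subsets. cm.gen.coeff_P S (mx g) * ?c S)" for g
    unfolding phi_def cm.lift_def by (rule coords_sum[OF l]) (intro cm.word_V_closed cm.W_V, simp)
  moreover have "regular stab_group aut_coords (\<lambda>g. cm.gen.coeff_P S (mx g))" for S
    unfolding cm.gen.coeff_P_def divide_inverse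
    by (intro regular_mult regular_trace regular_matrix_mult mx_regular regular_matrix_const P regular_const)
      (simp add: inverse_eq_divide rational_simps square_rational)
  ultimately show ?thesis
    by (simp only:) (intro regular_sum regular_mult regular_const c)
qed

text \<open>The matrix by which a class of the Clifford algebra acts, defined through a representative.\<close>

definition class_matrix :: "('v list \<Rightarrow> 'k alg_closure) set \<Rightarrow> 'k alg_closure ^ 'n ^ 'n" where
  "class_matrix s = cm.ev (SOME f. f \<in> carrier cm.F \<and> cm.cl f = s)"

lemma class_matrix_cl: assumes "f \<in> carrier cm.F" shows "class_matrix (cm.cl f) = cm.ev f"
proof -
  have "(SOME f'. f' \<in> carrier cm.F \<and> cm.cl f' = cm.cl f) \<in> carrier cm.F \<and>
      cm.cl (SOME f'. f' \<in> carrier cm.F \<and> cm.cl f' = cm.cl f) = cm.cl f"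
    by (rule someI[of _ f]) (simp add: assms)
  then show ?thesis unfolding class_matrix_def using cl_ev assms by blast
qed

lemma class_matrix_phi: "class_matrix (phi g) = mx g"
  unfolding phi_def by (simp add: class_matrix_cl cm.lift_closed cm.ev_lift)

lemma ev_rational:
  assumes f: "f \<in> carrier (free_algebra (V0 \<inter> Ak))" "range f \<subseteq> range to_ac"
  shows "rational_matrix (cm.ev f)"
proof -
  have "f u * cm.mp u $ i $ j \<in> range to_ac" if "f u \<noteq> 0" for u i j
  proof -
    have "set u \<subseteq> Ak" using f that by (auto simp: free_algebra_simps in_lists_conv_set)
    then have "cm.mp u $ i $ j \<in> range to_ac" using mp_rational by (simp add: rational_matrix_def)
    then show ?thesis using f(2) by (intro rational_simps) auto
  qed
  then show ?thesis
    unfolding rational_matrix_def cm.ev_def by (auto intro!: rational_sum)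
qed

lemma class_matrix_regular: "regular_matrix spin spin_coords class_matrix"
  unfolding regular_matrix_def
proof (intro allI regular_gen(1))
  fix i j
  have sub: "carrier (free_algebra (V0 \<inter> Ak)) \<subseteq> (carrier cm.F :: ('v list \<Rightarrow> 'k alg_closure) set)"
    by (auto simp: free_algebra_simps)
  show "(\<lambda>s. class_matrix s $ i $ j) \<in> spin_coords"
    unfolding clifford_coords_def
  proof (intro CollectI conjI ballI allI impI)
    fix s t assume "s \<in> carrier cm.Cl" "t \<in> carrier cm.Cl"
    then obtain f g where "f \<in> carrier cm.F" "g \<in> carrier cm.F" "s = cm.cl f" "t = cm.cl g"
      by (auto simp: cm.cl_carrier)
    then show "class_matrix (s \<oplus>\<^bsub>cm.Cl\<^esub> t) $ i $ j = class_matrix s $ i $ j + class_matrix t $ i $ j"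
      by (simp add: cm.cl_add class_matrix_cl free_add_closed cm.ev_add)
  next
    fix c s assume "s \<in> carrier cm.Cl"
    then obtain f where "f \<in> carrier cm.F" "s = cm.cl f" by (auto simp: cm.cl_carrier)
    then show "class_matrix (cm.cl (word c []) \<otimes>\<^bsub>cm.Cl\<^esub> s) $ i $ j = c * class_matrix s $ i $ j"
      by (simp add: cm.cl_mult word0_closed conv_closed class_matrix_cl cm.ev_conv ev_word0 mat_mult_mat)
  next
    fix f :: "'v list \<Rightarrow> 'k alg_closure"
    assume f: "f \<in> carrier (free_algebra (V0 \<inter> Ak))" "range f \<subseteq> range to_ac"
    then show "class_matrix (cm.cl f) $ i $ j \<in> range to_ac"
      using ev_rational[OF f] subsetD[OF sub f(1)] by (simp add: class_matrix_cl rational_matrix_def)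
  qed
qed

lemma trace_T_T: assumes "a \<in> V0" "c \<in> V0" shows "trace (T a ** T c) = 8 * bil a c"
proof -
  have "trace (T a ** T c) + trace (T c ** T a) = trace (mat (bil a c) :: 'k alg_closure ^ 'n ^ 'n)"
    using T_T[OF assms] by (simp add: trace_add[symmetric])
  moreover have "trace (mat (bil a c) :: 'k alg_closure ^ 'n ^ 'n) = bil a c * 16"
    unfolding mat_eq_matscale[of "bil a c"] trace_matscale cm.gen.trace_one ..
  ultimately have "2 * trace (T a ** T c) = 2 * (8 * bil a c)"
    using trace_mul_sym[of "T a" "T c"] by simp
  then show ?thesis unfolding mult_left_cancel[OF two_neq_0] .
qed

text \<open>Conversely, \<open>g\<close> is recovered from its spin element. On the half space it acts by the matrix of
  the element, and on \<open>V0\<close> by conjugation of Clifford vectors, whose coordinates are traces.\<close>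

lemma stab_V0_coord:
  assumes g: "stab g" and a: "a \<in> V0" and i: "i < 9"
  shows "bil (g a) (b i) = (1/8) * trace (mx g ** T a ** adj (mx g) ** T (b i))"
proof -
  have "T (g a) = mx g ** T a ** adj (mx g)"
    using stab_mx_T[OF g a] stab_adj(2)[OF g] by (simp add: matrix_mul_assoc[symmetric])
  then have tr: "trace (mx g ** T a ** adj (mx g) ** T (b i)) = 8 * bil (g a) (b i)"
    using trace_T_T[OF stab_V0[OF g a] b_V0[OF i]] by simp
  have "(8 :: 'k alg_closure) = 2 * (2 * 2)" by simp
  then have "(8 :: 'k alg_closure) \<noteq> 0" using two_neq_0 by (metis mult_eq_0_iff)
  then show ?thesis unfolding tr by simp
qed

lemma phi_inverse_regular:
  assumes l: "l \<in> aut_coords"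
  shows "regular spin spin_coords (\<lambda>s. l (inv_into (carrier stab_group) phi s))"
proof -
  let ?\<psi> = "inv_into (carrier stab_group) phi"
  obtain l' a where l': "l = (\<lambda>g. l' (g a))" "a \<in> Ak"
    and add: "\<And>x y. x \<in> A \<Longrightarrow> y \<in> A \<Longrightarrow> l' (x + y) = l' x + l' y"
    and sc: "\<And>c x. x \<in> A \<Longrightarrow> l' (c \<star> x) = c * l' x"
    and rat: "\<And>x. x \<in> Ak \<Longrightarrow> l' x \<in> range to_ac"
    using l unfolding aut_coords_def by auto
  have aA: "a \<in> A" using l' Ak_A by blast
  have \<psi>: "?\<psi> s \<in> Bij A" "stab (?\<psi> s)" "phi (?\<psi> s) = s" if "s \<in> carrier spin" for s
  proof -
    have "phi ` carrier stab_group = carrier spin" using phi_iso by (simp add: iso_def bij_betw_def)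
    then have "?\<psi> s \<in> carrier stab_group \<and> phi (?\<psi> s) = s"
      using that inv_into_into f_inv_into_f by metis
    then show "?\<psi> s \<in> Bij A" "stab (?\<psi> s)" "phi (?\<psi> s) = s" by (auto simp: stab_group_carrier)
  qed
  have M: "mx (?\<psi> s) = class_matrix s" if "s \<in> carrier spin" for s
    using class_matrix_phi[of "?\<psi> s"] \<psi>(3)[OF that] by simp
  have l'0: "l' 0 = 0" using sc[of 0 0] A_closed(6) by simp
  have l'sum: "l' (\<Sum>i\<in>S. c i \<star> y i) = (\<Sum>i\<in>S. c i * l' (y i))" if y: "\<And>i. i \<in> S \<Longrightarrow> y i \<in> A" for S :: "'z set" and c y
  proof -
    have "(\<Sum>i\<in>S. c i \<star> y i) \<in> A \<and> l' (\<Sum>i\<in>S. c i \<star> y i) = (\<Sum>i\<in>S. c i * l' (y i))"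
      using y by (induction S rule: infinite_finite_induct) (simp_all add: A_closed l'0 add sc)
    then show ?thesis by blast
  qed
  define a0 where "a0 = pr0 a"
  define a1 where "a1 = pr1 a"
  have mem: "a0 \<in> V0" "a1 \<in> V1" "a0 \<in> Ak" "a1 \<in> Ak"
    using pr0_V0[OF aA] pr1_V1[OF aA] Ak_pr l' by (auto simp: a0_def a1_def)
  have memA: "a0 \<in> A" "a1 \<in> A" "e - w \<in> A" using mem Ak_A A_closed e_A w_A by auto
  define a2 where "a2 = bil w a \<star> w + ((bil e a - bil w a) / 2) \<star> (e - w)"
  have a2: "a2 \<in> A" "a2 \<in> Ak"
    unfolding a2_def using memA w_A l' by (auto intro!: A_closed Ak_add Ak_scale Ak_diff Ak_e Ak_w rational_simps Ak_bil)
  have a: "a = a2 + a0 + a1" using peirce_decomposition[of a] by (simp add: a0_def a1_def a2_def)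
  have split: "l' (g a) = l' a2 + l' (g a0) + l' (g a1)" if g: "stab g" for g
  proof -
    have ga: "is_aut g" "g w = w" "g e = e" using g aut_e by (auto simp: stab_def)
    have "g a2 = a2"
      unfolding a2_def using memA w_A e_A ga
      by (simp add: autD(2,3)[OF ga(1)] aut_diff[OF ga(1)] A_closed)
    moreover have "g a = g a2 + g a0 + g a1"
      using a2 memA unfolding a by (simp add: autD(2)[OF ga(1)] A_closed)
    ultimately show ?thesis
      using a2 memA autD(1)[OF ga(1)] by (simp add: add A_closed)
  qed
  have half: "l' (g a1) = (\<Sum>i\<in>UNIV. (\<Sum>j\<in>UNIV. mx g $ i $ j * coord a1 j) * l' (xs i))" if g: "stab g" for g
  proof -
    have "g a1 = app (mx g) a1" using app_mx[OF stab_V1_linear[OF g] mem(2)] by simp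
    then show ?thesis unfolding app_def using l'sum[of UNIV xs] xs_V1 V1_D(1) by simp
  qed
  have zero: "l' (g a0) = (\<Sum>i<9. (1/8) * trace (mx g ** T a0 ** adj (mx g) ** T (b i)) / bil (b i) (b i) * l' (b i))"
    if g: "stab g" for g
  proof -
    have "g a0 = (\<Sum>x\<in>b ` {..<9}. (bil (g a0) x / bil x x) \<star> x)"
      using b_basis(1) stab_V0[OF g mem(1)] by (intro orthogonal_expansion) (auto simp: orthogonal_basis_def)
    then have "g a0 = (\<Sum>i<9. (bil (g a0) (b i) / bil (b i) (b i)) \<star> b i)"
      by (simp add: sum.reindex b_basis(2))
    then have "l' (g a0) = l' (\<Sum>i<9. (bil (g a0) (b i) / bil (b i) (b i)) \<star> b i)" by (rule arg_cong)
    also have "\<dots> = (\<Sum>i<9. bil (g a0) (b i) / bil (b i) (b i) * l' (b i))"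
      by (rule l'sum) (simp add: V0_D(1) b_V0)
    also have "\<dots> = (\<Sum>i<9. (1/8) * trace (mx g ** T a0 ** adj (mx g) ** T (b i)) / bil (b i) (b i) * l' (b i))"
      by (intro sum.cong refl) (simp only: stab_V0_coord[OF g mem(1)] lessThan_iff)
    finally show ?thesis .
  qed
  let ?C = class_matrix
  have ent: "regular spin spin_coords (\<lambda>s. ?C s $ i $ j)" for i j
    using class_matrix_regular by (simp add: regular_matrix_def)
  have adj: "regular_matrix spin spin_coords (\<lambda>s. adj (?C s))"
    unfolding regular_matrix_def
  proof (intro allI)
    fix i j
    have "N j / N i \<in> range to_ac" by (intro rational_simps Ak_bil Ak_xs)
    then have "regular spin spin_coords (\<lambda>s. ?C s $ j $ i * (N j / N i))"
      by (intro regular_mult ent regular_const)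
    then show "regular spin spin_coords (\<lambda>s. adj (?C s) $ i $ j)" by (simp add: adj_def)
  qed
  have "regular spin spin_coords (\<lambda>s. l' a2 +
      (\<Sum>i<9. (1/8) * trace (?C s ** T a0 ** adj (?C s) ** T (b i)) / bil (b i) (b i) * l' (b i)) +
      (\<Sum>i\<in>UNIV. (\<Sum>j\<in>UNIV. ?C s $ i $ j * coord a1 j) * l' (xs i)))"
    unfolding divide_inverse
    by (intro regular_add regular_sum regular_mult regular_trace regular_matrix_mult regular_matrix_const
        T_rational class_matrix_regular adj ent regular_const rat coord_rational mem a2 Ak_b Ak_xs)
      (auto intro!: rational_simps Ak_bil Ak_b simp: inverse_eq_divide)
  then show ?thesis
  proof (rule regular_cong)
    fix s assume s: "s \<in> carrier spin"
    show "l (?\<psi> s) = l' a2 +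
      (\<Sum>i<9. (1/8) * trace (?C s ** T a0 ** adj (?C s) ** T (b i)) / bil (b i) (b i) * l' (b i)) +
      (\<Sum>i\<in>UNIV. (\<Sum>j\<in>UNIV. ?C s $ i $ j * coord a1 j) * l' (xs i))"
      unfolding l'(1) split[OF \<psi>(2)[OF s]] half[OF \<psi>(2)[OF s]] zero[OF \<psi>(2)[OF s]] M[OF s] ..
  qed
qed

theorem stab_group_iso_spin:
  "alg_group_iso stab_group (coord_ring stab_group aut_coords) spin (coord_ring spin spin_coords)"
proof (rule alg_group_isoI[OF phi_iso])
  interpret G: group stab_group by (rule stab_group_group)
  show "inv\<^bsub>stab_group\<^esub> g \<in> carrier stab_group \<and> inv\<^bsub>stab_group\<^esub> (inv\<^bsub>stab_group\<^esub> g) = g"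
    if "g \<in> carrier stab_group" for g using that by simp
qed (simp_all add: phi_inv phi_regular phi_inverse_regular)

end

section \<open>The fixed points of an involution of type (II)\<close>

context spin_rep
begin

lemma centralizer_eq_stabilizer:
  assumes r: "r \<in> Bij A" "stab r" and cent: "\<And>g. g \<in> Bij A \<Longrightarrow> stab g \<Longrightarrow> compose A r g = compose A g r"
    and ne: "r \<noteq> (\<lambda>x\<in>A. x)" and inv: "compose A r r = (\<lambda>x\<in>A. x)"
  shows "{g \<in> Bij A. is_aut g \<and> compose A r g = compose A g r} = {g \<in> Bij A. stab g}"
proof (intro equalityI subsetI)
  fix g assume "g \<in> {g \<in> Bij A. is_aut g \<and> compose A r g = compose A g r}"
  then have g: "g \<in> Bij A" "is_aut g" "compose A r g = compose A g r" by auto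
  have ra: "is_aut r" "r w = w" using r by (auto simp: stab_def)
  note act = central_involution[OF r cent ne inv]
  have "g (r x) = r (g x)" if "x \<in> A" for x
    using fun_cong[OF g(3), of x] that by (simp add: compose_def)
  then have "g w = w" using centralizer_fixes_idempotent[OF ra act g(2)] by blast
  then show "g \<in> {g \<in> Bij A. stab g}" using g by (simp add: stab_def)
next
  fix g assume "g \<in> {g \<in> Bij A. stab g}"
  then show "g \<in> {g \<in> Bij A. is_aut g \<and> compose A r g = compose A g r}"
    using cent[of g] by (auto simp: stab_def)
qed

end

lemma involution_conjugation_fixes_iff:
  assumes "group G" and r: "r \<in> carrier G" "r \<otimes>\<^bsub>G\<^esub> r = \<one>\<^bsub>G\<^esub>" and g: "g \<in> carrier G"
  shows "r \<otimes>\<^bsub>G\<^esub> g \<otimes>\<^bsub>G\<^esub> r = g \<longleftrightarrow> r \<otimes>\<^bsub>G\<^esub> g = g \<otimes>\<^bsub>G\<^esub> r"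
proof -
  interpret G: group G by fact
  have "r \<otimes>\<^bsub>G\<^esub> g \<otimes>\<^bsub>G\<^esub> r \<otimes>\<^bsub>G\<^esub> r = r \<otimes>\<^bsub>G\<^esub> g" "g \<otimes>\<^bsub>G\<^esub> r \<otimes>\<^bsub>G\<^esub> r = g"
    using r g by (simp_all add: G.m_assoc)
  then show ?thesis by metis
qed

context albert_idempotent
begin

lemma mat_ac_injective: "mat_ac x = mat_ac y \<longleftrightarrow> x = y"
  by (simp add: vec_eq_iff mat_ac_nth to_ac_inj)

lemma rational_V0: "pK.V0 \<inter> mat_ac ` A = mat_ac ` p.V0"
proof (intro equalityI subsetI)
  fix z assume z: "z \<in> pK.V0 \<inter> mat_ac ` A"
  then obtain a where a: "a \<in> A" "z = mat_ac a" by blast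
  have "to_ac (tf a (albert_one C \<gamma>)) = 0" "mat_ac (albert_mult C w a) = mat_ac 0"
    using z unfolding pK.V0_def a(2)
    by (simp_all add: mat_ac_one[symmetric] tf_mat_ac mat_ac_mult[symmetric] mat_ac_simps)
  then have "a \<in> p.V0"
    unfolding p.V0_def using a(1) by (simp add: to_ac_eq_0_iff mat_ac_injective)
  then show "z \<in> mat_ac ` p.V0" using a by blast
qed (use mat_ac_V p.V0_D in auto)

lemma rational_spin_rep_exists:
  "\<exists>b x. rational_spin_rep mscale K.tf K.A (albert_mult D) (albert_one D (vec_ac \<gamma>)) wK
    (albert_Q D (vec_ac \<gamma>)) b (x :: 16 \<Rightarrow> _) (mat_ac ` A)"
proof -
  obtain b x where b: "\<And>i. i < 9 \<Longrightarrow> b i \<in> p.V0"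
      "K.ab.orthogonal_basis ((\<lambda>i. mat_ac (b i)) ` {..<9}) pK.V0" "inj_on (\<lambda>i. mat_ac (b i)) {..<9::nat}"
    and x: "\<And>i::16. x i \<in> p.V1" "K.ab.orthogonal_basis ((\<lambda>i. mat_ac (x i)) ` UNIV) pK.V1"
      "inj (\<lambda>i. mat_ac (x i))"
    using rational_bases by blast
  have "rational_spin_rep mscale K.tf K.A (albert_mult D) (albert_one D (vec_ac \<gamma>)) wK
    (albert_Q D (vec_ac \<gamma>)) (\<lambda>i. mat_ac (b i)) (\<lambda>i. mat_ac (x i)) (mat_ac ` A)"
  proof unfold_locales
    show "CARD(16) = 16" by simp
    show "albert_Q D (vec_ac \<gamma>) a = K.tf a a / 2" if "a \<in> pK.V0" for a
      by (rule K.albert_Q_eq) (rule pK.V0_D(1)[OF that])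
    show "K.ab.orthogonal_basis ((\<lambda>i. mat_ac (b i)) ` {..<9}) pK.V0" by (rule b)
    show "inj_on (\<lambda>i. mat_ac (b i)) {..<9}" by (rule b)
    show "K.ab.orthogonal_basis (range (\<lambda>i. mat_ac (x i))) pK.V1" by (rule x)
    show "inj (\<lambda>i. mat_ac (x i))" by (rule x)
    show "mat_ac ` A \<subseteq> K.A" using mat_ac_A by blast
    show "u + v \<in> mat_ac ` A" if "u \<in> mat_ac ` A" "v \<in> mat_ac ` A" for u v
      using that cj.A_closed by (auto simp: mat_ac_simps(1)[symmetric])
    show "mscale c u \<in> mat_ac ` A" if "c \<in> range to_ac" "u \<in> mat_ac ` A" for c u
      using that cj.A_closed by (auto simp: mat_ac_simps(3)[symmetric])
    show "albert_mult D u v \<in> mat_ac ` A" if "u \<in> mat_ac ` A" "v \<in> mat_ac ` A" for u v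
      using that cj.A_closed by (auto simp: mat_ac_mult[symmetric])
    show "albert_one D (vec_ac \<gamma>) \<in> mat_ac ` A" using albert_one_A by (auto simp: mat_ac_one[symmetric])
    show "wK \<in> mat_ac ` A" using w_props by blast
    show "K.tf u v \<in> range to_ac" if "u \<in> mat_ac ` A" "v \<in> mat_ac ` A" for u v
      using that by (auto simp: tf_mat_ac)
    show "mat_ac (b i) \<in> mat_ac ` A" if "i < 9" for i using b(1)[OF that] p.V0_D(1) by blast
    show "mat_ac (x j) \<in> mat_ac ` A" for j using x(1)[of j] p.V1_D(1) by blast
  qed
  then show ?thesis by blast
qed

theorem fixed_point_group_iso_spin:
  assumes "type_II_involution C \<gamma> w \<sigma>"
  shows "alg_group_iso
    (fixed_point_group (Aut_A C \<gamma>) \<sigma>)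
    (coord_ring (fixed_point_group (Aut_A C \<gamma>) \<sigma>) (Aut_A_coords C \<gamma>))
    (Spin_E0 C \<gamma> w)
    (coord_ring (Spin_E0 C \<gamma> w) (Spin_E0_coords C \<gamma> w))"
proof -
  obtain b x where "rational_spin_rep mscale K.tf K.A (albert_mult D) (albert_one D (vec_ac \<gamma>)) wK
    (albert_Q D (vec_ac \<gamma>)) b (x :: 16 \<Rightarrow> _) (mat_ac ` A)"
    using rational_spin_rep_exists by blast
  then interpret S: rational_spin_rep mscale K.tf K.A "albert_mult D" "albert_one D (vec_ac \<gamma>)" wK
    "albert_Q D (vec_ac \<gamma>)" b x "mat_ac ` A" .
  interpret B: group "BijGroup K.A" by (rule group_BijGroup)
  let ?G = "Aut_A C \<gamma>"
  have G_carrier: "carrier ?G = {g \<in> Bij K.A. S.is_aut g}"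
    by (auto simp: Aut_A_def albert_aut_def S.is_aut_def Bij_def)
  have G_mult: "g \<otimes>\<^bsub>?G\<^esub> h = g \<otimes>\<^bsub>BijGroup K.A\<^esub> h" and G_one: "\<one>\<^bsub>?G\<^esub> = \<one>\<^bsub>BijGroup K.A\<^esub>" for g h
    by (simp_all add: Aut_A_def albert_aut_def)
  have B_mult: "g \<otimes>\<^bsub>BijGroup K.A\<^esub> h = compose K.A g h" if "g \<in> Bij K.A" "h \<in> Bij K.A" for g h
    using that by (simp add: BijGroup_def)
  have B_one: "\<one>\<^bsub>BijGroup K.A\<^esub> = (\<lambda>x\<in>K.A. x)" by (simp add: BijGroup_def)
  have B_carrier: "carrier (BijGroup K.A) = Bij K.A" by (simp add: BijGroup_def)
  have stab: "stabilizer_A C \<gamma> w = {g \<in> Bij K.A. S.stab g}"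
    by (auto simp: stabilizer_A_def G_carrier S.stab_def)
  obtain r where r: "r \<in> stabilizer_A C \<gamma> w"
    and cent: "\<And>g. g \<in> stabilizer_A C \<gamma> w \<Longrightarrow> r \<otimes>\<^bsub>?G\<^esub> g = g \<otimes>\<^bsub>?G\<^esub> r"
    and ne: "r \<noteq> \<one>\<^bsub>?G\<^esub>" and rr: "r \<otimes>\<^bsub>?G\<^esub> r = \<one>\<^bsub>?G\<^esub>"
    and \<sigma>: "\<And>g. g \<in> carrier ?G \<Longrightarrow> \<sigma> g = r \<otimes>\<^bsub>?G\<^esub> g \<otimes>\<^bsub>?G\<^esub> inv\<^bsub>?G\<^esub> r"
    using assms unfolding type_II_involution_def by blast
  have rB: "r \<in> Bij K.A" "S.stab r" using r by (auto simp: stab)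
  have rG: "r \<in> carrier ?G" using r by (simp add: stabilizer_A_def)
  have "inv\<^bsub>?G\<^esub> r = r"
    unfolding m_inv_def
  proof (rule the_equality)
    fix y assume y: "y \<in> carrier ?G \<and> r \<otimes>\<^bsub>?G\<^esub> y = \<one>\<^bsub>?G\<^esub> \<and> y \<otimes>\<^bsub>?G\<^esub> r = \<one>\<^bsub>?G\<^esub>"
    then have "r \<otimes>\<^bsub>BijGroup K.A\<^esub> y = r \<otimes>\<^bsub>BijGroup K.A\<^esub> r" using rr by (simp add: G_mult)
    then show "y = r" using y rB by (simp add: B_carrier G_carrier)
  qed (use rG rr in auto)
  then have fix_iff: "\<sigma> g = g \<longleftrightarrow> compose K.A r g = compose K.A g r" if "g \<in> carrier ?G" for g
    using involution_conjugation_fixes_iff[OF B.is_group, of r g] \<sigma>[OF that] rB that rr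
    by (simp add: G_mult G_one B_carrier G_carrier B_mult)
  have "{g \<in> carrier ?G. \<sigma> g = g} = {g \<in> Bij K.A. S.is_aut g \<and> compose K.A r g = compose K.A g r}"
    using fix_iff by (auto simp: G_carrier)
  also have "\<dots> = {g \<in> Bij K.A. S.stab g}"
  proof (rule S.centralizer_eq_stabilizer[OF rB])
    show "compose K.A r g = compose K.A g r" if "g \<in> Bij K.A" "S.stab g" for g
      using cent[of g] that rB by (simp add: stab G_mult B_mult)
    show "r \<noteq> (\<lambda>x\<in>K.A. x)" using ne by (simp add: G_one B_one)
    show "compose K.A r r = (\<lambda>x\<in>K.A. x)" using rr rB by (simp add: G_mult G_one B_one B_mult)
  qed
  finally have "fixed_point_group ?G \<sigma> = S.stab_group"
    by (simp add: fixed_point_group_def S.stab_group_def) (simp add: Aut_A_def albert_aut_def)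
  moreover have "Aut_A_coords C \<gamma> = S.aut_coords"
    unfolding Aut_A_coords_def S.aut_coords_def by blast
  moreover have "Spin_E0 C \<gamma> w = S.spin" by (simp add: Spin_E0_def VK0_eq)
  moreover have "Spin_E0_coords C \<gamma> w = S.spin_coords"
    by (simp only: Spin_E0_coords_def rational_V0 V0_eq VK0_eq[symmetric])
  ultimately show ?thesis using S.stab_group_iso_spin by simp
qed

end

theorem proposition4p6p1:
  fixes C :: "'k::field octonions" and \<gamma> :: "'k ^ 3" and w :: "'k ^ 8 ^ 3 ^ 3"
  assumes "CHAR('k) \<noteq> 2"
    and "octonion_algebra C" and "split_octonions C"
    and "\<gamma> $ 1 \<noteq> 0" and "\<gamma> $ 2 \<noteq> 0" and "\<gamma> $ 3 \<noteq> 0"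
    and "type_II_involution C \<gamma> w \<sigma>"
  shows "alg_group_iso
    (fixed_point_group (Aut_A C \<gamma>) \<sigma>)
    (coord_ring (fixed_point_group (Aut_A C \<gamma>) \<sigma>) (Aut_A_coords C \<gamma>))
    (Spin_E0 C \<gamma> w)
    (coord_ring (Spin_E0 C \<gamma> w) (Spin_E0_coords C \<gamma> w))"
proof -
  have two: "(2::'k) \<noteq> 0"
  proof
    assume "(2::'k) = 0"
    then have "CHAR('k) dvd 2" using of_nat_eq_0_iff_char_dvd[of 2, where ?'a = 'k] by simp
    then show False using assms(1) CHAR_not_1'[where ?'a = 'k] dvd_imp_le[of "CHAR('k)" 2]
      by (metis dvd_refl le_antisym less_2_cases_iff nat_less_le prime_nat_iff two_is_prime_nat One_nat_def)
  qed
  interpret albert_idempotent C \<gamma> w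
    using assms two
    by unfold_locales (auto simp: type_II_involution_def)
  show ?thesis by (rule fixed_point_group_iso_spin[OF assms(7)])
qed

end
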